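(* Let $\mathcal{H}$ be a cocommutative Hopf $K$-algebra with a symmetric partial action on a unital $K$-algebra $A$. Then the bifunctors $$-\otimes_{\mathcal{H}_{par}}(A\otimes_{A^e}-):\ \operatorname{Mod-}\mathcal{H}_{par}\times(A\#\mathcal{H})^e\operatorname{-Mod}\to K\operatorname{-Mod}$$ and $$(-\otimes_{\mathcal{B}}A\#\mathcal{H})\otimes_{(A\#\mathcal{H})^e}-:\ \operatorname{Mod-}\mathcal{H}_{par}\times(A\#\mathcal{H})^e\operatorname{-Mod}\to K\operatorname{-Mod}$$ are naturally isomorphic.
   Context: $K$ is a commutative unital ring, $\otimes=\otimes_K$, all algebras are associative unital $K$-algebras. $\mathcal{H}$ has counit $\varepsilon$, antipode $S$, and Sweedler notation $\Delta(h)=h_{(1)}\otimes h_{(2)}$ is used. Symmetric partial action: a linear map $\mathcal{H}\otimes A\to A$, $h\otimes a\mapsto h\cdot a$, with $1_{\mathcal{H}}\cdot a=a$; $h\cdot(ab)=(h_{(1)}\cdot a)(h_{(2)}\cdot b)$; $h\cdot(k\cdot a)=(h_{(1)}\cdot 1_A)(h_{(2)}k\cdot a)$; and $h\cdot(k\cdot a)=(h_{(1)}k\cdot a)(h_{(2)}\cdot 1_A)$ (symmetry). Partial smash product: $A\otimes\mathcal{H}$ has the associative product $(a\otimes h)(b\otimes k)=a(h_{(1)}\cdot b)\otimes h_{(2)}k$, and $A\#\mathcal{H}:=(A\otimes\mathcal{H})(1_A\otimes 1_{\mathcal{H}})$, a unital algebra generated by the elements $a\#h:=a(h_{(1)}\cdot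 1_A)\otimes h_{(2)}$. For an algebra $R$, $R^e=R\otimes R^{op}$; an $R$-bimodule $X$ is a left $R^e$-module by $(a\otimes b)\cdot x=a\cdot x\cdot b$ and a right $R^e$-module by $x\cdot(a\otimes b)=b\cdot x\cdot a$. An $A\#\mathcal{H}$-bimodule is an $A$-bimodule via $a\mapsto a\#1_{\mathcal{H}}$. The algebra $\mathcal{H}_{par}$ is the quotient of the tensor algebra $T(\mathcal{H})$ by the ideal generated by the elements ($h,k\in\mathcal{H}$): $1_{\mathcal{H}}-1_{T(\mathcal{H})}$; $h\otimes k_{(1)}\otimes S(k_{(2)})-hk_{(1)}\otimes S(k_{(2)})$; $h_{(1)}\otimes S(h_{(2)})\otimes k-h_{(1)}\otimes S(h_{(2)})k$; $h\otimes S(k_{(1)})\otimes k_{(2)}-hS(k_{(1)})\otimes k_{(2)}$; $S(h_{(1)})\otimes h_{(2)}\otimes k-S(h_{(1)})\otimes h_{(2)}k$. The class of $h$ is $[h]$. $\mathcal{B}\subseteq\mathcal{H}_{par}$ is the subalgebra generated by the elements $e_h:=[h_{(1)}][S(h_{(2)})]$, $h\in\mathcal{H}$. Module structures used: (1) for an $A\#\mathcal{H}$-bimodule $M$, $A\otimes_{A^e}M$ is a left $\mathcal{H}_{par}$-module by $[h]\triangleright(a\otimes_{A^e}m)=(h_{(1)}\cdot a)\otimes_{A^e}(1_A\#h_{(2)})\cdot m\cdot(1_A\#S(h_{(3)}))$. (2) $A\#\mathcal{H}$ is a left $\mathcal{H}_{par}$-module by $[h]\triangleright(a\#k)=(1_A\#h)(a\#k)$,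 hence a left $\mathcal{B}$-module by restriction (with $e_h\triangleright(a\#k)=(h\cdot 1_A)a\#k$); a right $\mathcal{H}_{par}$-module $X$ is a right $\mathcal{B}$-module by restriction. (3) For a right $\mathcal{H}_{par}$-module $X$, $X\otimes_{\mathcal{B}}(A\#\mathcal{H})$ is an $A\#\mathcal{H}$-bimodule by $(a\#h)\cdot(x\otimes_{\mathcal{B}}c\#t)=x\cdot[S(h_{(1)})]\otimes_{\mathcal{B}}(a\#h_{(2)})(c\#t)$ and $(x\otimes_{\mathcal{B}}c\#t)\cdot(a\#h)=x\otimes_{\mathcal{B}}(c\#t)(a\#h)$. *)

theory Defs
  imports
    "HOL-Algebra.Free_Abelian_Groups"
    "HOL-Algebra.QuotRing"
    "HOL-Algebra.Subrings"
    "HOL-Algebra.Module"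
begin

section \<open>Modules over noncommutative rings\<close>

text \<open>The library locale \<open>module\<close> needs a commutative ring of scalars.  A right module uses the
  same record: there \<open>r \<odot>\<^bsub>X\<^esub> x\<close> stands for \<open>x \<cdot> r\<close>.\<close>

locale left_module = R?: ring R + M?: abelian_group M
  for R :: "('r, 'w) ring_scheme" (structure) and M :: "('r, 'm, 'z) module_scheme" (structure) +
  assumes closed: "\<lbrakk>a \<in> carrier R; x \<in> carrier M\<rbrakk> \<Longrightarrow> a \<odot>\<^bsub>M\<^esub> x \<in> carrier M"
    and distrib_scalar: "\<lbrakk>a \<in> carrier R; b \<in> carrier R; x \<in> carrier M\<rbrakk>
      \<Longrightarrow> (a \<oplus> b) \<odot>\<^bsub>M\<^esub> x = a \<odot>\<^bsub>M\<^esub> x \<oplus>\<^bsub>M\<^esub> b \<odot>\<^bsub>M\<^esub> x"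
    and distrib_vector: "\<lbrakk>a \<in> carrier R; x \<in> carrier M; y \<in> carrier M\<rbrakk>
      \<Longrightarrow> a \<odot>\<^bsub>M\<^esub> (x \<oplus>\<^bsub>M\<^esub> y) = a \<odot>\<^bsub>M\<^esub> x \<oplus>\<^bsub>M\<^esub> a \<odot>\<^bsub>M\<^esub> y"
    and assoc: "\<lbrakk>a \<in> carrier R; b \<in> carrier R; x \<in> carrier M\<rbrakk>
      \<Longrightarrow> (a \<otimes> b) \<odot>\<^bsub>M\<^esub> x = a \<odot>\<^bsub>M\<^esub> (b \<odot>\<^bsub>M\<^esub> x)"
    and unit: "x \<in> carrier M \<Longrightarrow> \<one> \<odot>\<^bsub>M\<^esub> x = x"

locale right_module = R?: ring R + X?: abelian_group X
  for R :: "('r, 'w) ring_scheme" (structure) and X :: "('r, 'x, 'z) module_scheme" (structure) +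
  assumes closed: "\<lbrakk>a \<in> carrier R; x \<in> carrier X\<rbrakk> \<Longrightarrow> a \<odot>\<^bsub>X\<^esub> x \<in> carrier X"
    and distrib_scalar: "\<lbrakk>a \<in> carrier R; b \<in> carrier R; x \<in> carrier X\<rbrakk>
      \<Longrightarrow> (a \<oplus> b) \<odot>\<^bsub>X\<^esub> x = a \<odot>\<^bsub>X\<^esub> x \<oplus>\<^bsub>X\<^esub> b \<odot>\<^bsub>X\<^esub> x"
    and distrib_vector: "\<lbrakk>a \<in> carrier R; x \<in> carrier X; y \<in> carrier X\<rbrakk>
      \<Longrightarrow> a \<odot>\<^bsub>X\<^esub> (x \<oplus>\<^bsub>X\<^esub> y) = a \<odot>\<^bsub>X\<^esub> x \<oplus>\<^bsub>X\<^esub> a \<odot>\<^bsub>X\<^esub> y"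
    and assoc: "\<lbrakk>a \<in> carrier R; b \<in> carrier R; x \<in> carrier X\<rbrakk>
      \<Longrightarrow> (a \<otimes> b) \<odot>\<^bsub>X\<^esub> x = b \<odot>\<^bsub>X\<^esub> (a \<odot>\<^bsub>X\<^esub> x)"
    and unit: "x \<in> carrier X \<Longrightarrow> \<one> \<odot>\<^bsub>X\<^esub> x = x"

definition mod_hom ::
  "('r, 'z) ring_scheme \<Rightarrow> ('r, 'm, 'u) module_scheme \<Rightarrow> ('r, 'n, 'v) module_scheme \<Rightarrow> ('m \<Rightarrow> 'n) set" where
  "mod_hom R M N = {f \<in> hom (add_monoid M) (add_monoid N).
     \<forall>r \<in> carrier R. \<forall>m \<in> carrier M. f (r \<odot>\<^bsub>M\<^esub> m) = r \<odot>\<^bsub>N\<^esub> f m}"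

definition with_smult ::
  "('s, 'm, 'u) module_scheme \<Rightarrow> ('r \<Rightarrow> 'm \<Rightarrow> 'm) \<Rightarrow> ('r, 'm) module" where
  "with_smult M s = \<lparr>carrier = carrier M, mult = mult M, one = one M,
     zero = zero M, add = add M, smult = s\<rparr>"

text \<open>Associative unital algebras; the library locale \<open>algebra\<close> is restricted to commutative ones.\<close>

locale k_algebra = module + ring M +
  assumes smult_mult_left: "\<lbrakk>c \<in> carrier R; x \<in> carrier M; y \<in> carrier M\<rbrakk>
      \<Longrightarrow> c \<odot>\<^bsub>M\<^esub> (x \<otimes>\<^bsub>M\<^esub> y) = (c \<odot>\<^bsub>M\<^esub> x) \<otimes>\<^bsub>M\<^esub> y"
    and smult_mult_right: "\<lbrakk>c \<in> carrier R; x \<in> carrier M; y \<in> carrier M\<rbrakk>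
      \<Longrightarrow> c \<odot>\<^bsub>M\<^esub> (x \<otimes>\<^bsub>M\<^esub> y) = x \<otimes>\<^bsub>M\<^esub> (c \<odot>\<^bsub>M\<^esub> y)"

definition self_alg :: "('k, 'z) ring_scheme \<Rightarrow> ('k, 'k) module" where
  "self_alg K = \<lparr>carrier = carrier K, mult = mult K, one = one K,
     zero = zero K, add = add K, smult = mult K\<rparr>"

definition opposite :: "('k, 'a, 'z) module_scheme \<Rightarrow> ('k, 'a, 'z) module_scheme" where
  "opposite A = A\<lparr>mult := \<lambda>x y. y \<otimes>\<^bsub>A\<^esub> x\<rparr>"

definition quot_alg :: "('k, 'a, 'z) module_scheme \<Rightarrow> 'a set \<Rightarrow> ('k, 'a set) module" where
  "quot_alg A I = ring.extend (A Quot I)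
     \<lparr>smult = (\<lambda>c Z. the_elem ((\<lambda>z. I +>\<^bsub>A\<^esub> (c \<odot>\<^bsub>A\<^esub> z)) ` Z))\<rparr>"

definition subalgebra_gen ::
  "('k, 'y) ring_scheme \<Rightarrow> ('k, 'a, 'z) module_scheme \<Rightarrow> 'a set \<Rightarrow> 'a set" where
  "subalgebra_gen K A E = \<Inter>{B. subring B A \<and>
     (\<forall>c \<in> carrier K. \<forall>b \<in> B. c \<odot>\<^bsub>A\<^esub> b \<in> B) \<and> E \<subseteq> B}"


section \<open>Tensor products\<close>

type_synonym ('x, 'y) tens = "('x \<times> 'y \<Rightarrow>\<^sub>0 int) set"

definition tensor_rels ::
  "('r, 'z) ring_scheme \<Rightarrow> ('r, 'x, 'u) module_scheme \<Rightarrow> ('r, 'y, 'v) module_scheme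
   \<Rightarrow> ('x \<times> 'y \<Rightarrow>\<^sub>0 int) set" where
  "tensor_rels R X Y =
     {frag_of (x \<oplus>\<^bsub>X\<^esub> x', y) - frag_of (x, y) - frag_of (x', y) | x x' y.
        x \<in> carrier X \<and> x' \<in> carrier X \<and> y \<in> carrier Y} \<union>
     {frag_of (x, y \<oplus>\<^bsub>Y\<^esub> y') - frag_of (x, y) - frag_of (x, y') | x y y'.
        x \<in> carrier X \<and> y \<in> carrier Y \<and> y' \<in> carrier Y} \<union>
     {frag_of (r \<odot>\<^bsub>X\<^esub> x, y) - frag_of (x, r \<odot>\<^bsub>Y\<^esub> y) | r x y.
        r \<in> carrier R \<and> x \<in> carrier X \<and> y \<in> carrier Y}"

definition tensor_null ::
  "('r, 'z) ring_scheme \<Rightarrow> ('r, 'x, 'u) module_scheme \<Rightarrow> ('r, 'y, 'v) module_scheme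
   \<Rightarrow> ('x \<times> 'y \<Rightarrow>\<^sub>0 int) set" where
  "tensor_null R X Y =
     generate (free_Abelian_group (carrier X \<times> carrier Y)) (tensor_rels R X Y)"

definition tensor_add ::
  "('r, 'z) ring_scheme \<Rightarrow> ('r, 'x, 'u) module_scheme \<Rightarrow> ('r, 'y, 'v) module_scheme
   \<Rightarrow> ('x, 'y) tens ring" where
  "tensor_add R X Y =
     (let G = free_Abelian_group (carrier X \<times> carrier Y) Mod tensor_null R X Y
      in \<lparr>carrier = carrier G, mult = undefined, one = undefined,
          zero = one G, add = mult G\<rparr>)"

definition tens ::
  "('r, 'z) ring_scheme \<Rightarrow> ('r, 'x, 'u) module_scheme \<Rightarrow> ('r, 'y, 'v) module_scheme
   \<Rightarrow> 'x \<Rightarrow> 'y \<Rightarrow> ('x, 'y) tens" where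
  "tens R X Y x y =
     tensor_null R X Y #>\<^bsub>free_Abelian_group (carrier X \<times> carrier Y)\<^esub> frag_of (x, y)"

text \<open>The additive map out of a tensor product with \<open>x \<otimes> y \<mapsto> f x y\<close>, for \<open>f\<close> balanced: a tensor is
  a coset of formal sums, and a balanced \<open>f\<close> gives the same value in \<open>P\<close> on each of them.\<close>

definition tens_lift ::
  "('p, 'z) ring_scheme \<Rightarrow> ('x \<Rightarrow> 'y \<Rightarrow> 'p) \<Rightarrow> ('x, 'y) tens \<Rightarrow> 'p" where
  "tens_lift P f t = the_elem
     ((\<lambda>c. \<Oplus>\<^bsub>P\<^esub>p \<in> Poly_Mapping.keys c.
            [Poly_Mapping.lookup c p] \<cdot>\<^bsub>P\<^esub> f (fst p) (snd p)) ` t)"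

text \<open>\<open>X \<otimes>\<^sub>R Y\<close> for a right module \<open>X\<close> and a left module \<open>Y\<close> over an algebra \<open>R\<close>, with the
  scalar multiplication \<open>c (x \<otimes> y) = x (c 1\<^sub>R) \<otimes> y\<close>.  The fields \<open>mult\<close> and \<open>one\<close> carry no
  information.\<close>

definition tensor ::
  "('k, 'r, 'z) module_scheme \<Rightarrow> ('r, 'x, 'u) module_scheme \<Rightarrow> ('r, 'y, 'v) module_scheme
   \<Rightarrow> ('k, ('x, 'y) tens) module" where
  "tensor R X Y = ring.extend (tensor_add R X Y)
     \<lparr>smult = (\<lambda>c. tens_lift (tensor_add R X Y)
                (\<lambda>x y. tens R X Y ((c \<odot>\<^bsub>R\<^esub> \<one>\<^bsub>R\<^esub>) \<odot>\<^bsub>X\<^esub> x) y))\<rparr>"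

text \<open>The map \<open>f \<otimes> g\<close> with codomain \<open>X' \<otimes>\<^sub>R Y'\<close>.\<close>

definition tensor_map ::
  "('k, 'r, 'z) module_scheme \<Rightarrow> ('r, 'x2, 'u) module_scheme \<Rightarrow> ('r, 'y2, 'v) module_scheme
   \<Rightarrow> ('x1 \<Rightarrow> 'x2) \<Rightarrow> ('y1 \<Rightarrow> 'y2) \<Rightarrow> ('x1, 'y1) tens \<Rightarrow> ('x2, 'y2) tens" where
  "tensor_map R X' Y' f g =
     tens_lift (tensor R X' Y') (\<lambda>x y. tens R X' Y' (f x) (g y))"

definition alg_tensor ::
  "'k ring \<Rightarrow> ('k, 'a, 'u) module_scheme \<Rightarrow> ('k, 'b, 'v) module_scheme
   \<Rightarrow> ('k, ('a, 'b) tens) module" where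
  "alg_tensor K A B =
     (let T = tensor (self_alg K) A B; t = tens (self_alg K) A B
      in T\<lparr>mult := \<lambda>s s'. tens_lift T (\<lambda>a b. tens_lift T
              (\<lambda>a' b'. t (a \<otimes>\<^bsub>A\<^esub> a') (b \<otimes>\<^bsub>B\<^esub> b')) s') s,
           one := t \<one>\<^bsub>A\<^esub> \<one>\<^bsub>B\<^esub>\<rparr>)"

definition enveloping ::
  "'k ring \<Rightarrow> ('k, 'a, 'z) module_scheme \<Rightarrow> ('k, ('a, 'a) tens) module" where
  "enveloping K A = alg_tensor K A (opposite A)"


section \<open>Hopf algebras and symmetric partial actions\<close>

record ('k, 'h) hopf = "('k, 'h) module" +
  comult :: "'h \<Rightarrow> ('h, 'h) tens"
  counit :: "'h \<Rightarrow> 'k"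
  antipode :: "'h \<Rightarrow> 'h"

text \<open>\<open>sweedler H P h f\<close> is the Sweedler sum \<open>f h\<^sub>(\<^sub>1\<^sub>) h\<^sub>(\<^sub>2\<^sub>)\<close> in \<open>P\<close>, for bilinear \<open>f\<close>.\<close>

abbreviation sweedler ::
  "('k, 'h) hopf \<Rightarrow> ('p, 'z) ring_scheme \<Rightarrow> 'h \<Rightarrow> ('h \<Rightarrow> 'h \<Rightarrow> 'p) \<Rightarrow> 'p" where
  "sweedler H P h f \<equiv> tens_lift P f (comult H h)"

locale hopf_algebra = k_algebra K H for K :: "'k ring" (structure) and H :: "('k, 'h) hopf" +
  assumes comult_linear: "comult H \<in> mod_hom K H (tensor (self_alg K) H H)"
    and counit_linear: "counit H \<in> mod_hom K H (self_alg K)"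
    and antipode_linear: "antipode H \<in> mod_hom K H H"
    and coassoc: "h \<in> carrier H \<Longrightarrow>
      (let HH = tensor (self_alg K) H H;
           HHH = tensor (self_alg K) H HH
       in sweedler H HHH h (\<lambda>x y. sweedler H HHH x
            (\<lambda>x1 x2. tens (self_alg K) H HH x1 (tens (self_alg K) H H x2 y))) =
          sweedler H HHH h (\<lambda>x y. tens (self_alg K) H HH x (comult H y)))"
    and counit_left: "h \<in> carrier H \<Longrightarrow> sweedler H H h (\<lambda>x y. counit H x \<odot>\<^bsub>H\<^esub> y) = h"
    and counit_right: "h \<in> carrier H \<Longrightarrow> sweedler H H h (\<lambda>x y. counit H y \<odot>\<^bsub>H\<^esub> x) = h"
    and comult_ring_hom: "comult H \<in> ring_hom H (alg_tensor K H H)"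
    and counit_ring_hom: "counit H \<in> ring_hom H K"
    and antipode_left: "h \<in> carrier H \<Longrightarrow>
      sweedler H H h (\<lambda>x y. antipode H x \<otimes>\<^bsub>H\<^esub> y) = counit H h \<odot>\<^bsub>H\<^esub> \<one>\<^bsub>H\<^esub>"
    and antipode_right: "h \<in> carrier H \<Longrightarrow>
      sweedler H H h (\<lambda>x y. x \<otimes>\<^bsub>H\<^esub> antipode H y) = counit H h \<odot>\<^bsub>H\<^esub> \<one>\<^bsub>H\<^esub>"

locale cocommutative_hopf_algebra = hopf_algebra +
  assumes cocommutative: "h \<in> carrier H \<Longrightarrow>
    sweedler H (tensor (self_alg K) H H) h (\<lambda>x y. tens (self_alg K) H H y x) = comult H h"

locale symmetric_partial_action = hopf_algebra K H + A?: k_algebra K A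
  for K :: "'k ring" (structure) and H :: "('k, 'h) hopf" and A :: "('k, 'a) module"
    and act :: "'h \<Rightarrow> 'a \<Rightarrow> 'a" +
  assumes act_linear_left: "a \<in> carrier A \<Longrightarrow> (\<lambda>h. act h a) \<in> mod_hom K H A"
    and act_linear_right: "h \<in> carrier H \<Longrightarrow> act h \<in> mod_hom K A A"
    and act_one: "a \<in> carrier A \<Longrightarrow> act \<one>\<^bsub>H\<^esub> a = a"
    and act_mult: "\<lbrakk>h \<in> carrier H; a \<in> carrier A; b \<in> carrier A\<rbrakk> \<Longrightarrow>
      act h (a \<otimes>\<^bsub>A\<^esub> b) = sweedler H A h (\<lambda>x y. act x a \<otimes>\<^bsub>A\<^esub> act y b)"
    and act_act: "\<lbrakk>h \<in> carrier H; k \<in> carrier H; a \<in> carrier A\<rbrakk> \<Longrightarrow>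
      act h (act k a) = sweedler H A h (\<lambda>x y. act x \<one>\<^bsub>A\<^esub> \<otimes>\<^bsub>A\<^esub> act (y \<otimes>\<^bsub>H\<^esub> k) a)"
    and act_act_sym: "\<lbrakk>h \<in> carrier H; k \<in> carrier H; a \<in> carrier A\<rbrakk> \<Longrightarrow>
      act h (act k a) = sweedler H A h (\<lambda>x y. act (x \<otimes>\<^bsub>H\<^esub> k) a \<otimes>\<^bsub>A\<^esub> act y \<one>\<^bsub>A\<^esub>)"


section \<open>The partial smash product\<close>

definition smash_mult ::
  "'k ring \<Rightarrow> ('k, 'h) hopf \<Rightarrow> ('k, 'a) module \<Rightarrow> ('h \<Rightarrow> 'a \<Rightarrow> 'a)
   \<Rightarrow> ('a, 'h) tens \<Rightarrow> ('a, 'h) tens \<Rightarrow> ('a, 'h) tens" where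
  "smash_mult K H A act s t =
     (let T = tensor (self_alg K) A H
      in tens_lift T (\<lambda>a h. tens_lift T (\<lambda>b k. sweedler H T h
           (\<lambda>x y. tens (self_alg K) A H (a \<otimes>\<^bsub>A\<^esub> act x b) (y \<otimes>\<^bsub>H\<^esub> k))) t) s)"

definition smash ::
  "'k ring \<Rightarrow> ('k, 'h) hopf \<Rightarrow> ('k, 'a) module \<Rightarrow> ('h \<Rightarrow> 'a \<Rightarrow> 'a)
   \<Rightarrow> ('k, ('a, 'h) tens) module" where
  "smash K H A act =
     (let T = tensor (self_alg K) A H; e = tens (self_alg K) A H \<one>\<^bsub>A\<^esub> \<one>\<^bsub>H\<^esub>
      in T\<lparr>carrier := (\<lambda>t. smash_mult K H A act t e) ` carrier T,
           mult := smash_mult K H A act, one := e\<rparr>)"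

definition smash_elem ::
  "'k ring \<Rightarrow> ('k, 'h) hopf \<Rightarrow> ('k, 'a) module \<Rightarrow> ('h \<Rightarrow> 'a \<Rightarrow> 'a)
   \<Rightarrow> 'a \<Rightarrow> 'h \<Rightarrow> ('a, 'h) tens" where
  "smash_elem K H A act a h = sweedler H (tensor (self_alg K) A H) h
     (\<lambda>x y. tens (self_alg K) A H (a \<otimes>\<^bsub>A\<^esub> act x \<one>\<^bsub>A\<^esub>) y)"


section \<open>The algebra \<open>H\<^sub>p\<^sub>a\<^sub>r\<close> and its subalgebra \<open>B\<close>\<close>

text \<open>The free algebra on a set, as the algebra of finitely supported functions on words.\<close>

definition free_alg :: "'k ring \<Rightarrow> 's set \<Rightarrow> ('k, 's list \<Rightarrow> 'k) module" where
  "free_alg K S = \<lparr>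
     carrier = {p. finite {w. p w \<noteq> \<zero>\<^bsub>K\<^esub>} \<and> (\<forall>w. p w \<in> carrier K) \<and>
                   (\<forall>w. w \<notin> lists S \<longrightarrow> p w = \<zero>\<^bsub>K\<^esub>)},
     mult = (\<lambda>p q w. \<Oplus>\<^bsub>K\<^esub>i \<in> {..length w}. p (take i w) \<otimes>\<^bsub>K\<^esub> q (drop i w)),
     one = (\<lambda>w. if w = [] then \<one>\<^bsub>K\<^esub> else \<zero>\<^bsub>K\<^esub>),
     zero = (\<lambda>w. \<zero>\<^bsub>K\<^esub>),
     add = (\<lambda>p q w. p w \<oplus>\<^bsub>K\<^esub> q w),
     smult = (\<lambda>c p w. c \<otimes>\<^bsub>K\<^esub> p w)\<rparr>"

definition letter :: "'k ring \<Rightarrow> 's \<Rightarrow> 's list \<Rightarrow> 'k" where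
  "letter K s = (\<lambda>w. if w = [s] then \<one>\<^bsub>K\<^esub> else \<zero>\<^bsub>K\<^esub>)"

text \<open>\<open>T(M)\<close> is the free algebra on the set \<open>M\<close> modulo the ideal that makes the inclusion of
  letters linear.  Words of length \<open>n\<close> modulo these relations (in every position) form the \<open>n\<close>-th
  tensor power of \<open>M\<close>.\<close>

definition linear_ideal ::
  "'k ring \<Rightarrow> ('k, 'h, 'z) module_scheme \<Rightarrow> ('h list \<Rightarrow> 'k) set" where
  "linear_ideal K M =
     (let F = free_alg K (carrier M)
      in Idl\<^bsub>F\<^esub>
       ({letter K (x \<oplus>\<^bsub>M\<^esub> y) \<ominus>\<^bsub>F\<^esub> (letter K x \<oplus>\<^bsub>F\<^esub> letter K y) | x y.
           x \<in> carrier M \<and> y \<in> carrier M} \<union>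
        {letter K (c \<odot>\<^bsub>M\<^esub> x) \<ominus>\<^bsub>F\<^esub> c \<odot>\<^bsub>F\<^esub> letter K x | c x.
           c \<in> carrier K \<and> x \<in> carrier M}))"

definition tensor_algebra ::
  "'k ring \<Rightarrow> ('k, 'h, 'z) module_scheme \<Rightarrow> ('k, ('h list \<Rightarrow> 'k) set) module" where
  "tensor_algebra K M = quot_alg (free_alg K (carrier M)) (linear_ideal K M)"

definition tgen ::
  "'k ring \<Rightarrow> ('k, 'h, 'z) module_scheme \<Rightarrow> 'h \<Rightarrow> ('h list \<Rightarrow> 'k) set" where
  "tgen K M x = linear_ideal K M +>\<^bsub>free_alg K (carrier M)\<^esub> letter K x"

definition hpar_ideal :: "'k ring \<Rightarrow> ('k, 'h) hopf \<Rightarrow> ('h list \<Rightarrow> 'k) set set" where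
  "hpar_ideal K H =
     (let T = tensor_algebra K H; i = tgen K H; S = antipode H
      in Idl\<^bsub>T\<^esub>
       ({i \<one>\<^bsub>H\<^esub> \<ominus>\<^bsub>T\<^esub> \<one>\<^bsub>T\<^esub>} \<union>
        {sweedler H T k (\<lambda>x y. i h \<otimes>\<^bsub>T\<^esub> i x \<otimes>\<^bsub>T\<^esub> i (S y)) \<ominus>\<^bsub>T\<^esub>
         sweedler H T k (\<lambda>x y. i (h \<otimes>\<^bsub>H\<^esub> x) \<otimes>\<^bsub>T\<^esub> i (S y)) | h k.
           h \<in> carrier H \<and> k \<in> carrier H} \<union>
        {sweedler H T h (\<lambda>x y. i x \<otimes>\<^bsub>T\<^esub> i (S y) \<otimes>\<^bsub>T\<^esub> i k) \<ominus>\<^bsub>T\<^esub>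
         sweedler H T h (\<lambda>x y. i x \<otimes>\<^bsub>T\<^esub> i (S y \<otimes>\<^bsub>H\<^esub> k)) | h k.
           h \<in> carrier H \<and> k \<in> carrier H} \<union>
        {sweedler H T k (\<lambda>x y. i h \<otimes>\<^bsub>T\<^esub> i (S x) \<otimes>\<^bsub>T\<^esub> i y) \<ominus>\<^bsub>T\<^esub>
         sweedler H T k (\<lambda>x y. i (h \<otimes>\<^bsub>H\<^esub> S x) \<otimes>\<^bsub>T\<^esub> i y) | h k.
           h \<in> carrier H \<and> k \<in> carrier H} \<union>
        {sweedler H T h (\<lambda>x y. i (S x) \<otimes>\<^bsub>T\<^esub> i y \<otimes>\<^bsub>T\<^esub> i k) \<ominus>\<^bsub>T\<^esub>
         sweedler H T h (\<lambda>x y. i (S x) \<otimes>\<^bsub>T\<^esub> i (y \<otimes>\<^bsub>H\<^esub> k)) | h k.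
           h \<in> carrier H \<and> k \<in> carrier H}))"

type_synonym ('k, 'h) hpar_elem = "('h list \<Rightarrow> 'k) set set"

definition hpar :: "'k ring \<Rightarrow> ('k, 'h) hopf \<Rightarrow> ('k, ('k, 'h) hpar_elem) module" where
  "hpar K H = quot_alg (tensor_algebra K H) (hpar_ideal K H)"

definition hclass :: "'k ring \<Rightarrow> ('k, 'h) hopf \<Rightarrow> 'h \<Rightarrow> ('k, 'h) hpar_elem" where
  "hclass K H h = hpar_ideal K H +>\<^bsub>tensor_algebra K H\<^esub> tgen K H h"

definition e_elem :: "'k ring \<Rightarrow> ('k, 'h) hopf \<Rightarrow> 'h \<Rightarrow> ('k, 'h) hpar_elem" where
  "e_elem K H h = sweedler H (hpar K H) h
     (\<lambda>x y. hclass K H x \<otimes>\<^bsub>hpar K H\<^esub> hclass K H (antipode H y))"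

definition B_alg :: "'k ring \<Rightarrow> ('k, 'h) hopf \<Rightarrow> ('k, ('k, 'h) hpar_elem) module" where
  "B_alg K H = (hpar K H)
     \<lparr>carrier := subalgebra_gen K (hpar K H) (e_elem K H ` carrier H)\<rparr>"

text \<open>The left \<open>H\<^sub>p\<^sub>a\<^sub>r\<close>-action on a module \<open>V\<close> over the base ring in which \<open>[h]\<close> acts by \<open>\<phi> h\<close>: a word
  acts by composition, and \<open>\<Union> Z\<close> is the set of all representatives of \<open>Z\<close> in the free algebra.
  All of them act in the same way if \<open>\<phi>\<close> satisfies the defining relations of \<open>H\<^sub>p\<^sub>a\<^sub>r\<close>.\<close>

definition hpar_action ::
  "'k ring \<Rightarrow> ('k, 'v, 'z) module_scheme \<Rightarrow> ('h \<Rightarrow> 'v \<Rightarrow> 'v) \<Rightarrow> ('k, 'h) hpar_elem \<Rightarrow> 'v \<Rightarrow> 'v" where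
  "hpar_action K V \<phi> Z v = the_elem
     ((\<lambda>p. \<Oplus>\<^bsub>V\<^esub>w \<in> {w. p w \<noteq> \<zero>\<^bsub>K\<^esub>}. p w \<odot>\<^bsub>V\<^esub> foldr \<phi> w v) ` (\<Union> Z))"


section \<open>The first bifunctor\<close>

text \<open>The category of bimodules over \<open>A#H\<close> is that of left modules over its enveloping algebra:
  \<open>a \<cdot> m \<cdot> b\<close> is \<open>(a \<otimes> b) \<cdot> m\<close>.\<close>

abbreviation smash_env ::
  "'k ring \<Rightarrow> ('k, 'h) hopf \<Rightarrow> ('k, 'a) module \<Rightarrow> ('h \<Rightarrow> 'a \<Rightarrow> 'a)
   \<Rightarrow> ('k, (('a, 'h) tens, ('a, 'h) tens) tens) module" where
  "smash_env K H A act \<equiv> enveloping K (smash K H A act)"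

abbreviation smash_env_tens ::
  "'k ring \<Rightarrow> ('k, 'h) hopf \<Rightarrow> ('k, 'a) module \<Rightarrow> ('h \<Rightarrow> 'a \<Rightarrow> 'a)
   \<Rightarrow> ('a, 'h) tens \<Rightarrow> ('a, 'h) tens \<Rightarrow> (('a, 'h) tens, ('a, 'h) tens) tens" where
  "smash_env_tens K H A act \<equiv>
     tens (self_alg K) (smash K H A act) (opposite (smash K H A act))"

definition regular_env :: "('k, 'a) module \<Rightarrow> (('a, 'a) tens, 'a) module" where
  "regular_env A = with_smult A (\<lambda>t x. tens_lift A (\<lambda>a b. b \<otimes>\<^bsub>A\<^esub> x \<otimes>\<^bsub>A\<^esub> a) t)"

definition restrict_env ::
  "'k ring \<Rightarrow> ('k, 'h) hopf \<Rightarrow> ('k, 'a) module \<Rightarrow> ('h \<Rightarrow> 'a \<Rightarrow> 'a)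
   \<Rightarrow> ((('a, 'h) tens, ('a, 'h) tens) tens, 'm) module \<Rightarrow> (('a, 'a) tens, 'm) module" where
  "restrict_env K H A act M = with_smult M (\<lambda>t m.
     tens_lift (smash_env K H A act)
       (\<lambda>a b. smash_env_tens K H A act
          (smash_elem K H A act a \<one>\<^bsub>H\<^esub>) (smash_elem K H A act b \<one>\<^bsub>H\<^esub>)) t \<odot>\<^bsub>M\<^esub> m)"

definition coinv_tensor ::
  "'k ring \<Rightarrow> ('k, 'h) hopf \<Rightarrow> ('k, 'a) module \<Rightarrow> ('h \<Rightarrow> 'a \<Rightarrow> 'a)
   \<Rightarrow> ((('a, 'h) tens, ('a, 'h) tens) tens, 'm) module
   \<Rightarrow> (('k, 'h) hpar_elem, ('a, 'm) tens) module" where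
  "coinv_tensor K H A act M =
     (let V = tensor (enveloping K A) (regular_env A) (restrict_env K H A act M);
          t = tens (enveloping K A) (regular_env A) (restrict_env K H A act M);
          sm = smash_elem K H A act;
          \<phi> = (\<lambda>h. tens_lift V (\<lambda>a m. sweedler H V h (\<lambda>x x'. sweedler H V x' (\<lambda>y z.
                 t (act x a)
                   (smash_env_tens K H A act (sm \<one>\<^bsub>A\<^esub> y) (sm \<one>\<^bsub>A\<^esub> (antipode H z)) \<odot>\<^bsub>M\<^esub> m)))))
      in with_smult V (hpar_action K V \<phi>))"

definition coinv_tensor_map ::
  "'k ring \<Rightarrow> ('k, 'h) hopf \<Rightarrow> ('k, 'a) module \<Rightarrow> ('h \<Rightarrow> 'a \<Rightarrow> 'a)
   \<Rightarrow> ((('a, 'h) tens, ('a, 'h) tens) tens, 'm2) module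
   \<Rightarrow> ('m1 \<Rightarrow> 'm2) \<Rightarrow> ('a, 'm1) tens \<Rightarrow> ('a, 'm2) tens" where
  "coinv_tensor_map K H A act M' g =
     tensor_map (enveloping K A) (regular_env A) (restrict_env K H A act M') id g"

definition functor1 ::
  "'k ring \<Rightarrow> ('k, 'h) hopf \<Rightarrow> ('k, 'a) module \<Rightarrow> ('h \<Rightarrow> 'a \<Rightarrow> 'a)
   \<Rightarrow> (('k, 'h) hpar_elem, 'x) module \<Rightarrow> ((('a, 'h) tens, ('a, 'h) tens) tens, 'm) module
   \<Rightarrow> ('k, ('x, ('a, 'm) tens) tens) module" where
  "functor1 K H A act X M = tensor (hpar K H) X (coinv_tensor K H A act M)"

definition functor1_map ::
  "'k ring \<Rightarrow> ('k, 'h) hopf \<Rightarrow> ('k, 'a) module \<Rightarrow> ('h \<Rightarrow> 'a \<Rightarrow> 'a)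
   \<Rightarrow> (('k, 'h) hpar_elem, 'x) module \<Rightarrow> ((('a, 'h) tens, ('a, 'h) tens) tens, 'm) module
   \<Rightarrow> ('x \<Rightarrow> 'x) \<Rightarrow> ('m \<Rightarrow> 'm) \<Rightarrow> ('x, ('a, 'm) tens) tens \<Rightarrow> ('x, ('a, 'm) tens) tens" where
  "functor1_map K H A act X' M' f g =
     tensor_map (hpar K H) X' (coinv_tensor K H A act M') f (coinv_tensor_map K H A act M' g)"


section \<open>The second bifunctor\<close>

definition smash_left_hpar ::
  "'k ring \<Rightarrow> ('k, 'h) hopf \<Rightarrow> ('k, 'a) module \<Rightarrow> ('h \<Rightarrow> 'a \<Rightarrow> 'a)
   \<Rightarrow> (('k, 'h) hpar_elem, ('a, 'h) tens) module" where
  "smash_left_hpar K H A act =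
     (let R = smash K H A act
      in with_smult R (hpar_action K R (\<lambda>h u. smash_elem K H A act \<one>\<^bsub>A\<^esub> h \<otimes>\<^bsub>R\<^esub> u)))"

text \<open>The bimodule \<open>X \<otimes>\<^sub>B (A#H)\<close>, as a right module over the enveloping algebra of \<open>A#H\<close> by
  \<open>v \<cdot> (s \<otimes> s') = s' \<cdot> v \<cdot> s\<close>.  In the left action of \<open>s \<in> A#H \<subseteq> A \<otimes> H\<close>, if
  \<open>s = \<Sum> a\<^sub>i \<otimes> h\<^sub>i\<close> then \<open>s = s (1 \<otimes> 1) = \<Sum> a\<^sub>i # h\<^sub>i\<close>, so that a lift over \<open>A \<otimes> H\<close> expresses
  the formula given on the generators \<open>a # h\<close>.\<close>

definition induced_env ::
  "'k ring \<Rightarrow> ('k, 'h) hopf \<Rightarrow> ('k, 'a) module \<Rightarrow> ('h \<Rightarrow> 'a \<Rightarrow> 'a)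
   \<Rightarrow> (('k, 'h) hpar_elem, 'x) module
   \<Rightarrow> ((('a, 'h) tens, ('a, 'h) tens) tens, ('x, ('a, 'h) tens) tens) module" where
  "induced_env K H A act X =
     (let R = smash K H A act; L = smash_left_hpar K H A act;
          V = tensor (B_alg K H) X L;
          t = tens (B_alg K H) X L;
          lact = (\<lambda>s v. tens_lift V (\<lambda>a h. tens_lift V (\<lambda>x u. sweedler H V h (\<lambda>y z.
                    t (hclass K H (antipode H y) \<odot>\<^bsub>X\<^esub> x)
                      (smash_elem K H A act a z \<otimes>\<^bsub>R\<^esub> u))) v) s);
          ract = (\<lambda>v s. tens_lift V (\<lambda>x u. t x (u \<otimes>\<^bsub>R\<^esub> s)) v)
      in with_smult V (\<lambda>e v. tens_lift V (\<lambda>s s'. ract (lact s' v) s) e))"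

definition functor2 ::
  "'k ring \<Rightarrow> ('k, 'h) hopf \<Rightarrow> ('k, 'a) module \<Rightarrow> ('h \<Rightarrow> 'a \<Rightarrow> 'a)
   \<Rightarrow> (('k, 'h) hpar_elem, 'x) module \<Rightarrow> ((('a, 'h) tens, ('a, 'h) tens) tens, 'm) module
   \<Rightarrow> ('k, (('x, ('a, 'h) tens) tens, 'm) tens) module" where
  "functor2 K H A act X M = tensor (smash_env K H A act) (induced_env K H A act X) M"

definition functor2_map ::
  "'k ring \<Rightarrow> ('k, 'h) hopf \<Rightarrow> ('k, 'a) module \<Rightarrow> ('h \<Rightarrow> 'a \<Rightarrow> 'a)
   \<Rightarrow> (('k, 'h) hpar_elem, 'x) module \<Rightarrow> ((('a, 'h) tens, ('a, 'h) tens) tens, 'm) module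
   \<Rightarrow> ('x \<Rightarrow> 'x) \<Rightarrow> ('m \<Rightarrow> 'm)
   \<Rightarrow> (('x, ('a, 'h) tens) tens, 'm) tens \<Rightarrow> (('x, ('a, 'h) tens) tens, 'm) tens" where
  "functor2_map K H A act X' M' f g =
     tensor_map (smash_env K H A act) (induced_env K H A act X') M'
       (tensor_map (B_alg K H) X' (smash_left_hpar K H A act) f id) g"


section \<open>Bifunctors and natural isomorphisms\<close>

text \<open>Covariant bifunctors from right \<open>R\<close>-modules and left \<open>S\<close>-modules to \<open>K\<close>-modules.  The modules
  range over the arbitrary carrier types \<open>'x\<close> and \<open>'m\<close>, which play the role of universes.
  \<open>Fm X' M' f g\<close> is the value on a pair of morphisms \<open>f : X \<rightarrow> X'\<close>, \<open>g : M \<rightarrow> M'\<close>.\<close>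

locale bifunctor =
  fixes K :: "'k ring" and R :: "('k, 'r) module" and S :: "('k, 's) module"
    and F :: "('r, 'x) module \<Rightarrow> ('s, 'm) module \<Rightarrow> ('k, 'p) module"
    and Fm :: "('r, 'x) module \<Rightarrow> ('s, 'm) module \<Rightarrow> ('x \<Rightarrow> 'x) \<Rightarrow> ('m \<Rightarrow> 'm) \<Rightarrow> 'p \<Rightarrow> 'p"
  assumes obj: "\<lbrakk>right_module R X; left_module S M\<rbrakk> \<Longrightarrow> module K (F X M)"
    and mor: "\<lbrakk>right_module R X; right_module R X'; left_module S M; left_module S M';
        f \<in> mod_hom R X X'; g \<in> mod_hom S M M'\<rbrakk>
      \<Longrightarrow> Fm X' M' f g \<in> mod_hom K (F X M) (F X' M')"
    and ident: "\<lbrakk>right_module R X; left_module S M; t \<in> carrier (F X M)\<rbrakk>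
      \<Longrightarrow> Fm X M id id t = t"
    and comp: "\<lbrakk>right_module R X; right_module R X'; right_module R X'';
        left_module S M; left_module S M'; left_module S M'';
        f \<in> mod_hom R X X'; f' \<in> mod_hom R X' X'';
        g \<in> mod_hom S M M'; g' \<in> mod_hom S M' M''; t \<in> carrier (F X M)\<rbrakk>
      \<Longrightarrow> Fm X'' M'' (f' \<circ> f) (g' \<circ> g) t = Fm X'' M'' f' g' (Fm X' M' f g t)"

definition naturally_isomorphic ::
  "'k ring \<Rightarrow> ('k, 'r) module \<Rightarrow> ('k, 's) module
   \<Rightarrow> (('r, 'x) module \<Rightarrow> ('s, 'm) module \<Rightarrow> ('k, 'p) module)
   \<Rightarrow> (('r, 'x) module \<Rightarrow> ('s, 'm) module \<Rightarrow> ('x \<Rightarrow> 'x) \<Rightarrow> ('m \<Rightarrow> 'm) \<Rightarrow> 'p \<Rightarrow> 'p)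
   \<Rightarrow> (('r, 'x) module \<Rightarrow> ('s, 'm) module \<Rightarrow> ('k, 'q) module)
   \<Rightarrow> (('r, 'x) module \<Rightarrow> ('s, 'm) module \<Rightarrow> ('x \<Rightarrow> 'x) \<Rightarrow> ('m \<Rightarrow> 'm) \<Rightarrow> 'q \<Rightarrow> 'q)
   \<Rightarrow> bool" where
  "naturally_isomorphic K R S F Fm G Gm \<longleftrightarrow>
     (\<exists>\<eta>.
       (\<forall>X M. right_module R X \<and> left_module S M \<longrightarrow>
          \<eta> X M \<in> mod_hom K (F X M) (G X M) \<and>
          bij_betw (\<eta> X M) (carrier (F X M)) (carrier (G X M))) \<and>
       (\<forall>X X' M M' f g.
          right_module R X \<and> right_module R X' \<and> left_module S M \<and> left_module S M' \<and>
          f \<in> mod_hom R X X' \<and> g \<in> mod_hom S M M' \<longrightarrow>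
          (\<forall>t \<in> carrier (F X M). \<eta> X' M' (Fm X' M' f g t) = Gm X' M' f g (\<eta> X M t))))"

end

theory Submission
  imports Defs
begin

text \<open>Write \<open>R = A # H\<close>, \<open>\<alpha>(a) = a # 1\<close> and \<open>\<gamma>(h) = 1 # h\<close>, so that \<open>a # h = \<alpha>(a) \<gamma>(h)\<close>.  Let \<open>M\<close> be an \<open>R\<close>-bimodule
and \<open>X\<close> a right \<open>H\<^sub>p\<^sub>a\<^sub>r\<close>-module.

The tensor product \<open>A \<otimes> M\<close> over \<open>A\<^sup>e\<close> is \<open>M\<close> modulo its commutators with \<open>A\<close>: the class \<open>\<tau>(m) = 1 \<otimes> m\<close>
satisfies \<open>\<tau>(\<alpha>(a) m) = \<tau>(m \<alpha>(a))\<close>, every element is such a class, and a linear map out of the tensor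
product is a linear trace on \<open>M\<close> (\<open>\<tau>_trace\<close>, \<open>VM_induct\<close>, \<open>VM_lift\<close>).  The generator \<open>[h]\<close> acts on it by the
conjugation \<open>\<tau>(m) \<mapsto> \<tau>(\<gamma>(h\<^sub>1) m \<gamma>(S h\<^sub>2))\<close>.  On the other side \<open>(x \<otimes> u) \<otimes> m = (x \<otimes> 1) \<otimes> u m\<close>
(\<open>t2_normal\<close>).  Hence both functors are generated by the pairs of an \<open>x\<close> in \<open>X\<close> and an \<open>m\<close> in \<open>M\<close>, and
the isomorphism has to be

  \<open>x \<otimes> \<tau>(m) \<longleftrightarrow> (x \<otimes> 1) \<otimes> m\<close>.

Naturality, and the fact that the two maps are inverse to each other, can then be read off on generators
(\<open>F1_eq\<close>, \<open>F2_eq\<close>).  The content is that both directions are well defined.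

From left to right, the trace property holds since \<open>\<alpha>(a)\<close> acts on \<open>x \<otimes> 1\<close> in the same way from the
left and from the right (\<open>fwd_at_facts\<close>).  Compatibility with \<open>[h]\<close> is the computation
(\<open>conjugate_unit\<close>)

  \<open>\<gamma>(S h\<^sub>2) (x \<otimes> 1) \<gamma>(h\<^sub>1) = x [h\<^sub>1] \<otimes> \<gamma>(S h\<^sub>2) \<gamma>(h\<^sub>3) = x [h\<^sub>1] \<otimes> \<alpha>(S h\<^sub>2 \<cdot> 1) = x [h\<^sub>1] e\<^bsub>S h\<^sub>2\<^esub> \<otimes> 1 = x [h] \<otimes> 1\<close>,

which uses that the tensor product is taken over the subalgebra \<open>B\<close> of the elements \<open>e\<^sub>k\<close>, and the
relation \<open>[h\<^sub>1] e\<^bsub>S h\<^sub>2\<^esub> = [h]\<close> in \<open>H\<^sub>p\<^sub>a\<^sub>r\<close> (\<open>hc_mult_ee_antipode\<close>).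

From right to left, \<open>(x \<otimes> u) \<otimes> m\<close> goes to \<open>x \<otimes> \<tau>(u m)\<close>.  This respects \<open>e\<^sub>k\<close> because \<open>e\<^sub>k\<close> multiplies both
\<open>u\<close> and \<open>\<tau>(m)\<close> by \<open>\<alpha>(k \<cdot> 1)\<close>.  For the left action of \<open>a # h\<close> on \<open>X \<otimes> R\<close> one needs (\<open>hcS_\<tau>\<close>)

  \<open>[S h\<^sub>1] \<tau>((a # h\<^sub>2) n) = \<tau>(n (a # h))\<close>,

which follows from the trace property and the identities \<open>\<gamma>(S h\<^sub>1) (a # h\<^sub>2) = \<alpha>(S h \<cdot> a)\<close> and
\<open>\<gamma>(h\<^sub>2) \<alpha>(S h\<^sub>1 \<cdot> a) = a # h\<close> in \<open>R\<close> (\<open>\<gamma>S_mult_sm\<close>, \<open>\<gamma>_mult_\<alpha>S\<close>).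

Two more facts are needed for the functors to exist.  The module structures over \<open>H\<^sub>p\<^sub>a\<^sub>r\<close> come from partial
representations of \<open>H\<close>: operators that satisfy the defining relations make a module
(\<open>hpar_action_left_module\<close>).  Left multiplication by \<open>\<gamma>(h)\<close> is a partial representation because
\<open>\<gamma>(h\<^sub>1) \<gamma>(S h\<^sub>2) = \<alpha>(h \<cdot> 1)\<close>, and conjugation is the product along the comultiplication of \<open>\<gamma>\<close> in \<open>R\<close> and
\<open>\<gamma> \<circ> S\<close> in the opposite of \<open>R\<close>, which is again a partial representation as \<open>H\<close> is cocommutative
(\<open>prod_rep_par_rep\<close>).  Finally \<open>X \<otimes> R\<close> over \<open>B\<close> is a bimodule since in \<open>H\<^sub>p\<^sub>a\<^sub>r\<close> the elements \<open>e\<^sub>k\<close> can be moved past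
\<open>[S h]\<close> (\<open>ee_mult_hcS\<close>), and the failure of \<open>h \<mapsto> [S h]\<close> to be multiplicative is again measured by elements
\<open>e\<^sub>k\<close> (\<open>hcS_mult_hcS\<close>), which the smash product absorbs (\<open>lact_mult_gen\<close>).\<close>

section \<open>Notation\<close>

text \<open>The structure to which an operation belongs is written in brackets: in most formulas below several
  algebras and modules occur side by side.\<close>

abbreviation mem_carrier (infix "\<in>." 50) where "x \<in>. M \<equiv> x \<in> carrier M"
abbreviation mult_in ("(_/ *[_] _)" [70, 0, 71] 70) where "x *[M] y \<equiv> x \<otimes>\<^bsub>M\<^esub> y"
abbreviation add_in ("(_/ +[_] _)" [65, 0, 66] 65) where "x +[M] y \<equiv> x \<oplus>\<^bsub>M\<^esub> y"
abbreviation smult_in ("(_/ \<cdot>[_] _)" [70, 0, 71] 70) where "c \<cdot>[M] x \<equiv> c \<odot>\<^bsub>M\<^esub> x"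
abbreviation one_in ("\<one>[_]") where "\<one>[M] \<equiv> \<one>\<^bsub>M\<^esub>"
abbreviation zero_in ("\<zero>[_]") where "\<zero>[M] \<equiv> \<zero>\<^bsub>M\<^esub>"

section \<open>Additive and linear maps\<close>

definition additive :: "('m, 'u) ring_scheme \<Rightarrow> ('n, 'v) ring_scheme \<Rightarrow> ('m \<Rightarrow> 'n) \<Rightarrow> bool" where
  "additive M N f \<longleftrightarrow> (\<forall>x \<in> carrier M. f x \<in>. N) \<and>
     (\<forall>x \<in> carrier M. \<forall>y \<in> carrier M. f (x +[M] y) = f x +[N] f y)"

text \<open>The condition that defines \<open>mod_hom\<close>, as a predicate on terms.  The simplifier can decide a goal
  \<open>lin K L N (\<lambda>x. \<dots>)\<close> by rules that follow the structure of the term.\<close>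

definition lin :: "('r, 'z) ring_scheme \<Rightarrow> ('r, 'm, 'u) module_scheme \<Rightarrow> ('r, 'n, 'v) module_scheme
    \<Rightarrow> ('m \<Rightarrow> 'n) \<Rightarrow> bool" where
  "lin R M N f \<longleftrightarrow> additive M N f \<and> (\<forall>r \<in> carrier R. \<forall>x \<in> carrier M. f (r \<cdot>[M] x) = r \<cdot>[N] f x)"

lemma mod_hom_iff_lin: "f \<in> mod_hom R M N \<longleftrightarrow> lin R M N f"
  by (auto simp: mod_hom_def lin_def additive_def hom_def)

lemma additiveI:
  assumes "\<And>x. x \<in>. M \<Longrightarrow> f x \<in>. N"
    and "\<And>x y. \<lbrakk>x \<in>. M; y \<in>. M\<rbrakk> \<Longrightarrow> f (x +[M] y) = f x +[N] f y"
  shows "additive M N f"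
  using assms by (simp add: additive_def)

lemma additive_closed: "additive M N f \<Longrightarrow> x \<in>. M \<Longrightarrow> f x \<in>. N" by (simp add: additive_def)

lemma additive_add:
  "additive M N f \<Longrightarrow> x \<in>. M \<Longrightarrow> y \<in>. M \<Longrightarrow> f (x +[M] y) = f x +[N] f y"
  by (simp add: additive_def)

lemma additive_hom: "additive M N f \<longleftrightarrow> f \<in> hom (add_monoid M) (add_monoid N)"
  by (auto simp: additive_def hom_def)

lemma additive_zero:
  assumes "additive M N f" "abelian_group M" "abelian_group N"
  shows "f \<zero>[M] = \<zero>[N]"
  using group.is_monoid
    hom_one[of f "add_monoid M" "add_monoid N"] assms by (simp add: additive_hom abelian_group.a_group)

lemma additive_minus:
  assumes "additive M N f" "abelian_group M" "abelian_group N" "x \<in>. M"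
  shows "f (\<ominus>\<^bsub>M\<^esub> x) = \<ominus>\<^bsub>N\<^esub> f x"
proof -
  interpret group_hom "add_monoid M" "add_monoid N" f
    using assms by (simp add: group_hom_def group_hom_axioms_def additive_hom abelian_group.a_group)
  show ?thesis using hom_inv[of x] assms(4) by (simp add: a_inv_def)
qed

lemma additive_finsum:
  assumes "abelian_group M" "abelian_group N" "additive M N g" "finite W" "f \<in> W \<rightarrow> carrier M"
  shows "g (finsum M f W) = finsum N (\<lambda>w. g (f w)) W"
proof -
  interpret M: abelian_group M by fact
  interpret N: abelian_group N by fact
  show ?thesis
    using assms(4,5)
  proof (induction W)
    case (insert w W)
    then have "(\<lambda>w. g (f w)) \<in> W \<rightarrow> carrier N" using additive_closed[OF assms(3)] by auto
    then show ?case using insert additive_add[OF assms(3)] additive_closed[OF assms(3)] by simp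
  qed (simp add: additive_zero[OF assms(3,1,2)])
qed

lemma linI:
  assumes "\<And>x. x \<in>. M \<Longrightarrow> f x \<in>. N"
    and "\<And>x y. \<lbrakk>x \<in>. M; y \<in>. M\<rbrakk> \<Longrightarrow> f (x +[M] y) = f x +[N] f y"
    and "\<And>r x. \<lbrakk>r \<in>. R; x \<in>. M\<rbrakk> \<Longrightarrow> f (r \<cdot>[M] x) = r \<cdot>[N] f x"
  shows "lin R M N f"
  using assms by (simp add: lin_def additive_def)

lemma lin_additive: "lin R M N f \<Longrightarrow> additive M N f" by (simp add: lin_def)

lemma lin_closed: "lin R M N f \<Longrightarrow> x \<in>. M \<Longrightarrow> f x \<in>. N" by (simp add: lin_def additive_def)

lemma lin_add:
  "lin R M N f \<Longrightarrow> x \<in>. M \<Longrightarrow> y \<in>. M \<Longrightarrow> f (x +[M] y) = f x +[N] f y"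
  by (simp add: lin_def additive_def)

lemma lin_smult:
  "lin R M N f \<Longrightarrow> r \<in>. R \<Longrightarrow> x \<in>. M \<Longrightarrow> f (r \<cdot>[M] x) = r \<cdot>[N] f x"
  by (simp add: lin_def)

lemma lin_comp: "lin R N P g \<Longrightarrow> lin R M N f \<Longrightarrow> lin R M P (\<lambda>x. g (f x))"
  by (simp add: lin_def additive_def)

lemma additive_comp: "additive N P g \<Longrightarrow> additive M N f \<Longrightarrow> additive M P (\<lambda>x. g (f x))"
  by (simp add: additive_def)

lemma additive_id: "additive P P (\<lambda>x. x)" by (simp add: additive_def)

lemma lin_id: "lin R M M (\<lambda>x. x)" by (simp add: lin_def additive_def)

lemma lin_cong:
  assumes "lin R M N f" "\<And>x. x \<in>. M \<Longrightarrow> f x = g x"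
    "\<And>x y. x \<in>. M \<Longrightarrow> y \<in>. M \<Longrightarrow> x +[M] y \<in>. M"
    "\<And>r x. r \<in>. R \<Longrightarrow> x \<in>. M \<Longrightarrow> r \<cdot>[M] x \<in>. M"
  shows "lin R M N g"
  using assms unfolding lin_def additive_def by metis


lemma abelian_group_negative_unique:
  assumes "abelian_group M" "a +[M] b = \<zero>[M]" "a +[M] c = \<zero>[M]"
    "a \<in>. M" "b \<in>. M" "c \<in>. M"
  shows "b = c"
proof -
  interpret abelian_group M by fact
  show ?thesis using assms(2-6) by (metis minus_equality a_comm)
qed

lemma abelian_group_fields:
  assumes "abelian_group M" "carrier N = carrier M" "add N = add M" "zero N = zero M"
  shows "abelian_group N"
proof -
  interpret M: abelian_group M by fact
  show ?thesis
    by (rule abelian_groupI) (use M.l_neg M.a_inv_closed in \<open>auto simp: assms(2-4) M.a_assoc intro: M.a_comm\<close>)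
qed


section \<open>Tensor products over a noncommutative ring\<close>

definition balanced :: "('r, 'z) ring_scheme \<Rightarrow> ('r, 'x, 'u) module_scheme \<Rightarrow> ('r, 'y, 'v) module_scheme
    \<Rightarrow> ('p, 'w) ring_scheme \<Rightarrow> ('x \<Rightarrow> 'y \<Rightarrow> 'p) \<Rightarrow> bool" where
  "balanced R X Y P f \<longleftrightarrow> (\<forall>x \<in> carrier X. additive Y P (f x)) \<and>
     (\<forall>y \<in> carrier Y. additive X P (\<lambda>x. f x y)) \<and>
     (\<forall>r \<in> carrier R. \<forall>x \<in> carrier X. \<forall>y \<in> carrier Y. f (r \<cdot>[X] x) y = f x (r \<cdot>[Y] y))"

lemma balancedI:
  assumes "\<And>x. x \<in>. X \<Longrightarrow> additive Y P (f x)"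
    and "\<And>y. y \<in>. Y \<Longrightarrow> additive X P (\<lambda>x. f x y)"
    and "\<And>r x y. \<lbrakk>r \<in>. R; x \<in>. X; y \<in>. Y\<rbrakk> \<Longrightarrow> f (r \<cdot>[X] x) y = f x (r \<cdot>[Y] y)"
  shows "balanced R X Y P f"
  using assms by (simp add: balanced_def)

text \<open>The sum that occurs in \<open>tens_lift\<close>.  It is additive in the formal sum and vanishes on the relations,
  and so its value depends only on the coset.\<close>

definition free_eval :: "('p, 'z) ring_scheme \<Rightarrow> ('x \<Rightarrow> 'y \<Rightarrow> 'p) \<Rightarrow> ('x \<times> 'y \<Rightarrow>\<^sub>0 int) \<Rightarrow> 'p" where
  "free_eval P f c = (\<Oplus>\<^bsub>P\<^esub>p \<in> Poly_Mapping.keys c.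
      [Poly_Mapping.lookup c p] \<cdot>\<^bsub>P\<^esub> f (fst p) (snd p))"

lemma free_eval_superset:
  assumes P: "abelian_group P" and f: "\<forall>x\<in>A. \<forall>y\<in>B. f x y \<in>. P"
    and "finite S" "Poly_Mapping.keys c \<subseteq> S" "S \<subseteq> A \<times> B"
  shows "free_eval P f c = (\<Oplus>\<^bsub>P\<^esub>p \<in> S. [Poly_Mapping.lookup c p] \<cdot>\<^bsub>P\<^esub> f (fst p) (snd p))"
proof -
  interpret abelian_group P by fact
  have cl: "f (fst p) (snd p) \<in>. P" if "p \<in> S" for p
    using that assms(5) f by auto
  show ?thesis
    unfolding free_eval_def by (rule add.finprod_mono_neutral_cong_left)
      (use assms cl in \<open>auto simp: in_keys_iff Pi_def add_pow_def intro!: add.int_pow_closed[unfolded add_pow_def]\<close>)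
qed

lemma free_eval_add:
  assumes P: "abelian_group P" and f: "\<forall>x\<in>A. \<forall>y\<in>B. f x y \<in>. P"
    and c: "Poly_Mapping.keys c \<subseteq> A \<times> B" and d: "Poly_Mapping.keys d \<subseteq> A \<times> B"
  shows "free_eval P f (c + d) = free_eval P f c +[P] free_eval P f d"
proof -
  interpret abelian_group P by fact
  let ?S = "Poly_Mapping.keys c \<union> Poly_Mapping.keys d"
  have S: "finite ?S" "?S \<subseteq> A \<times> B" using c d by auto
  have cl: "f (fst p) (snd p) \<in>. P" if "p \<in> ?S" for p
    using that S f by auto
  have "free_eval P f (c + d) = (\<Oplus>\<^bsub>P\<^esub>p \<in> ?S. [Poly_Mapping.lookup (c + d) p] \<cdot>\<^bsub>P\<^esub> f (fst p) (snd p))"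
    by (rule free_eval_superset[OF P f S(1) keys_add S(2)])
  also have "\<dots> = (\<Oplus>\<^bsub>P\<^esub>p \<in> ?S. [Poly_Mapping.lookup c p] \<cdot>\<^bsub>P\<^esub> f (fst p) (snd p)
      +[P] [Poly_Mapping.lookup d p] \<cdot>\<^bsub>P\<^esub> f (fst p) (snd p))"
    by (rule finsum_cong') (use cl in \<open>auto simp: Poly_Mapping.lookup_add add.int_pow_mult\<close>)
  also have "\<dots> = (\<Oplus>\<^bsub>P\<^esub>p \<in> ?S. [Poly_Mapping.lookup c p] \<cdot>\<^bsub>P\<^esub> f (fst p) (snd p))
      +[P] (\<Oplus>\<^bsub>P\<^esub>p \<in> ?S. [Poly_Mapping.lookup d p] \<cdot>\<^bsub>P\<^esub> f (fst p) (snd p))"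
    by (rule finsum_addf) (use cl in auto)
  also have "\<dots> = free_eval P f c +[P] free_eval P f d"
    using free_eval_superset[OF P f S(1) Un_upper1 S(2)] free_eval_superset[OF P f S(1) Un_upper2 S(2)] by simp
  finally show ?thesis .
qed

lemma free_eval_closed:
  assumes P: "abelian_group P" and f: "\<forall>x\<in>A. \<forall>y\<in>B. f x y \<in>. P"
    and c: "Poly_Mapping.keys c \<subseteq> A \<times> B"
  shows "free_eval P f c \<in>. P"
proof -
  interpret abelian_group P by fact
  show ?thesis unfolding free_eval_def by (rule finsum_closed) (use c f in force)
qed

lemma free_eval_frag_of:
  assumes P: "abelian_group P" and "f x y \<in>. P"
  shows "free_eval P f (frag_of (x, y)) = f x y"
proof -
  interpret abelian_group P by fact
  show ?thesis unfolding free_eval_def using assms by simp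
qed

lemma free_eval_diff:
  assumes P: "abelian_group P" and f: "\<forall>x\<in>A. \<forall>y\<in>B. f x y \<in>. P"
    and c: "Poly_Mapping.keys c \<subseteq> A \<times> B" and d: "Poly_Mapping.keys d \<subseteq> A \<times> B"
  shows "free_eval P f (c - d) = free_eval P f c \<ominus>\<^bsub>P\<^esub> free_eval P f d"
proof -
  interpret abelian_group P by fact
  have k: "Poly_Mapping.keys (c - d) \<subseteq> A \<times> B" using keys_diff[of c d] c d by blast
  have "free_eval P f c = free_eval P f (c - d) +[P] free_eval P f d"
    using free_eval_add[OF P f k d] by simp
  then show ?thesis
    using free_eval_closed[OF P f c] free_eval_closed[OF P f d] free_eval_closed[OF P f k]
    by (simp add: a_minus_def a_assoc r_neg)
qed

locale tensor_product =
  fixes R :: "('k, 'r, 'z) module_scheme" and X :: "('r, 'x, 'u) module_scheme"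
    and Y :: "('r, 'y, 'v) module_scheme"
  assumes gX: "abelian_group X" and gY: "abelian_group Y"
    and sX: "\<lbrakk>r \<in>. R; x \<in>. X\<rbrakk> \<Longrightarrow> r \<cdot>[X] x \<in>. X"
    and sY: "\<lbrakk>r \<in>. R; y \<in>. Y\<rbrakk> \<Longrightarrow> r \<cdot>[Y] y \<in>. Y"
begin

abbreviation "FG \<equiv> free_Abelian_group (carrier X \<times> carrier Y)"
abbreviation "NN \<equiv> tensor_null R X Y"

lemma rels_sub: "tensor_rels R X Y \<subseteq> carrier FG"
proof -
  have *: "Poly_Mapping.keys (frag_of a - frag_of b) \<subseteq> {a, b}"
    "Poly_Mapping.keys (frag_of a - frag_of b - frag_of c) \<subseteq> {a, b, c}" for a b c :: "'x \<times> 'y"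
    using keys_diff[of "frag_of a" "frag_of b"] keys_diff[of "frag_of a - frag_of b" "frag_of c"] by auto
  have aX: "x +[X] x' \<in>. X" if "x \<in>. X" "x' \<in>. X" for x x'
    using that gX by (simp add: abelian_group.axioms(1) abelian_monoid.a_closed)
  have aY: "x +[Y] x' \<in>. Y" if "x \<in>. Y" "x' \<in>. Y" for x x'
    using that gY by (simp add: abelian_group.axioms(1) abelian_monoid.a_closed)
  show ?thesis
    unfolding tensor_rels_def
    apply clarify
    unfolding carrier_free_Abelian_group_iff
    by (elim UnE CollectE exE conjE; simp only:; rule subset_trans[OF *(1)] subset_trans[OF *(2)];
        simp add: aX aY sX sY)
qed

lemma null_normal: "NN \<lhd> FG"
proof -
  interpret comm_group FG by (rule abelian_free_Abelian_group)
  show ?thesis unfolding tensor_null_def by (rule subgroup_imp_normal) (rule generate_is_subgroup[OF rels_sub])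
qed

lemma null_sub: "NN \<subseteq> carrier FG"
  using null_normal normal_imp_subgroup subgroup.subset by blast

lemma tensor_add_group: "abelian_group (tensor_add R X Y)"
proof -
  interpret G: comm_group FG by (rule abelian_free_Abelian_group)
  have "comm_group (FG Mod NN)"
    using null_normal G.abelian_FactGroup normal_imp_subgroup by blast
  moreover have "add_monoid (tensor_add R X Y) = FG Mod NN" by (simp add: tensor_add_def Let_def FactGroup_def)
  ultimately show ?thesis by (simp add: abelian_group_def abelian_group_axioms_def abelian_monoid_def comm_group_def)
qed

lemma tensor_fields [simp]:
  "carrier (tensor R X Y) = carrier (tensor_add R X Y)"
  "add (tensor R X Y) = add (tensor_add R X Y)"
  "zero (tensor R X Y) = zero (tensor_add R X Y)" by (simp_all add: tensor_def ring.defs)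

lemma tensor_group: "abelian_group (tensor R X Y)" by (rule abelian_group_fields[OF tensor_add_group]) simp_all

lemma coset_eq:
  assumes "a \<in>. FG" "b \<in>. FG" "a - b \<in> NN"
  shows "NN #>\<^bsub>FG\<^esub> a = NN #>\<^bsub>FG\<^esub> b"
proof -
  interpret comm_group FG by (rule abelian_free_Abelian_group)
  have "a \<in> NN #>\<^bsub>FG\<^esub> b"
    unfolding r_coset_def using assms(3) by (auto intro!: bexI[of _ "a - b"])
  then show ?thesis
    using repr_independence[of a NN b] assms(2) normal_imp_subgroup[OF null_normal] by simp
qed

lemma coset_add:
  assumes "a \<in>. FG" "b \<in>. FG"
  shows "(NN #>\<^bsub>FG\<^esub> a) +[tensor_add R X Y] (NN #>\<^bsub>FG\<^esub> b) = NN #>\<^bsub>FG\<^esub> (a + b)"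
  using normal.rcos_sum[OF null_normal assms] by (simp add: tensor_add_def Let_def)

lemma tensor_carrier_coset:
  "carrier (tensor_add R X Y) = (\<lambda>c. NN #>\<^bsub>FG\<^esub> c) ` carrier FG"
  by (simp add: tensor_add_def Let_def carrier_FactGroup)

lemma tens_closed:
  "x \<in>. X \<Longrightarrow> y \<in>. Y \<Longrightarrow> tens R X Y x y \<in>. (tensor R X Y)"
  by (auto simp: tens_def tensor_carrier_coset)

lemma tens_add_left:
  assumes "x \<in>. X" "x' \<in>. X" "y \<in>. Y"
  shows "tens R X Y (x +[X] x') y = tens R X Y x y +[tensor R X Y] tens R X Y x' y"
proof -
  have X: "x +[X] x' \<in>. X"
    using assms gX by (simp add: abelian_group.axioms(1) abelian_monoid.a_closed)
  let ?a = "frag_of (x +[X] x', y)" and ?b = "frag_of (x, y)" and ?c = "frag_of (x', y)"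
  have "?a - (?b + ?c) \<in> NN"
    unfolding tensor_null_def by (rule generate.incl) (use assms in \<open>auto simp: tensor_rels_def algebra_simps\<close>)
  moreover have "Poly_Mapping.keys (?b + ?c) \<subseteq> carrier X \<times> carrier Y"
    using keys_add[of ?b ?c] assms by auto
  ultimately have "NN #>\<^bsub>FG\<^esub> ?a = NN #>\<^bsub>FG\<^esub> (?b + ?c)"
    using coset_eq[of ?a "?b + ?c"] X assms by simp
  then show ?thesis using coset_add[of ?b ?c] assms by (simp add: tens_def)
qed

lemma tens_add_right:
  assumes "x \<in>. X" "y \<in>. Y" "y' \<in>. Y"
  shows "tens R X Y x (y +[Y] y') = tens R X Y x y +[tensor R X Y] tens R X Y x y'"
proof -
  have Y: "y +[Y] y' \<in>. Y"
    using assms gY by (simp add: abelian_group.axioms(1) abelian_monoid.a_closed)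
  let ?a = "frag_of (x, y +[Y] y')" and ?b = "frag_of (x, y)" and ?c = "frag_of (x, y')"
  have "?a - (?b + ?c) \<in> NN"
    unfolding tensor_null_def by (rule generate.incl) (use assms in \<open>auto simp: tensor_rels_def algebra_simps\<close>)
  moreover have "Poly_Mapping.keys (?b + ?c) \<subseteq> carrier X \<times> carrier Y"
    using keys_add[of ?b ?c] assms by auto
  ultimately have "NN #>\<^bsub>FG\<^esub> ?a = NN #>\<^bsub>FG\<^esub> (?b + ?c)"
    using coset_eq[of ?a "?b + ?c"] Y assms by simp
  then show ?thesis using coset_add[of ?b ?c] assms by (simp add: tens_def)
qed

lemma tens_middle:
  assumes "r \<in>. R" "x \<in>. X" "y \<in>. Y"
  shows "tens R X Y (r \<cdot>[X] x) y = tens R X Y x (r \<cdot>[Y] y)"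
  unfolding tens_def
proof (rule coset_eq)
  show "frag_of (r \<cdot>[X] x, y) - frag_of (x, r \<cdot>[Y] y) \<in> NN"
    unfolding tensor_null_def by (rule generate.incl) (use assms in \<open>auto simp: tensor_rels_def\<close>)
qed (use assms sX sY in auto)

lemma tens_balanced: "balanced R X Y (tensor R X Y) (tens R X Y)"
  by (intro balancedI additiveI) (auto intro: tens_closed simp: tens_add_left tens_add_right tens_middle
      simp del: tensor_fields)

text \<open>Negatives need no case of their own, since \<open>-(x \<otimes> y) = x \<otimes> (-y)\<close>.\<close>

lemma tensor_induct [consumes 1, case_names tens add]:
  assumes "t \<in>. (tensor R X Y)"
    and gen: "\<And>x y. x \<in>. X \<Longrightarrow> y \<in>. Y \<Longrightarrow> Q (tens R X Y x y)"
    and add: "\<And>s t. \<lbrakk>s \<in>. (tensor R X Y); t \<in>. (tensor R X Y); Q s; Q t\<rbrakk>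
      \<Longrightarrow> Q (s +[tensor R X Y] t)"
  shows "Q t"
proof -
  interpret G: comm_group FG by (rule abelian_free_Abelian_group)
  interpret X: abelian_group X by (rule gX)
  interpret Y: abelian_group Y by (rule gY)
  interpret T: abelian_group "tensor R X Y" by (rule tensor_group)
  have 0: "NN #>\<^bsub>FG\<^esub> 0 = \<zero>[tensor R X Y]"
    using G.coset_mult_one[OF null_sub] by (simp add: tensor_add_def Let_def FactGroup_def)
  have z: "tens R X Y x \<zero>[Y] = \<zero>[tensor R X Y]" if "x \<in>. X" for x
    using additive_zero[of Y "tensor R X Y" "tens R X Y x"] tens_balanced that tensor_group gY by (simp add: balanced_def)
  have neg: "NN #>\<^bsub>FG\<^esub> (- frag_of (x, y)) = tens R X Y x (\<ominus>\<^bsub>Y\<^esub> y)"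
    if xy: "x \<in>. X" "y \<in>. Y" for x y
  proof -
    show ?thesis
    proof (rule abelian_group_negative_unique[OF tensor_group])
      show "tens R X Y x y +[tensor R X Y] (NN #>\<^bsub>FG\<^esub> (- frag_of (x, y))) = \<zero>[tensor R X Y]"
        using coset_add[of "frag_of (x,y)" "- frag_of (x,y)"] xy 0 by (simp add: tens_def)
      show "tens R X Y x y +[tensor R X Y] tens R X Y x (\<ominus>\<^bsub>Y\<^esub> y) = \<zero>[tensor R X Y]"
        using tens_add_right[of x y "\<ominus>\<^bsub>Y\<^esub> y"] xy z by (simp add: Y.r_neg)
      show "(NN #>\<^bsub>FG\<^esub> (- frag_of (x, y))) \<in>. (tensor R X Y)"
        using xy by (auto simp: tensor_carrier_coset)
    qed (use tens_closed xy in auto)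
  qed
  have main: "Q (NN #>\<^bsub>FG\<^esub> c) \<and> Q (NN #>\<^bsub>FG\<^esub> (- c))" if "Poly_Mapping.keys c \<subseteq> carrier X \<times> carrier Y" for c
    using that
  proof (induction c rule: free_Abelian_group_induct[consumes 1, case_names zero diff gen])
    case zero
    then show ?case using 0 assms(2)[of "\<zero>[X]" "\<zero>[Y]"] z by simp
  next
    case (diff a b)
    have k: "a \<in>. FG" "b \<in>. FG" "- a \<in>. FG" "- b \<in>. FG" using diff by auto
    then have "NN #>\<^bsub>FG\<^esub> c \<in>. (tensor R X Y)" if "c \<in> {a, b, -a, -b}" for c
      using that by (auto simp: tensor_carrier_coset)
    then show ?case
      using diff coset_add[OF k(1) k(4)] coset_add[OF k(2) k(3)]
        add[of "NN #>\<^bsub>FG\<^esub> a" "NN #>\<^bsub>FG\<^esub> (-b)"] add[of "NN #>\<^bsub>FG\<^esub> b" "NN #>\<^bsub>FG\<^esub> (-a)"]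
      by simp
  next
    case (gen p)
    then obtain x y where "p = (x, y)" "x \<in>. X" "y \<in>. Y" by auto
    then show ?case using assms(2)[of x y] assms(2)[of x "\<ominus>\<^bsub>Y\<^esub> y"] neg[of x y] by (simp add: tens_def)
  qed
  show ?thesis using assms(1) main by (auto simp: tensor_carrier_coset)
qed

lemma free_eval_null:
  assumes P: "abelian_group P" and f: "balanced R X Y P f" and n: "n \<in> NN"
  shows "free_eval P f n = \<zero>[P]"
proof -
  interpret G: comm_group FG by (rule abelian_free_Abelian_group)
  interpret X: abelian_group X by (rule gX)
  interpret Y: abelian_group Y by (rule gY)
  interpret P: abelian_group P by (rule P)
  have cl: "\<forall>x\<in>carrier X. \<forall>y\<in>carrier Y. f x y \<in>. P"
    using f by (simp add: balanced_def additive_def)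
  have k2: "Poly_Mapping.keys (frag_of a - frag_of b) \<subseteq> {a, b}" for a b :: "'x \<times> 'y"
    using keys_diff[of "frag_of a" "frag_of b"] by auto
  have d2: "free_eval P f (frag_of (x, y) - frag_of (x', y')) = f x y \<ominus>\<^bsub>P\<^esub> f x' y'"
    if "x \<in>. X" "x' \<in>. X" "y \<in>. Y" "y' \<in>. Y" for x x' y y'
    using free_eval_diff[OF P cl, of "frag_of (x, y)" "frag_of (x', y')"] that by (simp add: free_eval_frag_of[OF P] cl)
  have d3: "free_eval P f (frag_of (x, y) - frag_of (x', y') - frag_of (x'', y'')) = f x y \<ominus>\<^bsub>P\<^esub> f x' y' \<ominus>\<^bsub>P\<^esub> f x'' y''"
    if "x \<in>. X" "x' \<in>. X" "y \<in>. Y" "y' \<in>. Y" "x'' \<in>. X" "y'' \<in>. Y"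
    for x x' y y' x'' y''
  proof -
    have "Poly_Mapping.keys (frag_of (x, y) - frag_of (x', y')) \<subseteq> carrier X \<times> carrier Y"
      by (rule subset_trans[OF k2]) (use that in auto)
    then show ?thesis
      using free_eval_diff[OF P cl, of "frag_of (x, y) - frag_of (x', y')" "frag_of (x'', y'')"]
        that d2[of x x' y y'] by (simp add: free_eval_frag_of[OF P] cl)
  qed
  have add: "f (x +[X] x') y = f x y +[P] f x' y" "f x'' (y +[Y] y') = f x'' y +[P] f x'' y'"
    if "x \<in>. X" "x' \<in>. X" "y \<in>. Y" "y' \<in>. Y" "x'' \<in>. X" for x x' x'' y y'
    using f that by (simp_all add: balanced_def additive_def)
  have cancel: "a +[P] b \<ominus>\<^bsub>P\<^esub> a \<ominus>\<^bsub>P\<^esub> b = \<zero>[P]" if "a \<in>. P" "b \<in>. P" for a b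
    using that by (metis P.a_inv_closed a_minus_def P.add.inv_solve_right' P.add.m_closed P.add.m_comm P.r_neg)
  have rel: "free_eval P f h = \<zero>[P]" if "h \<in> tensor_rels R X Y" for h
    using that unfolding tensor_rels_def
  proof (elim UnE CollectE exE conjE)
    fix r x y assume "h = frag_of (r \<cdot>[X] x, y) - frag_of (x, r \<cdot>[Y] y)"
      "r \<in>. R" "x \<in>. X" "y \<in>. Y"
    then show ?thesis using d2 f cl by (simp add: sX sY balanced_def P.r_neg a_minus_def)
  qed (simp_all add: d3 add cl cancel)
  have "Poly_Mapping.keys n \<subseteq> carrier X \<times> carrier Y \<and> free_eval P f n = \<zero>[P]"
    using n unfolding tensor_null_def
  proof (induction n rule: generate.induct)
    case one
    then show ?case by (simp add: free_eval_def)
  next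
    case (incl h)
    then have "h \<in>. FG" using rels_sub by blast
    then show ?case using rel[OF incl] by simp
  next
    case (inv h)
    then have "h \<in>. FG" using rels_sub by blast
    then have k: "Poly_Mapping.keys h \<subseteq> carrier X \<times> carrier Y" by simp
    have "free_eval P f 0 = \<zero>[P]" by (simp add: free_eval_def)
    then have "free_eval P f (0 - h) = \<zero>[P]"
      using free_eval_diff[OF P cl, of 0 h] rel[OF inv] k by (simp add: a_minus_def)
    then show ?case using k by simp
  next
    case (eng h1 h2)
    then show ?case
      using free_eval_add[OF P cl, of h1 h2] keys_add[of h1 h2] by auto
  qed
  then show ?thesis by simp
qed

lemma tens_lift_coset:
  assumes P: "abelian_group P" and f: "balanced R X Y P f" and c: "c \<in>. FG"
  shows "tens_lift P f (NN #>\<^bsub>FG\<^esub> c) = free_eval P f c"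
proof -
  interpret G: comm_group FG by (rule abelian_free_Abelian_group)
  interpret P: abelian_group P by (rule P)
  have cl: "\<forall>x\<in>carrier X. \<forall>y\<in>carrier Y. f x y \<in>. P"
    using f by (simp add: balanced_def additive_def)
  have "free_eval P f z = free_eval P f c" if "z \<in> NN #>\<^bsub>FG\<^esub> c" for z
  proof -
    from that obtain n where n: "n \<in> NN" "z = n + c" by (auto simp: r_coset_def)
    then show ?thesis
      using free_eval_add[OF P cl, of n c] free_eval_null[OF P f n(1)]
        null_sub c free_eval_closed[OF P cl, of c] by auto
  qed
  moreover have "c \<in> NN #>\<^bsub>FG\<^esub> c"
    using c G.rcos_self normal_imp_subgroup[OF null_normal] by blast
  ultimately have "free_eval P f ` (NN #>\<^bsub>FG\<^esub> c) = {free_eval P f c}"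
    by (intro equalityI subsetI) (blast, metis image_eqI singletonD)
  then show ?thesis
    unfolding tens_lift_def free_eval_def[symmetric] by simp
qed

lemma tens_lift_tens:
  assumes "abelian_group P" "balanced R X Y P f" "x \<in>. X" "y \<in>. Y"
  shows "tens_lift P f (tens R X Y x y) = f x y"
  using tens_lift_coset[OF assms(1,2), of "frag_of (x, y)"] assms
  by (simp add: tens_def free_eval_frag_of balanced_def additive_def)

lemma tens_lift_additive:
  assumes P: "abelian_group P" and f: "balanced R X Y P f"
  shows "additive (tensor R X Y) P (tens_lift P f)"
proof -
  have cl: "\<forall>x\<in>carrier X. \<forall>y\<in>carrier Y. f x y \<in>. P"
    using f by (simp add: balanced_def additive_def)
  show ?thesis
  proof (rule additiveI)
    fix s assume "s \<in>. (tensor R X Y)"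
    then show "tens_lift P f s \<in>. P"
      using tens_lift_coset[OF P f] free_eval_closed[OF P cl] by (auto simp: tensor_carrier_coset)
  next
    fix s t assume "s \<in>. (tensor R X Y)" "t \<in>. (tensor R X Y)"
    then obtain c d where cd: "c \<in>. FG" "d \<in>. FG" "s = NN #>\<^bsub>FG\<^esub> c" "t = NN #>\<^bsub>FG\<^esub> d"
      by (auto simp: tensor_carrier_coset)
    then have "c + d \<in>. FG" using keys_add[of c d] by auto
    then show "tens_lift P f (s +[tensor R X Y] t) = tens_lift P f s +[P] tens_lift P f t"
      using cd by (simp add: coset_add tens_lift_coset[OF P f] free_eval_add[OF P cl]
          del: carrier_free_Abelian_group_iff) (simp add: free_eval_add[OF P cl])
  qed
qed

lemma tens_lift_cong:
  assumes "t \<in>. (tensor R X Y)" "abelian_group P" "balanced R X Y P f"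
    and "\<And>x y. x \<in>. X \<Longrightarrow> y \<in>. Y \<Longrightarrow> f x y = g x y"
  shows "tens_lift P f t = tens_lift P g t"
proof -
  have "balanced R X Y P g"
    using assms(3,4) sX sY gX gY unfolding balanced_def additive_def
    by (simp add: abelian_group.axioms(1) abelian_monoid.a_closed)
  moreover obtain c where "c \<in>. FG" "t = NN #>\<^bsub>FG\<^esub> c"
    using assms(1) by (auto simp: tensor_carrier_coset)
  moreover have "free_eval P f c = free_eval P g c" if "c \<in>. FG" for c
  proof -
    interpret P: abelian_group P by fact
    show ?thesis unfolding free_eval_def by (rule P.add.finprod_cong')
        (use that assms(3,4) in \<open>force simp: balanced_def additive_def\<close>)+
  qed
  ultimately show ?thesis using tens_lift_coset assms(2,3) by metis
qed

lemma additive_eq: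
  assumes "t \<in>. (tensor R X Y)" "additive (tensor R X Y) P f" "additive (tensor R X Y) P g"
    and "\<And>x y. x \<in>. X \<Longrightarrow> y \<in>. Y \<Longrightarrow> f (tens R X Y x y) = g (tens R X Y x y)"
  shows "f t = g t"
  using assms(1) by (induction rule: tensor_induct) (use assms in \<open>auto simp: additive_def\<close>)

text \<open>Additive maps commute with lifts.  All rules for moving a linear map into or out of a Sweedler sum
  come from here.\<close>

lemma tens_lift_push:
  assumes "t \<in>. (tensor R X Y)" "abelian_group P" "abelian_group Q" "balanced R X Y P f" "additive P Q g"
  shows "g (tens_lift P f t) = tens_lift Q (\<lambda>x y. g (f x y)) t"
proof -
  have b: "balanced R X Y Q (\<lambda>x y. g (f x y))"
    using assms unfolding balanced_def additive_def by simp
  show ?thesis by (rule additive_eq[OF assms(1), where P = Q])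
      (simp_all add: additive_comp[OF assms(5) tens_lift_additive[OF assms(2,4)]]
        tens_lift_additive[OF assms(3) b] tens_lift_tens assms b del: tensor_fields)
qed

end


section \<open>Modules and algebras over the ground ring\<close>

lemma module_abelian_group: "module K M \<Longrightarrow> abelian_group M" by (simp add: module_def)

lemma module_cring: "module K M \<Longrightarrow> cring K" by (simp add: module_def)

lemma module_add_closed: "module K M \<Longrightarrow> x \<in>. M \<Longrightarrow> y \<in>. M \<Longrightarrow> x +[M] y \<in>. M"
  by (meson abelian_group.axioms(1) abelian_monoid.a_closed module_abelian_group)

lemma module_smult_closed: "module K M \<Longrightarrow> c \<in>. K \<Longrightarrow> x \<in>. M \<Longrightarrow> c \<cdot>[M] x \<in>. M"
  by (rule module.smult_closed)

lemma abelian_group_add4: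
  assumes "abelian_group M" "a \<in>. M" "b \<in>. M" "c \<in>. M" "d \<in>. M"
  shows "(a +[M] b) +[M] (c +[M] d) = (a +[M] c) +[M] (b +[M] d)"
proof -
  interpret abelian_group M by fact
  show ?thesis using assms(2-) by (simp add: a_ac)
qed

lemma additive_sum:
  assumes "abelian_group N" "additive M N f" "additive M N g"
  shows "additive M N (\<lambda>x. f x +[N] g x)"
  using assms abelian_group_add4[OF assms(1)] by (auto simp: additive_def abelian_group.axioms(1) abelian_monoid.a_closed)

lemma lin_sum:
  assumes "module K N" "lin K M N f" "lin K M N g"
  shows "lin K M N (\<lambda>x. f x +[N] g x)"
  using additive_sum[OF module_abelian_group[OF assms(1)] lin_additive[OF assms(2)] lin_additive[OF assms(3)]]
    module.smult_r_distr[OF assms(1)] assms(2,3) by (simp add: lin_def lin_closed)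

lemma lin_smult_right:
  assumes "module K N" "lin K M N f" "c \<in>. K"
  shows "lin K M N (\<lambda>x. c \<cdot>[N] f x)"
proof -
  interpret module K N by fact
  show ?thesis
    using assms(2,3) by (intro linI) (simp_all add: lin_closed lin_add lin_smult smult_r_distr
        smult_assoc1[symmetric] R.m_comm)
qed

lemma lin_smult_left:
  assumes "module K N" "lin K M (self_alg K) f" "n \<in>. N"
  shows "lin K M N (\<lambda>x. f x \<cdot>[N] n)"
proof -
  interpret module K N by fact
  have *: "f x \<in>. K" if "x \<in>. M" for x
    using lin_closed[OF assms(2) that] by (simp add: self_alg_def)
  show ?thesis
    using assms(3) lin_add[OF assms(2)] lin_smult[OF assms(2)] *
    by (intro linI) (simp_all add: smult_l_distr smult_assoc1 self_alg_def)
qed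

lemma k_algebraI:
  assumes M: "module K M" and one: "\<one>[M] \<in>. M"
    and left: "\<And>y. y \<in>. M \<Longrightarrow> lin K M M (\<lambda>x. x *[M] y)"
    and right: "\<And>x. x \<in>. M \<Longrightarrow> lin K M M (\<lambda>y. x *[M] y)"
    and assoc: "\<And>x y z. \<lbrakk>x \<in>. M; y \<in>. M; z \<in>. M\<rbrakk>
      \<Longrightarrow> (x *[M] y) *[M] z = x *[M] (y *[M] z)"
    and l_one: "\<And>x. x \<in>. M \<Longrightarrow> \<one>[M] *[M] x = x"
    and r_one: "\<And>x. x \<in>. M \<Longrightarrow> x *[M] \<one>[M] = x"
  shows "k_algebra K M"
proof -
  have "ring M"
  proof (rule ringI[OF module_abelian_group[OF M]])
    show "monoid M" by (rule monoidI) (use assms lin_closed[OF right] in auto)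
  qed (use lin_add[OF left] lin_add[OF right] in auto)
  then show ?thesis
    using M lin_smult[OF left] lin_smult[OF right] by (simp add: k_algebra_def k_algebra_axioms_def)
qed

lemma k_algebra_module: "k_algebra K A \<Longrightarrow> module K A" by (simp add: k_algebra_def)

lemma k_algebra_ring: "k_algebra K A \<Longrightarrow> ring A" by (simp add: k_algebra_def)

lemma k_algebra_mult_closed: "k_algebra K A \<Longrightarrow> x \<in>. A \<Longrightarrow> y \<in>. A \<Longrightarrow> x *[A] y \<in>. A"
  by (meson k_algebra_ring monoid.m_closed ring_def)

lemma k_algebra_one_closed: "k_algebra K A \<Longrightarrow> \<one>[A] \<in>. A"
  by (meson k_algebra_ring monoid.one_closed ring_def)

lemma k_algebra_assoc: "k_algebra K A \<Longrightarrow> x \<in>. A \<Longrightarrow> y \<in>. A \<Longrightarrow> z \<in>. A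
    \<Longrightarrow> (x *[A] y) *[A] z = x *[A] (y *[A] z)" by (meson k_algebra_ring monoid.m_assoc ring_def)

lemma k_algebra_l_one: "k_algebra K A \<Longrightarrow> x \<in>. A \<Longrightarrow> \<one>[A] *[A] x = x"
  by (meson k_algebra_ring monoid.l_one ring_def)

lemma k_algebra_r_one: "k_algebra K A \<Longrightarrow> x \<in>. A \<Longrightarrow> x *[A] \<one>[A] = x"
  by (meson k_algebra_ring monoid.r_one ring_def)

lemma k_algebra_smult_left: "k_algebra K A \<Longrightarrow> c \<in>. K \<Longrightarrow> x \<in>. A \<Longrightarrow> y \<in>. A
    \<Longrightarrow> (c \<cdot>[A] x) *[A] y = c \<cdot>[A] (x *[A] y)" by (simp add: k_algebra.smult_mult_left)

lemma k_algebra_smult_right: "k_algebra K A \<Longrightarrow> c \<in>. K \<Longrightarrow> x \<in>. A \<Longrightarrow> y \<in>. A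
    \<Longrightarrow> x *[A] (c \<cdot>[A] y) = c \<cdot>[A] (x *[A] y)" by (simp add: k_algebra.smult_mult_right)

lemma lin_mult_left:
  assumes "k_algebra K A" "lin K M A f" "a \<in>. A"
  shows "lin K M A (\<lambda>x. f x *[A] a)"
  using assms ring.ring_simprules(13)[OF k_algebra_ring[OF assms(1)]]
  by (intro linI) (simp_all add: k_algebra_mult_closed lin_closed lin_add lin_smult k_algebra_smult_left)

lemma lin_mult_right:
  assumes "k_algebra K A" "lin K M A f" "a \<in>. A"
  shows "lin K M A (\<lambda>x. a *[A] f x)"
  using assms ring.ring_simprules(23)[OF k_algebra_ring[OF assms(1)]]
  by (intro linI) (simp_all add: k_algebra_mult_closed lin_closed lin_add lin_smult k_algebra_smult_right)

lemma self_alg_simps [simp]: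
  "carrier (self_alg K) = carrier K" "mult (self_alg K) = mult K" "one (self_alg K) = one K"
  "add (self_alg K) = add K" "zero (self_alg K) = zero K" "smult (self_alg K) = mult K" by (simp_all add: self_alg_def)

lemma self_alg_k_algebra:
  assumes "cring K" shows "k_algebra K (self_alg K)"
proof -
  interpret cring K by fact
  have ag: "abelian_group (self_alg K)" by (rule abelian_group_fields[OF is_abelian_group]) simp_all
  have "module K (self_alg K)" by (rule moduleI[OF assms ag]) (auto simp: l_distr r_distr m_assoc)
  then show ?thesis by (intro k_algebraI linI) (auto simp: l_distr r_distr m_assoc m_lcomm)
qed

lemma opposite_simps [simp]:
  "carrier (opposite A) = carrier A" "mult (opposite A) x y = y *[A] x" "one (opposite A) = one A"
  "add (opposite A) = add A" "zero (opposite A) = zero A" "smult (opposite A) = smult A" by (simp_all add: opposite_def)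

lemma module_fields:
  assumes "module K M" "carrier N = carrier M" "add N = add M" "zero N = zero M"
    "\<And>c x. c \<in>. K \<Longrightarrow> x \<in>. M \<Longrightarrow> c \<cdot>[N] x = c \<cdot>[M] x"
  shows "module K N"
proof -
  interpret module K M by fact
  show ?thesis
    by (rule moduleI[OF module_cring[OF assms(1)] abelian_group_fields[OF module_abelian_group[OF assms(1)] assms(2-4)]])
      (simp_all add: assms(2-5) smult_l_distr smult_r_distr smult_assoc1)
qed

lemma lin_fields:
  assumes "lin K M N f" "carrier M' = carrier M" "add M' = add M"
    "\<And>c x. c \<in>. K \<Longrightarrow> x \<in>. M \<Longrightarrow> c \<cdot>[M'] x = c \<cdot>[M] x"
    "carrier N' = carrier N" "add N' = add N"
    "\<And>c x. c \<in>. K \<Longrightarrow> x \<in>. N \<Longrightarrow> c \<cdot>[N'] x = c \<cdot>[N] x"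
  shows "lin K M' N' f"
  using assms by (simp add: lin_def additive_def)

lemma opposite_k_algebra:
  assumes "k_algebra K A" shows "k_algebra K (opposite A)"
proof (rule k_algebraI)
  show "module K (opposite A)" by (rule module_fields[OF k_algebra_module[OF assms]]) simp_all
  show "lin K (opposite A) (opposite A) (\<lambda>x. x *[opposite A] y)" if "y \<in>. (opposite A)" for y
    unfolding opposite_simps by (rule lin_fields[OF lin_mult_right[OF assms lin_id]]) (use that in simp_all)
  show "lin K (opposite A) (opposite A) (\<lambda>x. y *[opposite A] x)" if "y \<in>. (opposite A)" for y
    unfolding opposite_simps by (rule lin_fields[OF lin_mult_left[OF assms lin_id]]) (use that in simp_all)
qed (use assms in \<open>simp_all add: k_algebra_assoc k_algebra_l_one k_algebra_r_one k_algebra_one_closed\<close>)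


section \<open>Left and right modules\<close>

lemma with_smult_simps [simp]:
  "carrier (with_smult M s) = carrier M" "add (with_smult M s) = add M"
  "zero (with_smult M s) = zero M" "smult (with_smult M s) = s"
  "mult (with_smult M s) = mult M" "one (with_smult M s) = one M" by (simp_all add: with_smult_def)

lemma with_smult_group: "abelian_group M \<Longrightarrow> abelian_group (with_smult M s)"
  by (rule abelian_group_fields) simp_all

lemma left_module_facts:
  assumes "left_module R M"
  shows "ring R" "abelian_group M"
    "\<And>a x. a \<in>. R \<Longrightarrow> x \<in>. M \<Longrightarrow> a \<cdot>[M] x \<in>. M"
    "\<And>a. a \<in>. R \<Longrightarrow> additive M M (\<lambda>x. a \<cdot>[M] x)"
    "\<And>x. x \<in>. M \<Longrightarrow> additive R M (\<lambda>a. a \<cdot>[M] x)"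
    "\<And>a b x. a \<in>. R \<Longrightarrow> b \<in>. R \<Longrightarrow> x \<in>. M \<Longrightarrow> (a *[R] b) \<cdot>[M] x = a \<cdot>[M] (b \<cdot>[M] x)"
    "\<And>x. x \<in>. M \<Longrightarrow> \<one>[R] \<cdot>[M] x = x"
proof -
  interpret left_module R M by fact
  show "ring R" "abelian_group M" by (fact R.ring_axioms M.abelian_group_axioms)+
qed (use assms in \<open>auto simp: additive_def left_module_def left_module_axioms_def\<close>)

lemma right_module_facts:
  assumes "right_module R M"
  shows "ring R" "abelian_group M"
    "\<And>a x. a \<in>. R \<Longrightarrow> x \<in>. M \<Longrightarrow> a \<cdot>[M] x \<in>. M"
    "\<And>a. a \<in>. R \<Longrightarrow> additive M M (\<lambda>x. a \<cdot>[M] x)"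
    "\<And>x. x \<in>. M \<Longrightarrow> additive R M (\<lambda>a. a \<cdot>[M] x)"
    "\<And>a b x. a \<in>. R \<Longrightarrow> b \<in>. R \<Longrightarrow> x \<in>. M \<Longrightarrow> (a *[R] b) \<cdot>[M] x = b \<cdot>[M] (a \<cdot>[M] x)"
    "\<And>x. x \<in>. M \<Longrightarrow> \<one>[R] \<cdot>[M] x = x"
proof -
  interpret right_module R M by fact
  show "ring R" "abelian_group M" by (fact R.ring_axioms X.abelian_group_axioms)+
qed (use assms in \<open>auto simp: additive_def right_module_def right_module_axioms_def\<close>)

lemma left_moduleI:
  assumes "ring R" "abelian_group M"
    "\<And>a. a \<in>. R \<Longrightarrow> additive M M (\<lambda>x. a \<cdot>[M] x)"
    "\<And>x. x \<in>. M \<Longrightarrow> additive R M (\<lambda>a. a \<cdot>[M] x)"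
    "\<And>a b x. a \<in>. R \<Longrightarrow> b \<in>. R \<Longrightarrow> x \<in>. M \<Longrightarrow> (a *[R] b) \<cdot>[M] x = a \<cdot>[M] (b \<cdot>[M] x)"
    "\<And>x. x \<in>. M \<Longrightarrow> \<one>[R] \<cdot>[M] x = x"
  shows "left_module R M"
  unfolding left_module_def left_module_axioms_def using assms by (auto simp: additive_def)

lemma right_moduleI:
  assumes "ring R" "abelian_group M"
    "\<And>a. a \<in>. R \<Longrightarrow> additive M M (\<lambda>x. a \<cdot>[M] x)"
    "\<And>x. x \<in>. M \<Longrightarrow> additive R M (\<lambda>a. a \<cdot>[M] x)"
    "\<And>a b x. a \<in>. R \<Longrightarrow> b \<in>. R \<Longrightarrow> x \<in>. M \<Longrightarrow> (a *[R] b) \<cdot>[M] x = b \<cdot>[M] (a \<cdot>[M] x)"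
    "\<And>x. x \<in>. M \<Longrightarrow> \<one>[R] \<cdot>[M] x = x"
  shows "right_module R M"
  unfolding right_module_def right_module_axioms_def using assms by (auto simp: additive_def)

lemma module_left_right:
  assumes "module K M"
  shows "left_module (self_alg K) M" "right_module (self_alg K) M"
proof -
  interpret module K M by fact
  have "ring (self_alg K)" using self_alg_k_algebra k_algebra_ring module_cring assms by blast
  then show "left_module (self_alg K) M" "right_module (self_alg K) M"
    by (auto intro!: left_moduleI right_moduleI additiveI simp: smult_l_distr smult_r_distr smult_assoc1
        M.abelian_group_axioms) (metis R.m_comm smult_assoc1)
qed

lemma tensor_productI: "right_module R X \<Longrightarrow> left_module R Y \<Longrightarrow> tensor_product R X Y"
  by (simp add: tensor_product_def left_module_facts right_module_facts)

lemma tensor_product_K: "module K M \<Longrightarrow> module K N \<Longrightarrow> tensor_product (self_alg K) M N"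
  by (simp add: tensor_productI module_left_right)

text \<open>A module over a \<open>K\<close>-algebra is a \<open>K\<close>-module through the multiples of the unit.\<close>

definition scal :: "('k, 'r, 'z) module_scheme \<Rightarrow> ('r, 'm, 'u) module_scheme \<Rightarrow> ('k, 'm) module" where
  "scal R M = with_smult M (\<lambda>c x. (c \<cdot>[R] \<one>[R]) \<cdot>[M] x)"

lemma scal_simps [simp]:
  "carrier (scal R M) = carrier M" "add (scal R M) = add M" "zero (scal R M) = zero M"
  "c \<cdot>[scal R M] x = (c \<cdot>[R] \<one>[R]) \<cdot>[M] x" by (simp_all add: scal_def)

lemma scal_mult:
  assumes "k_algebra K R" "c \<in>. K" "r \<in>. R"
  shows "(c \<cdot>[R] \<one>[R]) *[R] r = c \<cdot>[R] r" "r *[R] (c \<cdot>[R] \<one>[R]) = c \<cdot>[R] r"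
  using assms by (simp_all add: k_algebra_smult_left k_algebra_smult_right k_algebra_one_closed
      k_algebra_l_one k_algebra_r_one)

lemma scal_left_module:
  assumes R: "k_algebra K R" and M: "left_module R M"
  shows "module K (scal R M)"
proof -
  interpret R: module K R by (rule k_algebra_module[OF R])
  note f = left_module_facts[OF M]
  have c: "c \<cdot>[R] \<one>[R] \<in>. R" if "c \<in>. K" for c
    using that R by (simp add: k_algebra_one_closed)
  show ?thesis
  proof (rule moduleI)
    show "abelian_group (scal R M)" by (rule abelian_group_fields[OF f(2)]) simp_all
  qed (use R c in \<open>simp_all add: f(3,7) additive_add[OF f(4)] additive_add[OF f(5)] R.smult_l_distr
      k_algebra_one_closed R.smult_assoc1 R.R.cring_axioms f(6)[symmetric] scal_mult(1)\<close>)
qed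

lemma scal_right_module:
  assumes R: "k_algebra K R" and M: "right_module R M"
  shows "module K (scal R M)"
proof -
  interpret R: module K R by (rule k_algebra_module[OF R])
  note f = right_module_facts[OF M]
  have c: "c \<cdot>[R] \<one>[R] \<in>. R" if "c \<in>. K" for c
    using that R by (simp add: k_algebra_one_closed)
  show ?thesis
  proof (rule moduleI)
    show "abelian_group (scal R M)" by (rule abelian_group_fields[OF f(2)]) simp_all
    fix a b x assume ab: "a \<in>. K" "b \<in>. K" "x \<in>. (scal R M)"
    then have "(a *[K] b) \<cdot>[R] \<one>[R] = b \<cdot>[R] (a \<cdot>[R] \<one>[R])"
      using R by (metis R.R.m_comm R.smult_assoc1 k_algebra_one_closed)
    then show "a *[K] b \<cdot>[scal R M] x = a \<cdot>[scal R M] (b \<cdot>[scal R M] x)"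
      using ab c R f(6)[of "b \<cdot>[R] \<one>[R]" "a \<cdot>[R] \<one>[R]" x] by (simp add: scal_mult(1))
  qed (use R c in \<open>simp_all add: f additive_add[OF f(4)] additive_add[OF f(5)] R.smult_l_distr
      k_algebra_one_closed R.R.cring_axioms\<close>)
qed

lemma left_module_fields:
  assumes "left_module R M" "carrier N = carrier M" "add N = add M" "zero N = zero M"
    "\<And>r x. r \<in>. R \<Longrightarrow> x \<in>. M \<Longrightarrow> r \<cdot>[N] x = r \<cdot>[M] x"
  shows "left_module R N"
proof -
  note f = left_module_facts[OF assms(1)]
  interpret R: ring R by (rule f(1))
  interpret M: abelian_group M by (rule f(2))
  show ?thesis by (rule left_moduleI[OF f(1) abelian_group_fields[OF f(2) assms(2-4)]])
      (use f(4,5) in \<open>auto simp: assms(2-5) f(3,6,7) additive_def\<close>)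
qed

lemma left_module_diff_zero:
  assumes "left_module R M" "a \<in>. R" "b \<in>. R" "m \<in>. M" "a \<cdot>[M] m = b \<cdot>[M] m"
  shows "(a \<ominus>\<^bsub>R\<^esub> b) \<cdot>[M] m = \<zero>[M]"
proof -
  note f = left_module_facts[OF assms(1)]
  interpret R: ring R by (rule f(1))
  interpret M: abelian_group M by (rule f(2))
  show ?thesis
    using additive_add[OF f(5)[OF assms(4)], of a "\<ominus>\<^bsub>R\<^esub> b"] assms f(3)[OF assms(3,4)]
      additive_minus[OF f(5)[OF assms(4)] R.is_abelian_group f(2) assms(3)] by (simp add: a_minus_def M.r_neg)
qed

lemma regular_left_module:
  assumes "k_algebra K B"
  shows "left_module B (with_smult B (mult B))"
proof -
  interpret B: ring B by (rule k_algebra_ring[OF assms])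
  show ?thesis by (rule left_moduleI[OF B.ring_axioms with_smult_group[OF B.is_abelian_group]])
      (simp_all add: additive_def B.l_distr B.r_distr B.m_assoc)
qed

lemma lin_restrict_scalars:
  assumes R: "k_algebra K R" and M: "left_module R M" and m: "m \<in>. M" and f: "lin K L R f"
  shows "lin K L (scal R M) (\<lambda>x. f x \<cdot>[M] m)"
proof (rule linI)
  note F = left_module_facts[OF M]
  have c1: "c \<cdot>[R] \<one>[R] \<in>. R" if "c \<in>. K" for c
    using module_smult_closed[OF k_algebra_module[OF R] that k_algebra_one_closed[OF R]] .
  show "f (c \<cdot>[L] x) \<cdot>[M] m = c \<cdot>[scal R M] (f x \<cdot>[M] m)" if "c \<in>. K" "x \<in>. L" for c x
    using that lin_smult[OF f] lin_closed[OF f] m c1 by (simp add: F(6)[symmetric] scal_mult[OF R])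
qed (simp_all add: lin_closed[OF f] lin_add[OF f] m left_module_facts[OF M] additive_add[OF left_module_facts(5)[OF M]])

lemma lin_restrict_vectors:
  assumes R: "k_algebra K R" and M: "left_module R M" and r: "r \<in>. R" and f: "lin K L (scal R M) f"
  shows "lin K L (scal R M) (\<lambda>x. r \<cdot>[M] f x)"
proof (rule linI)
  note F = left_module_facts[OF M]
  have c1: "c \<cdot>[R] \<one>[R] \<in>. R" if "c \<in>. K" for c
    using module_smult_closed[OF k_algebra_module[OF R] that k_algebra_one_closed[OF R]] .
  show "r \<cdot>[M] f (c \<cdot>[L] x) = c \<cdot>[scal R M] (r \<cdot>[M] f x)" if "c \<in>. K" "x \<in>. L" for c x
    using that lin_smult[OF f] lin_closed[OF f] r c1 by (simp add: F(6)[symmetric] scal_mult[OF R])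
qed (use lin_closed[OF f] lin_add[OF f] r in \<open>simp_all add: left_module_facts[OF M] additive_add[OF left_module_facts(4)[OF M]]\<close>)

lemma lin_restrict_scalars_right:
  assumes R: "k_algebra K R" and M: "right_module R M" and m: "m \<in>. M" and f: "lin K L R f"
  shows "lin K L (scal R M) (\<lambda>x. f x \<cdot>[M] m)"
proof (rule linI)
  note F = right_module_facts[OF M]
  have c1: "c \<cdot>[R] \<one>[R] \<in>. R" if "c \<in>. K" for c
    using module_smult_closed[OF k_algebra_module[OF R] that k_algebra_one_closed[OF R]] .
  show "f (c \<cdot>[L] x) \<cdot>[M] m = c \<cdot>[scal R M] (f x \<cdot>[M] m)" if "c \<in>. K" "x \<in>. L" for c x
    using that lin_smult[OF f] lin_closed[OF f] m c1 by (simp add: F(6)[symmetric] scal_mult[OF R])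
qed (simp_all add: lin_closed[OF f] lin_add[OF f] m right_module_facts[OF M] additive_add[OF right_module_facts(5)[OF M]])

lemma lin_restrict_vectors_right:
  assumes R: "k_algebra K R" and M: "right_module R M" and r: "r \<in>. R" and f: "lin K L (scal R M) f"
  shows "lin K L (scal R M) (\<lambda>x. r \<cdot>[M] f x)"
proof (rule linI)
  note F = right_module_facts[OF M]
  have c1: "c \<cdot>[R] \<one>[R] \<in>. R" if "c \<in>. K" for c
    using module_smult_closed[OF k_algebra_module[OF R] that k_algebra_one_closed[OF R]] .
  show "r \<cdot>[M] f (c \<cdot>[L] x) = c \<cdot>[scal R M] (r \<cdot>[M] f x)" if "c \<in>. K" "x \<in>. L" for c x
    using that lin_smult[OF f] lin_closed[OF f] r c1 by (simp add: F(6)[symmetric] scal_mult[OF R])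
qed (use lin_closed[OF f] lin_add[OF f] r in \<open>simp_all add: right_module_facts[OF M] additive_add[OF right_module_facts(4)[OF M]]\<close>)


section \<open>The tensor product as a module over the ground ring\<close>

context
  fixes K :: "('k, 'kz) ring_scheme" and R :: "('k, 'r, 'z) module_scheme"
    and X :: "('r, 'x, 'u) module_scheme" and Y :: "('r, 'y, 'v) module_scheme"
  assumes R: "k_algebra K R" and X: "right_module R X" and Y: "left_module R Y"
begin

interpretation T: tensor_product R X Y by (rule tensor_productI[OF X Y])

lemma scalar_in: "c \<in>. K \<Longrightarrow> c \<cdot>[R] \<one>[R] \<in>. R"
  using k_algebra_module[OF R] k_algebra_one_closed[OF R] by (simp add: module_smult_closed)

text \<open>Multiples of the unit are central, hence multiplying the left factor by one of them is compatible with
  moving elements of \<open>R\<close> across the tensor sign.\<close>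

lemma scalar_balanced:
  assumes c: "c \<in>. K"
  shows "balanced R X Y (tensor R X Y) (\<lambda>x y. tens R X Y ((c \<cdot>[R] \<one>[R]) \<cdot>[X] x) y)"
proof (rule balancedI)
  note fX = right_module_facts[OF X] and b = T.tens_balanced[unfolded balanced_def]
  note c' = scalar_in[OF c]
  fix r x y assume xy: "r \<in>. R" "x \<in>. X" "y \<in>. Y"
  have "(c \<cdot>[R] \<one>[R]) \<cdot>[X] (r \<cdot>[X] x) = r \<cdot>[X] ((c \<cdot>[R] \<one>[R]) \<cdot>[X] x)"
    using xy c' fX(6)[symmetric] R c by (simp add: scal_mult)
  then show "tens R X Y ((c \<cdot>[R] \<one>[R]) \<cdot>[X] (r \<cdot>[X] x)) y =
      tens R X Y ((c \<cdot>[R] \<one>[R]) \<cdot>[X] x) (r \<cdot>[Y] y)"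
    using xy c' fX T.tens_middle by simp
next
  fix x assume "x \<in>. X"
  then show "additive Y (tensor R X Y) (tens R X Y ((c \<cdot>[R] \<one>[R]) \<cdot>[X] x))"
    using T.tens_balanced right_module_facts(3)[OF X] scalar_in[OF c] by (simp add: balanced_def del: T.tensor_fields)
next
  fix y assume "y \<in>. Y"
  then show "additive X (tensor R X Y) (\<lambda>x. tens R X Y ((c \<cdot>[R] \<one>[R]) \<cdot>[X] x) y)"
    by (intro additive_comp[OF _ right_module_facts(4)[OF X scalar_in[OF c]]])
      (use T.tens_balanced in \<open>simp add: balanced_def del: T.tensor_fields\<close>)
qed

lemma tensor_smult_eq:
  "smult (tensor R X Y) c t = tens_lift (tensor_add R X Y) (\<lambda>x y. tens R X Y ((c \<cdot>[R] \<one>[R]) \<cdot>[X] x) y) t"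
  by (simp add: tensor_def ring.defs)

lemma scalar_balanced':
  assumes c: "c \<in>. K"
  shows "balanced R X Y (tensor_add R X Y) (\<lambda>x y. tens R X Y ((c \<cdot>[R] \<one>[R]) \<cdot>[X] x) y)"
  using scalar_balanced[OF c] by (simp add: balanced_def additive_def)

lemma tensor_smult_tens:
  assumes "c \<in>. K" "x \<in>. X" "y \<in>. Y"
  shows "c \<cdot>[tensor R X Y] tens R X Y x y = tens R X Y ((c \<cdot>[R] \<one>[R]) \<cdot>[X] x) y"
  unfolding tensor_smult_eq using T.tens_lift_tens[OF T.tensor_add_group scalar_balanced'] assms by simp

lemma tensor_smult_additive:
  assumes "c \<in>. K"
  shows "additive (tensor R X Y) (tensor R X Y) (\<lambda>t. c \<cdot>[tensor R X Y] t)"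
  unfolding tensor_smult_eq using T.tens_lift_additive[OF T.tensor_add_group scalar_balanced'[OF assms]]
  by (simp add: additive_def)

lemma tensor_module: "module K (tensor R X Y)"
proof -
  note sX = scal_right_module[OF R X]
  interpret S: module K "scal R X" by (rule sX)
  have gT: "abelian_group (tensor R X Y)" by (rule T.tensor_group)
  note fX = right_module_facts[OF X]
  note cl = scalar_in
  note sm = tensor_smult_additive tensor_smult_tens
  show ?thesis
  proof (rule moduleI[OF module_cring[OF sX] gT])
    fix a t assume a: "a \<in>. K" "t \<in>. (tensor R X Y)"
    then show "a \<cdot>[tensor R X Y] t \<in>. (tensor R X Y)"
      using sm(1) by (meson additive_closed)
  next
    fix a b t assume a: "a \<in>. K" "b \<in>. K" and t: "t \<in>. (tensor R X Y)"
    then have ab: "a +[K] b \<in>. K" "a *[K] b \<in>. K" by auto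
    show "(a +[K] b) \<cdot>[tensor R X Y] t = a \<cdot>[tensor R X Y] t +[tensor R X Y] b \<cdot>[tensor R X Y] t"
    proof (rule T.additive_eq[OF t sm(1)[OF ab(1)] additive_sum[OF gT sm(1)[OF a(1)] sm(1)[OF a(2)]]])
      fix x y assume "x \<in>. X" "y \<in>. Y"
      then show "(a +[K] b) \<cdot>[tensor R X Y] tens R X Y x y =
          a \<cdot>[tensor R X Y] tens R X Y x y +[tensor R X Y] b \<cdot>[tensor R X Y] tens R X Y x y"
        using a ab S.smult_l_distr[of a b x] fX cl by (simp add: sm(2) T.tens_add_left[symmetric] del: T.tensor_fields)
    qed
    show "a *[K] b \<cdot>[tensor R X Y] t = a \<cdot>[tensor R X Y] (b \<cdot>[tensor R X Y] t)"
    proof (rule T.additive_eq[OF t sm(1)[OF ab(2)] additive_comp[OF sm(1)[OF a(1)] sm(1)[OF a(2)]]])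
      fix x y assume "x \<in>. X" "y \<in>. Y"
      then show "a *[K] b \<cdot>[tensor R X Y] tens R X Y x y =
          a \<cdot>[tensor R X Y] (b \<cdot>[tensor R X Y] tens R X Y x y)"
        using a ab S.smult_assoc1[of a b x] fX cl by (simp add: sm(2))
    qed
  next
    fix a s t assume "a \<in>. K" "s \<in>. (tensor R X Y)" "t \<in>. (tensor R X Y)"
    then show "a \<cdot>[tensor R X Y] (s +[tensor R X Y] t) = a \<cdot>[tensor R X Y] s +[tensor R X Y] a \<cdot>[tensor R X Y] t"
      using sm(1) by (meson additive_add)
  next
    fix t assume t: "t \<in>. (tensor R X Y)"
    have one: "\<one>[K] \<in>. K" by simp
    show "\<one>[K] \<cdot>[tensor R X Y] t = t" by (rule T.additive_eq[OF t sm(1)[OF one] lin_additive[OF lin_id]])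
        (use S.smult_one in \<open>simp add: sm(2)\<close>)
  qed
qed

lemma lin_tens_right_module:
  assumes "lin K L (scal R X) f" "y \<in>. Y"
  shows "lin K L (tensor R X Y) (\<lambda>l. tens R X Y (f l) y)"
proof -
  have "lin K (scal R X) (tensor R X Y) (\<lambda>x. tens R X Y x y)"
    by (rule linI) (use assms(2) T.tens_closed in \<open>auto simp: T.tens_add_left tensor_smult_tens simp del: T.tensor_fields\<close>)
  then show ?thesis by (rule lin_comp[OF _ assms(1)])
qed

lemma lin_tens_left_module:
  assumes "lin K L (scal R Y) f" "x \<in>. X"
  shows "lin K L (tensor R X Y) (\<lambda>l. tens R X Y x (f l))"
proof -
  have "lin K (scal R Y) (tensor R X Y) (\<lambda>y. tens R X Y x y)" by (rule linI) (use assms(2) T.tens_closed in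
        \<open>auto simp: T.tens_add_right tensor_smult_tens T.tens_middle scalar_in simp del: T.tensor_fields\<close>)
  then show ?thesis by (rule lin_comp[OF _ assms(1)])
qed

lemma tens_lift_lin:
  assumes P: "module K P" and f: "balanced R X Y P f"
    and c: "\<And>c x y. c \<in>. K \<Longrightarrow> x \<in>. X \<Longrightarrow> y \<in>. Y
      \<Longrightarrow> f ((c \<cdot>[R] \<one>[R]) \<cdot>[X] x) y = c \<cdot>[P] f x y"
  shows "lin K (tensor R X Y) P (tens_lift P f)"
proof -
  have gP: "abelian_group P" using P by (rule module_abelian_group)
  note l = T.tens_lift_additive[OF gP f]
  have "tens_lift P f (a \<cdot>[tensor R X Y] t) = a \<cdot>[P] tens_lift P f t"
    if a: "a \<in>. K" and t: "t \<in>. (tensor R X Y)" for a t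
  proof (rule T.additive_eq[OF t additive_comp[OF l tensor_smult_additive[OF a]]])
    have "additive P P (\<lambda>x. a \<cdot>[P] x)"
      using P a by (auto simp: additive_def module.smult_r_distr module_smult_closed)
    then show "additive (tensor R X Y) P (\<lambda>t. a \<cdot>[P] tens_lift P f t)" by (rule additive_comp[OF _ l])
  qed (simp add: a tensor_smult_tens T.tens_lift_tens[OF gP f] right_module_facts[OF X] scalar_in c)
  with l show ?thesis by (simp add: lin_def del: T.tensor_fields)
qed

end


section \<open>Tensor products over the ground ring\<close>

definition bilin :: "('k, 'z) ring_scheme \<Rightarrow> ('k, 'm, 'u) module_scheme \<Rightarrow> ('k, 'n, 'v) module_scheme
    \<Rightarrow> ('k, 'p, 'w) module_scheme \<Rightarrow> ('m \<Rightarrow> 'n \<Rightarrow> 'p) \<Rightarrow> bool" where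
  "bilin K M N P F \<longleftrightarrow> (\<forall>x \<in> carrier M. lin K N P (F x)) \<and> (\<forall>y \<in> carrier N. lin K M P (\<lambda>x. F x y))"

lemma bilinI:
  assumes "\<And>x. x \<in>. M \<Longrightarrow> lin K N P (\<lambda>y. F x y)" "\<And>y. y \<in>. N \<Longrightarrow> lin K M P (\<lambda>x. F x y)"
  shows "bilin K M N P F"
  using assms by (simp add: bilin_def)

lemma bilin_right: "bilin K M N P F \<Longrightarrow> x \<in>. M \<Longrightarrow> lin K N P (F x)" by (simp add: bilin_def)

lemma bilin_left: "bilin K M N P F \<Longrightarrow> y \<in>. N \<Longrightarrow> lin K M P (\<lambda>x. F x y)"
  by (simp add: bilin_def)

lemma bilin_closed: "bilin K M N P F \<Longrightarrow> x \<in>. M \<Longrightarrow> y \<in>. N \<Longrightarrow> F x y \<in>. P"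
  by (meson bilin_right lin_closed)

lemma bilin_comp: "bilin K M N P F \<Longrightarrow> lin K P Q g \<Longrightarrow> bilin K M N Q (\<lambda>x y. g (F x y))"
  by (auto simp: bilin_def intro: lin_comp)

lemma bilin_cong:
  assumes "bilin K M N P F" "module K M" "module K N"
    "\<And>x y. x \<in>. M \<Longrightarrow> y \<in>. N \<Longrightarrow> F x y = G x y"
  shows "bilin K M N P G"
proof (rule bilinI)
  show "lin K N P (G x)" if "x \<in>. M" for x by (rule lin_cong[OF bilin_right[OF assms(1) that]])
      (simp_all add: assms(4) that module_add_closed[OF assms(3)] module_smult_closed[OF assms(3)])
  show "lin K M P (\<lambda>x. G x y)" if "y \<in>. N" for y by (rule lin_cong[OF bilin_left[OF assms(1) that]])
      (simp_all add: assms(4) that module_add_closed[OF assms(2)] module_smult_closed[OF assms(2)])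
qed

lemma bilin_balanced: "bilin K M N P F \<Longrightarrow> balanced (self_alg K) M N P F"
  unfolding balanced_def bilin_def lin_def by simp

abbreviation kt where "kt K M N \<equiv> tensor (self_alg K) M N"
abbreviation kten where "kten K M N \<equiv> tens (self_alg K) M N"

context
  fixes K :: "('k, 'z) ring_scheme" and M :: "('k, 'm, 'u) module_scheme" and N :: "('k, 'n, 'v) module_scheme"
  assumes M: "module K M" and N: "module K N"
begin

lemma kt_alg: "k_algebra K (self_alg K)" by (rule self_alg_k_algebra[OF module_cring[OF M]])

interpretation T: tensor_product "self_alg K" M N by (rule tensor_product_K[OF M N])

lemma kt_module: "module K (kt K M N)" by (rule tensor_module[OF kt_alg module_left_right(2)[OF M] module_left_right(1)[OF N]])

lemma kt_tens_closed: "x \<in>. M \<Longrightarrow> y \<in>. N \<Longrightarrow> kten K M N x y \<in>. (kt K M N)"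
  by (rule T.tens_closed)

lemma kt_smult: "c \<in>. K \<Longrightarrow> x \<in>. M \<Longrightarrow> y \<in>. N
    \<Longrightarrow> c \<cdot>[kt K M N] kten K M N x y = kten K M N (c \<cdot>[M] x) y"
  using tensor_smult_tens[OF kt_alg module_left_right(2)[OF M] module_left_right(1)[OF N]] k_algebra_r_one[OF kt_alg] by simp

lemma kt_bilin: "bilin K M N (kt K M N) (kten K M N)"
proof (rule bilinI)
  fix x assume x: "x \<in>. M"
  show "lin K N (kt K M N) (kten K M N x)"
    using x by (intro linI) (auto simp: T.tens_add_right T.tens_closed kt_smult T.tens_middle[simplified]
        simp del: T.tensor_fields)
next
  fix y assume y: "y \<in>. N"
  show "lin K M (kt K M N) (\<lambda>x. kten K M N x y)"
    using y by (intro linI) (auto simp: T.tens_add_left T.tens_closed kt_smult simp del: T.tensor_fields)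
qed

lemma kt_lin_left: "lin K L M f \<Longrightarrow> y \<in>. N \<Longrightarrow> lin K L (kt K M N) (\<lambda>l. kten K M N (f l) y)"
  by (rule lin_comp[OF bilin_left[OF kt_bilin]])

lemma kt_lin_right: "lin K L N f \<Longrightarrow> x \<in>. M \<Longrightarrow> lin K L (kt K M N) (\<lambda>l. kten K M N x (f l))"
  by (rule lin_comp[OF bilin_right[OF kt_bilin]])

lemma kt_lift_lin:
  assumes P: "module K P" and F: "bilin K M N P F"
  shows "lin K (kt K M N) P (tens_lift P F)"
  by (rule tens_lift_lin[OF kt_alg module_left_right(2)[OF M] module_left_right(1)[OF N] P bilin_balanced[OF F]])
    (use lin_smult[OF bilin_left[OF F]] k_algebra_r_one[OF kt_alg] in auto)

lemma kt_lift_closed: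
  "module K P \<Longrightarrow> bilin K M N P F \<Longrightarrow> t \<in>. (kt K M N) \<Longrightarrow> tens_lift P F t \<in>. P"
  by (meson kt_lift_lin lin_closed)

lemma kt_lift_tens:
  assumes "module K P" "bilin K M N P F" "x \<in>. M" "y \<in>. N"
  shows "tens_lift P F (kten K M N x y) = F x y"
  by (rule T.tens_lift_tens[OF module_abelian_group[OF assms(1)] bilin_balanced[OF assms(2)] assms(3,4)])

lemma kt_lift_cong:
  assumes "t \<in>. (kt K M N)" "module K P" "bilin K M N P F"
    and "\<And>x y. x \<in>. M \<Longrightarrow> y \<in>. N \<Longrightarrow> F x y = G x y"
  shows "tens_lift P F t = tens_lift P G t"
  by (rule T.tens_lift_cong[OF assms(1) module_abelian_group[OF assms(2)] bilin_balanced[OF assms(3)] assms(4)])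

lemma kt_lift_push:
  assumes "t \<in>. (kt K M N)" "module K P" "module K Q" "bilin K M N P F" "lin K P Q g"
  shows "g (tens_lift P F t) = tens_lift Q (\<lambda>x y. g (F x y)) t"
  by (rule T.tens_lift_push[OF assms(1) module_abelian_group[OF assms(2)] module_abelian_group[OF assms(3)]
        bilin_balanced[OF assms(4)] lin_additive[OF assms(5)]])

lemma kt_eq:
  assumes "t \<in>. (kt K M N)" "lin K (kt K M N) P f" "lin K (kt K M N) P g"
    and "\<And>x y. x \<in>. M \<Longrightarrow> y \<in>. N \<Longrightarrow> f (kten K M N x y) = g (kten K M N x y)"
  shows "f t = g t" by (rule T.additive_eq[OF assms(1) lin_additive[OF assms(2)] lin_additive[OF assms(3)] assms(4)])

text \<open>Linearity in a parameter passes from the integrand to the lift.  Sweedler sums are nested, and the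
  inner sum has to be linear in the variables of the outer one.\<close>

lemma kt_lift_param_lin:
  assumes P: "module K P" and L: "module K L" and t: "t \<in>. (kt K M N)"
    and F: "\<And>z. z \<in>. L \<Longrightarrow> bilin K M N P (F z)"
    and z: "\<And>x y. x \<in>. M \<Longrightarrow> y \<in>. N \<Longrightarrow> lin K L P (\<lambda>z. F z x y)"
  shows "lin K L P (\<lambda>z. tens_lift P (F z) t)"
proof (rule linI)
  fix v w assume vw: "v \<in>. L" "w \<in>. L"
  note vw' = module_add_closed[OF L vw]
  show "tens_lift P (F (v +[L] w)) t = tens_lift P (F v) t +[P] tens_lift P (F w) t"
    by (rule kt_eq[OF t kt_lift_lin[OF P F[OF vw']]
          lin_sum[OF P kt_lift_lin[OF P F[OF vw(1)]] kt_lift_lin[OF P F[OF vw(2)]]]])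
      (simp add: kt_lift_tens[OF P F] vw vw' lin_add[OF z])
next
  fix c v assume cv: "c \<in>. K" "v \<in>. L"
  note cv' = module_smult_closed[OF L cv]
  show "tens_lift P (F (c \<cdot>[L] v)) t = c \<cdot>[P] tens_lift P (F v) t"
    by (rule kt_eq[OF t kt_lift_lin[OF P F[OF cv']] lin_smult_right[OF P kt_lift_lin[OF P F[OF cv(2)]] cv(1)]])
      (simp add: kt_lift_tens[OF P F] cv cv' lin_smult[OF z])
qed (use kt_lift_closed[OF P F t] in blast)

end

text \<open>Both sides are linear in \<open>s\<close> and in \<open>t\<close>, and agree on pure tensors.\<close>

lemma kt_lift_swap:
  assumes M: "module K M" "module K N" "module K M'" "module K N'" and P: "module K P"
    and s: "s \<in>. (kt K M N)" and t: "t \<in>. (kt K M' N')"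
    and 1: "\<And>a b. a \<in>. M \<Longrightarrow> b \<in>. N \<Longrightarrow> bilin K M' N' P (F a b)"
    and 2: "\<And>c d. c \<in>. M' \<Longrightarrow> d \<in>. N' \<Longrightarrow> bilin K M N P (\<lambda>a b. F a b c d)"
  shows "tens_lift P (\<lambda>a b. tens_lift P (F a b) t) s = tens_lift P (\<lambda>c d. tens_lift P (\<lambda>a b. F a b c d) s) t"
proof -
  have b1: "bilin K M N P (\<lambda>a b. tens_lift P (F a b) t)" if "t \<in>. (kt K M' N')" for t
    by (intro bilinI kt_lift_param_lin[OF M(3,4) P]) (use M 1 2 that in \<open>simp_all add: bilin_def\<close>)
  have b2: "bilin K M' N' P (\<lambda>c d. tens_lift P (\<lambda>a b. F a b c d) s)" if "s \<in>. (kt K M N)" for s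
    by (intro bilinI kt_lift_param_lin[OF M(1,2) P]) (use M 1 2 that in \<open>simp_all add: bilin_def\<close>)
  show ?thesis
  proof (rule kt_eq[OF M(3,4) t _ kt_lift_lin[OF M(3,4) P b2[OF s]]])
    show "lin K (kt K M' N') P (\<lambda>t. tens_lift P (\<lambda>a b. tens_lift P (F a b) t) s)"
    proof (rule kt_lift_param_lin[OF M(1,2) P kt_module[OF M(3,4)] s])
      show "lin K (kt K M' N') P (tens_lift P (F x y))" if "x \<in>. M" "y \<in>. N" for x y
        using kt_lift_lin[OF M(3,4) P 1[OF that]] .
    qed (rule b1)
    fix c d assume cd: "c \<in>. M'" "d \<in>. N'"
    show "tens_lift P (\<lambda>a b. tens_lift P (F a b) (kten K M' N' c d)) s =
        tens_lift P (\<lambda>c d. tens_lift P (\<lambda>a b. F a b c d) s) (kten K M' N' c d)"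
      unfolding kt_lift_tens[OF M(3,4) P b2[OF s] cd]
      by (rule kt_lift_cong[OF M(1,2) s P b1]) (use cd kt_tens_closed[OF M(3,4)] kt_lift_tens[OF M(3,4) P 1] in auto)
  qed
qed


section \<open>The tensor product of two algebras\<close>

lemma alg_tensor_simps [simp]:
  "carrier (alg_tensor K A B) = carrier (kt K A B)" "add (alg_tensor K A B) = add (kt K A B)"
  "zero (alg_tensor K A B) = zero (kt K A B)" "smult (alg_tensor K A B) = smult (kt K A B)"
  "one (alg_tensor K A B) = kten K A B \<one>[A] \<one>[B]" by (simp_all add: alg_tensor_def Let_def)

context
  fixes K :: "'k ring" and A :: "('k, 'a, 'u) module_scheme" and B :: "('k, 'b, 'v) module_scheme"
  assumes A: "k_algebra K A" and B: "k_algebra K B"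
begin

lemmas mA = k_algebra_module[OF A] and mB = k_algebra_module[OF B]
lemmas AB = mA mB
lemmas mT = kt_module[OF AB]

lemma alg_tensor_mult_eq:
  "mult (alg_tensor K A B) s s' = tens_lift (kt K A B) (\<lambda>a b. tens_lift (kt K A B)
     (\<lambda>a' b'. kten K A B (a *[A] a') (b *[B] b')) s') s" by (simp add: alg_tensor_def Let_def)

lemma alg_tensor_inner_bilin:
  assumes "a \<in>. A" "b \<in>. B"
  shows "bilin K A B (kt K A B) (\<lambda>a' b'. kten K A B (a *[A] a') (b *[B] b'))"
    "bilin K A B (kt K A B) (\<lambda>a' b'. kten K A B (a' *[A] a) (b' *[B] b))"
  using assms A B by (auto intro!: bilinI kt_lin_left kt_lin_right AB lin_mult_right lin_mult_left lin_id
    k_algebra_mult_closed)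

lemma alg_tensor_outer_bilin:
  assumes "s \<in>. (kt K A B)"
  shows "bilin K A B (kt K A B) (\<lambda>a b. tens_lift (kt K A B)
     (\<lambda>a' b'. kten K A B (a *[A] a') (b *[B] b')) s)"
  by (intro bilinI kt_lift_param_lin[OF AB mT] AB assms alg_tensor_inner_bilin)
    (use bilin_left[OF alg_tensor_inner_bilin(2)] bilin_right[OF alg_tensor_inner_bilin(2)] in auto)

lemma alg_tensor_tens_mult:
  assumes "a \<in>. A" "b \<in>. B" "a' \<in>. A" "b' \<in>. B"
  shows "kten K A B a b *[alg_tensor K A B] kten K A B a' b' = kten K A B (a *[A] a') (b *[B] b')"
  unfolding alg_tensor_mult_eq
  using assms by (simp add: kt_lift_tens[OF AB mT] alg_tensor_outer_bilin alg_tensor_inner_bilin kt_tens_closed[OF AB])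

lemma alg_tensor_mult_lin_left:
  assumes "t \<in>. (kt K A B)"
  shows "lin K (kt K A B) (kt K A B) (\<lambda>s. s *[alg_tensor K A B] t)"
  unfolding alg_tensor_mult_eq by (rule kt_lift_lin[OF AB mT alg_tensor_outer_bilin[OF assms]])

lemma alg_tensor_mult_lin_right:
  assumes "s \<in>. (kt K A B)"
  shows "lin K (kt K A B) (kt K A B) (\<lambda>t. s *[alg_tensor K A B] t)"
  unfolding alg_tensor_mult_eq
  by (rule kt_lift_param_lin[OF AB mT mT assms]) (auto intro!: alg_tensor_outer_bilin kt_lift_lin[OF AB mT] alg_tensor_inner_bilin)

lemma alg_tensor_k_algebra: "k_algebra K (alg_tensor K A B)"
proof (rule k_algebraI)
  let ?T = "kt K A B" and ?E = "alg_tensor K A B"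
  note lr = alg_tensor_mult_lin_left alg_tensor_mult_lin_right
  note cl = k_algebra_mult_closed[OF A] k_algebra_mult_closed[OF B] k_algebra_one_closed[OF A] k_algebra_one_closed[OF B]
    kt_tens_closed[OF AB]
  note closed = lin_closed[OF lr(1)]
  show "module K ?E" by (rule module_fields[OF mT]) simp_all
  show "\<one>[?E] \<in>. ?E" by (simp add: cl)
  show "lin K ?E ?E (\<lambda>x. x *[?E] y)" if "y \<in>. ?E" for y by (rule lin_fields[OF lr(1)]) (use that in simp_all)
  show "lin K ?E ?E (\<lambda>y. x *[?E] y)" if "x \<in>. ?E" for x by (rule lin_fields[OF lr(2)]) (use that in simp_all)
  show "\<one>[?E] *[?E] x = x" if "x \<in>. ?E" for x by (rule kt_eq[OF AB _ lr(2) lin_id, of x "\<one>[?E]"])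
      (use that in \<open>auto simp: cl alg_tensor_tens_mult k_algebra_l_one[OF A] k_algebra_l_one[OF B]\<close>)
  show "x *[?E] \<one>[?E] = x" if "x \<in>. ?E" for x by (rule kt_eq[OF AB _ lr(1) lin_id, of x "\<one>[?E]"])
      (use that in \<open>auto simp: cl alg_tensor_tens_mult k_algebra_r_one[OF A] k_algebra_r_one[OF B]\<close>)
  fix x y z assume "x \<in>. ?E" "y \<in>. ?E" "z \<in>. ?E"
  then have xyz: "x \<in>. ?T" "y \<in>. ?T" "z \<in>. ?T" by auto
  have 1: "(kten K A B a b *[?E] kten K A B a' b') *[?E] z = kten K A B a b *[?E] (kten K A B a' b' *[?E] z)"
    if "a \<in>. A" "b \<in>. B" "a' \<in>. A" "b' \<in>. B" for a b a' b'
    by (rule kt_eq[OF AB xyz(3) lr(2) lin_comp[OF lr(2) lr(2)]])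
      (use that in \<open>auto simp: cl alg_tensor_tens_mult k_algebra_assoc[OF A] k_algebra_assoc[OF B]\<close>)
  have 2: "(kten K A B a b *[?E] y) *[?E] z = kten K A B a b *[?E] (y *[?E] z)"
    if "a \<in>. A" "b \<in>. B" for a b by (rule kt_eq[OF AB xyz(2) lin_comp[OF lr(1) lr(2)] lin_comp[OF lr(2) lr(1)]])
      (use that 1 xyz in \<open>auto simp: cl\<close>)
  show "(x *[?E] y) *[?E] z = x *[?E] (y *[?E] z)" by (rule kt_eq[OF AB xyz(1) lin_comp[OF lr(1) lr(1)] lr(1)])
      (use 2 xyz closed in auto)
qed

end


section \<open>Sweedler calculus\<close>

text \<open>\<open>sw P h F\<close> below is the lift of a bilinear \<open>F\<close> applied to the coproduct of \<open>h\<close>.  A computation with such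
  sums uses few moves: rewriting the integrand (\<open>sw_cong\<close>), moving a linear map in or out (\<open>sw_push\<close>),
  reassociating (\<open>sw_coassoc\<close>), exchanging independent sums (\<open>sw_swap\<close>), and, under cocommutativity,
  permuting the factors of an iterated coproduct.  Each move asks for linearity of the integrand in its
  variables; multilinearity is spelled out in terms of \<open>lin\<close> so that the simplifier can decide it.\<close>

abbreviation trilin where
  "trilin K H P F \<equiv> (\<forall>x \<in> carrier H. \<forall>y \<in> carrier H. lin K H P (F x y)) \<and>
     (\<forall>x \<in> carrier H. \<forall>z \<in> carrier H. lin K H P (\<lambda>y. F x y z)) \<and>
     (\<forall>y \<in> carrier H. \<forall>z \<in> carrier H. lin K H P (\<lambda>x. F x y z))"

context hopf_algebra
begin

lemma H_alg: "k_algebra K H"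
  using k_algebra_axioms .

lemmas H_assoc = k_algebra_assoc[OF H_alg] and H_l_one = k_algebra_l_one[OF H_alg] and H_r_one = k_algebra_r_one[OF H_alg]

lemma H_mod: "module K H"
  using k_algebra_module[OF H_alg] .

lemma K_cring: "cring K"
  using module_cring[OF H_mod] .

abbreviation "HT \<equiv> kt K H H"
abbreviation "\<Delta> \<equiv> comult H"
abbreviation "\<epsilon> \<equiv> counit H"
abbreviation "S \<equiv> antipode H"
abbreviation "sw P h F \<equiv> sweedler H P h F"

lemma comult_lin: "lin K H HT \<Delta>"
  using comult_linear by (simp add: mod_hom_iff_lin)

lemma counit_lin: "lin K H (self_alg K) \<epsilon>"
  using counit_linear by (simp add: mod_hom_iff_lin)

lemma antipode_lin: "lin K H H S"
  using antipode_linear by (simp add: mod_hom_iff_lin)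

lemma comult_closed: "h \<in>. H \<Longrightarrow> \<Delta> h \<in>. HT" by (rule lin_closed[OF comult_lin])

lemma counit_closed: "h \<in>. H \<Longrightarrow> \<epsilon> h \<in>. K"
  using lin_closed[OF counit_lin] by simp

lemma antipode_closed: "h \<in>. H \<Longrightarrow> S h \<in>. H" by (rule lin_closed[OF antipode_lin])

lemma sw_lin: "module K P \<Longrightarrow> lin K L H f \<Longrightarrow> bilin K H H P F \<Longrightarrow> lin K L P (\<lambda>z. sw P (f z) F)"
  by (rule lin_comp[OF kt_lift_lin[OF H_mod H_mod] lin_comp[OF comult_lin]])

lemma sw_closed: "module K P \<Longrightarrow> h \<in>. H \<Longrightarrow> bilin K H H P F \<Longrightarrow> sw P h F \<in>. P"
  by (rule kt_lift_closed[OF H_mod H_mod _ _ comult_closed])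

lemma sw_param_lin:
  "module K P \<Longrightarrow> module K L \<Longrightarrow> h \<in>. H \<Longrightarrow> (\<And>z. z \<in>. L \<Longrightarrow> bilin K H H P (F z))
   \<Longrightarrow> (\<And>x y. x \<in>. H \<Longrightarrow> y \<in>. H \<Longrightarrow> lin K L P (\<lambda>z. F z x y))
   \<Longrightarrow> lin K L P (\<lambda>z. sw P h (F z))" by (rule kt_lift_param_lin[OF H_mod H_mod _ _ comult_closed])

lemma sw_cong:
  "module K P \<Longrightarrow> h \<in>. H \<Longrightarrow> bilin K H H P F
   \<Longrightarrow> (\<And>x y. x \<in>. H \<Longrightarrow> y \<in>. H \<Longrightarrow> F x y = G x y) \<Longrightarrow> sw P h F = sw P h G"
  by (rule kt_lift_cong[OF H_mod H_mod comult_closed])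

lemma sw_push:
  "module K P \<Longrightarrow> module K Q \<Longrightarrow> h \<in>. H \<Longrightarrow> bilin K H H P F \<Longrightarrow> lin K P Q g
   \<Longrightarrow> g (sw P h F) = sw Q h (\<lambda>x y. g (F x y))" by (rule kt_lift_push[OF H_mod H_mod comult_closed])

lemma sw_swap:
  assumes "module K P" "h \<in>. H" "k \<in>. H"
    "\<And>a b. a \<in>. H \<Longrightarrow> b \<in>. H \<Longrightarrow> bilin K H H P (F a b)"
    "\<And>a b. a \<in>. H \<Longrightarrow> b \<in>. H \<Longrightarrow> bilin K H H P (\<lambda>x y. F x y a b)"
  shows "sw P h (\<lambda>a b. sw P k (F a b)) = sw P k (\<lambda>c d. sw P h (\<lambda>a b. F a b c d))"
  by (rule kt_lift_swap[OF H_mod H_mod H_mod H_mod assms(1) comult_closed comult_closed]) (use assms in auto)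

text \<open>Both sides arise from the two sides of the coassociativity law in \<open>H \<otimes> (H \<otimes> H)\<close> by the lift of \<open>F\<close>.\<close>

lemma sw_coassoc:
  assumes P: "module K P" and h: "h \<in>. H" and F: "trilin K H P F"
  shows "sw P h (\<lambda>x z. sw P x (\<lambda>x y. F x y z)) = sw P h (\<lambda>x y. sw P y (F x))"
proof -
  note HH = H_mod H_mod
  let ?HHH = "kt K H HT"
  note mHT = kt_module[OF HH]
  note mHHH = kt_module[OF H_mod mHT]
  let ?G = "tens_lift P (\<lambda>a t. tens_lift P (F a) t)"
  have b: "bilin K H H P (F a)" if "a \<in>. H" for a using F that by (auto intro!: bilinI)
  have b3: "bilin K H H P (\<lambda>x y. F x y a)" if "a \<in>. H" for a using F that by (auto intro!: bilinI)
  have b2: "bilin K H HT P (\<lambda>a t. tens_lift P (F a) t)"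
    by (rule bilinI) (use F b in \<open>auto intro!: kt_lift_lin[OF HH P] kt_lift_param_lin[OF HH P]  H_mod\<close>)
  have G: "lin K ?HHH P ?G" by (rule kt_lift_lin[OF H_mod mHT P b2])
  have Gt: "?G (kten K H HT x t) = tens_lift P (F x) t" if "x \<in>. H" "t \<in>. HT" for x t
    by (rule kt_lift_tens[OF H_mod mHT P b2 that])
  have Gt2: "?G (kten K H HT x (kten K H H y z)) = F x y z" if "x \<in>. H" "y \<in>. H" "z \<in>. H" for x y z
    using that by (simp add: Gt kt_tens_closed[OF HH] kt_lift_tens[OF HH P b])
  have bA: "bilin K H H ?HHH (\<lambda>x1 x2. kten K H HT x1 (kten K H H x2 y))" if "y \<in>. H" for y
    by (intro bilinI kt_lin_right[OF H_mod mHT] kt_lin_left[OF H_mod mHT] kt_lin_left[OF HH] kt_lin_right[OF HH] lin_id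
        kt_tens_closed[OF HH] that)
  have bA': "bilin K H H ?HHH (\<lambda>x y. kten K H HT x' (kten K H H x y))" if "x' \<in>. H" for x'
    by (intro bilinI kt_lin_right[OF H_mod mHT] kt_lin_left[OF H_mod mHT] kt_lin_left[OF HH] kt_lin_right[OF HH] lin_id
        kt_tens_closed[OF HH] that)
  have bB: "bilin K H H ?HHH (\<lambda>x y. sw ?HHH x (\<lambda>x1 x2. kten K H HT x1 (kten K H H x2 y)))"
    by (intro bilinI sw_lin sw_param_lin mHHH lin_id bA H_mod)
      (use bilin_left[OF bA] bilin_right[OF bA'] bilin_right[OF bA] in auto)
  have bC: "bilin K H H ?HHH (\<lambda>x y. kten K H HT x (\<Delta> y))"
    by (intro bilinI kt_lin_right[OF H_mod mHT] kt_lin_left[OF H_mod mHT] comult_lin comult_closed lin_id)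
  have "?G (sw ?HHH h (\<lambda>x y. sw ?HHH x (\<lambda>x1 x2. kten K H HT x1 (kten K H H x2 y))))
      = sw P h (\<lambda>x y. ?G (sw ?HHH x (\<lambda>x1 x2. kten K H HT x1 (kten K H H x2 y))))"
    by (rule sw_push[OF mHHH P h bB G])
  also have "\<dots> = sw P h (\<lambda>x z. sw P x (\<lambda>x y. F x y z))"
  proof (rule sw_cong[OF P h bilin_comp[OF bB G]])
    fix x y assume xy: "x \<in>. H" "y \<in>. H"
    have "?G (sw ?HHH x (\<lambda>x1 x2. kten K H HT x1 (kten K H H x2 y))) =
        sw P x (\<lambda>x1 x2. ?G (kten K H HT x1 (kten K H H x2 y)))" by (rule sw_push[OF mHHH P xy(1) bA[OF xy(2)] G])
    also have "\<dots> = sw P x (\<lambda>x1 x2. F x1 x2 y)"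
      by (rule sw_cong[OF P xy(1) bilin_comp[OF bA[OF xy(2)] G]]) (use xy Gt2 in auto)
    finally show "?G (sw ?HHH x (\<lambda>x1 x2. kten K H HT x1 (kten K H H x2 y))) =
      sw P x (\<lambda>x1 x2. F x1 x2 y)" .
  qed
  finally have 1: "?G (sw ?HHH h (\<lambda>x y. sw ?HHH x (\<lambda>x1 x2. kten K H HT x1 (kten K H H x2 y))))
      = sw P h (\<lambda>x z. sw P x (\<lambda>x y. F x y z))" .
  have "?G (sw ?HHH h (\<lambda>x y. kten K H HT x (\<Delta> y))) = sw P h (\<lambda>x y. ?G (kten K H HT x (\<Delta> y)))"
    by (rule sw_push[OF mHHH P h bC G])
  also have "\<dots> = sw P h (\<lambda>x y. sw P y (F x))"
    by (rule sw_cong[OF P h bilin_comp[OF bC G]]) (use Gt comult_closed in auto)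
  finally show ?thesis using 1 coassoc[OF h] by (simp add: Let_def)
qed

end


context hopf_algebra
begin

lemma sw_lin':
  "module K P \<Longrightarrow> lin K L H f \<Longrightarrow> (\<And>x. x \<in>. H \<Longrightarrow> lin K H P (F x))
   \<Longrightarrow> (\<And>y. y \<in>. H \<Longrightarrow> lin K H P (\<lambda>x. F x y)) \<Longrightarrow> lin K L P (\<lambda>z. sw P (f z) F)"
  by (rule sw_lin) (auto intro: bilinI)

lemma sw_param_lin':
  "module K P \<Longrightarrow> module K L \<Longrightarrow> h \<in>. H
   \<Longrightarrow> (\<And>z x. z \<in>. L \<Longrightarrow> x \<in>. H \<Longrightarrow> lin K H P (F z x))
   \<Longrightarrow> (\<And>z y. z \<in>. L \<Longrightarrow> y \<in>. H \<Longrightarrow> lin K H P (\<lambda>x. F z x y))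
   \<Longrightarrow> (\<And>x y. x \<in>. H \<Longrightarrow> y \<in>. H \<Longrightarrow> lin K L P (\<lambda>z. F z x y))
   \<Longrightarrow> lin K L P (\<lambda>z. sw P h (F z))" by (rule sw_param_lin) (auto intro: bilinI)

lemma sw_closed':
  "module K P \<Longrightarrow> h \<in>. H \<Longrightarrow> (\<And>x. x \<in>. H \<Longrightarrow> lin K H P (F x))
   \<Longrightarrow> (\<And>y. y \<in>. H \<Longrightarrow> lin K H P (\<lambda>x. F x y)) \<Longrightarrow> sw P h F \<in>. P"
  by (rule sw_closed) (auto intro: bilinI)

lemma lin_mult_H:
  "lin K L H f \<Longrightarrow> a \<in>. H \<Longrightarrow> lin K L H (\<lambda>x. f x *[H] a)"
  "lin K L H f \<Longrightarrow> a \<in>. H \<Longrightarrow> lin K L H (\<lambda>x. a *[H] f x)"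
  by (rule lin_mult_left[OF H_alg] lin_mult_right[OF H_alg]; assumption)+

lemma lin_antipode: "lin K L H f \<Longrightarrow> lin K L H (\<lambda>x. S (f x))" by (rule lin_comp[OF antipode_lin])

lemma lin_counit: "lin K L H f \<Longrightarrow> lin K L (self_alg K) (\<lambda>x. \<epsilon> (f x))"
  by (rule lin_comp[OF counit_lin])

lemma lin_comult: "lin K L H f \<Longrightarrow> lin K L HT (\<lambda>x. \<Delta> (f x))" by (rule lin_comp[OF comult_lin])

lemmas lin_rules = lin_id sw_lin' sw_param_lin' lin_mult_H lin_antipode lin_counit lin_comult
  lin_smult_left lin_smult_right lin_mult_left lin_mult_right kt_lin_left kt_lin_right

lemma HT_mod: "module K HT" by (rule kt_module[OF H_mod H_mod])

lemma mult_H_closed: "x \<in>. H \<Longrightarrow> y \<in>. H \<Longrightarrow> x *[H] y \<in>. H"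
  by (rule k_algebra_mult_closed[OF H_alg])

lemma one_H_closed: "\<one>[H] \<in>. H" by (rule k_algebra_one_closed[OF H_alg])

lemmas hopf_closed = H_mod H_alg HT_mod comult_closed counit_closed antipode_closed mult_H_closed one_H_closed
  module_smult_closed[where K = K] kt_tens_closed[where K = K] bilin_def

lemma sw_counit_left:
  assumes P: "module K P" and h: "h \<in>. H" and f: "lin K H P f"
  shows "sw P h (\<lambda>x y. \<epsilon> x \<cdot>[P] f y) = f h"
proof -
  have b: "bilin K H H H (\<lambda>x y. \<epsilon> x \<cdot>[H] y)" by (simp add: lin_rules hopf_closed)
  have "f h = f (sw H h (\<lambda>x y. \<epsilon> x \<cdot>[H] y))" using counit_left[OF h] by simp
  also have "\<dots> = sw P h (\<lambda>x y. f (\<epsilon> x \<cdot>[H] y))" by (rule sw_push[OF H_mod P h b f])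
  also have "\<dots> = sw P h (\<lambda>x y. \<epsilon> x \<cdot>[P] f y)"
    by (rule sw_cong[OF P h bilin_comp[OF b f]]) (simp add: lin_smult[OF f] counit_closed)
  finally show ?thesis by simp
qed

lemma sw_counit_right:
  assumes P: "module K P" and h: "h \<in>. H" and f: "lin K H P f"
  shows "sw P h (\<lambda>x y. \<epsilon> y \<cdot>[P] f x) = f h"
proof -
  have b: "bilin K H H H (\<lambda>x y. \<epsilon> y \<cdot>[H] x)" by (simp add: lin_rules hopf_closed)
  have "f h = f (sw H h (\<lambda>x y. \<epsilon> y \<cdot>[H] x))" using counit_right[OF h] by simp
  also have "\<dots> = sw P h (\<lambda>x y. f (\<epsilon> y \<cdot>[H] x))" by (rule sw_push[OF H_mod P h b f])
  also have "\<dots> = sw P h (\<lambda>x y. \<epsilon> y \<cdot>[P] f x)"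
    by (rule sw_cong[OF P h bilin_comp[OF b f]]) (simp add: lin_smult[OF f] counit_closed)
  finally show ?thesis by simp
qed

lemma sw_antipode_right:
  assumes P: "module K P" and h: "h \<in>. H" and f: "lin K H P f"
  shows "sw P h (\<lambda>x y. f (x *[H] S y)) = \<epsilon> h \<cdot>[P] f \<one>[H]"
proof -
  have b: "bilin K H H H (\<lambda>x y. x *[H] S y)" by (simp add: lin_rules hopf_closed)
  show ?thesis
    using sw_push[OF H_mod P h b f] antipode_right[OF h] lin_smult[OF f counit_closed[OF h] one_H_closed] by simp
qed

lemma sw_antipode_left:
  assumes P: "module K P" and h: "h \<in>. H" and f: "lin K H P f"
  shows "sw P h (\<lambda>x y. f (S x *[H] y)) = \<epsilon> h \<cdot>[P] f \<one>[H]"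
proof -
  have b: "bilin K H H H (\<lambda>x y. S x *[H] y)" by (simp add: lin_rules hopf_closed)
  show ?thesis
    using sw_push[OF H_mod P h b f] antipode_left[OF h] lin_smult[OF f counit_closed[OF h] one_H_closed] by simp
qed

text \<open>The antipode axiom inside a larger sum: two neighbouring factors of the coproduct cancel.\<close>

lemma sw_collapse_right:
  assumes P: "module K P" and h: "h \<in>. H" and G: "bilin K H H P G"
  shows "sw P h (\<lambda>x y. sw P y (\<lambda>p q. G x (p *[H] S q))) = G h \<one>[H]"
proof -
  note G' = bilin_left[OF G] bilin_right[OF G]
  have "sw P h (\<lambda>x y. sw P y (\<lambda>p q. G x (p *[H] S q))) = sw P h (\<lambda>x y. \<epsilon> y \<cdot>[P] G x \<one>[H])"
    by (rule sw_cong[OF P h])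
      (auto simp: P lin_rules hopf_closed G' lin_comp[OF G'(2)] sw_antipode_right[OF P])
  also have "\<dots> = G h \<one>[H]" by (rule sw_counit_right[OF P h G'(1)[OF one_H_closed]])
  finally show ?thesis .
qed

lemma sw_collapse_left:
  assumes P: "module K P" and h: "h \<in>. H" and G: "bilin K H H P G"
  shows "sw P h (\<lambda>x y. sw P y (\<lambda>p q. G x (S p *[H] q))) = G h \<one>[H]"
proof -
  note G' = bilin_left[OF G] bilin_right[OF G]
  have "sw P h (\<lambda>x y. sw P y (\<lambda>p q. G x (S p *[H] q))) = sw P h (\<lambda>x y. \<epsilon> y \<cdot>[P] G x \<one>[H])"
    by (rule sw_cong[OF P h])
      (auto simp: P lin_rules hopf_closed G' lin_comp[OF G'(2)] sw_antipode_left[OF P])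
  also have "\<dots> = G h \<one>[H]" by (rule sw_counit_right[OF P h G'(1)[OF one_H_closed]])
  finally show ?thesis .
qed

lemma comult_mult:
  "h \<in>. H \<Longrightarrow> k \<in>. H \<Longrightarrow> \<Delta> (h *[H] k) = \<Delta> h *[alg_tensor K H H] \<Delta> k"
  using comult_ring_hom by (simp add: ring_hom_def)

lemma comult_one: "\<Delta> \<one>[H] = kten K H H \<one>[H] \<one>[H]"
  using comult_ring_hom by (simp add: ring_hom_def)

lemma counit_mult: "h \<in>. H \<Longrightarrow> k \<in>. H \<Longrightarrow> \<epsilon> (h *[H] k) = \<epsilon> h *[K] \<epsilon> k"
  using counit_ring_hom by (simp add: ring_hom_def)

lemma counit_one: "\<epsilon> \<one>[H] = \<one>[K]"
  using counit_ring_hom by (simp add: ring_hom_def)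

lemma sw_one:
  assumes "module K P" "bilin K H H P F"
  shows "sw P \<one>[H] F = F \<one>[H] \<one>[H]"
  unfolding comult_one by (rule kt_lift_tens[OF H_mod H_mod assms one_H_closed one_H_closed])

lemma sw_mult:
  assumes P: "module K P" and h: "h \<in>. H" and k: "k \<in>. H" and F: "bilin K H H P F"
  shows "sw P (h *[H] k) F =
    sw P h (\<lambda>x y. sw P k (\<lambda>p q. F (x *[H] p) (y *[H] q)))"
proof -
  note HH = H_mod H_mod and F' = bilin_left[OF F] bilin_right[OF F]
  have F'': "lin K H P (\<lambda>z. F (f z) y)" if "lin K H H f" "y \<in>. H" for f y
    using lin_comp[OF F'(1) that(1)] that by simp
  have F''': "lin K H P (\<lambda>z. F y (f z))" if "lin K H H f" "y \<in>. H" for f y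
    using lin_comp[OF F'(2) that(1)] that by simp
  have l: "lin K HT P (tens_lift P F)" by (rule kt_lift_lin[OF HH P F])
  have "sw P (h *[H] k) F = tens_lift P F (\<Delta> h *[alg_tensor K H H] \<Delta> k)" by (simp add: comult_mult h k)
  also have "\<dots> = sw P h (\<lambda>x y. tens_lift P F (sw HT k (\<lambda>p q. kten K H H (x *[H] p) (y *[H] q))))"
    unfolding alg_tensor_mult_eq[OF H_alg H_alg]
    by (rule sw_push[OF HT_mod P h _ l]) (rule alg_tensor_outer_bilin[OF H_alg H_alg comult_closed[OF k]])
  also have "\<dots> = sw P h (\<lambda>x y. sw P k (\<lambda>p q. F (x *[H] p) (y *[H] q)))"
  proof (rule sw_cong[OF P h])
    show "bilin K H H P (\<lambda>x y. tens_lift P F (sw HT k (\<lambda>p q. kten K H H (x *[H] p) (y *[H] q))))"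
      by (rule bilin_comp[OF alg_tensor_outer_bilin[OF H_alg H_alg comult_closed[OF k]] l])
    fix x y assume xy: "x \<in>. H" "y \<in>. H"
    note ib = alg_tensor_inner_bilin[OF H_alg H_alg xy]
    have "tens_lift P F (sw HT k (\<lambda>p q. kten K H H (x *[H] p) (y *[H] q)))
      = sw P k (\<lambda>p q. tens_lift P F (kten K H H (x *[H] p) (y *[H] q)))" by (rule sw_push[OF HT_mod P k ib(1) l])
    also have "\<dots> = sw P k (\<lambda>p q. F (x *[H] p) (y *[H] q))"
      by (rule sw_cong[OF P k bilin_comp[OF ib(1) l]]) (simp add: kt_lift_tens[OF HH P F] xy mult_H_closed)
    finally show "tens_lift P F (sw HT k (\<lambda>p q. kten K H H (x *[H] p) (y *[H] q)))
      = sw P k (\<lambda>p q. F (x *[H] p) (y *[H] q))" .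
  qed
  finally show ?thesis .
qed

text \<open>A left and a right inverse of \<open>g\<close> for the convolution product agree, since both are equal to \<open>f * g * k\<close>.
  The scalar \<open>c\<close> allows an application to maps of two arguments of which one is kept fixed: there \<open>g * k\<close>
  is the unit of the convolution product only up to the counit of the fixed argument.\<close>

lemma convolution_inverse:
  assumes E: "k_algebra K E" and f: "lin K H E f" and g: "lin K H E g" and k: "lin K H E k"
    and c: "c \<in>. K"
    and fg: "\<And>h. h \<in>. H \<Longrightarrow> sw E h (\<lambda>x y. f x *[E] g y) = \<epsilon> h \<cdot>[E] \<one>[E]"
    and gk: "\<And>h. h \<in>. H \<Longrightarrow> sw E h (\<lambda>x y. g x *[E] k y) = c \<cdot>[E] (\<epsilon> h \<cdot>[E] \<one>[E])"
    and h: "h \<in>. H"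
  shows "k h = c \<cdot>[E] f h"
proof -
  note mE = k_algebra_module[OF E] and fgk = f g k
  note cl = fgk[THEN lin_closed] E mE c k_algebra_mult_closed[OF E] k_algebra_one_closed[OF E]
  note facts = cl lin_rules fgk hopf_closed
  have "c \<cdot>[E] f h = sw E h (\<lambda>x y. \<epsilon> y \<cdot>[E] (c \<cdot>[E] f x))"
    by (rule sw_counit_right[symmetric, OF mE h lin_smult_right[OF mE f c]])
  also have "\<dots> = sw E h (\<lambda>x y. sw E y (\<lambda>p q. f x *[E] (g p *[E] k q)))"
  proof (rule sw_cong[OF mE h])
    show "bilin K H H E (\<lambda>x y. \<epsilon> y \<cdot>[E] (c \<cdot>[E] f x))" by (simp add: facts)
    fix x y assume xy: "x \<in>. H" "y \<in>. H"
    have "sw E y (\<lambda>p q. f x *[E] (g p *[E] k q)) = f x *[E] sw E y (\<lambda>p q. g p *[E] k q)"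
      by (rule sw_push[OF mE mE xy(2), symmetric]) (simp_all add: xy facts)
    also have "\<dots> = \<epsilon> y \<cdot>[E] (c \<cdot>[E] f x)"
      using xy module.smult_assoc1[OF mE, of c "\<epsilon> y" "f x"] module.smult_assoc1[OF mE, of "\<epsilon> y" c "f x"]
        cring.cring_simprules(14)[OF K_cring, of c "\<epsilon> y"]
      by (simp add: gk cl counit_closed k_algebra_smult_right[OF E] k_algebra_r_one[OF E] module_smult_closed[OF mE])
    finally show "\<epsilon> y \<cdot>[E] (c \<cdot>[E] f x) = sw E y (\<lambda>p q. f x *[E] (g p *[E] k q))" by simp
  qed
  also have "\<dots> = sw E h (\<lambda>x z. sw E x (\<lambda>p q. f p *[E] (g q *[E] k z)))"
    by (rule sw_coassoc[OF mE h, symmetric]) (simp add: facts)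
  also have "\<dots> = sw E h (\<lambda>x z. \<epsilon> x \<cdot>[E] k z)"
  proof (rule sw_cong[OF mE h])
    show "bilin K H H E (\<lambda>x z. sw E x (\<lambda>p q. f p *[E] (g q *[E] k z)))" by (simp add: facts)
    fix x z assume xz: "x \<in>. H" "z \<in>. H"
    have "sw E x (\<lambda>p q. f p *[E] (g q *[E] k z)) = sw E x (\<lambda>p q. (f p *[E] g q) *[E] k z)"
      by (rule sw_cong[OF mE xz(1)]) (simp_all add: xz facts k_algebra_assoc[OF E])
    also have "\<dots> = sw E x (\<lambda>p q. f p *[E] g q) *[E] k z"
      by (rule sw_push[OF mE mE xz(1), symmetric]) (simp_all add: xz facts)
    also have "\<dots> = \<epsilon> x \<cdot>[E] k z"
      using xz by (simp add: fg cl counit_closed k_algebra_smult_left[OF E] k_algebra_l_one[OF E])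
    finally show "sw E x (\<lambda>p q. f p *[E] (g q *[E] k z)) = \<epsilon> x \<cdot>[E] k z" .
  qed
  also have "\<dots> = k h" by (rule sw_counit_left[OF mE h k])
  finally show ?thesis by simp
qed

lemma antipode_one: "S \<one>[H] = \<one>[H]"
proof -
  have b: "bilin K H H H (\<lambda>x y. x *[H] S y)" by (simp add: lin_rules hopf_closed)
  show ?thesis
    using antipode_right[OF one_H_closed] sw_one[OF H_mod b] module.smult_one[OF H_mod one_H_closed]
    by (simp add: counit_one H_l_one antipode_closed one_H_closed)
qed

text \<open>For fixed \<open>k\<close> the map \<open>h \<mapsto> k\<^sub>1 S(h k\<^sub>2)\<close> is inverse to the identity up to the factor \<open>\<epsilon>(k)\<close>, hence equal to
  \<open>\<epsilon>(k) S(h)\<close>.  Multiplying by \<open>S(k)\<close> from the left gives the claim.\<close>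

lemma antipode_mult:
  assumes h: "h \<in>. H" and k: "k \<in>. H"
  shows "S (h *[H] k) = S k *[H] S h"
proof -
  note facts = lin_rules hopf_closed
  define J where "J k h = sw H k (\<lambda>p q. p *[H] S (h *[H] q))" for k h
  have Jlin: "lin K H H (\<lambda>h. J k h)" "lin K H H (\<lambda>k. J k h)" if "k \<in>. H" "h \<in>. H" for k h
    unfolding J_def using that by (simp_all add: facts)
  have J: "J k h = \<epsilon> k \<cdot>[H] S h" if k: "k \<in>. H" and h: "h \<in>. H" for k h
  proof (rule convolution_inverse[OF H_alg antipode_lin lin_id Jlin(1)[OF k h] counit_closed[OF k] _ _ h])
    fix h assume h: "h \<in>. H"
    show "sw H h (\<lambda>x y. S x *[H] y) = \<epsilon> h \<cdot>[H] \<one>[H]" by (rule antipode_left[OF h])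
    have "sw H h (\<lambda>x y. x *[H] J k y) = sw H h (\<lambda>x y. sw H k (\<lambda>p q. (x *[H] p) *[H] S (y *[H] q)))"
    proof (rule sw_cong[OF H_mod h])
      show "bilin K H H H (\<lambda>x y. x *[H] J k y)" unfolding J_def using k by (simp add: facts sw_closed')
      fix x y assume xy: "x \<in>. H" "y \<in>. H"
      have "x *[H] J k y = sw H k (\<lambda>p q. x *[H] (p *[H] S (y *[H] q)))"
        unfolding J_def by (rule sw_push[OF H_mod H_mod k]) (simp_all add: xy k facts)
      also have "\<dots> = sw H k (\<lambda>p q. (x *[H] p) *[H] S (y *[H] q))"
        by (rule sw_cong[OF H_mod k]) (simp_all add: xy facts H_assoc)
      finally show "x *[H] J k y = sw H k (\<lambda>p q. (x *[H] p) *[H] S (y *[H] q))" .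
    qed
    also have "\<dots> = sw H (h *[H] k) (\<lambda>x y. x *[H] S y)"
      by (rule sw_mult[OF H_mod h k, symmetric]) (simp add: facts)
    also have "\<dots> = \<epsilon> k \<cdot>[H] (\<epsilon> h \<cdot>[H] \<one>[H])"
      using h k by (simp add: antipode_right mult_H_closed counit_mult counit_closed one_H_closed
          module.smult_assoc1[OF H_mod, symmetric] cring.cring_simprules(14)[OF K_cring])
    finally show "sw H h (\<lambda>x y. x *[H] J k y) = \<epsilon> k \<cdot>[H] (\<epsilon> h \<cdot>[H] \<one>[H])" .
  qed
  have "S k *[H] S h = sw H k (\<lambda>p q. \<epsilon> q \<cdot>[H] (S p *[H] S h))"
    by (rule sw_counit_right[symmetric, OF H_mod k]) (simp add: h facts)
  also have "\<dots> = sw H k (\<lambda>p q. sw H q (\<lambda>u v. S p *[H] (u *[H] S (h *[H] v))))"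
  proof (rule sw_cong[OF H_mod k])
    show "bilin K H H H (\<lambda>p q. \<epsilon> q \<cdot>[H] (S p *[H] S h))" using h by (simp add: facts)
    fix p q assume pq: "p \<in>. H" "q \<in>. H"
    have "\<epsilon> q \<cdot>[H] (S p *[H] S h) = S p *[H] J q h"
      using pq h by (simp add: J antipode_closed counit_closed k_algebra_smult_right[OF H_alg])
    also have "\<dots> = sw H q (\<lambda>u v. S p *[H] (u *[H] S (h *[H] v)))"
      unfolding J_def by (rule sw_push[OF H_mod H_mod pq(2)]) (simp_all add: pq h facts)
    finally show "\<epsilon> q \<cdot>[H] (S p *[H] S h) = sw H q (\<lambda>u v. S p *[H] (u *[H] S (h *[H] v)))" .
  qed
  also have "\<dots> = sw H k (\<lambda>x z. sw H x (\<lambda>p u. S p *[H] (u *[H] S (h *[H] z))))"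
    by (rule sw_coassoc[symmetric, OF H_mod k]) (simp add: h facts)
  also have "\<dots> = sw H k (\<lambda>x z. \<epsilon> x \<cdot>[H] S (h *[H] z))"
  proof (rule sw_cong[OF H_mod k])
    show "bilin K H H H (\<lambda>x z. sw H x (\<lambda>p u. S p *[H] (u *[H] S (h *[H] z))))" using h by (simp add: facts)
    fix x z assume xz: "x \<in>. H" "z \<in>. H"
    have "sw H x (\<lambda>p u. S p *[H] (u *[H] S (h *[H] z))) = sw H x (\<lambda>p u. (S p *[H] u) *[H] S (h *[H] z))"
      by (rule sw_cong[OF H_mod xz(1)]) (simp_all add: xz h facts H_assoc)
    also have "\<dots> = \<epsilon> x \<cdot>[H] (\<one>[H] *[H] S (h *[H] z))"
      by (rule sw_antipode_left[OF H_mod xz(1)]) (simp_all add: xz h facts)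
    finally show "sw H x (\<lambda>p u. S p *[H] (u *[H] S (h *[H] z))) = \<epsilon> x \<cdot>[H] S (h *[H] z)"
      using xz h by (simp add: H_l_one hopf_closed)
  qed
  also have "\<dots> = S (h *[H] k)" by (rule sw_counit_left[OF H_mod k]) (simp add: h facts)
  finally show ?thesis by simp
qed

end


section \<open>Cocommutative Hopf algebras\<close>

abbreviation quadlin where
  "quadlin K H P F \<equiv>
     (\<forall>x \<in> carrier H. \<forall>y \<in> carrier H. \<forall>z \<in> carrier H. lin K H P (F x y z)) \<and>
     (\<forall>x \<in> carrier H. \<forall>y \<in> carrier H. \<forall>w \<in> carrier H. lin K H P (\<lambda>z. F x y z w)) \<and>
     (\<forall>x \<in> carrier H. \<forall>z \<in> carrier H. \<forall>w \<in> carrier H. lin K H P (\<lambda>y. F x y z w)) \<and>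
     (\<forall>y \<in> carrier H. \<forall>z \<in> carrier H. \<forall>w \<in> carrier H. lin K H P (\<lambda>x. F x y z w))"

context cocommutative_hopf_algebra
begin

lemma sw_comm:
  assumes P: "module K P" and h: "h \<in>. H" and F: "bilin K H H P F"
  shows "sw P h F = sw P h (\<lambda>x y. F y x)"
proof -
  have b: "bilin K H H HT (\<lambda>x y. kten K H H y x)" by (simp add: lin_rules hopf_closed)
  have "sw P h F = tens_lift P F (sw HT h (\<lambda>x y. kten K H H y x))"
    using cocommutative[OF h] by simp
  also have "\<dots> = sw P h (\<lambda>x y. tens_lift P F (kten K H H y x))"
    by (rule sw_push[OF HT_mod P h b kt_lift_lin[OF H_mod H_mod P F]])
  also have "\<dots> = sw P h (\<lambda>x y. F y x)" by (rule sw_cong[OF P h bilin_comp[OF b kt_lift_lin[OF H_mod H_mod P F]]])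
      (simp add: kt_lift_tens[OF H_mod H_mod P F])
  finally show ?thesis .
qed

lemma sw_swap12:
  assumes P: "module K P" and h: "h \<in>. H" and F: "trilin K H P F"
  shows "sw P h (\<lambda>x y. sw P y (\<lambda>p q. F x p q)) = sw P h (\<lambda>x y. sw P y (\<lambda>p q. F p x q))"
proof -
  have "sw P h (\<lambda>x y. sw P y (\<lambda>p q. F x p q)) = sw P h (\<lambda>x z. sw P x (\<lambda>p q. F p q z))"
    by (rule sw_coassoc[symmetric, OF P h F])
  also have "\<dots> = sw P h (\<lambda>x z. sw P x (\<lambda>p q. F q p z))"
    by (rule sw_cong[OF P h]) (use F P in \<open>auto simp: lin_rules hopf_closed intro!: sw_comm\<close>)
  also have "\<dots> = sw P h (\<lambda>x y. sw P y (\<lambda>p q. F p x q))" by (rule sw_coassoc[OF P h]) (simp add: F)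
  finally show ?thesis .
qed

lemma sw_swap23:
  assumes P: "module K P" and h: "h \<in>. H" and F: "trilin K H P F"
  shows "sw P h (\<lambda>x y. sw P y (\<lambda>p q. F x p q)) = sw P h (\<lambda>x y. sw P y (\<lambda>p q. F x q p))"
  by (rule sw_cong[OF P h]) (use F P in \<open>auto simp: lin_rules hopf_closed intro!: sw_comm\<close>)

text \<open>Reassociating makes the two inner factors neighbours, which may be exchanged.  This is what allows to
  separate two families of operators that are multiplied along the comultiplication.\<close>

lemma sw_middle_swap:
  assumes P: "module K P" and h: "h \<in>. H" and F: "quadlin K H P F"
  shows "sw P h (\<lambda>x y. sw P x (\<lambda>a b. sw P y (\<lambda>p q. F a b p q))) =
    sw P h (\<lambda>x y. sw P x (\<lambda>a b. sw P y (\<lambda>p q. F a p b q)))"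
proof -
  note facts = lin_rules hopf_closed P
  have "sw P h (\<lambda>x y. sw P x (\<lambda>a b. sw P y (\<lambda>p q. F a b p q))) =
      sw P h (\<lambda>a y. sw P y (\<lambda>b z. sw P z (\<lambda>p q. F a b p q)))"
    by (rule sw_coassoc[OF P h]) (simp add: F facts)
  also have "\<dots> = sw P h (\<lambda>a y. sw P y (\<lambda>b z. sw P z (\<lambda>p q. F a p b q)))"
    by (rule sw_cong[OF P h]) (use F in \<open>auto simp: facts intro!: sw_swap12[OF P]\<close>)
  also have "\<dots> = sw P h (\<lambda>x y. sw P x (\<lambda>a b. sw P y (\<lambda>p q. F a p b q)))"
    by (rule sw_coassoc[OF P h, symmetric]) (simp add: F facts)
  finally show ?thesis .
qed

text \<open>\<open>S \<circ> S\<close> is a convolution inverse of \<open>S\<close>, like the identity; cocommutativity turns \<open>S(S h\<^sub>1) S(h\<^sub>2)\<close> into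
  \<open>S(h\<^sub>1 S(h\<^sub>2))\<close>.\<close>

lemma antipode_involutive:
  assumes h: "h \<in>. H" shows "S (S h) = h"
proof -
  have "h = \<one>[K] \<cdot>[H] S (S h)"
  proof (rule convolution_inverse[OF H_alg _ antipode_lin lin_id _ _ _ h])
    fix h assume h: "h \<in>. H"
    have "sw H h (\<lambda>x y. S (S x) *[H] S y) = sw H h (\<lambda>x y. S (S y) *[H] S x)"
      by (rule sw_comm[OF H_mod h]) (simp add: lin_rules hopf_closed)
    also have "\<dots> = sw H h (\<lambda>x y. S (x *[H] S y))"
      by (rule sw_cong[OF H_mod h]) (simp_all add: lin_rules hopf_closed antipode_mult)
    also have "\<dots> = \<epsilon> h \<cdot>[H] \<one>[H]"
      using sw_antipode_right[OF H_mod h antipode_lin] by (simp add: antipode_one)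
    finally show "sw H h (\<lambda>x y. S (S x) *[H] S y) = \<epsilon> h \<cdot>[H] \<one>[H]" .
    show "sw H h (\<lambda>x y. S x *[H] y) = \<one>[K] \<cdot>[H] (\<epsilon> h \<cdot>[H] \<one>[H])"
      using h by (simp add: antipode_left module.smult_one[OF H_mod] hopf_closed)
  qed (simp_all add: K_cring lin_antipode antipode_lin cring.cring_simprules(6))
  then show ?thesis using module.smult_one[OF H_mod] h antipode_closed by simp
qed

text \<open>Both \<open>\<Delta> \<circ> S\<close> and \<open>h \<mapsto> S h\<^sub>1 \<otimes> S h\<^sub>2\<close> are convolution inverses of \<open>\<Delta>\<close>.\<close>

lemma comult_antipode:
  assumes h: "h \<in>. H"
  shows "\<Delta> (S h) = sw HT h (\<lambda>x y. kten K H H (S x) (S y))"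
proof -
  let ?E = "alg_tensor K H H"
  note E = alg_tensor_k_algebra[OF H_alg H_alg]
  note mE = k_algebra_module[OF E]
  note facts = lin_rules hopf_closed E mE
  have ch: "lin K M HT f \<Longrightarrow> lin K M ?E f" for M :: "('a, 'm, 'w) module_scheme" and f
    by (rule lin_fields[where N = HT]) simp_all
  have ch': "lin K ?E HT (\<lambda>x. x)" by (rule lin_fields[OF lin_id[of K HT]]) simp_all
  have swE: "sw ?E h F = sw HT h F" if "h \<in>. H" "bilin K H H ?E F" for h F by (rule sw_push[OF mE HT_mod that ch'])
  have kl: "lin K H HT (\<lambda>h. sw HT h (\<lambda>x y. kten K H H (S x) (S y)))" by (simp add: facts)
  have kt: "lin K L H f \<Longrightarrow> y \<in>. H \<Longrightarrow> lin K L ?E (\<lambda>l. kten K H H (f l) y)"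
       "lin K L H f \<Longrightarrow> y \<in>. H \<Longrightarrow> lin K L ?E (\<lambda>l. kten K H H y (f l))" for L :: "('a, 'l, 'w) module_scheme" and f y
    by (rule ch, simp add: facts)+
  have dl: "lin K L H f \<Longrightarrow> lin K L ?E (\<lambda>l. \<Delta> (f l))" for L :: "('a, 'l, 'w) module_scheme" and f
    by (rule ch[OF lin_comult])
  note facts = facts kt dl
  have "sw HT h (\<lambda>x y. kten K H H (S x) (S y)) = \<one>[K] \<cdot>[?E] \<Delta> (S h)"
  proof (rule convolution_inverse[OF E ch[OF lin_comp[OF comult_lin antipode_lin]] ch[OF comult_lin] ch[OF kl] _ _ _ h])
    fix h assume h: "h \<in>. H"
    have "sw ?E h (\<lambda>x y. \<Delta> (S x) *[?E] \<Delta> y) = sw ?E h (\<lambda>x y. \<Delta> (S x *[H] y))"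
      by (rule sw_cong[OF mE h]) (simp_all add: facts comult_mult)
    also have "\<dots> = \<epsilon> h \<cdot>[?E] \<one>[?E]"
      using sw_antipode_left[OF mE h ch[OF comult_lin]] by (simp add: comult_one)
    finally show "sw ?E h (\<lambda>x y. \<Delta> (S x) *[?E] \<Delta> y) = \<epsilon> h \<cdot>[?E] \<one>[?E]" .
    let ?F = "\<lambda>a b p q. kten K H H (a *[H] S p) (b *[H] S q)"
    have Dk: "\<Delta> x *[?E] sw HT y (\<lambda>x y. kten K H H (S x) (S y)) =
       sw ?E x (\<lambda>a b. sw ?E y (\<lambda>p q. ?F a b p q))" if xy: "x \<in>. H" "y \<in>. H" for x y
    proof -
      have "\<Delta> x = sw HT x (\<lambda>a b. kten K H H a b)"
        by (rule kt_eq[OF H_mod H_mod comult_closed[OF xy(1)] lin_id kt_lift_lin[OF H_mod H_mod HT_mod kt_bilin[OF H_mod H_mod]]])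
          (simp add: kt_lift_tens[OF H_mod H_mod HT_mod kt_bilin[OF H_mod H_mod]])
      have cl: "sw ?E y (\<lambda>x y. kten K H H (S x) (S y)) \<in>. HT"
        using sw_closed'[OF mE xy(2), of "\<lambda>x y. kten K H H (S x) (S y)"] by (simp add: facts)
      note facts = facts cl
      note \<open>\<Delta> x = _\<close>
      then have "\<Delta> x *[?E] sw HT y (\<lambda>x y. kten K H H (S x) (S y)) =
         sw ?E x (\<lambda>a b. kten K H H a b) *[?E] sw ?E y (\<lambda>x y. kten K H H (S x) (S y))"
        using swE xy by (simp add: facts)
      also have "\<dots> = sw ?E x (\<lambda>a b. kten K H H a b *[?E] sw ?E y (\<lambda>x y. kten K H H (S x) (S y)))"
        by (rule sw_push[OF mE mE xy(1)]) (simp_all add: xy facts)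
      also have "\<dots> = sw ?E x (\<lambda>a b. sw ?E y (\<lambda>p q. ?F a b p q))"
      proof (rule sw_cong[OF mE xy(1)])
        show "bilin K H H ?E (\<lambda>a b. kten K H H a b *[?E] sw ?E y (\<lambda>x y. kten K H H (S x) (S y)))"
          using xy by (simp add: facts)
        fix a b assume ab: "a \<in>. H" "b \<in>. H"
        have "kten K H H a b *[?E] sw ?E y (\<lambda>x y. kten K H H (S x) (S y)) =
          sw ?E y (\<lambda>p q. kten K H H a b *[?E] kten K H H (S p) (S q))"
          by (rule sw_push[OF mE mE xy(2)]) (simp_all add: ab facts)
        also have "\<dots> = sw ?E y (\<lambda>p q. ?F a b p q)"
          by (rule sw_cong[OF mE xy(2)]) (simp_all add: ab facts alg_tensor_tens_mult[OF H_alg H_alg])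
        finally show "kten K H H a b *[?E] sw ?E y (\<lambda>x y. kten K H H (S x) (S y)) =
          sw ?E y (\<lambda>p q. ?F a b p q)" .
      qed
      finally show ?thesis .
    qed
    have "sw ?E h (\<lambda>x y. \<Delta> x *[?E] sw HT y (\<lambda>x y. kten K H H (S x) (S y))) =
       sw ?E h (\<lambda>x y. sw ?E x (\<lambda>a b. sw ?E y (\<lambda>p q. ?F a b p q)))"
      by (rule sw_cong[OF mE h]) (simp_all add: ch[OF comult_lin] ch[OF kl] lin_closed[OF kl] Dk facts)
    also have "\<dots> = sw ?E h (\<lambda>x y. sw ?E x (\<lambda>a b. sw ?E y (\<lambda>p q. ?F a p b q)))"
      by (rule sw_middle_swap[OF mE h]) (simp add: facts)
    also have "\<dots> = sw ?E h (\<lambda>x y. \<epsilon> x \<cdot>[?E] (\<epsilon> y \<cdot>[?E] \<one>[?E]))"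
    proof (rule sw_cong[OF mE h])
      show "bilin K H H ?E (\<lambda>x y. sw ?E x (\<lambda>a b. sw ?E y (\<lambda>p q. ?F a p b q)))" by (simp add: facts)
      fix x y assume xy: "x \<in>. H" "y \<in>. H"
      have "sw ?E x (\<lambda>a b. sw ?E y (\<lambda>p q. ?F a p b q)) =
         sw ?E x (\<lambda>a b. \<epsilon> y \<cdot>[?E] kten K H H (a *[H] S b) \<one>[H])"
      proof (rule sw_cong[OF mE xy(1)])
        show "bilin K H H ?E (\<lambda>a b. sw ?E y (\<lambda>p q. ?F a p b q))" using xy by (simp add: facts)
        show "sw ?E y (\<lambda>p q. ?F a p b q) = \<epsilon> y \<cdot>[?E] kten K H H (a *[H] S b) \<one>[H]"
          if "a \<in>. H" "b \<in>. H" for a b by (rule sw_antipode_right[OF mE xy(2)]) (simp add: that facts)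
      qed
      also have "\<dots> = \<epsilon> x \<cdot>[?E] (\<epsilon> y \<cdot>[?E] \<one>[?E])"
        using sw_antipode_right[OF mE xy(1), of "\<lambda>z. \<epsilon> y \<cdot>[?E] kten K H H z \<one>[H]"] xy facts
          lin_smult_right[OF mE kt(1)[OF lin_id one_H_closed] counit_closed[OF xy(2)]] by simp
      finally show "sw ?E x (\<lambda>a b. sw ?E y (\<lambda>p q. ?F a p b q)) = \<epsilon> x \<cdot>[?E] (\<epsilon> y \<cdot>[?E] \<one>[?E])" .
    qed
    also have "\<dots> = \<epsilon> h \<cdot>[?E] \<one>[?E]"
      by (rule sw_counit_left[OF mE h]) (simp add: k_algebra_one_closed[OF E] facts del: alg_tensor_simps)
    finally show "sw ?E h (\<lambda>x y. \<Delta> x *[?E] sw HT y (\<lambda>x y. kten K H H (S x) (S y)))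
      = \<one>[K] \<cdot>[?E] (\<epsilon> h \<cdot>[?E] \<one>[?E])"
      using module.smult_one[OF mE] k_algebra_one_closed[OF E] h counit_closed module_smult_closed[OF mE] by simp
  qed (simp add: K_cring cring.cring_simprules(6))
  then show ?thesis using module.smult_one[OF mE] comult_closed antipode_closed h by simp
qed

lemma sw_antipode:
  assumes P: "module K P" and h: "h \<in>. H" and F: "bilin K H H P F"
  shows "sw P (S h) F = sw P h (\<lambda>x y. F (S x) (S y))"
proof -
  have b: "bilin K H H HT (\<lambda>x y. kten K H H (S x) (S y))" by (simp add: lin_rules hopf_closed)
  have "sw P (S h) F = sw P h (\<lambda>x y. tens_lift P F (kten K H H (S x) (S y)))"
    unfolding comult_antipode[OF h] by (rule sw_push[OF HT_mod P h b kt_lift_lin[OF H_mod H_mod P F]])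
  also have "\<dots> = sw P h (\<lambda>x y. F (S x) (S y))"
    by (rule sw_cong[OF P h bilin_comp[OF b kt_lift_lin[OF H_mod H_mod P F]]])
      (simp add: kt_lift_tens[OF H_mod H_mod P F] antipode_closed)
  finally show ?thesis .
qed

text \<open>The antipode is an involution compatible with the comultiplication, so that it may be moved to the other
  factor if \<open>h\<close> is replaced by \<open>S h\<close>.\<close>

lemma sw_antipode_move:
  assumes P: "module K P" and h: "h \<in>. H" and F: "bilin K H H P F"
  shows "sw P h (\<lambda>x y. F (S x) y) = sw P (S h) (\<lambda>x y. F x (S y))"
proof -
  note l = bilin_left[OF F] bilin_right[OF F]
  have Fl: "lin K H P (\<lambda>x. F (f x) y)" "lin K H P (\<lambda>y. F x (f y))" if "lin K H H f" "x \<in>. H" "y \<in>. H" for f x y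
    using lin_comp[OF l(1) that(1)] lin_comp[OF l(2) that(1)] that by blast+
  have "sw P (S h) (\<lambda>x y. F x (S y)) = sw P h (\<lambda>x y. F (S x) (S (S y)))"
    by (rule sw_antipode[OF P h]) (simp add: Fl lin_rules hopf_closed)
  also have "\<dots> = sw P h (\<lambda>x y. F (S x) y)"
    by (rule sw_cong[symmetric, OF P h]) (simp_all add: Fl l lin_rules hopf_closed antipode_involutive)
  finally show ?thesis by simp
qed

end


section \<open>Symmetric partial actions of cocommutative Hopf algebras\<close>

locale partial_smash = cocommutative_hopf_algebra K H + symmetric_partial_action K H A act
  for K :: "'k ring" (structure) and H :: "('k, 'h) hopf" and A :: "('k, 'a) module"
    and act :: "'h \<Rightarrow> 'a \<Rightarrow> 'a"
begin

lemma A_alg: "k_algebra K A" by (rule A.k_algebra_axioms)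

lemmas A_assoc = k_algebra_assoc[OF A_alg] and A_l_one = k_algebra_l_one[OF A_alg] and A_r_one = k_algebra_r_one[OF A_alg]

lemma A_mod: "module K A" by (rule k_algebra_module[OF A_alg])

lemma act_closed: "h \<in>. H \<Longrightarrow> a \<in>. A \<Longrightarrow> act h a \<in>. A"
  using act_linear_left lin_closed by (fastforce simp: mod_hom_iff_lin)

lemma lin_act_left: "lin K L H f \<Longrightarrow> a \<in>. A \<Longrightarrow> lin K L A (\<lambda>x. act (f x) a)"
  by (rule lin_comp[OF act_linear_left[unfolded mod_hom_iff_lin]])

lemma lin_act_right: "lin K L A f \<Longrightarrow> h \<in>. H \<Longrightarrow> lin K L A (\<lambda>x. act h (f x))"
  by (rule lin_comp[OF act_linear_right[unfolded mod_hom_iff_lin]])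

lemma lin_mult_A:
  "lin K L A f \<Longrightarrow> a \<in>. A \<Longrightarrow> lin K L A (\<lambda>x. f x *[A] a)"
  "lin K L A f \<Longrightarrow> a \<in>. A \<Longrightarrow> lin K L A (\<lambda>x. a *[A] f x)"
  by (rule lin_mult_left[OF A_alg] lin_mult_right[OF A_alg]; assumption)+

lemma mult_A_closed: "x \<in>. A \<Longrightarrow> y \<in>. A \<Longrightarrow> x *[A] y \<in>. A"
  by (rule k_algebra_mult_closed[OF A_alg])

lemma one_A_closed: "\<one>[A] \<in>. A" by (rule k_algebra_one_closed[OF A_alg])

abbreviation "TT \<equiv> kt K A H"

lemma TT_mod: "module K TT" by (rule kt_module[OF A_mod H_mod])

lemmas act_rules = lin_rules hopf_closed lin_act_left lin_act_right lin_mult_A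
  A_alg A_mod TT_mod act_closed mult_A_closed one_A_closed

lemma act_absorb_left:
  "h \<in>. H \<Longrightarrow> a \<in>. A \<Longrightarrow> sw A h (\<lambda>x y. act x \<one>[A] *[A] act y a) = act h a"
  using act_mult[of h "\<one>[A]" a] by (simp add: one_A_closed A_l_one)

lemma act_absorb_right:
  "h \<in>. H \<Longrightarrow> a \<in>. A \<Longrightarrow> sw A h (\<lambda>x y. act x a *[A] act y \<one>[A]) = act h a"
  using act_mult[of h a "\<one>[A]"] by (simp add: one_A_closed A_r_one)

text \<open>The axiom for \<open>h\<^sub>1 \<cdot> (S h\<^sub>2 \<cdot> a)\<close> leaves \<open>h\<^sub>2 S(h\<^sub>3)\<close>, which cancels.  The symmetric form of the axiom
  puts the unit on the other side; comparing the two shows that the elements \<open>h \<cdot> 1\<close> are central.\<close>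

lemma act_act_antipode:
  assumes h: "h \<in>. H" and a: "a \<in>. A"
  shows "sw A h (\<lambda>x y. act x (act (S y) a)) = act h \<one>[A] *[A] a"
proof -
  have "sw A h (\<lambda>x y. act x (act (S y) a)) =
      sw A h (\<lambda>x z. sw A x (\<lambda>x y. act x \<one>[A] *[A] act (y *[H] S z) a))"
    by (rule sw_cong[OF A_mod h]) (simp_all add: a act_rules act_act)
  also have "\<dots> = sw A h (\<lambda>x y. sw A y (\<lambda>p q. act x \<one>[A] *[A] act (p *[H] S q) a))"
    by (rule sw_coassoc[OF A_mod h]) (simp add: a act_rules)
  also have "\<dots> = act h \<one>[A] *[A] act \<one>[H] a" by (rule sw_collapse_right[OF A_mod h]) (simp add: a act_rules)
  finally show ?thesis using a by (simp add: act_one)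
qed

lemma act_act_antipode_sym:
  assumes h: "h \<in>. H" and a: "a \<in>. A"
  shows "sw A h (\<lambda>x y. act x (act (S y) a)) = a *[A] act h \<one>[A]"
proof -
  have "sw A h (\<lambda>x y. act x (act (S y) a)) =
      sw A h (\<lambda>x z. sw A x (\<lambda>x y. act (x *[H] S z) a *[A] act y \<one>[A]))"
    by (rule sw_cong[OF A_mod h]) (simp_all add: a act_rules act_act_sym)
  also have "\<dots> = sw A h (\<lambda>x y. sw A y (\<lambda>p q. act (x *[H] S q) a *[A] act p \<one>[A]))"
    by (rule sw_coassoc[OF A_mod h]) (simp add: a act_rules)
  also have "\<dots> = sw A h (\<lambda>x y. sw A y (\<lambda>p q. act (p *[H] S q) a *[A] act x \<one>[A]))"
    by (rule sw_swap12[OF A_mod h]) (simp add: a act_rules)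
  also have "\<dots> = act \<one>[H] a *[A] act h \<one>[A]" by (rule sw_collapse_right[OF A_mod h]) (simp add: a act_rules)
  finally show ?thesis using a by (simp add: act_one)
qed

lemma act_unit_central:
  "h \<in>. H \<Longrightarrow> a \<in>. A \<Longrightarrow> act h \<one>[A] *[A] a = a *[A] act h \<one>[A]"
  using act_act_antipode act_act_antipode_sym by metis

lemma act_antipode_act:
  assumes h: "h \<in>. H" and a: "a \<in>. A"
  shows "sw A h (\<lambda>x y. act (S x) (act y a)) = act (S h) \<one>[A] *[A] a"
proof -
  have "act (S h) \<one>[A] *[A] a = sw A (S h) (\<lambda>x y. act x (act (S y) a))"
    using act_act_antipode a antipode_closed[OF h] by simp
  also have "\<dots> = sw A h (\<lambda>x y. act (S x) (act (S (S y)) a))"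
    by (rule sw_antipode[OF A_mod h]) (simp add: a act_rules)
  also have "\<dots> = sw A h (\<lambda>x y. act (S x) (act y a))"
    by (rule sw_cong[OF A_mod h]) (simp_all add: a act_rules antipode_involutive)
  finally show ?thesis by simp
qed

lemma act_mult_act:
  assumes h: "h \<in>. H" and k: "k \<in>. H" and b: "b \<in>. A" and c: "c \<in>. A"
  shows "act h (b *[A] act k c) = sw A h (\<lambda>x y. act x b *[A] act (y *[H] k) c)"
proof -
  note hyps = k b c
  have "act h (b *[A] act k c) = sw A h (\<lambda>x y. act x b *[A] act y (act k c))"
    using h hyps by (simp add: act_mult act_closed)
  also have "\<dots> = sw A h (\<lambda>x y. sw A y (\<lambda>p q. act x b *[A] (act p \<one>[A] *[A] act (q *[H] k) c)))"
  proof (rule sw_cong[OF A_mod h])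
    show "bilin K H H A (\<lambda>x y. act x b *[A] act y (act k c))" using hyps by (simp add: act_rules)
    fix x y assume xy: "x \<in>. H" "y \<in>. H"
    show "act x b *[A] act y (act k c) = sw A y (\<lambda>p q. act x b *[A] (act p \<one>[A] *[A] act (q *[H] k) c))"
      unfolding act_act[OF xy(2) k c] by (rule sw_push[OF A_mod A_mod xy(2)]) (simp_all add: xy hyps act_rules)
  qed
  also have "\<dots> = sw A h (\<lambda>x z. sw A x (\<lambda>p q. act p b *[A] (act q \<one>[A] *[A] act (z *[H] k) c)))"
    by (rule sw_coassoc[symmetric, OF A_mod h]) (simp add: hyps act_rules)
  also have "\<dots> = sw A h (\<lambda>x y. act x b *[A] act (y *[H] k) c)"
  proof (rule sw_cong[OF A_mod h])
    show "bilin K H H A (\<lambda>x z. sw A x (\<lambda>p q. act p b *[A] (act q \<one>[A] *[A] act (z *[H] k) c)))"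
      using hyps by (simp add: act_rules)
    fix x z assume xz: "x \<in>. H" "z \<in>. H"
    have "act x b *[A] act (z *[H] k) c = sw A x (\<lambda>p q. (act p b *[A] act q \<one>[A]) *[A] act (z *[H] k) c)"
      unfolding act_absorb_right[OF xz(1) b, symmetric]
      by (rule sw_push[OF A_mod A_mod xz(1)]) (simp_all add: xz hyps act_rules)
    also have "\<dots> = sw A x (\<lambda>p q. act p b *[A] (act q \<one>[A] *[A] act (z *[H] k) c))"
      by (rule sw_cong[OF A_mod xz(1)]) (simp_all add: xz hyps act_rules A_assoc)
    finally show "sw A x (\<lambda>p q. act p b *[A] (act q \<one>[A] *[A] act (z *[H] k) c)) =
       act x b *[A] act (z *[H] k) c" by simp
  qed
  finally show ?thesis .
qed


section \<open>The partial smash product\<close>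

abbreviation "R \<equiv> smash K H A act"
abbreviation "sm \<equiv> smash_elem K H A act"
abbreviation "mulT \<equiv> smash_mult K H A act"
abbreviation "ten \<equiv> kten K A H"

lemma smash_simps [simp]:
  "carrier R = (\<lambda>t. mulT t (ten \<one>[A] \<one>[H])) ` carrier TT"
  "add R = add TT" "zero R = zero TT" "smult R = smult TT" "mult R = mulT" "one R = ten \<one>[A] \<one>[H]"
  by (simp_all add: smash_def Let_def)

lemma mulT_inner_bilin:
  assumes "a \<in>. A" "h \<in>. H"
  shows "bilin K A H TT (\<lambda>b k. sw TT h (\<lambda>x y. ten (a *[A] act x b) (y *[H] k)))"
    "bilin K A H TT (\<lambda>b k. sw TT k (\<lambda>x y. ten (b *[A] act x a) (y *[H] h)))"
  using assms by (simp_all add: act_rules)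

lemma mulT_outer_bilin:
  assumes "t \<in>. TT"
  shows "bilin K A H TT (\<lambda>a h. tens_lift TT (\<lambda>b k. sw TT h (\<lambda>x y. ten (a *[A] act x b) (y *[H] k))) t)"
  by (intro bilinI kt_lift_param_lin[OF A_mod H_mod TT_mod] A_mod H_mod assms mulT_inner_bilin) (simp_all add: act_rules)

lemma mulT_lin_left: "t \<in>. TT \<Longrightarrow> lin K TT TT (\<lambda>s. mulT s t)"
  unfolding smash_mult_def Let_def by (rule kt_lift_lin[OF A_mod H_mod TT_mod mulT_outer_bilin])

lemma mulT_lin_right: "s \<in>. TT \<Longrightarrow> lin K TT TT (\<lambda>t. mulT s t)"
  unfolding smash_mult_def Let_def by (rule kt_lift_param_lin[OF A_mod H_mod TT_mod TT_mod])
    (auto intro!: mulT_outer_bilin kt_lift_lin[OF A_mod H_mod TT_mod] mulT_inner_bilin)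

lemma mulT_closed: "s \<in>. TT \<Longrightarrow> t \<in>. TT \<Longrightarrow> mulT s t \<in>. TT"
  using lin_closed[OF mulT_lin_left] .

lemma lin_mulT:
  "lin K L TT f \<Longrightarrow> t \<in>. TT \<Longrightarrow> lin K L TT (\<lambda>x. mulT (f x) t)"
  "lin K L TT f \<Longrightarrow> t \<in>. TT \<Longrightarrow> lin K L TT (\<lambda>x. mulT t (f x))"
  by (rule lin_comp[OF mulT_lin_left] lin_comp[OF mulT_lin_right]; assumption)+

lemma mulT_tens:
  assumes "a \<in>. A" "h \<in>. H" "b \<in>. A" "k \<in>. H"
  shows "mulT (ten a h) (ten b k) = sw TT h (\<lambda>x y. ten (a *[A] act x b) (y *[H] k))"
  unfolding smash_mult_def Let_def
  using assms by (simp add: kt_lift_tens[OF A_mod H_mod TT_mod] mulT_outer_bilin[simplified] mulT_inner_bilin[simplified]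
      kt_tens_closed[OF A_mod H_mod])

lemmas tensor_rules = act_rules mulT_closed lin_mulT

text \<open>Both products are equal to \<open>a (h\<^sub>1 \<cdot> b) (h\<^sub>2 k\<^sub>1 \<cdot> c) \<otimes> h\<^sub>3 k\<^sub>2 l\<close>; for the second one the action of \<open>h\<close> on a
  product that contains \<open>k \<cdot> c\<close> is computed in \<open>act_mult_act\<close>.\<close>

lemma mulT_assoc_tens:
  assumes abc: "a \<in>. A" "b \<in>. A" "c \<in>. A" and hkl: "h \<in>. H" "k \<in>. H" "l \<in>. H"
  shows "mulT (mulT (ten a h) (ten b k)) (ten c l) = mulT (ten a h) (mulT (ten b k) (ten c l))"
proof -
  note as = abc hkl
  let ?F = "\<lambda>p q y r s. ten (a *[A] (act p b *[A] act (q *[H] r) c)) ((y *[H] s) *[H] l)"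
  have "mulT (mulT (ten a h) (ten b k)) (ten c l) =
      sw TT h (\<lambda>x y. mulT (ten (a *[A] act x b) (y *[H] k)) (ten c l))"
    unfolding mulT_tens[OF as(1,4,2,5)] by (rule sw_push[OF TT_mod TT_mod hkl(1)]) (simp_all add: as tensor_rules)
  also have "\<dots> = sw TT h (\<lambda>x y. sw TT y (\<lambda>p q. sw TT k (\<lambda>r s. ?F x p q r s)))"
  proof (rule sw_cong[OF TT_mod hkl(1)])
    show "bilin K H H TT (\<lambda>x y. mulT (ten (a *[A] act x b) (y *[H] k)) (ten c l))" using as by (simp add: tensor_rules)
    fix x y assume xy: "x \<in>. H" "y \<in>. H"
    have "mulT (ten (a *[A] act x b) (y *[H] k)) (ten c l) =
        sw TT (y *[H] k) (\<lambda>p q. ten ((a *[A] act x b) *[A] act p c) (q *[H] l))"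
      by (rule mulT_tens) (simp_all add: as xy tensor_rules)
    also have "\<dots> = sw TT (y *[H] k) (\<lambda>p q. ten (a *[A] (act x b *[A] act p c)) (q *[H] l))"
      by (rule sw_cong[OF TT_mod]) (simp_all add: as xy tensor_rules A_assoc)
    also have "\<dots> = sw TT y (\<lambda>p q. sw TT k (\<lambda>r s. ?F x p q r s))"
      by (rule sw_mult[OF TT_mod xy(2) hkl(2)]) (simp_all add: as xy tensor_rules)
    finally show "mulT (ten (a *[A] act x b) (y *[H] k)) (ten c l) =
      sw TT y (\<lambda>p q. sw TT k (\<lambda>r s. ?F x p q r s))" .
  qed
  also have "\<dots> = sw TT h (\<lambda>x y. sw TT x (\<lambda>p q. sw TT k (\<lambda>r s. ?F p q y r s)))"
    by (rule sw_coassoc[symmetric, OF TT_mod hkl(1)]) (simp add: as tensor_rules)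
  also have "\<dots> = sw TT h (\<lambda>x y. sw TT k (\<lambda>r s. sw TT x (\<lambda>p q. ?F p q y r s)))"
  proof (rule sw_cong[OF TT_mod hkl(1)])
    show "bilin K H H TT (\<lambda>x y. sw TT x (\<lambda>p q. sw TT k (\<lambda>r s. ?F p q y r s)))" using as by (simp add: tensor_rules)
    show "sw TT x (\<lambda>p q. sw TT k (\<lambda>r s. ?F p q y r s)) = sw TT k (\<lambda>r s. sw TT x (\<lambda>p q. ?F p q y r s))"
      if "x \<in>. H" "y \<in>. H" for x y by (rule sw_swap[OF TT_mod]) (simp_all add: as that tensor_rules)
  qed
  also have "\<dots> = sw TT k (\<lambda>r s. sw TT h (\<lambda>x y. sw TT x (\<lambda>p q. ?F p q y r s)))"
    by (rule sw_swap[OF TT_mod]) (simp_all add: as tensor_rules)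
  also have "\<dots> = sw TT k (\<lambda>r s. mulT (ten a h) (ten (b *[A] act r c) (s *[H] l)))"
  proof (rule sw_cong[OF TT_mod hkl(2)])
    show "bilin K H H TT (\<lambda>r s. sw TT h (\<lambda>x y. sw TT x (\<lambda>p q. ?F p q y r s)))" using as by (simp add: tensor_rules)
    fix r s assume rs: "r \<in>. H" "s \<in>. H"
    have "mulT (ten a h) (ten (b *[A] act r c) (s *[H] l)) =
      sw TT h (\<lambda>x y. ten (a *[A] act x (b *[A] act r c)) (y *[H] (s *[H] l)))"
      by (rule mulT_tens) (simp_all add: as rs tensor_rules)
    also have "\<dots> = sw TT h (\<lambda>x y. sw TT x (\<lambda>p q. ?F p q y r s))"
    proof (rule sw_cong[OF TT_mod hkl(1)])
      show "bilin K H H TT (\<lambda>x y. ten (a *[A] act x (b *[A] act r c)) (y *[H] (s *[H] l)))" using as rs by (simp add: tensor_rules)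
      fix x y assume xy: "x \<in>. H" "y \<in>. H"
      show "ten (a *[A] act x (b *[A] act r c)) (y *[H] (s *[H] l)) = sw TT x (\<lambda>p q. ?F p q y r s)"
        unfolding act_mult_act[OF xy(1) rs(1) abc(2,3)] k_algebra_assoc[OF H_alg xy(2) rs(2) hkl(3)]
        by (rule sw_push[OF A_mod TT_mod xy(1)]) (simp_all add: as rs xy tensor_rules)
    qed
    finally show "sw TT h (\<lambda>x y. sw TT x (\<lambda>p q. ?F p q y r s)) = mulT (ten a h) (ten (b *[A] act r c) (s *[H] l))"
      by simp
  qed
  also have "\<dots> = mulT (ten a h) (mulT (ten b k) (ten c l))"
    unfolding mulT_tens[OF as(2,5,3,6)] by (rule sw_push[OF TT_mod TT_mod hkl(2), symmetric]) (simp_all add: as tensor_rules)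
  finally show ?thesis .
qed

lemma mulT_assoc:
  assumes "s \<in>. TT" "t \<in>. TT" "u \<in>. TT"
  shows "mulT (mulT s t) u = mulT s (mulT t u)"
proof -
  note AH = A_mod H_mod
  note cl = kt_tens_closed[OF AH] mulT_closed
  have 1: "mulT (mulT (ten a h) (ten b k)) u = mulT (ten a h) (mulT (ten b k) u)"
    if "a \<in>. A" "b \<in>. A" "h \<in>. H" "k \<in>. H" for a b h k
    by (rule kt_eq[OF AH assms(3), where P = TT]) (simp_all add: that tensor_rules mulT_assoc_tens)
  have 2: "mulT (mulT (ten a h) t) u = mulT (ten a h) (mulT t u)"
    if "a \<in>. A" "h \<in>. H" for a h by (rule kt_eq[OF AH assms(2), where P = TT]) (simp_all add: that assms tensor_rules 1)
  show ?thesis by (rule kt_eq[OF AH assms(1), where P = TT]) (simp_all add: assms tensor_rules 2)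
qed

abbreviation "unit \<equiv> ten \<one>[A] \<one>[H]"

lemma unit_closed: "unit \<in>. TT" by (simp add: tensor_rules)

lemma mulT_unit_left:
  assumes "t \<in>. TT" shows "mulT unit t = t"
proof (rule kt_eq[OF A_mod H_mod assms mulT_lin_right[OF unit_closed] lin_id])
  fix b k assume bk: "b \<in>. A" "k \<in>. H"
  have "mulT unit (ten b k) = ten (\<one>[A] *[A] act \<one>[H] b) (\<one>[H] *[H] k)"
    unfolding mulT_tens[OF one_A_closed one_H_closed bk] by (rule sw_one[OF TT_mod]) (simp add: bk tensor_rules)
  then show "mulT unit (ten b k) = ten b k"
    using bk by (simp add: act_one A_l_one H_l_one)
qed

text \<open>Right multiplication by \<open>1 \<otimes> 1\<close> is idempotent, and its image is its set of fixed points.  In this form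
  closure under the operations is immediate.\<close>

lemma smash_carrier: "t \<in>. R \<longleftrightarrow> t \<in>. TT \<and> mulT t unit = t"
proof
  assume "t \<in>. R"
  then obtain s where s: "s \<in>. TT" "t = mulT s unit" by auto
  then show "t \<in>. TT \<and> mulT t unit = t"
    using mulT_assoc[OF s(1) unit_closed unit_closed] by (simp add: mulT_closed unit_closed mulT_unit_left)
qed (metis image_eqI smash_simps(1))

lemma smash_mod: "module K R"
proof -
  interpret T: module K TT by (rule TT_mod)
  note r = mulT_lin_left[OF unit_closed]
  have add: "s +[TT] t \<in>. R" if "s \<in>. R" "t \<in>. R" for s t
    using that lin_add[OF r] by (simp add: smash_carrier del: smash_simps)
  have sm: "c \<cdot>[TT] t \<in>. R" if "c \<in>. K" "t \<in>. R" for c t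
    using that lin_smult[OF r] by (simp add: smash_carrier del: smash_simps)
  have z: "\<zero>[TT] \<in>. R"
    using additive_zero[OF lin_additive[OF r]] T.abelian_group_axioms by (simp add: smash_carrier del: smash_simps)
  have neg: "\<ominus>\<^bsub>TT\<^esub> t \<in>. R" if "t \<in>. R" for t
    using additive_minus[OF lin_additive[OF r]] T.abelian_group_axioms that by (simp add: smash_carrier del: smash_simps)
  have sub: "t \<in>. TT" if "t \<in>. R" for t
    using that by (simp add: smash_carrier del: smash_simps)
  have "abelian_group R"
  proof (rule abelian_groupI)
    fix x y assume x: "x \<in>. R"
    show "\<exists>y \<in> carrier R. y +[R] x = \<zero>[R]"
      using neg[OF x] T.M.l_neg[OF sub[OF x]] by (metis smash_simps(2,3))
    show "x +[R] y = y +[R] x" if "y \<in>. R"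
      using T.M.a_comm[OF sub[OF x] sub[OF that]] by simp
  qed (simp_all add: add z sub T.M.a_assoc del: smash_simps(1))
  then show ?thesis by (intro moduleI[OF K_cring])
      (use sm sub in \<open>auto simp: T.smult_l_distr T.smult_r_distr T.smult_assoc1 simp del: smash_simps(1)\<close>)
qed

lemma lin_smash: "lin K L R f \<longleftrightarrow> lin K L TT f \<and> (\<forall>x \<in> carrier L. f x \<in>. R)"
  by (auto simp: lin_def additive_def smash_carrier simp del: smash_simps(1))

lemma lin_from_smash: "lin K TT N f \<Longrightarrow> lin K R N f"
  by (auto simp: lin_def additive_def smash_carrier simp del: smash_simps(1))

lemma smash_mult_closed: "s \<in>. TT \<Longrightarrow> t \<in>. R \<Longrightarrow> mulT s t \<in>. R"
  using mulT_assoc[of s t unit] unit_closed by (auto simp: smash_carrier mulT_closed simp del: smash_simps(1))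

lemma smash_alg: "k_algebra K R"
proof (rule k_algebraI[OF smash_mod])
  have sub: "t \<in>. TT" if "t \<in>. R" for t
    using that by (simp add: smash_carrier del: smash_simps)
  show "\<one>[R] \<in>. R"
    using unit_closed by (simp add: smash_carrier mulT_unit_left del: smash_simps(1))
  show "lin K R R (\<lambda>x. x *[R] y)" if "y \<in>. R" for y
    using that lin_from_smash[OF mulT_lin_left] smash_mult_closed sub by (simp add: lin_smash del: smash_simps(1))
  show "lin K R R (\<lambda>x. y *[R] x)" if "y \<in>. R" for y
    using that lin_from_smash[OF mulT_lin_right] smash_mult_closed sub by (simp add: lin_smash del: smash_simps(1))
qed (simp_all add: smash_carrier mulT_assoc mulT_unit_left del: smash_simps(1))

lemmas R_assoc = k_algebra_assoc[OF smash_alg] and R_l_one = k_algebra_l_one[OF smash_alg] and R_r_one = k_algebra_r_one[OF smash_alg]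

end


context partial_smash
begin

declare smash_simps [simp del]

lemma smash_subset: "t \<in>. R \<Longrightarrow> t \<in>. TT" by (simp add: smash_carrier)

lemma smash_incl: "lin K R TT (\<lambda>x. x)" by (rule lin_from_smash[OF lin_id])

lemma sm_mulT:
  assumes "a \<in>. A" "h \<in>. H"
  shows "sm a h = mulT (ten a h) unit"
proof -
  have "sm a h = sw TT h (\<lambda>x y. ten (a *[A] act x \<one>[A]) (y *[H] \<one>[H]))"
    unfolding smash_elem_def Let_def by (rule sw_cong[OF TT_mod assms(2)]) (simp_all add: assms tensor_rules H_r_one)
  then show ?thesis using assms by (simp add: mulT_tens one_A_closed one_H_closed)
qed

lemma sm_closed: "a \<in>. A \<Longrightarrow> h \<in>. H \<Longrightarrow> sm a h \<in>. R"
  unfolding sm_mulT by (auto simp: smash_simps(1) tensor_rules)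

lemma lin_sm:
  "lin K L A f \<Longrightarrow> h \<in>. H \<Longrightarrow> lin K L R (\<lambda>x. sm (f x) h)"
  "lin K L H g \<Longrightarrow> a \<in>. A \<Longrightarrow> lin K L R (\<lambda>x. sm a (g x))"
proof -
  show "lin K L R (\<lambda>x. sm (f x) h)" if f: "lin K L A f" and h: "h \<in>. H"
  proof -
    have "lin K L TT (\<lambda>x. mulT (ten (f x) h) unit)" using f h by (simp add: tensor_rules)
    then show ?thesis using f h lin_closed[OF f] by (simp add: lin_smash sm_closed) (simp add: lin_def additive_def sm_mulT)
  qed
  show "lin K L R (\<lambda>x. sm a (g x))" if g: "lin K L H g" and a: "a \<in>. A"
  proof -
    have "lin K L TT (\<lambda>x. mulT (ten a (g x)) unit)" using g a by (simp add: tensor_rules)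
    then show ?thesis using g a lin_closed[OF g] by (simp add: lin_smash sm_closed) (simp add: lin_def additive_def sm_mulT)
  qed
qed

lemma smash_induct [consumes 1, case_names sm add]:
  assumes t: "t \<in>. R"
    and gen: "\<And>a h. a \<in>. A \<Longrightarrow> h \<in>. H \<Longrightarrow> Q (sm a h)"
    and add: "\<And>s t. \<lbrakk>s \<in>. R; t \<in>. R; Q s; Q t\<rbrakk> \<Longrightarrow> Q (s +[R] t)"
  shows "Q t"
proof -
  interpret T: tensor_product "self_alg K" A H by (rule tensor_product_K[OF A_mod H_mod])
  have "Q (mulT t unit)" if "t \<in>. TT" for t
    using that
  proof (induction rule: T.tensor_induct)
    case (tens a h)
    then show ?case using gen by (simp add: sm_mulT[symmetric])
  next
    case (add s t)
    have "mulT s unit \<in>. R" "mulT t unit \<in>. R" using add by (auto simp: smash_simps(1))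
    then show ?case
      using add assms(3)[of "mulT s unit" "mulT t unit"] lin_add[OF mulT_lin_left[OF unit_closed] add(1,2)]
      by (simp add: smash_simps)
  qed
  then show ?thesis using t by (metis smash_carrier)
qed

lemma smash_eq:
  assumes "t \<in>. R" "lin K R N f" "lin K R N g"
    "\<And>a h. a \<in>. A \<Longrightarrow> h \<in>. H \<Longrightarrow> f (sm a h) = g (sm a h)"
  shows "f t = g t"
  using assms(1) by (induction rule: smash_induct) (simp_all add: assms(4) lin_add[OF assms(2)] lin_add[OF assms(3)])

lemma mult_R_closed: "s \<in>. R \<Longrightarrow> t \<in>. R \<Longrightarrow> s *[R] t \<in>. R"
  by (rule k_algebra_mult_closed[OF smash_alg])

lemma lin_mult_R:
  "lin K L R f \<Longrightarrow> t \<in>. R \<Longrightarrow> lin K L R (\<lambda>x. f x *[R] t)"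
  "lin K L R f \<Longrightarrow> t \<in>. R \<Longrightarrow> lin K L R (\<lambda>x. t *[R] f x)"
  by (rule lin_mult_left[OF smash_alg] lin_mult_right[OF smash_alg]; assumption)+

lemmas smash_rules = act_rules smash_mod smash_alg sm_closed lin_sm mult_R_closed lin_mult_R

lemma sw_smash:
  "h \<in>. H \<Longrightarrow> bilin K H H R F \<Longrightarrow> sw R h F = sw TT h F"
  by (rule sw_push[OF smash_mod TT_mod _ _ smash_incl])

lemma sm_one: "sm \<one>[A] \<one>[H] = \<one>[R]"
  using mulT_unit_left[OF unit_closed] by (simp add: sm_mulT one_A_closed one_H_closed smash_simps)

lemma sm_mult:
  assumes as: "a \<in>. A" "h \<in>. H" "b \<in>. A" "k \<in>. H"
  shows "sm a h *[R] sm b k = sw R h (\<lambda>x y. sm (a *[A] act x b) (y *[H] k))"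
proof -
  have t: "ten a h \<in>. TT" "ten b k \<in>. TT" using as by (simp_all add: tensor_rules)
  have "sm a h *[R] sm b k = mulT (mulT (ten a h) unit) (mulT (ten b k) unit)"
    using as by (simp add: sm_mulT smash_simps)
  also have "\<dots> = mulT (mulT (ten a h) (ten b k)) unit"
    using t unit_closed by (simp add: mulT_assoc mulT_closed mulT_unit_left)
  also have "\<dots> = sw TT h (\<lambda>x y. mulT (ten (a *[A] act x b) (y *[H] k)) unit)"
    unfolding mulT_tens[OF as] by (rule sw_push[OF TT_mod TT_mod as(2)]) (simp_all add: as tensor_rules)
  also have "\<dots> = sw TT h (\<lambda>x y. sm (a *[A] act x b) (y *[H] k))"
    by (rule sw_cong[OF TT_mod as(2)]) (simp_all add: as tensor_rules sm_mulT)
  also have "\<dots> = sw R h (\<lambda>x y. sm (a *[A] act x b) (y *[H] k))"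
    by (rule sw_smash[symmetric]) (simp_all add: as smash_rules)
  finally show ?thesis .
qed

lemma sm_absorb:
  assumes as: "a \<in>. A" "h \<in>. H"
  shows "sw R h (\<lambda>x y. sm (a *[A] act x \<one>[A]) y) = sm a h"
proof -
  have "sm a h = sw R h (\<lambda>x y. sm (a *[A] act x \<one>[A]) (y *[H] \<one>[H]))"
    using sm_mult[OF as one_A_closed one_H_closed] k_algebra_r_one[OF smash_alg sm_closed[OF as]] by (simp add: sm_one)
  also have "\<dots> = sw R h (\<lambda>x y. sm (a *[A] act x \<one>[A]) y)"
    by (rule sw_cong[OF smash_mod as(2)]) (simp_all add: as smash_rules H_r_one)
  finally show ?thesis by simp
qed

text \<open>The two halves of the smash product.  \<open>\<alpha>\<close> is a homomorphism of algebras, whereas \<open>\<gamma>\<close> is multiplicative only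
  up to factors \<open>\<alpha>(h \<cdot> 1)\<close>.\<close>

abbreviation "\<alpha> a \<equiv> sm a \<one>[H]"
abbreviation "\<gamma> h \<equiv> sm \<one>[A] h"

lemma \<alpha>_mult_sm:
  assumes as: "a \<in>. A" "b \<in>. A" "k \<in>. H"
  shows "\<alpha> a *[R] sm b k = sm (a *[A] b) k"
proof -
  have "\<alpha> a *[R] sm b k = sm (a *[A] act \<one>[H] b) (\<one>[H] *[H] k)"
    unfolding sm_mult[OF as(1) one_H_closed as(2,3)] by (rule sw_one[OF smash_mod]) (simp add: as smash_rules)
  then show ?thesis using as by (simp add: act_one H_l_one)
qed

lemma \<alpha>_mult: "a \<in>. A \<Longrightarrow> b \<in>. A \<Longrightarrow> \<alpha> a *[R] \<alpha> b = \<alpha> (a *[A] b)"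
  by (rule \<alpha>_mult_sm[OF _ _ one_H_closed])

lemma sm_split: "a \<in>. A \<Longrightarrow> h \<in>. H \<Longrightarrow> \<alpha> a *[R] \<gamma> h = sm a h"
  by (simp add: \<alpha>_mult_sm one_A_closed A_r_one)

lemma \<gamma>_mult_sm:
  assumes as: "h \<in>. H" "b \<in>. A" "k \<in>. H"
  shows "\<gamma> h *[R] sm b k = sw R h (\<lambda>x y. sm (act x b) (y *[H] k))"
  unfolding sm_mult[OF one_A_closed as] by (rule sw_cong[OF smash_mod as(1)]) (simp_all add: as smash_rules A_l_one)

lemma \<gamma>_mult_\<alpha>:
  assumes as: "h \<in>. H" "b \<in>. A"
  shows "\<gamma> h *[R] \<alpha> b = sw R h (\<lambda>x y. sm (act x b) y)"
  unfolding \<gamma>_mult_sm[OF as one_H_closed] by (rule sw_cong[OF smash_mod as(1)]) (simp_all add: as smash_rules H_r_one)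

lemma \<gamma>_\<gamma>S:
  assumes h: "h \<in>. H" and as: "b \<in>. A" "k \<in>. H"
  shows "sw R h (\<lambda>x y. \<gamma> x *[R] sm b (S y *[H] k)) = sm (act h b) k"
proof -
  have "sw R h (\<lambda>x y. \<gamma> x *[R] sm b (S y *[H] k)) =
      sw R h (\<lambda>x z. sw R x (\<lambda>x y. sm (act x b) ((y *[H] S z) *[H] k)))"
    by (rule sw_cong[OF smash_mod h]) (simp_all add: as smash_rules \<gamma>_mult_sm H_assoc
       del: sm_mult cong: sw_cong)
  also have "\<dots> = sw R h (\<lambda>x y. sw R y (\<lambda>p q. sm (act x b) ((p *[H] S q) *[H] k)))"
    by (rule sw_coassoc[OF smash_mod h]) (simp add: as smash_rules)
  also have "\<dots> = sm (act h b) (\<one>[H] *[H] k)" by (rule sw_collapse_right[OF smash_mod h]) (simp add: as smash_rules)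
  finally show ?thesis using as by (simp add: H_l_one)
qed

text \<open>For a global action this would be \<open>\<epsilon>(h) 1\<close>.  The central elements \<open>h \<cdot> 1\<close> measure how far the action is
  from being global.\<close>

lemma \<gamma>_\<gamma>S_one:
  assumes h: "h \<in>. H"
  shows "sw R h (\<lambda>x y. \<gamma> x *[R] \<gamma> (S y)) = \<alpha> (act h \<one>[A])"
proof -
  have "sw R h (\<lambda>x y. \<gamma> x *[R] \<gamma> (S y)) = sw R h (\<lambda>x y. \<gamma> x *[R] \<gamma> (S y *[H] \<one>[H]))"
    by (rule sw_cong[OF smash_mod h]) (simp_all add: smash_rules H_r_one)
  then show ?thesis using \<gamma>_\<gamma>S[OF h one_A_closed one_H_closed] by simp
qed

text \<open>By \<open>\<gamma>_\<gamma>S_one\<close> the left hand side is \<open>\<alpha>(h \<cdot> 1) \<gamma>(k)\<close>, and \<open>\<gamma>_\<gamma>S\<close> says the same of the right hand side.  The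
  mirrored relation needs a longer proof because \<open>\<alpha>(k \<cdot> 1)\<close> has to be moved past \<open>\<gamma>(h)\<close>.\<close>

lemma \<gamma>_rel_left:
  assumes h: "h \<in>. H" and k: "k \<in>. H"
  shows "sw R h (\<lambda>x y. \<gamma> x *[R] (\<gamma> (S y) *[R] \<gamma> k)) = sw R h (\<lambda>x y. \<gamma> x *[R] \<gamma> (S y *[H] k))"
proof -
  have "sw R h (\<lambda>x y. \<gamma> x *[R] (\<gamma> (S y) *[R] \<gamma> k)) = sw R h (\<lambda>x y. (\<gamma> x *[R] \<gamma> (S y)) *[R] \<gamma> k)"
    by (rule sw_cong[OF smash_mod h]) (simp_all add: k smash_rules R_assoc)
  also have "\<dots> = \<alpha> (act h \<one>[A]) *[R] \<gamma> k"
    unfolding \<gamma>_\<gamma>S_one[OF h, symmetric]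
    by (rule sw_push[OF smash_mod smash_mod h, symmetric]) (simp_all add: k smash_rules)
  also have "\<dots> = sm (act h \<one>[A]) k" using h k by (simp add: sm_split smash_rules)
  finally show ?thesis using \<gamma>_\<gamma>S[OF h one_A_closed k] by simp
qed

lemma \<gamma>_mult_\<alpha>_act:
  assumes h: "h \<in>. H" and k: "k \<in>. H"
  shows "\<gamma> h *[R] \<alpha> (act k \<one>[A]) = sw R h (\<lambda>x y. sm (act (x *[H] k) \<one>[A]) y)"
proof -
  have "\<gamma> h *[R] \<alpha> (act k \<one>[A]) = sw R h (\<lambda>x z. sm (act x (act k \<one>[A])) z)"
    by (rule \<gamma>_mult_\<alpha>) (simp_all add: h k smash_rules)
  also have "\<dots> = sw R h (\<lambda>x z. sw R x (\<lambda>x y. sm (act (x *[H] k) \<one>[A] *[A] act y \<one>[A]) z))"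
  proof (rule sw_cong[OF smash_mod h])
    show "bilin K H H R (\<lambda>x z. sm (act x (act k \<one>[A])) z)" using k by (simp add: smash_rules)
    fix x z assume xz: "x \<in>. H" "z \<in>. H"
    show "sm (act x (act k \<one>[A])) z = sw R x (\<lambda>x y. sm (act (x *[H] k) \<one>[A] *[A] act y \<one>[A]) z)"
      unfolding act_act_sym[OF xz(1) k one_A_closed]
      by (rule sw_push[OF A_mod smash_mod xz(1)]) (simp_all add: xz k smash_rules)
  qed
  also have "\<dots> = sw R h (\<lambda>x y. sw R y (\<lambda>p q. sm (act (x *[H] k) \<one>[A] *[A] act p \<one>[A]) q))"
    by (rule sw_coassoc[OF smash_mod h]) (simp add: k smash_rules)
  also have "\<dots> = sw R h (\<lambda>x y. sm (act (x *[H] k) \<one>[A]) y)"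
    by (rule sw_cong[OF smash_mod h]) (simp_all add: k smash_rules sm_absorb)
  finally show ?thesis .
qed

lemma \<gamma>_rel_right:
  assumes h: "h \<in>. H" and k: "k \<in>. H"
  shows "sw R k (\<lambda>x y. \<gamma> h *[R] (\<gamma> x *[R] \<gamma> (S y))) = sw R k (\<lambda>x y. \<gamma> (h *[H] x) *[R] \<gamma> (S y))"
proof -
  have "sw R k (\<lambda>x y. \<gamma> h *[R] (\<gamma> x *[R] \<gamma> (S y))) = \<gamma> h *[R] \<alpha> (act k \<one>[A])"
    unfolding \<gamma>_\<gamma>S_one[OF k, symmetric]
    by (rule sw_push[OF smash_mod smash_mod k, symmetric]) (simp_all add: h smash_rules)
  also have "\<dots> = sw R h (\<lambda>x y. sm (act (x *[H] k) \<one>[A]) y)" by (rule \<gamma>_mult_\<alpha>_act[OF h k])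
  finally have 1: "sw R k (\<lambda>x y. \<gamma> h *[R] (\<gamma> x *[R] \<gamma> (S y))) = sw R h (\<lambda>x y. sm (act (x *[H] k) \<one>[A]) y)" .
  let ?F = "\<lambda>x y p q z. sm (act (p *[H] x) \<one>[A]) (q *[H] (y *[H] S z))"
  have "sw R k (\<lambda>x y. \<gamma> (h *[H] x) *[R] \<gamma> (S y)) =
      sw R k (\<lambda>x z. sw R x (\<lambda>x y. sw R h (\<lambda>p q. ?F x y p q z)))"
  proof (rule sw_cong[OF smash_mod k])
    show "bilin K H H R (\<lambda>x y. \<gamma> (h *[H] x) *[R] \<gamma> (S y))" using h by (simp add: smash_rules)
    fix x z assume xz: "x \<in>. H" "z \<in>. H"
    have "\<gamma> (h *[H] x) *[R] \<gamma> (S z) = sw R (h *[H] x) (\<lambda>p q. sm (act p \<one>[A]) (q *[H] S z))"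
      by (rule \<gamma>_mult_sm) (simp_all add: h xz smash_rules)
    also have "\<dots> = sw R h (\<lambda>p q. sw R x (\<lambda>x y. sm (act (p *[H] x) \<one>[A]) ((q *[H] y) *[H] S z)))"
      by (rule sw_mult[OF smash_mod h xz(1)]) (simp_all add: xz smash_rules)
    also have "\<dots> = sw R x (\<lambda>x y. sw R h (\<lambda>p q. sm (act (p *[H] x) \<one>[A]) ((q *[H] y) *[H] S z)))"
      by (rule sw_swap[OF smash_mod]) (simp_all add: h xz smash_rules)
    also have "\<dots> = sw R x (\<lambda>x y. sw R h (\<lambda>p q. ?F x y p q z))"
    proof (rule sw_cong[OF smash_mod xz(1)])
      show "sw R h (\<lambda>p q. sm (act (p *[H] x) \<one>[A]) ((q *[H] y) *[H] S z)) = sw R h (\<lambda>p q. ?F x y p q z)"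
        if "x \<in>. H" "y \<in>. H" for x y by (rule sw_cong[OF smash_mod h]) (simp_all add: that xz smash_rules H_assoc)
    qed (simp add: h xz smash_rules)
    finally show "\<gamma> (h *[H] x) *[R] \<gamma> (S z) = sw R x (\<lambda>x y. sw R h (\<lambda>p q. ?F x y p q z))" .
  qed
  also have "\<dots> = sw R k (\<lambda>x y. sw R y (\<lambda>y z. sw R h (\<lambda>p q. ?F x y p q z)))"
    by (rule sw_coassoc[OF smash_mod k]) (simp add: h smash_rules)
  also have "\<dots> = sw R h (\<lambda>p q. sm (act (p *[H] k) \<one>[A]) (q *[H] \<one>[H]))"
    by (rule sw_collapse_right[OF smash_mod k, where G = "\<lambda>x w. sw R h (\<lambda>p q. sm (act (p *[H] x) \<one>[A]) (q *[H] w))"])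
      (simp add: h smash_rules)
  also have "\<dots> = sw R h (\<lambda>x y. sm (act (x *[H] k) \<one>[A]) y)"
    by (rule sw_cong[OF smash_mod h]) (simp_all add: k smash_rules H_r_one)
  finally show ?thesis using 1 by simp
qed

text \<open>The commutation rule of \<open>\<gamma>_mult_\<alpha>\<close>, read backwards: \<open>S\<close> in the smash product exchanges the two sides.\<close>

lemma \<alpha>_mult_\<gamma>S:
  assumes h: "h \<in>. H" and b: "b \<in>. A"
  shows "\<alpha> b *[R] \<gamma> (S h) = sw R h (\<lambda>x y. \<gamma> (S x) *[R] \<alpha> (act y b))"
proof -
  let ?F = "\<lambda>x q y. sm (act (S q) (act y b)) (S x)"
  have "sw R h (\<lambda>x y. \<gamma> (S x) *[R] \<alpha> (act y b)) = sw R h (\<lambda>x y. sw R x (\<lambda>p q. ?F p q y))"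
  proof (rule sw_cong[OF smash_mod h])
    show "bilin K H H R (\<lambda>x y. \<gamma> (S x) *[R] \<alpha> (act y b))" using b by (simp add: smash_rules)
    fix x y assume xy: "x \<in>. H" "y \<in>. H"
    have "\<gamma> (S x) *[R] \<alpha> (act y b) = sw R (S x) (\<lambda>p q. sm (act p (act y b)) q)"
      by (rule \<gamma>_mult_\<alpha>) (simp_all add: b xy smash_rules)
    also have "\<dots> = sw R x (\<lambda>p q. sm (act (S p) (act y b)) (S q))"
      by (rule sw_antipode[OF smash_mod xy(1)]) (simp_all add: b xy smash_rules)
    also have "\<dots> = sw R x (\<lambda>p q. ?F p q y)" by (rule sw_comm[OF smash_mod xy(1)]) (simp_all add: b xy smash_rules)
    finally show "\<gamma> (S x) *[R] \<alpha> (act y b) = sw R x (\<lambda>p q. ?F p q y)" .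
  qed
  also have "\<dots> = sw R h (\<lambda>x y. sw R y (\<lambda>p q. ?F x p q))"
    by (rule sw_coassoc[OF smash_mod h]) (simp add: b smash_rules)
  also have "\<dots> = sw R h (\<lambda>x y. sm (b *[A] act (S y) \<one>[A]) (S x))"
  proof (rule sw_cong[OF smash_mod h])
    show "bilin K H H R (\<lambda>x y. sw R y (\<lambda>p q. ?F x p q))" using b by (simp add: smash_rules)
    fix x y assume xy: "x \<in>. H" "y \<in>. H"
    have "sw R y (\<lambda>p q. ?F x p q) = sm (sw A y (\<lambda>p q. act (S p) (act q b))) (S x)"
      by (rule sw_push[OF A_mod smash_mod xy(2), symmetric]) (simp_all add: b xy smash_rules)
    then show "sw R y (\<lambda>p q. ?F x p q) = sm (b *[A] act (S y) \<one>[A]) (S x)"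
      using xy b by (simp add: act_antipode_act act_unit_central antipode_closed)
  qed
  also have "\<dots> = sw R h (\<lambda>x y. sm (b *[A] act (S x) \<one>[A]) (S y))"
    by (rule sw_comm[OF smash_mod h]) (simp add: b smash_rules)
  also have "\<dots> = sw R (S h) (\<lambda>x y. sm (b *[A] act x \<one>[A]) y)"
    by (rule sw_antipode[OF smash_mod h, symmetric]) (simp add: b smash_rules)
  also have "\<dots> = sm b (S h)" by (rule sm_absorb[OF b antipode_closed[OF h]])
  finally show ?thesis using h b by (simp add: sm_split antipode_closed)
qed

text \<open>This identity and the next one say that conjugation by \<open>\<gamma>\<close> takes left multiplication by \<open>a # h\<close> to right
  multiplication.  They carry the two halves of the isomorphism.\<close>

lemma \<gamma>S_mult_sm:
  assumes h: "h \<in>. H" and a: "a \<in>. A"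
  shows "sw R h (\<lambda>x y. \<gamma> (S x) *[R] sm a y) = \<alpha> (act (S h) a)"
proof -
  let ?F = "\<lambda>p q y. sm (act (S p) a) (S q *[H] y)"
  have "sw R h (\<lambda>x y. \<gamma> (S x) *[R] sm a y) = sw R h (\<lambda>x y. sw R x (\<lambda>p q. ?F p q y))"
  proof (rule sw_cong[OF smash_mod h])
    show "bilin K H H R (\<lambda>x y. \<gamma> (S x) *[R] sm a y)" using a by (simp add: smash_rules)
    fix x y assume xy: "x \<in>. H" "y \<in>. H"
    have "\<gamma> (S x) *[R] sm a y = sw R (S x) (\<lambda>p q. sm (act p a) (q *[H] y))"
      by (rule \<gamma>_mult_sm) (simp_all add: a xy smash_rules)
    also have "\<dots> = sw R x (\<lambda>p q. ?F p q y)"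
      by (rule sw_antipode[OF smash_mod xy(1)]) (simp_all add: a xy smash_rules)
    finally show "\<gamma> (S x) *[R] sm a y = sw R x (\<lambda>p q. ?F p q y)" .
  qed
  also have "\<dots> = sw R h (\<lambda>x y. sw R y (\<lambda>p q. ?F x p q))"
    by (rule sw_coassoc[OF smash_mod h]) (simp add: a smash_rules)
  also have "\<dots> = sm (act (S h) a) \<one>[H]" by (rule sw_collapse_left[OF smash_mod h]) (simp add: a smash_rules)
  finally show ?thesis .
qed

lemma \<gamma>_mult_\<alpha>S:
  assumes h: "h \<in>. H" and a: "a \<in>. A"
  shows "sw R h (\<lambda>x y. \<gamma> y *[R] \<alpha> (act (S x) a)) = sm a h"
proof -
  let ?F = "\<lambda>x p q. sm (act p (act (S x) a)) q"
  have "sw R h (\<lambda>x y. \<gamma> y *[R] \<alpha> (act (S x) a)) = sw R h (\<lambda>x y. sw R y (\<lambda>p q. ?F x p q))"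
    by (rule sw_cong[OF smash_mod h]) (simp_all add: a smash_rules \<gamma>_mult_\<alpha>)
  also have "\<dots> = sw R h (\<lambda>x y. sw R y (\<lambda>p q. ?F p x q))"
    by (rule sw_swap12[OF smash_mod h]) (simp add: a smash_rules)
  also have "\<dots> = sw R h (\<lambda>x y. sw R x (\<lambda>p q. ?F q p y))"
    by (rule sw_coassoc[OF smash_mod h, symmetric]) (simp add: a smash_rules)
  also have "\<dots> = sw R h (\<lambda>x y. sm (a *[A] act x \<one>[A]) y)"
  proof (rule sw_cong[OF smash_mod h])
    show "bilin K H H R (\<lambda>x y. sw R x (\<lambda>p q. ?F q p y))" using a by (simp add: smash_rules)
    fix x y assume xy: "x \<in>. H" "y \<in>. H"
    have "sw R x (\<lambda>p q. ?F q p y) = sm (sw A x (\<lambda>p q. act p (act (S q) a))) y"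
      by (rule sw_push[OF A_mod smash_mod xy(1), symmetric]) (simp_all add: a xy smash_rules)
    then show "sw R x (\<lambda>p q. ?F q p y) = sm (a *[A] act x \<one>[A]) y"
      using xy a by (simp add: act_act_antipode_sym)
  qed
  also have "\<dots> = sm a h" by (rule sm_absorb[OF a h])
  finally show ?thesis .
qed

end


section \<open>The free algebra\<close>

context
  fixes K :: "'k ring"
  assumes K: "cring K"
begin

interpretation cring K by (rule K)

text \<open>The product of the free algebra.  Recursion on the first letter, as in \<open>conv_Cons\<close>, reduces its properties
  to those of the ground ring.\<close>

definition conv :: "('s list \<Rightarrow> 'k) \<Rightarrow> ('s list \<Rightarrow> 'k) \<Rightarrow> 's list \<Rightarrow> 'k" where
  "conv p q w = (\<Oplus>\<^bsub>K\<^esub>i \<in> {..length w}. p (take i w) *[K] q (drop i w))"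

abbreviation "coeffs p \<equiv> (\<forall>w. p w \<in>. K)"

lemma conv_closed: "coeffs p \<Longrightarrow> coeffs q \<Longrightarrow> conv p q w \<in>. K"
  unfolding conv_def by (rule finsum_closed) auto

lemma conv_Nil: "coeffs p \<Longrightarrow> coeffs q \<Longrightarrow> conv p q [] = p [] *[K] q []" by (simp add: conv_def)

lemma conv_Cons:
  "coeffs p \<Longrightarrow> coeffs q \<Longrightarrow> conv p q (a # w) = p [] *[K] q (a # w) +[K] conv (\<lambda>u. p (a # u)) q w"
  by (simp add: conv_def finsum_Suc2 a_comm Pi_def finsum_closed del: finsum_Suc)

lemma conv_add_left:
  "coeffs p \<Longrightarrow> coeffs p' \<Longrightarrow> coeffs q \<Longrightarrow> conv (\<lambda>u. p u +[K] p' u) q w = conv p q w +[K] conv p' q w"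
  unfolding conv_def by (simp add: l_distr finsum_addf Pi_def)

lemma conv_add_right:
  "coeffs p \<Longrightarrow> coeffs q' \<Longrightarrow> coeffs q \<Longrightarrow> conv p (\<lambda>u. q u +[K] q' u) w = conv p q w +[K] conv p q' w"
  unfolding conv_def by (simp add: r_distr finsum_addf Pi_def)

lemma conv_smult_left:
  "coeffs p \<Longrightarrow> coeffs q \<Longrightarrow> c \<in>. K \<Longrightarrow> conv (\<lambda>u. c *[K] p u) q w = c *[K] conv p q w"
  unfolding conv_def by (simp add: m_assoc finsum_rdistr Pi_def)

lemma conv_smult_right:
  "coeffs p \<Longrightarrow> coeffs q \<Longrightarrow> c \<in>. K \<Longrightarrow> conv p (\<lambda>u. c *[K] q u) w = c *[K] conv p q w"
  unfolding conv_def by (simp add: m_lcomm finsum_rdistr Pi_def)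

lemma conv_assoc:
  assumes "coeffs p" "coeffs q" "coeffs r"
  shows "conv (conv p q) r w = conv p (conv q r) w"
  using assms(1)
proof (induction w arbitrary: p)
  case Nil
  then show ?case using assms by (simp add: conv_Nil conv_closed m_assoc)
next
  case (Cons a w)
  note cl = Cons.prems assms(2,3)
  have "conv (\<lambda>u. conv p q (a # u)) r w = conv (\<lambda>u. p [] *[K] q (a # u) +[K] conv (\<lambda>u. p (a # u)) q u) r w"
    using cl by (simp add: conv_Cons)
  also have "\<dots> = p [] *[K] conv (\<lambda>u. q (a # u)) r w +[K] conv (\<lambda>u. p (a # u)) (conv q r) w"
    using cl Cons.IH[of "\<lambda>u. p (a # u)"] by (simp add: conv_add_left conv_smult_left conv_closed)
  finally show ?case
    using cl by (simp add: conv_Cons[of "conv p q"] conv_Cons[of p "conv q r"] conv_closed conv_Nil)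
      (simp add: conv_Cons[of q] conv_closed r_distr m_assoc a_assoc)
qed

lemma conv_zero_left: "coeffs q \<Longrightarrow> conv (\<lambda>u. \<zero>[K]) q w = \<zero>[K]"
  unfolding conv_def by (simp add: finsum_zero)

abbreviation one_word :: "'s list \<Rightarrow> 'k" where "one_word \<equiv> (\<lambda>w. if w = [] then \<one>[K] else \<zero>[K])"

lemma conv_one_left: "coeffs q \<Longrightarrow> conv one_word q w = q w"
  by (cases w) (simp_all add: conv_Nil conv_Cons conv_zero_left)

lemma conv_one_right: "coeffs p \<Longrightarrow> conv p one_word w = p w"
  by (induction w arbitrary: p) (simp_all add: conv_Nil conv_Cons)

lemma conv_letter:
  assumes "coeffs q"
  shows "conv (letter K s) q w = (case w of [] \<Rightarrow> \<zero>[K] | a # u \<Rightarrow> if a = s then q u else \<zero>[K])"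
proof (cases w)
  case (Cons a u)
  have "(\<lambda>u. letter K s (a # u)) = (if a = s then one_word else (\<lambda>u. \<zero>[K]))" by (auto simp: letter_def)
  then show ?thesis
    using assms conv_Cons[of "letter K s" q a u] Cons by (simp add: letter_def conv_one_left conv_zero_left)
qed (simp add: assms conv_Nil letter_def)

lemma free_alg_simps:
  "p \<in>. (free_alg K X) \<longleftrightarrow> finite {w. p w \<noteq> \<zero>[K]} \<and> coeffs p \<and> (\<forall>w. w \<notin> lists X \<longrightarrow> p w = \<zero>[K])"
  "p *[free_alg K X] q = conv p q" "\<one>[free_alg K X] = one_word"
  "p +[free_alg K X] q = (\<lambda>w. p w +[K] q w)" "\<zero>[free_alg K X] = (\<lambda>w. \<zero>[K])"
  "c \<cdot>[free_alg K X] p = (\<lambda>w. c *[K] p w)" by (auto simp: free_alg_def conv_def)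

lemma free_alg_mult_closed:
  assumes p: "p \<in>. (free_alg K X)" and q: "q \<in>. (free_alg K X)"
  shows "conv p q \<in>. (free_alg K X)"
proof -
  have pq: "coeffs p" "coeffs q" using p q by (auto simp: free_alg_simps(1))
  have nz: "\<exists>u v. w = u @ v \<and> p u \<noteq> \<zero>[K] \<and> q v \<noteq> \<zero>[K]" if "conv p q w \<noteq> \<zero>[K]" for w
  proof (rule ccontr)
    assume no: "\<not> ?thesis"
    then have "p (take i w) *[K] q (drop i w) = \<zero>[K]" for i
      using pq by (metis append_take_drop_id l_null r_null)
    then show False using that by (simp add: conv_def)
  qed
  have "{w. conv p q w \<noteq> \<zero>[K]} \<subseteq> (\<lambda>(u, v). u @ v) ` ({w. p w \<noteq> \<zero>[K]} \<times> {w. q w \<noteq> \<zero>[K]})"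
  proof
    fix w assume "w \<in> {w. conv p q w \<noteq> \<zero>[K]}"
    then obtain u v where "w = u @ v" "p u \<noteq> \<zero>[K]" "q v \<noteq> \<zero>[K]" using nz by blast
    then show "w \<in> (\<lambda>(u, v). u @ v) ` ({w. p w \<noteq> \<zero>[K]} \<times> {w. q w \<noteq> \<zero>[K]})"
      by (intro image_eqI[of _ _ "(u, v)"]) auto
  qed
  moreover have "conv p q w = \<zero>[K]" if "w \<notin> lists X" for w
  proof (rule ccontr)
    assume "conv p q w \<noteq> \<zero>[K]"
    then obtain u v where uv: "w = u @ v" "p u \<noteq> \<zero>[K]" "q v \<noteq> \<zero>[K]" using nz by blast
    then have "u \<in> lists X" "v \<in> lists X" using p q unfolding free_alg_simps(1) by blast+
    then show False using that uv(1) by simp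
  qed
  moreover have "finite ((\<lambda>(u, v). u @ v) ` ({w. p w \<noteq> \<zero>[K]} \<times> {w. q w \<noteq> \<zero>[K]}))"
    using p q unfolding free_alg_simps(1) by blast
  ultimately show ?thesis
    unfolding free_alg_simps(1) using conv_closed[OF pq] by (meson finite_subset)
qed

lemma free_alg_module: "module K (free_alg K X)"
proof -
  have co: "coeffs p" if "p \<in>. (free_alg K X)" for p using that by (simp add: free_alg_simps(1))
  have add: "p +[free_alg K X] q \<in>. (free_alg K X)"
    if "p \<in>. (free_alg K X)" "q \<in>. (free_alg K X)" for p q
  proof -
    have "{w. p w +[K] q w \<noteq> \<zero>[K]} \<subseteq> {w. p w \<noteq> \<zero>[K]} \<union> {w. q w \<noteq> \<zero>[K]}"
      using that by (auto simp: free_alg_simps)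
    then show ?thesis using that by (auto simp: free_alg_simps intro: finite_subset)
  qed
  have sm: "c \<cdot>[free_alg K X] p \<in>. (free_alg K X)"
    if "p \<in>. (free_alg K X)" "c \<in>. K" for c p
  proof -
    have "{w. c *[K] p w \<noteq> \<zero>[K]} \<subseteq> {w. p w \<noteq> \<zero>[K]}"
      using that by (auto simp: free_alg_simps)
    then show ?thesis using that by (auto simp: free_alg_simps intro: finite_subset)
  qed
  have "abelian_group (free_alg K X)"
  proof (rule abelian_groupI)
    fix p assume p: "p \<in>. (free_alg K X)"
    have 1: "\<ominus>\<^bsub>K\<^esub> \<one>[K] \<cdot>[free_alg K X] p \<in>. (free_alg K X)" by (rule sm[OF p]) simp
    have "\<ominus>\<^bsub>K\<^esub> \<one>[K] *[K] x +[K] x = \<zero>[K]" if "x \<in>. K" for x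
      using that by (simp add: l_minus l_neg)
    then have "(\<ominus>\<^bsub>K\<^esub> \<one>[K] \<cdot>[free_alg K X] p) +[free_alg K X] p = \<zero>[free_alg K X]"
      using p by (auto simp: free_alg_simps)
    then show "\<exists>q \<in> carrier (free_alg K X). q +[free_alg K X] p = \<zero>[free_alg K X]" using 1 by blast
  next
    fix p q r assume p: "p \<in>. (free_alg K X)" and q: "q \<in>. (free_alg K X)"
    show "p +[free_alg K X] q = q +[free_alg K X] p"
      unfolding free_alg_simps(4) using p[THEN co] q[THEN co] by (intro ext a_comm) auto
    show "(p +[free_alg K X] q) +[free_alg K X] r = p +[free_alg K X] (q +[free_alg K X] r)"
      if r: "r \<in>. (free_alg K X)"
      unfolding free_alg_simps(4) using p[THEN co] q[THEN co] r[THEN co] by (intro ext a_assoc) auto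
    show "\<zero>[free_alg K X] +[free_alg K X] p = p"
      unfolding free_alg_simps(4,5) using p[THEN co] by (intro ext l_zero) auto
  qed (use add in \<open>simp_all add: free_alg_simps\<close>)
  then show ?thesis
  proof (rule moduleI[OF K])
    fix c p assume c: "c \<in>. K" and p: "p \<in>. (free_alg K X)"
    show "(c +[K] d) \<cdot>[free_alg K X] p = c \<cdot>[free_alg K X] p +[free_alg K X] d \<cdot>[free_alg K X] p"
      "(c *[K] d) \<cdot>[free_alg K X] p = c \<cdot>[free_alg K X] (d \<cdot>[free_alg K X] p)"
      if d: "d \<in>. K" for d
      unfolding free_alg_simps(4,6) using c d p[THEN co] by (auto intro!: ext l_distr m_assoc)
    show "c \<cdot>[free_alg K X] (p +[free_alg K X] q) = c \<cdot>[free_alg K X] p +[free_alg K X] c \<cdot>[free_alg K X] q"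
      if q: "q \<in>. (free_alg K X)" for q
      unfolding free_alg_simps(4,6) using c p[THEN co] q[THEN co] by (auto intro!: ext r_distr)
  next
    fix p assume p: "p \<in>. (free_alg K X)"
    show "\<one>[K] \<cdot>[free_alg K X] p = p"
      unfolding free_alg_simps(6) using p[THEN co] by (intro ext l_one) auto
  qed (use sm in blast)
qed

lemma free_alg_k_algebra: "k_algebra K (free_alg K X)"
proof (rule k_algebraI[OF free_alg_module])
  have co: "coeffs p" if "p \<in>. (free_alg K X)" for p using that by (simp add: free_alg_simps(1))
  have one: "\<one>[free_alg K X] \<in>. (free_alg K X)" by (simp add: free_alg_simps)
  show "\<one>[free_alg K X] \<in>. (free_alg K X)" by (rule one)
  show "lin K (free_alg K X) (free_alg K X) (\<lambda>p. p *[free_alg K X] q)" if q: "q \<in>. (free_alg K X)" for q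
    unfolding free_alg_simps(2)
  proof (rule linI)
    fix p p' assume "p \<in>. (free_alg K X)" "p' \<in>. (free_alg K X)"
    then show "conv (p +[free_alg K X] p') q = conv p q +[free_alg K X] conv p' q"
      using q[THEN co] co unfolding free_alg_simps(4) by (intro ext conv_add_left) blast+
  next
    fix c p assume "c \<in>. K" "p \<in>. (free_alg K X)"
    then show "conv (c \<cdot>[free_alg K X] p) q = c \<cdot>[free_alg K X] conv p q"
      using q[THEN co] co unfolding free_alg_simps(6) by (intro ext conv_smult_left) blast+
  qed (rule free_alg_mult_closed[OF _ q])
  show "lin K (free_alg K X) (free_alg K X) (\<lambda>p. q *[free_alg K X] p)" if q: "q \<in>. (free_alg K X)" for q
    unfolding free_alg_simps(2)
  proof (rule linI)
    fix p p' assume "p \<in>. (free_alg K X)" "p' \<in>. (free_alg K X)"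
    then show "conv q (p +[free_alg K X] p') = conv q p +[free_alg K X] conv q p'"
      using q[THEN co] co unfolding free_alg_simps(4) by (intro ext conv_add_right) blast+
  next
    fix c p assume "c \<in>. K" "p \<in>. (free_alg K X)"
    then show "conv q (c \<cdot>[free_alg K X] p) = c \<cdot>[free_alg K X] conv q p"
      using q[THEN co] co unfolding free_alg_simps(6) by (intro ext conv_smult_right) blast+
  qed (rule free_alg_mult_closed[OF q])
  show "(p *[free_alg K X] q) *[free_alg K X] r = p *[free_alg K X] (q *[free_alg K X] r)"
    if "p \<in>. (free_alg K X)" "q \<in>. (free_alg K X)" "r \<in>. (free_alg K X)" for p q r
    unfolding free_alg_simps(2) using that[THEN co] by (intro ext conv_assoc)
  show "\<one>[free_alg K X] *[free_alg K X] p = p" if "p \<in>. (free_alg K X)" for p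
    unfolding free_alg_simps(2,3) using that[THEN co] by (intro ext conv_one_left)
  show "p *[free_alg K X] \<one>[free_alg K X] = p" if "p \<in>. (free_alg K X)" for p
    unfolding free_alg_simps(2,3) using that[THEN co] by (intro ext conv_one_right)
qed

lemma letter_closed: "s \<in> X \<Longrightarrow> letter K s \<in>. (free_alg K X)" by (auto simp: free_alg_simps letter_def)

text \<open>Words are built up by letters from the left, which matches the way in which words act on modules.\<close>

lemma free_alg_induct [consumes 1, case_names scalar letter add]:
  assumes p: "p \<in>. (free_alg K X)"
    and scalar: "\<And>c. c \<in>. K \<Longrightarrow> Q (c \<cdot>[free_alg K X] \<one>[free_alg K X])"
    and letter: "\<And>s p. s \<in> X \<Longrightarrow> p \<in>. (free_alg K X) \<Longrightarrow> Q p \<Longrightarrow> Q (letter K s *[free_alg K X] p)"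
    and add: "\<And>p q. p \<in>. (free_alg K X) \<Longrightarrow> q \<in>. (free_alg K X) \<Longrightarrow> Q p \<Longrightarrow> Q q
      \<Longrightarrow> Q (p +[free_alg K X] q)"
  shows "Q p"
proof -
  define single where "single c w = (\<lambda>u :: 'a list. if u = w then c else \<zero>[K])" for c :: 'k and w
  have sc: "single c w \<in>. (free_alg K X)" if "c \<in>. K" "w \<in> lists X" for c w
    using that by (auto simp: free_alg_simps single_def)
  have single: "Q (single c w)" if c: "c \<in>. K" and "w \<in> lists X" for c w
    using that(2)
  proof (induction w)
    case Nil
    have "single c [] = c \<cdot>[free_alg K X] \<one>[free_alg K X]"
      using c by (auto simp: single_def free_alg_simps)
    then show ?case using scalar[OF c] by simp
  next
    case (Cons s w)
    have "letter K s *[free_alg K X] single c w = single c (s # w)"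
      using sc[OF c Cons(2)] by (auto simp: free_alg_simps conv_letter single_def split: list.split intro!: ext)
    then show ?case using letter[OF Cons(1) sc[OF c Cons(2)] Cons(3)] by simp
  qed
  have "\<forall>p \<in> carrier (free_alg K X). {w. p w \<noteq> \<zero>[K]} \<subseteq> W \<longrightarrow> Q p" if "finite W" for W
    using that
  proof (induction W)
    case empty
    have "Q (single \<zero>[K] [])" by (rule single) auto
    moreover have "p = single \<zero>[K] []" if "{w. p w \<noteq> \<zero>[K]} \<subseteq> {}" for p
      using that by (auto simp: single_def)
    ultimately show ?case by auto
  next
    case (insert w W)
    show ?case
    proof (intro ballI impI)
      fix p assume p: "p \<in>. (free_alg K X)" and sub: "{u. p u \<noteq> \<zero>[K]} \<subseteq> insert w W"
      show "Q p"
      proof (cases "w \<in> lists X")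
        case True
        let ?q = "p (w := \<zero>[K])"
        have q: "?q \<in>. (free_alg K X)"
          using p by (auto simp: free_alg_simps intro: rev_finite_subset)
        moreover have "{u. ?q u \<noteq> \<zero>[K]} \<subseteq> W" using sub by auto
        ultimately have "Q ?q" using insert by blast
        moreover have "p = single (p w) w +[free_alg K X] ?q"
          using p by (auto simp: free_alg_simps single_def)
        moreover have "p w \<in>. K" using p by (simp add: free_alg_simps)
        ultimately show ?thesis using add[OF sc q] single True by metis
      next
        case False
        then have "{u. p u \<noteq> \<zero>[K]} \<subseteq> W" using p sub by (auto simp: free_alg_simps)
        then show ?thesis using insert p by blast
      qed
    qed
  qed
  then show ?thesis using p by (auto simp: free_alg_simps(1))
qed

end


section \<open>Quotient algebras\<close>

context
  fixes K :: "('k, 'y) ring_scheme" and A :: "('k, 'a, 'z) module_scheme" and I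
  assumes A: "k_algebra K A" and I: "ideal I A"
begin

interpretation A: k_algebra K A by (rule A)
interpretation I: ideal I A by (rule I)

abbreviation "cls a \<equiv> I +>\<^bsub>A\<^esub> a"

lemma quot_simps:
  "carrier (quot_alg A I) = cls ` carrier A"
  "a \<in>. A \<Longrightarrow> b \<in>. A \<Longrightarrow> cls a *[quot_alg A I] cls b = cls (a *[A] b)"
  "a \<in>. A \<Longrightarrow> b \<in>. A \<Longrightarrow> cls a +[quot_alg A I] cls b = cls (a +[A] b)"
  "\<one>[quot_alg A I] = cls \<one>[A]" "\<zero>[quot_alg A I] = cls \<zero>[A]"
  using I.rcos_ring_hom A.a_rcos_zero[OF I I.zero_closed]
  by (auto simp: quot_alg_def ring.defs ring_hom_def FactRing_def A_RCOSETS_def')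

lemma cls_eq: "a \<in>. A \<Longrightarrow> b \<in>. A \<Longrightarrow> cls a = cls b \<longleftrightarrow> a \<ominus>\<^bsub>A\<^esub> b \<in> I"
  using A.quotient_eq_iff_same_a_r_cos[OF I] by simp

lemma cls_self: "a \<in>. A \<Longrightarrow> a \<in> cls a"
  using I.a_rcos_self by simp

lemma mem_cls:
  assumes a: "a \<in>. A" and z: "z \<in> cls a"
  shows "z \<in>. A \<and> cls z = cls a"
proof -
  obtain i where i: "i \<in> I" "z = i +[A] a" using z by (auto simp: a_r_coset_def')
  have iA: "i \<in>. A" using I.Icarr[OF i(1)] .
  then have "z \<ominus>\<^bsub>A\<^esub> a = i" using i(2) a by (simp add: a_minus_def A.a_assoc A.r_neg)
  then show ?thesis using i iA a by (simp add: cls_eq)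
qed

lemma smult_ideal: "c \<in>. K \<Longrightarrow> z \<in> I \<Longrightarrow> c \<cdot>[A] z \<in> I"
  using I.I_l_closed[of z "c \<cdot>[A] \<one>[A]"] I.Icarr[of z] scal_mult(1)[OF A, of c z] by simp

lemma quot_smult:
  assumes c: "c \<in>. K" and a: "a \<in>. A"
  shows "c \<cdot>[quot_alg A I] cls a = cls (c \<cdot>[A] a)"
proof -
  have "cls (c \<cdot>[A] z) = cls (c \<cdot>[A] a)" if z: "z \<in> cls a" for z
  proof -
    have z': "z \<in>. A" "z \<ominus>\<^bsub>A\<^esub> a \<in> I" using mem_cls[OF a z] cls_eq a by auto
    have "c \<cdot>[A] z \<ominus>\<^bsub>A\<^esub> c \<cdot>[A] a = c \<cdot>[A] (z \<ominus>\<^bsub>A\<^esub> a)"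
      using c a z' by (simp add: a_minus_def A.smult_r_distr A.smult_r_minus)
    then show ?thesis using smult_ideal[OF c z'(2)] cls_eq c a z' by simp
  qed
  then have "(\<lambda>z. cls (c \<cdot>[A] z)) ` cls a = {cls (c \<cdot>[A] a)}" using cls_self[OF a] by blast
  then show ?thesis by (simp add: quot_alg_def ring.defs)
qed

lemma quot_abelian_group: "abelian_group (quot_alg A I)"
proof -
  interpret Q: ring "A Quot I" by (rule I.quotient_is_ring)
  show ?thesis by (rule abelian_group_fields[OF Q.is_abelian_group]) (simp_all add: quot_alg_def ring.defs)
qed

lemma quot_module: "module K (quot_alg A I)" by (rule moduleI[OF module_cring[OF k_algebra_module[OF A]] quot_abelian_group])
    (auto simp: quot_simps quot_smult A.smult_l_distr A.smult_r_distr A.smult_assoc1)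

lemma quot_k_algebra: "k_algebra K (quot_alg A I)"
proof (rule k_algebraI[OF quot_module])
  show "lin K (quot_alg A I) (quot_alg A I) (\<lambda>x. x *[quot_alg A I] y)" if "y \<in>. (quot_alg A I)" for y
    using that by (intro linI) (auto simp: quot_simps quot_smult A.l_distr k_algebra_smult_left[OF A])
  show "lin K (quot_alg A I) (quot_alg A I) (\<lambda>y. x *[quot_alg A I] y)" if "x \<in>. (quot_alg A I)" for x
    using that by (intro linI) (auto simp: quot_simps quot_smult A.r_distr k_algebra_smult_right[OF A])
qed (auto simp: quot_simps A.m_assoc)

lemma cls_lin: "lin K A (quot_alg A I) (\<lambda>a. cls a)" by (rule linI) (auto simp: quot_simps quot_smult)

text \<open>The elements that act by zero form a two-sided ideal; it contains the generators of \<open>I\<close>, hence \<open>I\<close>.\<close>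

lemma left_module_quot:
  assumes M: "left_module A M" and G: "I = Idl\<^bsub>A\<^esub> G" "G \<subseteq> carrier A"
    and zero: "\<forall>g \<in> G. \<forall>m \<in> carrier M. g \<cdot>[M] m = \<zero>[M]"
  defines "N \<equiv> with_smult M (\<lambda>Z m. the_elem ((\<lambda>z. z \<cdot>[M] m) ` Z))"
  shows "left_module (quot_alg A I) N"
    and "\<And>a z m. a \<in>. A \<Longrightarrow> z \<in> cls a \<Longrightarrow> m \<in>. M \<Longrightarrow> cls a \<cdot>[N] m = z \<cdot>[M] m"
proof -
  note f = left_module_facts[OF M]
  interpret M: abelian_group M by (rule f(2))
  let ?J = "{a \<in> carrier A. \<forall>m \<in> carrier M. a \<cdot>[M] m = \<zero>[M]}"
  have z0: "\<zero>[A] \<cdot>[M] m = \<zero>[M]" if "m \<in>. M" for m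
    by (rule additive_zero[OF f(5)[OF that] A.is_abelian_group f(2)])
  have a0: "a \<cdot>[M] \<zero>[M] = \<zero>[M]" if "a \<in>. A" for a by (rule additive_zero[OF f(4)[OF that] f(2) f(2)])
  have neg: "(\<ominus>\<^bsub>A\<^esub> a) \<cdot>[M] m = \<ominus>\<^bsub>M\<^esub> (a \<cdot>[M] m)" if "a \<in>. A" "m \<in>. M" for a m
    by (rule additive_minus[OF f(5)[OF that(2)] A.is_abelian_group f(2) that(1)])
  have "ideal ?J A"
  proof (rule idealI[OF A.ring_axioms])
    show "subgroup ?J (add_monoid A)"
      by (rule A.add.subgroupI) (use z0 neg additive_add[OF f(5)] in \<open>auto simp: a_inv_def[symmetric]\<close>)
  qed (auto simp: f(6) f(3) a0)
  then have J: "I \<subseteq> ?J" unfolding G(1) by (rule A.genideal_minimal) (use zero G(2) in auto)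
  show cls: "cls a \<cdot>[N] m = z \<cdot>[M] m" if a: "a \<in>. A" and z: "z \<in> cls a" and m: "m \<in>. M" for a z m
  proof -
    have eq: "y \<cdot>[M] m = a \<cdot>[M] m" if "y \<in> cls a" for y
    proof -
      have y: "y \<in>. A" "y \<ominus>\<^bsub>A\<^esub> a \<in> ?J" using mem_cls[OF a that] cls_eq a J by auto
      have "y = (y \<ominus>\<^bsub>A\<^esub> a) +[A] a" using y a by (simp add: a_minus_def A.a_assoc A.l_neg)
      then have "y \<cdot>[M] m = (y \<ominus>\<^bsub>A\<^esub> a) \<cdot>[M] m +[M] a \<cdot>[M] m"
        using additive_add[OF f(5)[OF m]] y a by (metis (no_types, lifting) A.minus_closed)
      then show ?thesis using y a m f(3) by simp
    qed
    then have "(\<lambda>z. z \<cdot>[M] m) ` cls a = {a \<cdot>[M] m}" using cls_self[OF a] by blast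
    then show ?thesis using eq[OF z] by (simp add: N_def)
  qed
  have cls': "cls a \<cdot>[N] m = a \<cdot>[M] m" if "a \<in>. A" "m \<in>. M" for a m
    using cls[OF that(1) cls_self[OF that(1)] that(2)] .
  have gN: "abelian_group N" unfolding N_def by (rule with_smult_group[OF f(2)])
  have N [simp]: "carrier N = carrier M" "add N = add M" by (simp_all add: N_def)
  show "left_module (quot_alg A I) N" by (rule left_moduleI[OF k_algebra_ring[OF quot_k_algebra] gN])
      (auto simp: quot_simps cls' f(3,6,7) additive_add[OF f(4)] additive_add[OF f(5)] intro!: additiveI)
qed

end


section \<open>Actions of the free algebra\<close>

text \<open>The value on a single representative in \<open>hpar_action\<close>.\<close>

definition word_action ::
  "('k, 'y) ring_scheme \<Rightarrow> ('k, 'v, 'z) module_scheme \<Rightarrow> ('s \<Rightarrow> 'v \<Rightarrow> 'v) \<Rightarrow> ('s list \<Rightarrow> 'k) \<Rightarrow> 'v \<Rightarrow> 'v" where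
  "word_action K V \<phi> p v = (\<Oplus>\<^bsub>V\<^esub>w \<in> {w. p w \<noteq> \<zero>[K]}. p w \<cdot>[V] foldr \<phi> w v)"

context
  fixes K :: "'k ring" and V :: "('k, 'v, 'z) module_scheme" and X :: "'s set" and \<phi> :: "'s \<Rightarrow> 'v \<Rightarrow> 'v"
  assumes V: "module K V" and \<phi>: "\<And>s. s \<in> X \<Longrightarrow> lin K V V (\<phi> s)"
begin

interpretation V: module K V by (rule V)

lemma foldr_closed: "w \<in> lists X \<Longrightarrow> v \<in>. V \<Longrightarrow> foldr \<phi> w v \<in>. V"
  by (induction w) (auto simp: lin_closed[OF \<phi>])

lemma foldr_add: "w \<in> lists X \<Longrightarrow> v \<in>. V \<Longrightarrow> v' \<in>. V
    \<Longrightarrow> foldr \<phi> w (v +[V] v') = foldr \<phi> w v +[V] foldr \<phi> w v'"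
  by (induction w) (auto simp: lin_add[OF \<phi>] foldr_closed)

lemmas fs = free_alg_simps[OF V.R.cring_axioms]

lemma word_action_superset:
  assumes p: "p \<in>. (free_alg K X)" and v: "v \<in>. V"
    and "finite W" "{w. p w \<noteq> \<zero>[K]} \<subseteq> W" "W \<subseteq> lists X"
  shows "word_action K V \<phi> p v = (\<Oplus>\<^bsub>V\<^esub>w \<in> W. p w \<cdot>[V] foldr \<phi> w v)"
  unfolding word_action_def
proof (rule V.M.add.finprod_mono_neutral_cong_left)
  have wl: "w \<in> lists X" if "w \<in> W" for w using that assms(5) by blast
  have cl: "p w \<cdot>[V] foldr \<phi> w v \<in>. V" if "w \<in> W" for w
    using foldr_closed[OF wl[OF that] v] p by (simp add: fs(1))
  then show "(\<lambda>w. p w \<cdot>[V] foldr \<phi> w v) \<in> W \<rightarrow> carrier V" by auto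
  show "p w \<cdot>[V] foldr \<phi> w v = \<zero>[V]" if "w \<in> W - {w. p w \<noteq> \<zero>[K]}" for w
    using foldr_closed[of w v] wl[of w] v that by simp
qed (use assms in auto)

lemma support:
  assumes "p \<in>. (free_alg K X)"
  shows "finite {w. p w \<noteq> \<zero>[K]}" "{w. p w \<noteq> \<zero>[K]} \<subseteq> lists X"
  using assms by (auto simp: fs(1))

lemma word_action_closed:
  assumes "p \<in>. (free_alg K X)" "v \<in>. V"
  shows "word_action K V \<phi> p v \<in>. V"
proof -
  have "w \<in> lists X" "p w \<in>. K" if "w \<in> {w. p w \<noteq> \<zero>[K]}" for w
    using that support[OF assms(1)] assms(1) unfolding fs(1) by blast+
  then show ?thesis
    unfolding word_action_def using foldr_closed assms(2) by (intro V.M.finsum_closed) blast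
qed

lemma word_action_add_vector:
  assumes p: "p \<in>. (free_alg K X)" and v: "v \<in>. V" "v' \<in>. V"
  shows "word_action K V \<phi> p (v +[V] v') = word_action K V \<phi> p v +[V] word_action K V \<phi> p v'"
proof -
  let ?W = "{w. p w \<noteq> \<zero>[K]}"
  have c: "w \<in> ?W \<Longrightarrow> w \<in> lists X" "p w \<in>. K" for w using support[OF p] p by (auto simp: fs(1))
  have "word_action K V \<phi> p (v +[V] v') = (\<Oplus>\<^bsub>V\<^esub>w \<in> ?W. p w \<cdot>[V] foldr \<phi> w v +[V] p w \<cdot>[V] foldr \<phi> w v')"
    unfolding word_action_def
  proof (rule V.M.finsum_cong')
    fix w assume "w \<in> ?W"
    then have w: "w \<in> lists X" using c by blast
    then show "p w \<cdot>[V] foldr \<phi> w (v +[V] v') = p w \<cdot>[V] foldr \<phi> w v +[V] p w \<cdot>[V] foldr \<phi> w v'"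
      using c v by (simp add: foldr_add foldr_closed V.smult_r_distr)
  qed (use c v foldr_closed in auto)
  also have "\<dots> = word_action K V \<phi> p v +[V] word_action K V \<phi> p v'"
    unfolding word_action_def by (rule V.M.finsum_addf) (use c v foldr_closed in auto)
  finally show ?thesis .
qed

lemma word_action_add:
  assumes p: "p \<in>. (free_alg K X)" "q \<in>. (free_alg K X)" and v: "v \<in>. V"
  shows "word_action K V \<phi> (p +[free_alg K X] q) v = word_action K V \<phi> p v +[V] word_action K V \<phi> q v"
proof -
  let ?W = "{w. p w \<noteq> \<zero>[K]} \<union> {w. q w \<noteq> \<zero>[K]}" and ?pq = "p +[free_alg K X] q"
  have W: "finite ?W" "?W \<subseteq> lists X" using support[OF p(1)] support[OF p(2)] by auto
  have c: "w \<in> ?W \<Longrightarrow> w \<in> lists X" "p w \<in>. K" "q w \<in>. K" for w using W p by (auto simp: fs(1))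
  have "?pq \<in>. (free_alg K X)" by (rule module_add_closed[OF free_alg_module[OF V.R.cring_axioms] p])
  then have "word_action K V \<phi> ?pq v = (\<Oplus>\<^bsub>V\<^esub>w \<in> ?W. ?pq w \<cdot>[V] foldr \<phi> w v)"
    by (rule word_action_superset[OF _ v W(1) _ W(2)]) (use c(2,3) in \<open>auto simp: fs(4)\<close>)
  also have "\<dots> = (\<Oplus>\<^bsub>V\<^esub>w \<in> ?W. p w \<cdot>[V] foldr \<phi> w v +[V] q w \<cdot>[V] foldr \<phi> w v)"
  proof (rule V.M.finsum_cong')
    fix w assume "w \<in> ?W"
    then have w: "w \<in> lists X" using c by blast
    then show "?pq w \<cdot>[V] foldr \<phi> w v = p w \<cdot>[V] foldr \<phi> w v +[V] q w \<cdot>[V] foldr \<phi> w v"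
      using c v by (simp add: fs(4) foldr_closed V.smult_l_distr)
  qed (use c v foldr_closed in auto)
  also have "\<dots> = (\<Oplus>\<^bsub>V\<^esub>w \<in> ?W. p w \<cdot>[V] foldr \<phi> w v) +[V] (\<Oplus>\<^bsub>V\<^esub>w \<in> ?W. q w \<cdot>[V] foldr \<phi> w v)"
    by (rule V.M.finsum_addf) (use c v foldr_closed in auto)
  also have "\<dots> = word_action K V \<phi> p v +[V] word_action K V \<phi> q v"
    using word_action_superset[OF p(1) v W(1) Un_upper1 W(2)] word_action_superset[OF p(2) v W(1) Un_upper2 W(2)] by simp
  finally show ?thesis .
qed

lemma word_action_scalar:
  assumes c: "c \<in>. K" and v: "v \<in>. V"
  shows "word_action K V \<phi> (c \<cdot>[free_alg K X] \<one>[free_alg K X]) v = c \<cdot>[V] v"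
proof -
  have "c \<cdot>[free_alg K X] \<one>[free_alg K X] \<in>. (free_alg K X)"
    by (rule module_smult_closed[OF k_algebra_module c k_algebra_one_closed]; rule free_alg_k_algebra[OF V.R.cring_axioms])
  then have "word_action K V \<phi> (c \<cdot>[free_alg K X] \<one>[free_alg K X]) v =
     (\<Oplus>\<^bsub>V\<^esub>w \<in> {[]}. (c \<cdot>[free_alg K X] \<one>[free_alg K X]) w \<cdot>[V] foldr \<phi> w v)"
    by (rule word_action_superset[OF _ v]) (use c in \<open>auto simp: fs split: if_splits\<close>)
  then show ?thesis using c v by (simp add: fs)
qed

lemma word_action_letter:
  assumes s: "s \<in> X" and q: "q \<in>. (free_alg K X)" and v: "v \<in>. V"
  shows "word_action K V \<phi> (letter K s *[free_alg K X] q) v = \<phi> s (word_action K V \<phi> q v)"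
proof -
  let ?W = "{w. q w \<noteq> \<zero>[K]}" and ?p = "letter K s *[free_alg K X] q"
  have co: "\<forall>w. q w \<in>. K" using q by (simp add: fs(1))
  have c: "w \<in> ?W \<Longrightarrow> w \<in> lists X" "q w \<in>. K" for w using support[OF q] q by (auto simp: fs(1))
  have pw: "?p w = (case w of [] \<Rightarrow> \<zero>[K] | a # u \<Rightarrow> if a = s then q u else \<zero>[K])" for w
    unfolding fs(2) by (rule conv_letter[OF V.R.cring_axioms co])
  have p: "?p \<in>. (free_alg K X)"
    by (rule k_algebra_mult_closed[OF free_alg_k_algebra[OF V.R.cring_axioms] letter_closed[OF V.R.cring_axioms s] q])
  have "word_action K V \<phi> ?p v = (\<Oplus>\<^bsub>V\<^esub>w \<in> (#) s ` ?W. ?p w \<cdot>[V] foldr \<phi> w v)"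
  proof (rule word_action_superset[OF p v])
    show "{w. ?p w \<noteq> \<zero>[K]} \<subseteq> (#) s ` ?W"
    proof
      fix w assume "w \<in> {w. ?p w \<noteq> \<zero>[K]}"
      then show "w \<in> (#) s ` ?W" unfolding pw by (cases w) (auto split: if_splits)
    qed
    show "(#) s ` ?W \<subseteq> lists X"
    proof (rule image_subsetI)
      fix w assume "w \<in> ?W"
      then show "s # w \<in> lists X" using c(1)[of w] s by simp
    qed
  qed (use support(1)[OF q] in auto)
  also have "\<dots> = (\<Oplus>\<^bsub>V\<^esub>w \<in> ?W. ?p (s # w) \<cdot>[V] foldr \<phi> (s # w) v)"
    by (rule V.M.add.finprod_reindex) (use c s v foldr_closed lin_closed[OF \<phi>[OF s]] in \<open>auto simp: pw\<close>)
  also have "\<dots> = (\<Oplus>\<^bsub>V\<^esub>w \<in> ?W. \<phi> s (q w \<cdot>[V] foldr \<phi> w v))"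
    by (rule V.M.finsum_cong') (use c s v foldr_closed lin_closed[OF \<phi>[OF s]] lin_smult[OF \<phi>[OF s]] in \<open>auto simp: pw\<close>)
  also have "\<dots> = \<phi> s (word_action K V \<phi> q v)"
    unfolding word_action_def
    by (rule additive_finsum[symmetric, OF V.M.abelian_group_axioms V.M.abelian_group_axioms lin_additive[OF \<phi>[OF s]] support(1)[OF q]])
      (use c v foldr_closed in auto)
  finally show ?thesis .
qed

text \<open>By induction on the left factor only products with a letter have to be considered.\<close>

lemma word_action_mult:
  assumes p: "p \<in>. (free_alg K X)" and q: "q \<in>. (free_alg K X)" and v: "v \<in>. V"
  shows "word_action K V \<phi> (p *[free_alg K X] q) v = word_action K V \<phi> p (word_action K V \<phi> q v)"
proof -
  note F = free_alg_k_algebra[OF V.R.cring_axioms, of X]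
  interpret F: ring "free_alg K X" by (rule k_algebra_ring[OF F])
  have qv: "word_action K V \<phi> q v \<in>. V" by (rule word_action_closed[OF q v])
  show ?thesis
    using p
  proof (induction rule: free_alg_induct[OF V.R.cring_axioms, consumes 1, case_names scalar letter add])
    case (scalar c)
    have cq: "(c \<cdot>[free_alg K X] \<one>[free_alg K X]) *[free_alg K X] q = c \<cdot>[free_alg K X] q"
      by (rule scal_mult[OF F scalar q])
    have "word_action K V \<phi> (c \<cdot>[free_alg K X] q) v = c \<cdot>[V] word_action K V \<phi> q v"
    proof -
      have cl: "w \<in> {w. q w \<noteq> \<zero>[K]} \<Longrightarrow> w \<in> lists X" "q w \<in>. K" for w using support[OF q] q by (auto simp: fs(1))
      have "word_action K V \<phi> (c \<cdot>[free_alg K X] q) v =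
         (\<Oplus>\<^bsub>V\<^esub>w \<in> {w. q w \<noteq> \<zero>[K]}. (c \<cdot>[free_alg K X] q) w \<cdot>[V] foldr \<phi> w v)"
        by (rule word_action_superset[OF module_smult_closed[OF k_algebra_module[OF F] scalar q] v])
          (use support[OF q] scalar in \<open>auto simp: fs(6)\<close>)
      also have "\<dots> = (\<Oplus>\<^bsub>V\<^esub>w \<in> {w. q w \<noteq> \<zero>[K]}. c \<cdot>[V] (q w \<cdot>[V] foldr \<phi> w v))"
        by (rule V.M.finsum_cong') (use cl scalar v foldr_closed in \<open>auto simp: fs(6) V.smult_assoc1\<close>)
      also have "\<dots> = c \<cdot>[V] word_action K V \<phi> q v"
        unfolding word_action_def
        by (rule additive_finsum[symmetric, OF V.M.abelian_group_axioms V.M.abelian_group_axioms _ support(1)[OF q]])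
          (use cl scalar v foldr_closed in \<open>auto simp: additive_def V.smult_r_distr\<close>)
      finally show ?thesis .
    qed
    then show ?case using cq word_action_scalar[OF scalar qv] by simp
  next
    case (letter s p)
    then show ?case
      using word_action_letter[OF letter(1)] q v qv letter_closed[OF V.R.cring_axioms letter(1)] by (simp add: F.m_assoc)
  next
    case (add p p')
    then show ?case using q v qv by (simp add: F.l_distr word_action_add)
  qed
qed

lemma word_action_left_module: "left_module (free_alg K X) (with_smult V (word_action K V \<phi>))"
proof (rule left_moduleI)
  note F = free_alg_k_algebra[OF V.R.cring_axioms, of X]
  show "ring (free_alg K X)" by (rule k_algebra_ring[OF F])
  show "abelian_group (with_smult V (word_action K V \<phi>))" by (rule with_smult_group) (rule V.M.abelian_group_axioms)
  show "\<one>[free_alg K X] \<cdot>[with_smult V (word_action K V \<phi>)] x = x" if "x \<in>. (with_smult V (word_action K V \<phi>))" for x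
    using word_action_scalar[of "\<one>[K]" x] module.smult_one[OF k_algebra_module[OF F] k_algebra_one_closed[OF F]] that by simp
qed (auto intro!: additiveI simp: word_action_closed word_action_add_vector word_action_add word_action_mult)

end

lemma image_eq_singleton: "a \<in> A \<Longrightarrow> (\<And>x. x \<in> A \<Longrightarrow> f x = c) \<Longrightarrow> f ` A = {c}"
  by auto

section \<open>The algebra \<open>H\<^sub>p\<^sub>a\<^sub>r\<close>\<close>

context cocommutative_hopf_algebra
begin

abbreviation "FF \<equiv> free_alg K (carrier H)"
abbreviation "TA \<equiv> tensor_algebra K H"
abbreviation "Q \<equiv> hpar K H"
abbreviation "tg \<equiv> tgen K H"
abbreviation "hc \<equiv> hclass K H"

lemma FF_alg: "k_algebra K FF" by (rule free_alg_k_algebra[OF K_cring])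

definition "lin_gens = {letter K (x +[H] y) \<ominus>\<^bsub>FF\<^esub> (letter K x +[FF] letter K y) | x y.
           x \<in>. H \<and> y \<in>. H} \<union>
        {letter K (c \<cdot>[H] x) \<ominus>\<^bsub>FF\<^esub> c \<cdot>[FF] letter K x | c x. c \<in>. K \<and> x \<in>. H}"

lemma lin_gens_sub: "lin_gens \<subseteq> carrier FF"
proof -
  interpret F: k_algebra K FF by (rule FF_alg)
  show ?thesis unfolding lin_gens_def
    using module_add_closed[OF H_mod] module_smult_closed[OF H_mod]
    by (auto intro!: F.minus_closed F.M.a_closed F.smult_closed letter_closed[OF K_cring])
qed

lemma linear_ideal_eq: "linear_ideal K H = Idl\<^bsub>FF\<^esub> lin_gens" by (simp add: linear_ideal_def Let_def lin_gens_def)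

lemma linear_ideal_ideal: "ideal (linear_ideal K H) FF"
  unfolding linear_ideal_eq by (rule ring.genideal_ideal[OF k_algebra_ring[OF FF_alg] lin_gens_sub])

lemma TA_alg: "k_algebra K TA"
  unfolding tensor_algebra_def by (rule quot_k_algebra[OF FF_alg linear_ideal_ideal])

lemma tg_lin: "lin K H TA tg"
proof -
  interpret F: k_algebra K FF by (rule FF_alg)
  note qs = quot_simps[OF FF_alg linear_ideal_ideal] quot_smult[OF FF_alg linear_ideal_ideal]
  note l = letter_closed[OF K_cring, of _ "carrier H"]
  have self: "g \<in> lin_gens \<Longrightarrow> g \<in> linear_ideal K H" for g
    using ring.genideal_self[OF k_algebra_ring[OF FF_alg] lin_gens_sub] by (auto simp: linear_ideal_eq)
  show ?thesis
    unfolding tensor_algebra_def tgen_def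
  proof (rule linI)
    fix x y assume xy: "x \<in>. H" "y \<in>. H"
    then have xy': "x +[H] y \<in>. H" by (rule module_add_closed[OF H_mod])
    have "letter K (x +[H] y) \<ominus>\<^bsub>FF\<^esub> (letter K x +[FF] letter K y) \<in> linear_ideal K H"
      by (rule self) (use xy in \<open>auto simp: lin_gens_def\<close>)
    then show "linear_ideal K H +>\<^bsub>FF\<^esub> letter K (x +[H] y) =
        (linear_ideal K H +>\<^bsub>FF\<^esub> letter K x) +[quot_alg FF (linear_ideal K H)] (linear_ideal K H +>\<^bsub>FF\<^esub> letter K y)"
      using cls_eq[OF FF_alg linear_ideal_ideal l[OF xy'], of "letter K x +[FF] letter K y"] l xy by (simp add: qs)
  next
    fix c x assume cx: "c \<in>. K" "x \<in>. H"
    then have cx': "c \<cdot>[H] x \<in>. H" by (rule module_smult_closed[OF H_mod])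
    have "letter K (c \<cdot>[H] x) \<ominus>\<^bsub>FF\<^esub> c \<cdot>[FF] letter K x \<in> linear_ideal K H"
      by (rule self) (use cx in \<open>auto simp: lin_gens_def\<close>)
    then show "linear_ideal K H +>\<^bsub>FF\<^esub> letter K (c \<cdot>[H] x) =
        c \<cdot>[quot_alg FF (linear_ideal K H)] (linear_ideal K H +>\<^bsub>FF\<^esub> letter K x)"
      using cls_eq[OF FF_alg linear_ideal_ideal l[OF cx'], of "c \<cdot>[FF] letter K x"] l cx by (simp add: qs)
  qed (simp add: qs l)
qed

lemma lin_tg: "lin K L H f \<Longrightarrow> lin K L TA (\<lambda>x. tg (f x))" by (rule lin_comp[OF tg_lin])

lemma lin_mult_TA:
  "lin K L TA f \<Longrightarrow> a \<in>. TA \<Longrightarrow> lin K L TA (\<lambda>x. f x *[TA] a)"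
  "lin K L TA f \<Longrightarrow> a \<in>. TA \<Longrightarrow> lin K L TA (\<lambda>x. a *[TA] f x)"
  by (rule lin_mult_left[OF TA_alg] lin_mult_right[OF TA_alg]; assumption)+

lemmas tensor_alg_rules = lin_rules hopf_closed TA_alg k_algebra_module[OF TA_alg] lin_tg lin_mult_TA lin_closed[OF tg_lin]
  k_algebra_mult_closed[OF TA_alg] k_algebra_one_closed[OF TA_alg]

text \<open>Of the four families of relations that define \<open>H\<^sub>p\<^sub>a\<^sub>r\<close> the last two arise from the first two by
  replacing the argument of the coproduct by its antipode, since \<open>H\<close> is cocommutative.\<close>

definition "rel_right h k =
  sw TA k (\<lambda>x y. tg h *[TA] tg x *[TA] tg (S y)) \<ominus>\<^bsub>TA\<^esub> sw TA k (\<lambda>x y. tg (h *[H] x) *[TA] tg (S y))"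

definition "rel_left h k =
  sw TA h (\<lambda>x y. tg x *[TA] tg (S y) *[TA] tg k) \<ominus>\<^bsub>TA\<^esub> sw TA h (\<lambda>x y. tg x *[TA] tg (S y *[H] k))"

definition "par_gens = {tg \<one>[H] \<ominus>\<^bsub>TA\<^esub> \<one>[TA]} \<union> {rel_right h k | h k. h \<in>. H \<and> k \<in>. H} \<union>
  {rel_left h k | h k. h \<in>. H \<and> k \<in>. H}"

lemma rel_right_antipode:
  assumes "h \<in>. H" "k \<in>. H"
  shows "sw TA k (\<lambda>x y. tg h *[TA] tg (S x) *[TA] tg y) \<ominus>\<^bsub>TA\<^esub> sw TA k (\<lambda>x y. tg (h *[H] S x) *[TA] tg y) = rel_right h (S k)"
  unfolding rel_right_def
  by (intro arg_cong2[where f = "\<lambda>a b. a \<ominus>\<^bsub>TA\<^esub> b"]; rule sw_antipode_move; use assms in \<open>simp add: tensor_alg_rules\<close>)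

lemma rel_left_antipode:
  assumes "h \<in>. H" "k \<in>. H"
  shows "sw TA h (\<lambda>x y. tg (S x) *[TA] tg y *[TA] tg k) \<ominus>\<^bsub>TA\<^esub> sw TA h (\<lambda>x y. tg (S x) *[TA] tg (y *[H] k)) = rel_left (S h) k"
  unfolding rel_left_def
  by (intro arg_cong2[where f = "\<lambda>a b. a \<ominus>\<^bsub>TA\<^esub> b"]; rule sw_antipode_move; use assms in \<open>simp add: tensor_alg_rules\<close>)

lemma hpar_ideal_eq: "hpar_ideal K H = Idl\<^bsub>TA\<^esub> par_gens"
proof -
  let ?A = "{rel_right h k | h k. h \<in>. H \<and> k \<in>. H}" and ?B = "{rel_left h k | h k. h \<in>. H \<and> k \<in>. H}"
  have cong: "{f h k | h k. h \<in>. H \<and> k \<in>. H} = {g h k | h k. h \<in>. H \<and> k \<in>. H}"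
    if "\<And>h k. h \<in>. H \<Longrightarrow> k \<in>. H \<Longrightarrow> f h k = g h k" for f g :: "'b \<Rightarrow> 'b \<Rightarrow> ('b list \<Rightarrow> 'a) set"
  proof (intro Collect_cong ex_cong1)
    show "(u = f h k \<and> h \<in>. H \<and> k \<in>. H) = (u = g h k \<and> h \<in>. H \<and> k \<in>. H)" for u h k
      using that[of h k] by auto
  qed
  have absorb: "X \<union> A \<union> B = X \<union> A \<union> B \<union> C \<union> D" if "C \<subseteq> A" "D \<subseteq> B" for X A B C D :: "('b list \<Rightarrow> 'a) set set"
    using that by blast
  have "par_gens = {tg \<one>[H] \<ominus>\<^bsub>TA\<^esub> \<one>[TA]} \<union> ?A \<union> ?B \<union>
      {rel_right h (S k) | h k. h \<in>. H \<and> k \<in>. H} \<union> {rel_left (S h) k | h k. h \<in>. H \<and> k \<in>. H}"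
    unfolding par_gens_def by (rule absorb) (use antipode_closed in blast)+
  then show ?thesis
    unfolding hpar_ideal_def Let_def by (simp only: cong[OF rel_right_antipode] cong[OF rel_left_antipode])
      (simp only: rel_right_def[symmetric] rel_left_def[symmetric])
qed

lemma par_gens_sub: "par_gens \<subseteq> carrier TA"
proof -
  interpret T: k_algebra K TA by (rule TA_alg)
  show ?thesis unfolding par_gens_def rel_right_def rel_left_def
    apply (rule subsetI)
    apply (elim UnE CollectE exE conjE singletonE; simp only:; rule T.minus_closed)
             apply (simp_all add: tensor_alg_rules sw_closed')
    done
qed

lemma hpar_ideal_ideal: "ideal (hpar_ideal K H) TA"
  unfolding hpar_ideal_eq by (rule ring.genideal_ideal[OF k_algebra_ring[OF TA_alg] par_gens_sub])

lemma Q_alg: "k_algebra K Q"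
  unfolding hpar_def by (rule quot_k_algebra[OF TA_alg hpar_ideal_ideal])

lemmas Q_assoc = k_algebra_assoc[OF Q_alg] and Q_l_one = k_algebra_l_one[OF Q_alg] and Q_r_one = k_algebra_r_one[OF Q_alg]

lemma Q_mod: "module K Q" by (rule k_algebra_module[OF Q_alg])

abbreviation "qc t \<equiv> hpar_ideal K H +>\<^bsub>TA\<^esub> t"

lemma qc_lin: "lin K TA Q (\<lambda>t. qc t)"
  unfolding hpar_def by (rule cls_lin[OF TA_alg hpar_ideal_ideal])

lemmas Q_simps = quot_simps[OF TA_alg hpar_ideal_ideal, folded hpar_def]

lemma hc_qc: "hc h = qc (tg h)" by (simp add: hclass_def)

lemma hc_lin: "lin K H Q hc"
  using lin_comp[OF qc_lin tg_lin] by (simp add: hclass_def[abs_def])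

lemma hc_closed: "h \<in>. H \<Longrightarrow> hc h \<in>. Q" by (rule lin_closed[OF hc_lin])

lemma lin_hc: "lin K L H f \<Longrightarrow> lin K L Q (\<lambda>x. hc (f x))" by (rule lin_comp[OF hc_lin])

lemma mult_Q_closed: "s \<in>. Q \<Longrightarrow> t \<in>. Q \<Longrightarrow> s *[Q] t \<in>. Q"
  by (rule k_algebra_mult_closed[OF Q_alg])

lemma lin_mult_Q:
  "lin K L Q f \<Longrightarrow> a \<in>. Q \<Longrightarrow> lin K L Q (\<lambda>x. f x *[Q] a)"
  "lin K L Q f \<Longrightarrow> a \<in>. Q \<Longrightarrow> lin K L Q (\<lambda>x. a *[Q] f x)"
  by (rule lin_mult_left[OF Q_alg] lin_mult_right[OF Q_alg]; assumption)+

lemmas hpar_rules = lin_rules hopf_closed Q_alg Q_mod lin_hc lin_mult_Q hc_closed mult_Q_closed k_algebra_one_closed[OF Q_alg]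

lemma par_gens_zero: "s \<ominus>\<^bsub>TA\<^esub> t \<in> par_gens \<Longrightarrow> s \<in>. TA \<Longrightarrow> t \<in>. TA \<Longrightarrow> qc s = qc t"
  using cls_eq[OF TA_alg hpar_ideal_ideal] ring.genideal_self[OF k_algebra_ring[OF TA_alg] par_gens_sub]
  by (auto simp: hpar_ideal_eq)

lemma hc_one: "hc \<one>[H] = \<one>[Q]"
  unfolding hc_qc Q_simps by (rule par_gens_zero) (simp_all add: par_gens_def tensor_alg_rules)

lemma par_rel_sw:
  assumes "sw TA k F \<ominus>\<^bsub>TA\<^esub> sw TA k G \<in> par_gens" and k: "k \<in>. H"
    and F: "bilin K H H TA F" and G: "bilin K H H TA G"
  shows "sw Q k (\<lambda>x y. qc (F x y)) = sw Q k (\<lambda>x y. qc (G x y))"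
proof -
  note mT = k_algebra_module[OF TA_alg]
  have "qc (sw TA k F) = qc (sw TA k G)" by (rule par_gens_zero[OF assms(1)]) (simp_all add: F G k mT sw_closed)
  then show ?thesis
    using sw_push[OF mT Q_mod k F qc_lin] sw_push[OF mT Q_mod k G qc_lin] by simp
qed

lemma hc_rel_right:
  assumes h: "h \<in>. H" and k: "k \<in>. H"
  shows "sw Q k (\<lambda>x y. hc h *[Q] (hc x *[Q] hc (S y))) =
    sw Q k (\<lambda>x y. hc (h *[H] x) *[Q] hc (S y))"
proof -
  note ch = k_algebra_assoc[OF Q_alg, symmetric] hc_qc Q_simps(2)
  have "sw Q k (\<lambda>x y. hc h *[Q] (hc x *[Q] hc (S y))) =
      sw Q k (\<lambda>x y. qc (tg h *[TA] tg x *[TA] tg (S y)))"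
  proof (rule sw_cong[OF Q_mod k])
    fix x y assume "x \<in>. H" "y \<in>. H"
    then show "hc h *[Q] (hc x *[Q] hc (S y)) = qc (tg h *[TA] tg x *[TA] tg (S y))"
      using h k_algebra_assoc[OF Q_alg, of "hc h" "hc x" "hc (S y)"]
      by (simp add: hpar_rules) (simp add: hc_qc Q_simps tensor_alg_rules)
  qed (simp add: h hpar_rules)
  also have "\<dots> = sw Q k (\<lambda>x y. qc (tg (h *[H] x) *[TA] tg (S y)))"
    by (rule par_rel_sw) (use h k in \<open>auto simp: par_gens_def rel_right_def rel_left_def tensor_alg_rules\<close>)
  also have "\<dots> = sw Q k (\<lambda>x y. hc (h *[H] x) *[Q] hc (S y))"
    by (rule sw_cong[symmetric, OF Q_mod k]) (use h in \<open>simp_all add: hpar_rules\<close>, simp add: hc_qc Q_simps tensor_alg_rules)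
  finally show ?thesis .
qed

lemma hc_rel_left:
  assumes h: "h \<in>. H" and k: "k \<in>. H"
  shows "sw Q h (\<lambda>x y. hc x *[Q] (hc (S y) *[Q] hc k)) =
    sw Q h (\<lambda>x y. hc x *[Q] hc (S y *[H] k))"
proof -
  have "sw Q h (\<lambda>x y. hc x *[Q] (hc (S y) *[Q] hc k)) =
      sw Q h (\<lambda>x y. qc (tg x *[TA] tg (S y) *[TA] tg k))"
  proof (rule sw_cong[OF Q_mod h])
    fix x y assume "x \<in>. H" "y \<in>. H"
    then show "hc x *[Q] (hc (S y) *[Q] hc k) = qc (tg x *[TA] tg (S y) *[TA] tg k)"
      using k k_algebra_assoc[OF Q_alg, of "hc x" "hc (S y)" "hc k"]
      by (simp add: hpar_rules) (simp add: hc_qc Q_simps tensor_alg_rules)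
  qed (simp add: k hpar_rules)
  also have "\<dots> = sw Q h (\<lambda>x y. qc (tg x *[TA] tg (S y *[H] k)))"
    by (rule par_rel_sw) (use h k in \<open>auto simp: par_gens_def rel_right_def rel_left_def tensor_alg_rules\<close>)
  also have "\<dots> = sw Q h (\<lambda>x y. hc x *[Q] hc (S y *[H] k))"
    by (rule sw_cong[symmetric, OF Q_mod h]) (use k in \<open>simp_all add: hpar_rules\<close>, simp add: hc_qc Q_simps tensor_alg_rules)
  finally show ?thesis .
qed

text \<open>The representatives in the free algebra are sums of words.\<close>

lemma hpar_induct [consumes 1, case_names scalar hc add]:
  assumes z: "z \<in>. Q"
    and scalar: "\<And>c. c \<in>. K \<Longrightarrow> P (c \<cdot>[Q] \<one>[Q])"
    and hc: "\<And>h z. h \<in>. H \<Longrightarrow> z \<in>. Q \<Longrightarrow> P z \<Longrightarrow> P (hc h *[Q] z)"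
    and add: "\<And>y z. y \<in>. Q \<Longrightarrow> z \<in>. Q \<Longrightarrow> P y \<Longrightarrow> P z \<Longrightarrow> P (y +[Q] z)"
  shows "P z"
proof -
  note fs = quot_simps[OF FF_alg linear_ideal_ideal, folded tensor_algebra_def]
    quot_smult[OF FF_alg linear_ideal_ideal, folded tensor_algebra_def]
  note qs = Q_simps quot_smult[OF TA_alg hpar_ideal_ideal, folded hpar_def]
  note oF = k_algebra_one_closed[OF FF_alg]
  let ?c = "\<lambda>p. linear_ideal K H +>\<^bsub>FF\<^esub> p"
  have cT: "?c p \<in>. TA" if "p \<in>. FF" for p using that by (simp add: fs)
  have cQ: "qc (?c p) \<in>. Q" if "p \<in>. FF" for p using cT[OF that] by (simp add: qs)
  have "P (qc (?c p))" if "p \<in>. FF" for p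
    using that
  proof (induction rule: free_alg_induct[OF K_cring, consumes 1, case_names scalar letter add])
    case (scalar c)
    have "qc (?c (c \<cdot>[FF] \<one>[FF])) = c \<cdot>[Q] \<one>[Q]"
      using scalar oF cT[OF oF] by (simp add: fs(6)[symmetric] fs(4)[symmetric] qs del: fs)
    then show ?case using assms(2)[OF scalar] by simp
  next
    case (letter s p)
    note l = letter_closed[OF K_cring letter(1)]
    have "qc (?c (letter K s *[FF] p)) = hc s *[Q] qc (?c p)"
      unfolding hclass_def tgen_def
      using l letter(2) cT by (simp add: fs(2)[symmetric] qs(2))
    then show ?case using assms(3)[OF letter(1) cQ[OF letter(2)] letter(3)] by simp
  next
    case (add p q)
    have "qc (?c (p +[FF] q)) = qc (?c p) +[Q] qc (?c q)"
      using add(1,2) cT by (simp add: fs(3)[symmetric] qs(3))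
    then show ?case using assms(4)[OF cQ[OF add(1)] cQ[OF add(2)] add(3,4)] by simp
  qed
  moreover obtain p where "p \<in>. FF" "z = qc (?c p)"
    using z unfolding qs(1) fs(1) by blast
  ultimately show ?thesis by simp
qed

text \<open>Operators \<open>\<phi> h\<close> that satisfy the relations of a partial representation make \<open>V\<close> a module: first over the
  free algebra, where words act by composition, then over its quotients, the tensor algebra and \<open>H\<^sub>p\<^sub>a\<^sub>r\<close>.\<close>

lemma hpar_action_left_module:
  assumes V: "module K V"
    and \<phi>: "\<And>h. h \<in>. H \<Longrightarrow> lin K V V (\<phi> h)"
    and \<phi>': "\<And>v. v \<in>. V \<Longrightarrow> lin K H V (\<lambda>h. \<phi> h v)"
    and one: "\<And>v. v \<in>. V \<Longrightarrow> \<phi> \<one>[H] v = v"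
    and right: "\<And>h k v. h \<in>. H \<Longrightarrow> k \<in>. H \<Longrightarrow> v \<in>. V \<Longrightarrow>
      sw V k (\<lambda>x y. \<phi> h (\<phi> x (\<phi> (S y) v))) = sw V k (\<lambda>x y. \<phi> (h *[H] x) (\<phi> (S y) v))"
    and left: "\<And>h k v. h \<in>. H \<Longrightarrow> k \<in>. H \<Longrightarrow> v \<in>. V \<Longrightarrow>
      sw V h (\<lambda>x y. \<phi> x (\<phi> (S y) (\<phi> k v))) = sw V h (\<lambda>x y. \<phi> x (\<phi> (S y *[H] k) v))"
  shows "left_module Q (with_smult V (hpar_action K V \<phi>))"
    and "\<And>h v. h \<in>. H \<Longrightarrow> v \<in>. V \<Longrightarrow> hpar_action K V \<phi> (hc h) v = \<phi> h v"
proof -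
  interpret V: module K V by (rule V)
  interpret F: k_algebra K FF by (rule FF_alg)
  interpret T: k_algebra K TA by (rule TA_alg)
  \<comment> \<open>the free algebra\<close>
  let ?M1 = "with_smult V (word_action K V \<phi>)"
  have M1: "left_module FF ?M1" by (rule word_action_left_module[OF V \<phi>])
  note f1 = left_module_facts[OF M1]
  have g1: "abelian_group ?M1" by (rule f1(2))
  have let1: "word_action K V \<phi> (letter K s) v = \<phi> s v" if "s \<in>. H" "v \<in>. V" for s v
    using word_action_letter[OF V \<phi> that(1) k_algebra_one_closed[OF FF_alg] that(2)] letter_closed[OF K_cring that(1)] f1(7) that(2)
    by simp
  note diff = left_module_diff_zero
  have z1: "g \<cdot>[?M1] m = \<zero>[?M1]" if g: "g \<in> lin_gens" and m: "m \<in>. ?M1" for g m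
  proof -
    note l = letter_closed[OF K_cring, of _ "carrier H"]
    from g consider x y where "x \<in>. H" "y \<in>. H" "g = letter K (x +[H] y) \<ominus>\<^bsub>FF\<^esub> (letter K x +[FF] letter K y)"
      | c x where "c \<in>. K" "x \<in>. H" "g = letter K (c \<cdot>[H] x) \<ominus>\<^bsub>FF\<^esub> c \<cdot>[FF] letter K x"
      unfolding lin_gens_def by blast
    then show ?thesis
    proof cases
      case 1
      have m': "m \<in>. V" using m by simp
      show ?thesis unfolding 1(3) by (rule diff[OF M1 _ _ m])
          (use 1 m' l module_add_closed[OF H_mod 1(1,2)] lin_add[OF \<phi>'[OF m']] additive_add[OF f1(5)[OF m]] in
           \<open>simp_all add: let1\<close>)
    next
      case 2
      have m': "m \<in>. V" using m by simp
      have cx: "c \<cdot>[FF] letter K x = (c \<cdot>[FF] \<one>[FF]) *[FF] letter K x"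
        using 2 l by (simp add: scal_mult[OF FF_alg])
      have c1: "c \<cdot>[FF] \<one>[FF] \<in>. FF" using 2 by simp
      have "word_action K V \<phi> (c \<cdot>[FF] letter K x) m = c \<cdot>[V] \<phi> x m"
        unfolding cx using f1(6)[OF c1 l[OF 2(2)] m] word_action_scalar[OF V \<phi> 2(1) lin_closed[OF \<phi>[OF 2(2)] m']] 2 m'
        by (simp add: let1)
      then show ?thesis unfolding 2(3) by (intro diff[OF M1 _ _ m])
          (use 2 m' l module_smult_closed[OF H_mod 2(1,2)] lin_smult[OF \<phi>'[OF m']] in \<open>simp_all add: let1\<close>)
    qed
  qed
  have z1': "\<forall>g \<in> lin_gens. \<forall>m \<in> carrier ?M1. g \<cdot>[?M1] m = \<zero>[?M1]" using z1 by blast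
  \<comment> \<open>the tensor algebra: the linearity relations act by zero, as \<open>\<phi>\<close> is linear in \<open>h\<close>\<close>
  let ?M2 = "with_smult ?M1 (\<lambda>Z m. the_elem ((\<lambda>z. z \<cdot>[?M1] m) ` Z))"
  note q1 = left_module_quot[OF FF_alg linear_ideal_ideal M1 linear_ideal_eq lin_gens_sub z1', folded tensor_algebra_def]
  have M2: "left_module TA ?M2" by (rule q1(1))
  note f2 = left_module_facts[OF M2]
  have let2: "tg s \<cdot>[?M2] v = \<phi> s v" if "s \<in>. H" "v \<in>. V" for s v
  proof -
    note l = letter_closed[OF K_cring that(1)]
    have "tg s \<cdot>[?M2] v = letter K s \<cdot>[?M1] v"
      unfolding tgen_def by (rule q1(2)[OF l cls_self[OF FF_alg linear_ideal_ideal l]]) (simp add: that)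
    then show ?thesis using let1 that by simp
  qed
  have s2: "(c \<cdot>[TA] t) \<cdot>[?M2] v = c \<cdot>[V] (t \<cdot>[?M2] v)"
    if c: "c \<in>. K" and t: "t \<in>. TA" and v: "v \<in>. V" for c t v
  proof -
    note fs = quot_simps[OF FF_alg linear_ideal_ideal, folded tensor_algebra_def]
      quot_smult[OF FF_alg linear_ideal_ideal, folded tensor_algebra_def]
    have c1: "c \<cdot>[TA] \<one>[TA] \<in>. TA" "c \<cdot>[FF] \<one>[FF] \<in>. FF" using c by auto
    have tv: "t \<cdot>[?M2] v \<in>. V" using f2(3)[OF t] v by simp
    have "(c \<cdot>[TA] \<one>[TA]) = linear_ideal K H +>\<^bsub>FF\<^esub> (c \<cdot>[FF] \<one>[FF])"
      using c by (simp add: fs)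
    then have "(c \<cdot>[TA] \<one>[TA]) \<cdot>[?M2] w = (c \<cdot>[FF] \<one>[FF]) \<cdot>[?M1] w" if "w \<in>. V" for w
      using q1(2)[OF c1(2) cls_self[OF FF_alg linear_ideal_ideal c1(2)], of w] that by simp
    then have "(c \<cdot>[TA] \<one>[TA]) \<cdot>[?M2] (t \<cdot>[?M2] v) = c \<cdot>[V] (t \<cdot>[?M2] v)"
      using word_action_scalar[OF V \<phi> c tv] tv by simp
    then show ?thesis using f2(6)[OF c1(1) t, of v] v scal_mult[OF TA_alg c t] by simp
  qed
  have ev: "lin K TA V (\<lambda>t. t \<cdot>[?M2] v)" if v: "v \<in>. V" for v
    using f2(3) f2(5)[of v] s2 v by (simp add: lin_def additive_def)
  have sw2: "sw TA k G \<cdot>[?M2] v = sw V k (\<lambda>x y. G x y \<cdot>[?M2] v)"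
    if "k \<in>. H" "bilin K H H TA G" "v \<in>. V" for k G v
    by (rule sw_push[OF k_algebra_module[OF TA_alg] V that(1,2) ev[OF that(3)]])
  have tv2: "(a *[TA] b) \<cdot>[?M2] v = a \<cdot>[?M2] (b \<cdot>[?M2] v)" "a \<cdot>[?M2] v \<in>. V"
    if "a \<in>. TA" "b \<in>. TA" "v \<in>. V" for a b v
    using f2(6)[OF that(1,2)] f2(3)[OF that(1)] that(3) by simp_all
  have \<phi>c: "\<phi> h v \<in>. V" if "h \<in>. H" "v \<in>. V" for h v
    using lin_closed[OF \<phi>] that .
  have lp: "lin K H V (\<lambda>x. \<phi> h (f x))" if "lin K H V f" "h \<in>. H" for f h
    by (rule lin_comp[OF \<phi>[OF that(2)] that(1)])
  have lp': "lin K H V (\<lambda>x. \<phi> (g x) v)" if "lin K H H g" "v \<in>. V" for g v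
    by (rule lin_comp[OF \<phi>'[OF that(2)] that(1)])
  note facts = tensor_alg_rules sw_closed' tv2 let2 \<phi>c lp lp' V
  have eq2: "(sw TA k G \<ominus>\<^bsub>TA\<^esub> sw TA k G') \<cdot>[?M2] m = \<zero>[?M2]"
    if k: "k \<in>. H" and G: "bilin K H H TA G" and G': "bilin K H H TA G'" and m: "m \<in>. ?M2"
      and e: "sw V k (\<lambda>x y. G x y \<cdot>[?M2] m) = sw V k (\<lambda>x y. G' x y \<cdot>[?M2] m)"
    for k G G' m
  proof (rule diff[OF M2 sw_closed[OF k_algebra_module[OF TA_alg] k G] sw_closed[OF k_algebra_module[OF TA_alg] k G'] m])
    have m': "m \<in>. V" using m by simp
    show "sw TA k G \<cdot>[?M2] m = sw TA k G' \<cdot>[?M2] m"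
      unfolding sw2[OF k G m'] sw2[OF k G' m'] by (rule e)
  qed
  have cong2: "sw V k F = sw V k G" if "k \<in>. H" "bilin K H H V G"
    "\<And>x y. x \<in>. H \<Longrightarrow> y \<in>. H \<Longrightarrow> F x y = G x y" for k F G
    by (rule sw_cong[symmetric, OF V that(1,2)]) (simp add: that(3))
  have z2: "g \<cdot>[?M2] m = \<zero>[?M2]" if g: "g \<in> par_gens" and m: "m \<in>. ?M2" for g m
  proof -
    have m': "m \<in>. V" using m by simp
    note bl = m' facts
    from g consider "g = tg \<one>[H] \<ominus>\<^bsub>TA\<^esub> \<one>[TA]" | h k where "h \<in>. H" "k \<in>. H" "g = rel_right h k"
      | h k where "h \<in>. H" "k \<in>. H" "g = rel_left h k"
      unfolding par_gens_def by blast
    then show ?thesis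
    proof cases
      case 1
      show ?thesis unfolding 1
        by (rule diff[OF M2 _ _ m]) (use f2(7)[OF m] m' in \<open>simp_all add: bl one del: with_smult_simps\<close>)
    next
      case (2 h k)
      show ?thesis unfolding 2(3) rel_right_def
      proof (rule eq2[OF 2(2) _ _ m])
        have "sw V k (\<lambda>x y. (tg h *[TA] tg x *[TA] tg (S y)) \<cdot>[?M2] m) = sw V k (\<lambda>x y. \<phi> h (\<phi> x (\<phi> (S y) m)))"
          by (rule cong2[OF 2(2)]) (simp_all add: 2 bl del: with_smult_simps)
        also have "\<dots> = sw V k (\<lambda>x y. \<phi> (h *[H] x) (\<phi> (S y) m))" by (rule right[OF 2(1,2) m'])
        also have "\<dots> = sw V k (\<lambda>x y. (tg (h *[H] x) *[TA] tg (S y)) \<cdot>[?M2] m)"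
          by (rule cong2[symmetric, OF 2(2)]) (simp_all add: 2 bl del: with_smult_simps)
        finally show "sw V k (\<lambda>x y. (tg h *[TA] tg x *[TA] tg (S y)) \<cdot>[?M2] m) =
          sw V k (\<lambda>x y. (tg (h *[H] x) *[TA] tg (S y)) \<cdot>[?M2] m)" .
      qed (simp_all add: 2 tensor_alg_rules)
    next
      case (3 h k)
      show ?thesis unfolding 3(3) rel_left_def
      proof (rule eq2[OF 3(1) _ _ m])
        have "sw V h (\<lambda>x y. (tg x *[TA] tg (S y) *[TA] tg k) \<cdot>[?M2] m) = sw V h (\<lambda>x y. \<phi> x (\<phi> (S y) (\<phi> k m)))"
          by (rule cong2[OF 3(1)]) (simp_all add: 3 bl del: with_smult_simps)
        also have "\<dots> = sw V h (\<lambda>x y. \<phi> x (\<phi> (S y *[H] k) m))" by (rule left[OF 3(1,2) m'])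
        also have "\<dots> = sw V h (\<lambda>x y. (tg x *[TA] tg (S y *[H] k)) \<cdot>[?M2] m)"
          by (rule cong2[symmetric, OF 3(1)]) (simp_all add: 3 bl del: with_smult_simps)
        finally show "sw V h (\<lambda>x y. (tg x *[TA] tg (S y) *[TA] tg k) \<cdot>[?M2] m) =
          sw V h (\<lambda>x y. (tg x *[TA] tg (S y *[H] k)) \<cdot>[?M2] m)" .
      qed (simp_all add: 3 tensor_alg_rules)
    qed
  qed
  have z2': "\<forall>g \<in> par_gens. \<forall>m \<in> carrier ?M2. g \<cdot>[?M2] m = \<zero>[?M2]" using z2 by blast
  \<comment> \<open>\<open>H\<^sub>p\<^sub>a\<^sub>r\<close>: the relations of a partial representation act by zero\<close>
  let ?M3 = "with_smult ?M2 (\<lambda>Z m. the_elem ((\<lambda>z. z \<cdot>[?M2] m) ` Z))"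
  note q2 = left_module_quot[OF TA_alg hpar_ideal_ideal M2 hpar_ideal_eq par_gens_sub z2', folded hpar_def]
  have M3: "left_module Q ?M3" by (rule q2(1))
  note fs = quot_simps[OF FF_alg linear_ideal_ideal, folded tensor_algebra_def]
  \<comment> \<open>the explicit formula agrees with the iterated quotient, as it picks a representative of a representative\<close>
  have act3: "hpar_action K V \<phi> Z v = Z \<cdot>[?M3] v" if Z: "Z \<in>. Q" and v: "v \<in>. V" for Z v
  proof -
    have v': "v \<in>. ?M2" "v \<in>. ?M1" using v by auto
    obtain t where t: "t \<in>. TA" "Z = qc t" using Z unfolding Q_simps by blast
    have rep: "word_action K V \<phi> p v = Z \<cdot>[?M3] v" if p: "p \<in> Y" "Y \<in> Z" for p Y
    proof -
      have Y: "Y \<in>. TA" using mem_cls[OF TA_alg hpar_ideal_ideal t(1)] p(2) t(2) by blast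
      then obtain a where a: "a \<in>. FF" "Y = linear_ideal K H +>\<^bsub>FF\<^esub> a" unfolding fs by blast
      have "Z \<cdot>[?M3] v = Y \<cdot>[?M2] v" unfolding t(2) by (rule q2(2)[OF t(1) _ v'(1)]) (use p t in blast)
      also have "\<dots> = p \<cdot>[?M1] v" unfolding a(2) by (rule q1(2)[OF a(1) _ v'(2)]) (use p a in blast)
      finally show ?thesis by simp
    qed
    have "t \<in> Z" using cls_self[OF TA_alg hpar_ideal_ideal t(1)] t(2) by simp
    moreover obtain a where a: "a \<in>. FF" "t = linear_ideal K H +>\<^bsub>FF\<^esub> a" using t(1) unfolding fs by blast
    ultimately have "a \<in> \<Union> Z" using cls_self[OF FF_alg linear_ideal_ideal a(1)] by blast
    then have "(\<lambda>p. word_action K V \<phi> p v) ` (\<Union> Z) = {Z \<cdot>[?M3] v}"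
      by (rule image_eq_singleton) (elim UnionE, rule rep)
    then show ?thesis unfolding hpar_action_def word_action_def by (simp del: with_smult_simps)
  qed
  show "left_module Q (with_smult V (hpar_action K V \<phi>))" by (rule left_module_fields[OF M3]) (simp_all add: act3)
  show "hpar_action K V \<phi> (hc h) v = \<phi> h v" if "h \<in>. H" "v \<in>. V" for h v
  proof -
    have tl: "tg h \<in>. TA" using that by (simp add: tensor_alg_rules)
    have "hpar_action K V \<phi> (hc h) v = hc h \<cdot>[?M3] v" by (rule act3) (simp_all add: that hc_closed)
    also have "\<dots> = tg h \<cdot>[?M2] v"
      unfolding hclass_def by (rule q2(2)[OF tl cls_self[OF TA_alg hpar_ideal_ideal tl]]) (simp add: that)
    finally show ?thesis using let2 that by simp
  qed
qed

end


section \<open>Modules over a tensor product of algebras\<close>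

context
  fixes K :: "'k ring" and A :: "('k, 'a, 'u) module_scheme" and B :: "('k, 'b, 'v) module_scheme"
    and V :: "('k, 'x, 'w) module_scheme" and g :: "'a \<Rightarrow> 'b \<Rightarrow> 'x \<Rightarrow> 'x"
  assumes A: "k_algebra K A" and B: "k_algebra K B" and V: "module K V"
    and g1: "\<And>b v. b \<in>. B \<Longrightarrow> v \<in>. V \<Longrightarrow> lin K A V (\<lambda>a. g a b v)"
    and g2: "\<And>a v. a \<in>. A \<Longrightarrow> v \<in>. V \<Longrightarrow> lin K B V (\<lambda>b. g a b v)"
    and g3: "\<And>a b. a \<in>. A \<Longrightarrow> b \<in>. B \<Longrightarrow> lin K V V (g a b)"
    and one: "\<And>v. v \<in>. V \<Longrightarrow> g \<one>[A] \<one>[B] v = v"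
begin

lemmas ABm = k_algebra_module[OF A] k_algebra_module[OF B]

lemma env_bilin: "v \<in>. V \<Longrightarrow> bilin K A B V (\<lambda>a b. g a b v)" by (rule bilinI) (auto intro: g1 g2)

text \<open>An action \<open>g a b\<close> on \<open>V\<close> that is linear in \<open>a\<close> and in \<open>b\<close> extends to \<open>A \<otimes> B\<close>.  For \<open>B\<close> the opposite of \<open>A\<close> this makes
  bimodules into modules over the enveloping algebra, left or right according to the order in which \<open>g\<close>
  composes.\<close>

lemma env_act_tens:
  "a \<in>. A \<Longrightarrow> b \<in>. B \<Longrightarrow> v \<in>. V \<Longrightarrow> tens_lift V (\<lambda>a b. g a b v) (kten K A B a b) = g a b v"
  by (rule kt_lift_tens[OF ABm V env_bilin])

lemma env_act_lin: "v \<in>. V \<Longrightarrow> lin K (kt K A B) V (\<lambda>e. tens_lift V (\<lambda>a b. g a b v) e)"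
  by (rule kt_lift_lin[OF ABm V env_bilin])

lemma env_act_lin': "e \<in>. (kt K A B) \<Longrightarrow> lin K V V (\<lambda>v. tens_lift V (\<lambda>a b. g a b v) e)"
  by (rule kt_lift_param_lin[OF ABm V V _ env_bilin g3])

lemma env_act_one: "v \<in>. V \<Longrightarrow> tens_lift V (\<lambda>a b. g a b v) \<one>[alg_tensor K A B] = v"
  by (simp add: env_act_tens one k_algebra_one_closed[OF A] k_algebra_one_closed[OF B])

lemma env_act_mult:
  assumes m: "\<And>a b a' b' v. \<lbrakk>a \<in>. A; b \<in>. B; a' \<in>. A; b' \<in>. B; v \<in>. V\<rbrakk>
      \<Longrightarrow> g (a *[A] a') (b *[B] b') v = g a' b' (g a b v)"
    and e: "e \<in>. (kt K A B)" and e': "e' \<in>. (kt K A B)" and v: "v \<in>. V"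
  shows "tens_lift V (\<lambda>a b. g a b v) (e *[alg_tensor K A B] e') =
      tens_lift V (\<lambda>a b. g a b (tens_lift V (\<lambda>a b. g a b v) e)) e'"
proof -
  note ml = alg_tensor_mult_lin_left[OF A B] alg_tensor_mult_lin_right[OF A B]
  note cl = kt_tens_closed[OF ABm] k_algebra_mult_closed[OF A] k_algebra_mult_closed[OF B]
  have 1: "tens_lift V (\<lambda>a b. g a b v) (kten K A B a b *[alg_tensor K A B] e') = tens_lift V (\<lambda>c d. g c d (g a b v)) e'"
    if ab: "a \<in>. A" "b \<in>. B" for a b by (rule kt_eq[OF ABm e' lin_comp[OF env_act_lin[OF v] ml(2)] env_act_lin])
      (simp_all add: ab v m lin_closed[OF g3] cl alg_tensor_tens_mult[OF A B] env_act_tens)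
  show ?thesis
    by (rule kt_eq[OF ABm e lin_comp[OF env_act_lin[OF v] ml(1)[OF e']] lin_comp[OF env_act_lin'[OF e'] env_act_lin[OF v]]])
      (simp add: v 1 env_act_tens)
qed

abbreviation "env \<equiv> with_smult V (\<lambda>e v. tens_lift V (\<lambda>a b. g a b v) e)"

lemma right_module_alg_tensor:
  assumes m: "\<And>a b a' b' v. \<lbrakk>a \<in>. A; b \<in>. B; a' \<in>. A; b' \<in>. B; v \<in>. V\<rbrakk>
      \<Longrightarrow> g (a *[A] a') (b *[B] b') v = g a' b' (g a b v)"
  shows "right_module (alg_tensor K A B) env"
proof (rule right_moduleI)
  show "ring (alg_tensor K A B)" by (rule k_algebra_ring[OF alg_tensor_k_algebra[OF A B]])
  show "abelian_group env" by (rule with_smult_group[OF module_abelian_group[OF V]])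
  show "additive env env
     (\<lambda>v. e \<cdot>[env] v)" if "e \<in>. (alg_tensor K A B)" for e
    using lin_additive[OF env_act_lin'] that by (simp add: additive_def)
  show "additive (alg_tensor K A B) env
     (\<lambda>e. e \<cdot>[env] v)"
     if "v \<in>. env" for v
    using lin_additive[OF env_act_lin] that by (simp add: additive_def)
qed (use env_act_mult[OF m] env_act_one in simp_all)

lemma left_module_alg_tensor:
  assumes m: "\<And>a b a' b' v. \<lbrakk>a \<in>. A; b \<in>. B; a' \<in>. A; b' \<in>. B; v \<in>. V\<rbrakk>
      \<Longrightarrow> g (a *[A] a') (b *[B] b') v = g a b (g a' b' v)"
  shows "left_module (alg_tensor K A B) env"
proof (rule left_moduleI)
  show "ring (alg_tensor K A B)" by (rule k_algebra_ring[OF alg_tensor_k_algebra[OF A B]])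
  show "abelian_group env" by (rule with_smult_group[OF module_abelian_group[OF V]])
  show "additive env env
     (\<lambda>v. e \<cdot>[env] v)" if "e \<in>. (alg_tensor K A B)" for e
    using lin_additive[OF env_act_lin'] that by (simp add: additive_def)
  show "additive (alg_tensor K A B) env
     (\<lambda>e. e \<cdot>[env] v)"
     if "v \<in>. env" for v
    using lin_additive[OF env_act_lin] that by (simp add: additive_def)
  show "e *[alg_tensor K A B] e' \<cdot>[env] v =
      e \<cdot>[env] (e' \<cdot>[env] v)"
    if "e \<in>. (alg_tensor K A B)" "e' \<in>. (alg_tensor K A B)"
       "v \<in>. env" for e e' v
  proof -
    note ml = alg_tensor_mult_lin_left[OF A B] alg_tensor_mult_lin_right[OF A B]
    note cl = kt_tens_closed[OF ABm] k_algebra_mult_closed[OF A] k_algebra_mult_closed[OF B]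
    from that have e: "e \<in>. (kt K A B)" and e': "e' \<in>. (kt K A B)" and v: "v \<in>. V" by simp_all
    have v': "tens_lift V (\<lambda>a b. g a b v) e' \<in>. V" by (rule lin_closed[OF env_act_lin[OF v] e'])
    have 1: "tens_lift V (\<lambda>a b. g a b v) (kten K A B a b *[alg_tensor K A B] e') = g a b (tens_lift V (\<lambda>c d. g c d v) e')"
      if ab: "a \<in>. A" "b \<in>. B" for a b
      by (rule kt_eq[OF ABm e' lin_comp[OF env_act_lin[OF v] ml(2)] lin_comp[OF g3[OF ab] env_act_lin[OF v]]])
        (simp_all add: ab v m lin_closed[OF g3] cl alg_tensor_tens_mult[OF A B] env_act_tens)
    have "tens_lift V (\<lambda>a b. g a b v) (e *[alg_tensor K A B] e') = tens_lift V (\<lambda>a b. g a b (tens_lift V (\<lambda>c d. g c d v) e')) e"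
      by (rule kt_eq[OF ABm e lin_comp[OF env_act_lin[OF v] ml(1)[OF e']] env_act_lin[OF v']]) (simp add: v v' 1 env_act_tens)
    then show ?thesis by simp
  qed
qed (use env_act_one in simp_all)

end


section \<open>Identities in \<open>H\<^sub>p\<^sub>a\<^sub>r\<close>\<close>

context cocommutative_hopf_algebra
begin

abbreviation "ee \<equiv> e_elem K H"

lemma ee_lin: "lin K H Q ee"
proof -
  have "lin K H Q (\<lambda>h. sw Q h (\<lambda>x y. hc x *[Q] hc (S y)))" by (simp add: hpar_rules)
  then show ?thesis by (simp add: e_elem_def[abs_def])
qed

lemma lin_ee: "lin K L H f \<Longrightarrow> lin K L Q (\<lambda>x. ee (f x))" by (rule lin_comp[OF ee_lin])

lemma ee_closed: "h \<in>. H \<Longrightarrow> ee h \<in>. Q" by (rule lin_closed[OF ee_lin])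

lemmas ee_rules = hpar_rules lin_ee ee_closed

text \<open>By the relations both sides are equal to \<open>[h k\<^sub>1] [S k\<^sub>2]\<close>; on the right hand side \<open>S(h\<^sub>2) h\<^sub>3\<close> cancels.\<close>

lemma hc_mult_ee:
  assumes h: "h \<in>. H" and k: "k \<in>. H"
  shows "hc h *[Q] ee k = sw Q h (\<lambda>x y. ee (x *[H] k) *[Q] hc y)"
proof -
  have 1: "hc h *[Q] ee k = sw Q k (\<lambda>x y. hc (h *[H] x) *[Q] hc (S y))"
    unfolding e_elem_def hc_rel_right[OF h k, symmetric] by (rule sw_push[OF Q_mod Q_mod k]) (simp_all add: h ee_rules)
  let ?F = "\<lambda>a b y. sw Q k (\<lambda>p q. hc (a *[H] p) *[Q] hc (S q *[H] (S b *[H] y)))"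
  have "sw Q h (\<lambda>x y. ee (x *[H] k) *[Q] hc y) = sw Q h (\<lambda>x y. sw Q x (\<lambda>a b. ?F a b y))"
  proof (rule sw_cong[OF Q_mod h])
    show "bilin K H H Q (\<lambda>x y. ee (x *[H] k) *[Q] hc y)" using k by (simp add: ee_rules)
    fix x y assume xy: "x \<in>. H" "y \<in>. H"
    have xk: "x *[H] k \<in>. H" using xy k by (simp add: ee_rules)
    have "ee (x *[H] k) *[Q] hc y = sw Q (x *[H] k) (\<lambda>p q. (hc p *[Q] hc (S q)) *[Q] hc y)"
      unfolding e_elem_def by (rule sw_push[OF Q_mod Q_mod xk]) (simp_all add: xy ee_rules)
    also have "\<dots> = sw Q (x *[H] k) (\<lambda>p q. hc p *[Q] (hc (S q) *[Q] hc y))"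
      by (rule sw_cong[OF Q_mod xk]) (simp_all add: xy ee_rules Q_assoc)
    also have "\<dots> = sw Q (x *[H] k) (\<lambda>p q. hc p *[Q] hc (S q *[H] y))" by (rule hc_rel_left[OF xk xy(2)])
    also have "\<dots> = sw Q x (\<lambda>a b. sw Q k (\<lambda>p q. hc (a *[H] p) *[Q] hc (S (b *[H] q) *[H] y)))"
      by (rule sw_mult[OF Q_mod xy(1) k]) (simp_all add: xy ee_rules)
    also have "\<dots> = sw Q x (\<lambda>a b. ?F a b y)"
    proof (rule sw_cong[OF Q_mod xy(1)])
      show "sw Q k (\<lambda>p q. hc (a *[H] p) *[Q] hc (S (b *[H] q) *[H] y)) = ?F a b y"
        if "a \<in>. H" "b \<in>. H" for a b
        by (rule sw_cong[OF Q_mod k]) (simp_all add: that xy ee_rules antipode_mult H_assoc)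
    qed (simp add: xy k ee_rules)
    finally show "ee (x *[H] k) *[Q] hc y = sw Q x (\<lambda>a b. ?F a b y)" .
  qed
  also have "\<dots> = sw Q h (\<lambda>x y. sw Q y (\<lambda>p q. ?F x p q))"
    by (rule sw_coassoc[OF Q_mod h]) (simp add: k ee_rules)
  also have "\<dots> = sw Q k (\<lambda>p q. hc (h *[H] p) *[Q] hc (S q *[H] \<one>[H]))"
    by (rule sw_collapse_left[OF Q_mod h, where G = "\<lambda>a w. sw Q k (\<lambda>p q. hc (a *[H] p) *[Q] hc (S q *[H] w))"])
      (simp add: k ee_rules)
  also have "\<dots> = sw Q k (\<lambda>x y. hc (h *[H] x) *[Q] hc (S y))"
    by (rule sw_cong[OF Q_mod k]) (simp_all add: h ee_rules H_r_one)
  finally show ?thesis using 1 by simp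
qed

text \<open>\<open>hc_mult_ee\<close> solved for the other order of the factors.\<close>

lemma ee_mult_hc:
  assumes h: "h \<in>. H" and k: "k \<in>. H"
  shows "ee k *[Q] hc h = sw Q h (\<lambda>x y. hc x *[Q] ee (S y *[H] k))"
proof -
  let ?F = "\<lambda>q p y. ee ((p *[H] S y) *[H] k) *[Q] hc q"
  have "sw Q h (\<lambda>x y. hc x *[Q] ee (S y *[H] k)) = sw Q h (\<lambda>x y. sw Q x (\<lambda>q p. ?F q p y))"
  proof (rule sw_cong[OF Q_mod h])
    show "bilin K H H Q (\<lambda>x y. hc x *[Q] ee (S y *[H] k))" using k by (simp add: ee_rules)
    fix x y assume xy: "x \<in>. H" "y \<in>. H"
    have "hc x *[Q] ee (S y *[H] k) = sw Q x (\<lambda>p q. ee (p *[H] (S y *[H] k)) *[Q] hc q)"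
      by (rule hc_mult_ee) (simp_all add: xy k ee_rules)
    also have "\<dots> = sw Q x (\<lambda>p q. ?F q p y)"
      by (rule sw_cong[OF Q_mod xy(1)]) (simp_all add: xy k ee_rules H_assoc)
    also have "\<dots> = sw Q x (\<lambda>q p. ?F q p y)" by (rule sw_comm[OF Q_mod xy(1)]) (simp_all add: xy k ee_rules)
    finally show "hc x *[Q] ee (S y *[H] k) = sw Q x (\<lambda>q p. ?F q p y)" .
  qed
  also have "\<dots> = sw Q h (\<lambda>x y. sw Q y (\<lambda>p q. ?F x p q))"
    by (rule sw_coassoc[OF Q_mod h]) (simp add: k ee_rules)
  also have "\<dots> = ee (\<one>[H] *[H] k) *[Q] hc h"
    by (rule sw_collapse_right[OF Q_mod h, where G = "\<lambda>q w. ee (w *[H] k) *[Q] hc q"]) (simp add: k ee_rules)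
  finally show ?thesis using k by (simp add: H_l_one)
qed

text \<open>\<open>[h]\<close> and \<open>[S h]\<close> are generalized inverses of each other.\<close>

lemma hc_regular:
  assumes h: "h \<in>. H"
  shows "sw Q h (\<lambda>w q. sw Q w (\<lambda>x p. hc x *[Q] (hc (S p) *[Q] hc q))) = hc h"
proof -
  have "sw Q h (\<lambda>w q. sw Q w (\<lambda>x p. hc x *[Q] (hc (S p) *[Q] hc q))) =
     sw Q h (\<lambda>w q. sw Q w (\<lambda>x p. hc x *[Q] hc (S p *[H] q)))"
    by (rule sw_cong[OF Q_mod h]) (simp_all add: ee_rules hc_rel_left)
  also have "\<dots> = sw Q h (\<lambda>x y. sw Q y (\<lambda>p q. hc x *[Q] hc (S p *[H] q)))"
    by (rule sw_coassoc[OF Q_mod h]) (simp add: ee_rules)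
  also have "\<dots> = hc h *[Q] hc \<one>[H]" by (rule sw_collapse_left[OF Q_mod h]) (simp add: ee_rules)
  finally show ?thesis using h by (simp add: hc_one Q_r_one ee_rules)
qed

lemma ee_antipode:
  assumes y: "y \<in>. H"
  shows "ee (S y) = sw Q y (\<lambda>p q. hc (S p) *[Q] hc q)"
  unfolding e_elem_def by (rule sw_antipode_move[symmetric, OF Q_mod y]) (simp add: ee_rules)

text \<open>Up to factors in \<open>B\<close> the classes multiply like elements of \<open>H\<close>: insert \<open>[h] = [h\<^sub>1] [S h\<^sub>2] [h\<^sub>3]\<close> and apply the
  relation that merges \<open>[k]\<close> and \<open>[h\<^sub>1]\<close>.\<close>

lemma hc_mult_hc:
  assumes h: "h \<in>. H" and k: "k \<in>. H"
  shows "hc k *[Q] hc h = sw Q h (\<lambda>x y. hc (k *[H] x) *[Q] ee (S y))"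
proof -
  have "sw Q h (\<lambda>x y. hc (k *[H] x) *[Q] ee (S y)) =
     sw Q h (\<lambda>x y. sw Q y (\<lambda>p q. hc (k *[H] x) *[Q] (hc (S p) *[Q] hc q)))"
  proof (rule sw_cong[OF Q_mod h])
    show "hc (k *[H] x) *[Q] ee (S y) = sw Q y (\<lambda>p q. hc (k *[H] x) *[Q] (hc (S p) *[Q] hc q))"
      if "x \<in>. H" "y \<in>. H" for x y
      unfolding ee_antipode[OF that(2)] by (rule sw_push[OF Q_mod Q_mod that(2)]) (simp_all add: that k ee_rules)
  qed (simp add: k ee_rules)
  also have "\<dots> = sw Q h (\<lambda>w q. sw Q w (\<lambda>x p. hc (k *[H] x) *[Q] (hc (S p) *[Q] hc q)))"
    by (rule sw_coassoc[symmetric, OF Q_mod h]) (simp add: k ee_rules)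
  also have "\<dots> = sw Q h (\<lambda>w q. hc k *[Q] sw Q w (\<lambda>x p. hc x *[Q] (hc (S p) *[Q] hc q)))"
  proof (rule sw_cong[OF Q_mod h])
    show "bilin K H H Q (\<lambda>w q. sw Q w (\<lambda>x p. hc (k *[H] x) *[Q] (hc (S p) *[Q] hc q)))" using k by (simp add: ee_rules)
    fix w q assume wq: "w \<in>. H" "q \<in>. H"
    have "sw Q w (\<lambda>x p. hc (k *[H] x) *[Q] (hc (S p) *[Q] hc q)) =
        sw Q w (\<lambda>x p. (hc (k *[H] x) *[Q] hc (S p)) *[Q] hc q)"
      by (rule sw_cong[OF Q_mod wq(1)]) (simp_all add: wq k ee_rules Q_assoc)
    also have "\<dots> = sw Q w (\<lambda>x p. hc (k *[H] x) *[Q] hc (S p)) *[Q] hc q"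
      by (rule sw_push[symmetric, OF Q_mod Q_mod wq(1)]) (simp_all add: wq k ee_rules)
    also have "\<dots> = sw Q w (\<lambda>x p. hc k *[Q] (hc x *[Q] hc (S p))) *[Q] hc q"
      unfolding hc_rel_right[OF k wq(1)] ..
    also have "\<dots> = sw Q w (\<lambda>x p. (hc k *[Q] (hc x *[Q] hc (S p))) *[Q] hc q)"
      by (rule sw_push[OF Q_mod Q_mod wq(1)]) (simp_all add: wq k ee_rules)
    also have "\<dots> = sw Q w (\<lambda>x p. hc k *[Q] (hc x *[Q] (hc (S p) *[Q] hc q)))"
      by (rule sw_cong[OF Q_mod wq(1)]) (simp_all add: wq k ee_rules Q_assoc)
    also have "\<dots> = hc k *[Q] sw Q w (\<lambda>x p. hc x *[Q] (hc (S p) *[Q] hc q))"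
      by (rule sw_push[symmetric, OF Q_mod Q_mod wq(1)]) (simp_all add: wq k ee_rules)
    finally show "sw Q w (\<lambda>x p. hc (k *[H] x) *[Q] (hc (S p) *[Q] hc q)) =
       hc k *[Q] sw Q w (\<lambda>x p. hc x *[Q] (hc (S p) *[Q] hc q))" .
  qed
  also have "\<dots> = hc k *[Q] hc h"
    unfolding hc_regular[OF h, symmetric] by (rule sw_push[symmetric, OF Q_mod Q_mod h]) (simp_all add: k ee_rules)
  finally show ?thesis by simp
qed

lemma hc_mult_ee_antipode:
  assumes h: "h \<in>. H"
  shows "sw Q h (\<lambda>x y. hc x *[Q] ee (S y)) = hc h"
proof -
  have "hc h = sw Q h (\<lambda>x y. hc (\<one>[H] *[H] x) *[Q] ee (S y))"
    using hc_mult_hc[OF h one_H_closed] h by (simp add: hc_one Q_l_one hc_closed)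
  also have "\<dots> = sw Q h (\<lambda>x y. hc x *[Q] ee (S y))" by (rule sw_cong[OF Q_mod h]) (simp_all add: ee_rules H_l_one)
  finally show ?thesis by simp
qed

text \<open>The forms with antipodes are the ones that occur in the left action on the induced bimodule.\<close>

lemma hcS_mult_hcS:
  assumes h: "h \<in>. H" and k: "k \<in>. H"
  shows "hc (S k) *[Q] hc (S h) = sw Q h (\<lambda>x y. hc (S k *[H] S x) *[Q] ee y)"
proof -
  have "hc (S k) *[Q] hc (S h) = sw Q (S h) (\<lambda>x y. hc (S k *[H] x) *[Q] ee (S y))"
    by (rule hc_mult_hc) (simp_all add: h k ee_rules)
  also have "\<dots> = sw Q h (\<lambda>x y. hc (S k *[H] S x) *[Q] ee (S (S y)))"
    by (rule sw_antipode[OF Q_mod h]) (simp add: k ee_rules)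
  also have "\<dots> = sw Q h (\<lambda>x y. hc (S k *[H] S x) *[Q] ee y)"
    by (rule sw_cong[OF Q_mod h]) (simp_all add: k ee_rules antipode_involutive)
  finally show ?thesis .
qed

lemma ee_mult_hcS:
  assumes h: "h \<in>. H" and k: "k \<in>. H"
  shows "ee k *[Q] hc (S h) = sw Q h (\<lambda>x y. hc (S x) *[Q] ee (y *[H] k))"
proof -
  have "ee k *[Q] hc (S h) = sw Q (S h) (\<lambda>x y. hc x *[Q] ee (S y *[H] k))"
    by (rule ee_mult_hc) (simp_all add: h k ee_rules)
  also have "\<dots> = sw Q h (\<lambda>x y. hc (S x) *[Q] ee (S (S y) *[H] k))"
    by (rule sw_antipode[OF Q_mod h]) (simp add: k ee_rules)
  also have "\<dots> = sw Q h (\<lambda>x y. hc (S x) *[Q] ee (y *[H] k))"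
    by (rule sw_cong[OF Q_mod h]) (simp_all add: k ee_rules antipode_involutive)
  finally show ?thesis .
qed


section \<open>The subalgebra of the elements \<open>e\<^sub>h\<close>\<close>

abbreviation "BB \<equiv> B_alg K H"

lemma BB_simps [simp]:
  "mult BB = mult Q" "one BB = one Q" "add BB = add Q" "zero BB = zero Q" "smult BB = smult Q" by (simp_all add: B_alg_def)

lemma BB_carrier: "carrier BB = subalgebra_gen K Q (ee ` carrier H)" by (simp add: B_alg_def)

text \<open>Negatives are multiples by \<open>-1\<close>, hence the closure conditions suffice for a subring.\<close>

lemma BB_minimal:
  assumes D: "D \<subseteq> carrier Q" "\<one>[Q] \<in> D" "\<And>h. h \<in>. H \<Longrightarrow> ee h \<in> D"
    "\<And>x y. x \<in> D \<Longrightarrow> y \<in> D \<Longrightarrow> x *[Q] y \<in> D" "\<And>x y. x \<in> D \<Longrightarrow> y \<in> D \<Longrightarrow> x +[Q] y \<in> D"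
    "\<And>c x. c \<in>. K \<Longrightarrow> x \<in> D \<Longrightarrow> c \<cdot>[Q] x \<in> D"
  shows "carrier BB \<subseteq> D"
proof -
  interpret Q: k_algebra K Q by (rule Q_alg)
  have "\<ominus>\<^bsub>Q\<^esub> x = (\<ominus>\<^bsub>K\<^esub> \<one>[K]) \<cdot>[Q] x" if "x \<in> D" for x
    using that D(1) by (simp add: subset_iff Q.smult_l_minus)
  then have "\<ominus>\<^bsub>Q\<^esub> x \<in> D" if "x \<in> D" for x using that D(6)[of "\<ominus>\<^bsub>K\<^esub> \<one>[K]" x] by simp
  then have "subring D Q" by (intro Q.subringI) (use D in auto)
  then show ?thesis unfolding BB_carrier subalgebra_gen_def by (intro Inter_lower CollectI conjI ballI image_subsetI D(3,6))
qed

lemma BB_closed: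
  "subring (carrier BB) Q" "\<And>c b. c \<in>. K \<Longrightarrow> b \<in>. BB \<Longrightarrow> c \<cdot>[Q] b \<in>. BB"
  "\<And>h. h \<in>. H \<Longrightarrow> ee h \<in>. BB" "carrier BB \<subseteq> carrier Q"
proof -
  interpret Q: k_algebra K Q by (rule Q_alg)
  have full: "subring (carrier Q) Q \<and> (\<forall>c \<in> carrier K. \<forall>b \<in> carrier Q. c \<cdot>[Q] b \<in>. Q) \<and> ee ` carrier H \<subseteq> carrier Q"
    using Q.carrier_is_subring ee_closed by auto
  show "subring (carrier BB) Q"
    unfolding BB_carrier subalgebra_gen_def by (rule Q.subring_Inter) (use full in auto)
  show "c \<cdot>[Q] b \<in>. BB" if "c \<in>. K" "b \<in>. BB" for c b
    using that unfolding BB_carrier subalgebra_gen_def by blast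
  show "ee h \<in>. BB" if "h \<in>. H" for h
    using that unfolding BB_carrier subalgebra_gen_def by blast
  show "carrier BB \<subseteq> carrier Q"
    unfolding BB_carrier subalgebra_gen_def using full by blast
qed

lemma BB_sub: "b \<in>. BB \<Longrightarrow> b \<in>. Q"
  using BB_closed(4) by blast

lemma BB_alg: "k_algebra K BB"
proof -
  interpret Q: k_algebra K Q by (rule Q_alg)
  note sr = subringE[OF BB_closed(1)]
  have ag: "abelian_group BB"
  proof (rule abelian_groupI)
    fix x y assume x: "x \<in>. BB"
    show "x +[BB] y = y +[BB] x" if "y \<in>. BB"
      using x that BB_sub by (simp add: Q.M.a_comm)
    show "\<exists>y\<in>carrier BB. y +[BB] x = \<zero>[BB]"
      by (rule bexI[of _ "\<ominus>\<^bsub>Q\<^esub> x"]) (simp_all add: x BB_sub sr Q.M.l_neg)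
  qed (simp_all add: sr BB_sub Q.M.a_assoc)
  have "module K BB"
    by (rule moduleI[OF K_cring ag]) (use BB_sub BB_closed(2) in \<open>simp_all add: Q.smult_l_distr Q.smult_r_distr Q.smult_assoc1\<close>)
  then show ?thesis
  proof (rule k_algebraI)
    show "lin K BB BB (\<lambda>x. x *[BB] y)" if "y \<in>. BB" for y
      by (rule linI) (simp_all add: that sr BB_sub Q.l_distr k_algebra_smult_left[OF Q_alg])
    show "lin K BB BB (\<lambda>y. x *[BB] y)" if "x \<in>. BB" for x
      by (rule linI) (simp_all add: that sr BB_sub Q.r_distr k_algebra_smult_right[OF Q_alg])
  qed (simp_all add: sr BB_sub Q.m_assoc)
qed

lemma BB_left_module: "left_module Q M \<Longrightarrow> left_module BB M"
  using BB_sub k_algebra_ring[OF BB_alg]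
  by (intro left_moduleI) (auto simp: left_module_facts additive_add[OF left_module_facts(4)] additive_add[OF left_module_facts(5)]
     intro!: additiveI)

lemma BB_right_module: "right_module Q M \<Longrightarrow> right_module BB M"
  using BB_sub k_algebra_ring[OF BB_alg]
  by (intro right_moduleI) (auto simp: right_module_facts additive_add[OF right_module_facts(4)] additive_add[OF right_module_facts(5)]
     intro!: additiveI)

end


section \<open>Partial representations\<close>

context cocommutative_hopf_algebra
begin

text \<open>By \<open>rel_right_antipode\<close> and \<open>rel_left_antipode\<close> two of the four families of relations suffice.\<close>

definition par_rep :: "('a, 'e, 'w) module_scheme \<Rightarrow> ('b \<Rightarrow> 'e) \<Rightarrow> bool" where
  "par_rep E f \<longleftrightarrow> k_algebra K E \<and> lin K H E f \<and> f \<one>[H] = \<one>[E] \<and>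
    (\<forall>h \<in> carrier H. \<forall>k \<in> carrier H.
      sw E k (\<lambda>x y. f h *[E] (f x *[E] f (S y))) = sw E k (\<lambda>x y. f (h *[H] x) *[E] f (S y))) \<and>
    (\<forall>h \<in> carrier H. \<forall>k \<in> carrier H.
      sw E h (\<lambda>x y. f x *[E] (f (S y) *[E] f k)) = sw E h (\<lambda>x y. f x *[E] f (S y *[H] k)))"

lemma par_repD:
  assumes "par_rep E f"
  shows "k_algebra K E" "module K E" "lin K H E f" "f \<one>[H] = \<one>[E]"
    "\<And>h k. h \<in>. H \<Longrightarrow> k \<in>. H \<Longrightarrow>
      sw E k (\<lambda>x y. f h *[E] (f x *[E] f (S y))) = sw E k (\<lambda>x y. f (h *[H] x) *[E] f (S y))"
    "\<And>h k. h \<in>. H \<Longrightarrow> k \<in>. H \<Longrightarrow>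
      sw E h (\<lambda>x y. f x *[E] (f (S y) *[E] f k)) = sw E h (\<lambda>x y. f x *[E] f (S y *[H] k))"
    "\<And>(L :: ('a, 'l, 'lw) module_scheme) g. lin K L H g \<Longrightarrow> lin K L E (\<lambda>x. f (g x))"
    "\<And>h. h \<in>. H \<Longrightarrow> f h \<in>. E"
    "\<And>x y. x \<in>. E \<Longrightarrow> y \<in>. E \<Longrightarrow> x *[E] y \<in>. E"
proof -
  show E: "k_algebra K E" and l: "lin K H E f" and "f \<one>[H] = \<one>[E]" using assms unfolding par_rep_def by simp_all
  show "module K E" by (rule k_algebra_module[OF E])
  show "lin K L E (\<lambda>x. f (g x))" if "lin K L H g" for L :: "('a, 'l, 'lw) module_scheme" and g by (rule lin_comp[OF l that])
  show "f h \<in>. E" if "h \<in>. H" for h by (rule lin_closed[OF l that])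
  show "x *[E] y \<in>. E" if "x \<in>. E" "y \<in>. E" for x y by (rule k_algebra_mult_closed[OF E that])
qed (use assms in \<open>simp_all add: par_rep_def\<close>)

text \<open>How both module structures over \<open>H\<^sub>p\<^sub>a\<^sub>r\<close> are obtained: \<open>f\<close> is a partial representation in \<open>E\<close>, and the operators
  \<open>\<phi> h\<close> on \<open>V\<close> come from the action of \<open>f h\<close> on an \<open>E\<close>-module \<open>M\<close> through a surjection \<open>\<tau>\<close>.  For the smash
  product \<open>\<tau>\<close> is the identity, for the coinvariants it is the projection of \<open>M\<close> onto them.\<close>

lemma par_rep_module:
  assumes f: "par_rep E f" and M: "left_module E M" and V: "module K V"
    and \<tau>: "lin K (scal E M) V \<tau>"
    and span: "\<And>P v. v \<in>. V \<Longrightarrow> (\<And>m. m \<in>. M \<Longrightarrow> P (\<tau> m)) \<Longrightarrow>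
      (\<And>v w. v \<in>. V \<Longrightarrow> w \<in>. V \<Longrightarrow> P v \<Longrightarrow> P w \<Longrightarrow> P (v +[V] w)) \<Longrightarrow> P v"
    and \<phi>: "\<And>h. h \<in>. H \<Longrightarrow> lin K V V (\<phi> h)"
    and \<phi>\<tau>: "\<And>h m. h \<in>. H \<Longrightarrow> m \<in>. M \<Longrightarrow> \<phi> h (\<tau> m) = \<tau> (f h \<cdot>[M] m)"
  defines "N \<equiv> with_smult V (hpar_action K V \<phi>)"
  shows "left_module Q N" "\<And>h v. h \<in>. H \<Longrightarrow> v \<in>. V \<Longrightarrow> hc h \<cdot>[N] v = \<phi> h v"
    "\<And>c v. c \<in>. K \<Longrightarrow> v \<in>. V \<Longrightarrow> (c \<cdot>[Q] \<one>[Q]) \<cdot>[N] v = c \<cdot>[V] v"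
    "\<And>k m. k \<in>. H \<Longrightarrow> m \<in>. M \<Longrightarrow>
      ee k \<cdot>[N] \<tau> m = \<tau> (sw E k (\<lambda>x y. f x *[E] f (S y)) \<cdot>[M] m)"
proof -
  note F = left_module_facts[OF M]
  note fD = par_repD[OF f]
  have et: "lin K E V (\<lambda>e. \<tau> (e \<cdot>[M] m))" if "m \<in>. M" for m
    by (rule lin_comp[OF \<tau> lin_restrict_scalars[OF fD(1) M that lin_id]])
  have \<tau>c: "\<tau> m \<in>. V" if "m \<in>. M" for m using lin_closed[OF \<tau>] that by simp
  have eq: "a v = b v" if "lin K V V a" "lin K V V b" "\<And>m. m \<in>. M \<Longrightarrow> a (\<tau> m) = b (\<tau> m)" "v \<in>. V" for a b v
    using that(4) by (rule span) (use that lin_add[OF that(1)] lin_add[OF that(2)] in auto)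
  have \<phi>': "lin K H V (\<lambda>h. \<phi> h v)" if "v \<in>. V" for v
    using that
  proof (rule span)
    fix m assume m: "m \<in>. M"
    show "lin K H V (\<lambda>h. \<phi> h (\<tau> m))" by (rule lin_cong[OF lin_comp[OF et[OF m] fD(3)]])
        (simp_all add: m \<phi>\<tau> module_add_closed[OF H_mod] module_smult_closed[OF H_mod])
  next
    fix v w assume vw: "v \<in>. V" "w \<in>. V" "lin K H V (\<lambda>h. \<phi> h v)" "lin K H V (\<lambda>h. \<phi> h w)"
    show "lin K H V (\<lambda>h. \<phi> h (v +[V] w))" by (rule lin_cong[OF lin_sum[OF V vw(3,4)]])
        (simp_all add: lin_add[OF \<phi>] vw module_add_closed[OF H_mod] module_smult_closed[OF H_mod])
  qed
  have \<phi>c: "\<phi> h v \<in>. V" if "h \<in>. H" "v \<in>. V" for h v using lin_closed[OF \<phi>] that .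
  have lp: "lin K L V (\<lambda>x. \<phi> h (g x))" if "lin K L V g" "h \<in>. H" for L :: "('a, 'l, 'lw) module_scheme" and g h
    by (rule lin_comp[OF \<phi>[OF that(2)] that(1)])
  have lp': "lin K H V (\<lambda>x. \<phi> (g x) v)" if "lin K H H g" "v \<in>. V" for g v
    by (rule lin_comp[OF \<phi>'[OF that(2)] that(1)])
  note facts = lin_rules hopf_closed V \<phi>c lp lp' fD(1-4,7-9) F(3) \<tau>c
  have push: "sw V k (\<lambda>x y. \<tau> (G x y \<cdot>[M] m)) = \<tau> (sw E k G \<cdot>[M] m)"
    if "k \<in>. H" "m \<in>. M" "bilin K H H E G" for k m G by (rule sw_push[symmetric, OF fD(2) V that(1,3) et[OF that(2)]])
  have one: "\<phi> \<one>[H] v = v" if "v \<in>. V" for v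
    by (rule eq[OF \<phi> lin_id _ that]) (use \<phi>\<tau> fD(4) F(7) in \<open>simp_all add: one_H_closed\<close>)
  \<comment> \<open>an identity in \<open>E\<close> becomes one of operators on \<open>V\<close>, which is checked on the values of \<open>\<tau>\<close>\<close>
  have rel: "sw V k (\<lambda>x y. a x y v) = sw V k (\<lambda>x y. b x y v)"
    if k: "k \<in>. H" and v: "v \<in>. V" and FG: "bilin K H H E F" "bilin K H H E G" "sw E k F = sw E k G"
      and a: "\<And>x y m. x \<in>. H \<Longrightarrow> y \<in>. H \<Longrightarrow> m \<in>. M \<Longrightarrow> a x y (\<tau> m) = \<tau> (F x y \<cdot>[M] m)"
      and b: "\<And>x y m. x \<in>. H \<Longrightarrow> y \<in>. H \<Longrightarrow> m \<in>. M \<Longrightarrow> b x y (\<tau> m) = \<tau> (G x y \<cdot>[M] m)"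
      and l: "lin K V V (\<lambda>v. sw V k (\<lambda>x y. a x y v))" "lin K V V (\<lambda>v. sw V k (\<lambda>x y. b x y v))"
    for k v F G a b
  proof (rule eq[OF l _ v])
    fix m assume m: "m \<in>. M"
    have "sw V k (\<lambda>x y. c x y (\<tau> m)) = \<tau> (sw E k J \<cdot>[M] m)"
      if "bilin K H H E J" "\<And>x y m. x \<in>. H \<Longrightarrow> y \<in>. H \<Longrightarrow> m \<in>. M \<Longrightarrow> c x y (\<tau> m) = \<tau> (J x y \<cdot>[M] m)" for c J
      unfolding push[OF k m that(1), symmetric]
      by (rule sw_cong[symmetric, OF V k bilin_comp[OF that(1) et[OF m]]]) (simp add: that(2) m)
    from this[OF FG(1) a] this[OF FG(2) b] show "sw V k (\<lambda>x y. a x y (\<tau> m)) = sw V k (\<lambda>x y. b x y (\<tau> m))"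
      by (simp add: FG(3))
  qed
  have right: "sw V k (\<lambda>x y. \<phi> h (\<phi> x (\<phi> (S y) v))) = sw V k (\<lambda>x y. \<phi> (h *[H] x) (\<phi> (S y) v))"
    if "h \<in>. H" "k \<in>. H" "v \<in>. V" for h k v
    by (rule rel[OF that(2,3) _ _ fD(5)[OF that(1,2)]]) (simp_all add: that facts \<phi>\<tau> F(6))
  have left: "sw V h (\<lambda>x y. \<phi> x (\<phi> (S y) (\<phi> k v))) = sw V h (\<lambda>x y. \<phi> x (\<phi> (S y *[H] k) v))"
    if "h \<in>. H" "k \<in>. H" "v \<in>. V" for h k v
    by (rule rel[OF that(1,3) _ _ fD(6)[OF that(1,2)]]) (simp_all add: that facts \<phi>\<tau> F(6))
  note act = hpar_action_left_module[OF V \<phi> \<phi>' one right left]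
  show N: "left_module Q N" unfolding N_def by (rule act(1); assumption)
  show hcN: "hc h \<cdot>[N] v = \<phi> h v" if "h \<in>. H" "v \<in>. V" for h v
  proof -
    have "hpar_action K V \<phi> (hc h) v = \<phi> h v" by (rule act(2)) (simp_all add: that)
    then show ?thesis by (simp add: N_def)
  qed
  note FN = left_module_facts[OF N]
  have cN: "carrier N = carrier V" "add N = add V" by (simp_all add: N_def)
  show cv: "(c \<cdot>[Q] \<one>[Q]) \<cdot>[N] v = c \<cdot>[V] v" if "c \<in>. K" "v \<in>. V" for c v
  proof -
    have "c \<cdot>[Q] \<one>[Q] = hc (c \<cdot>[H] \<one>[H])"
      using lin_smult[OF hc_lin that(1) one_H_closed] by (simp add: hc_one)
    then show ?thesis
      using that hcN[OF module_smult_closed[OF H_mod that(1) one_H_closed] that(2)] lin_smult[OF \<phi>'[OF that(2)] that(1) one_H_closed]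
      by (simp add: one)
  qed
  have QN: "lin K Q V (\<lambda>z. z \<cdot>[N] v)" if v: "v \<in>. V" for v
  proof (rule linI)
    fix c z assume cz: "c \<in>. K" "z \<in>. Q"
    have "c \<cdot>[Q] z = (c \<cdot>[Q] \<one>[Q]) *[Q] z" using scal_mult[OF Q_alg cz] by simp
    then show "(c \<cdot>[Q] z) \<cdot>[N] v = c \<cdot>[V] (z \<cdot>[N] v)"
      using FN(6)[OF module_smult_closed[OF Q_mod cz(1) k_algebra_one_closed[OF Q_alg]] cz(2), of v] v cv[OF cz(1)] FN(3)[OF cz(2), of v] cN
      by simp
  qed (use v FN(3) additive_add[OF FN(5)] cN in auto)
  show "ee k \<cdot>[N] \<tau> m = \<tau> (sw E k (\<lambda>x y. f x *[E] f (S y)) \<cdot>[M] m)" if k: "k \<in>. H" and m: "m \<in>. M" for k m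
  proof -
    have "ee k \<cdot>[N] \<tau> m = sw V k (\<lambda>x y. (hc x *[Q] hc (S y)) \<cdot>[N] \<tau> m)"
      unfolding e_elem_def by (rule sw_push[OF Q_mod V k _ QN[OF \<tau>c[OF m]]]) (simp add: hpar_rules)
    also have "\<dots> = sw V k (\<lambda>x y. \<tau> ((f x *[E] f (S y)) \<cdot>[M] m))"
    proof (rule sw_cong[symmetric, OF V k])
      show "bilin K H H V (\<lambda>x y. \<tau> ((f x *[E] f (S y)) \<cdot>[M] m))"
        by (rule bilin_comp[OF _ et[OF m]]) (simp add: facts)
      show "\<tau> ((f x *[E] f (S y)) \<cdot>[M] m) = (hc x *[Q] hc (S y)) \<cdot>[N] \<tau> m" if "x \<in>. H" "y \<in>. H" for x y
        using that m FN(6)[of "hc x" "hc (S y)" "\<tau> m"] by (simp add: cN facts hc_closed hcN \<phi>\<tau> F(6))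
    qed
    also have "\<dots> = \<tau> (sw E k (\<lambda>x y. f x *[E] f (S y)) \<cdot>[M] m)" by (rule push[OF k m]) (simp add: facts)
    finally show ?thesis .
  qed
qed


definition prod_rep :: "('a, 'e, 'w) module_scheme \<Rightarrow> ('a, 'f, 'x) module_scheme \<Rightarrow> ('b \<Rightarrow> 'e) \<Rightarrow> ('b \<Rightarrow> 'f) \<Rightarrow> 'b \<Rightarrow> ('e, 'f) tens" where
  "prod_rep D E f g h = sw (alg_tensor K D E) h (\<lambda>x y. kten K D E (f x) (g y))"

context
  fixes D E :: "('a, 'e, 'w) module_scheme" and f g :: "'b \<Rightarrow> 'e"
  assumes f: "par_rep D f" and g: "par_rep E g"
begin

abbreviation "DE \<equiv> alg_tensor K D E"
abbreviation "dt \<equiv> kten K D E"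

abbreviation "prd \<equiv> prod_rep D E f g"

lemmas fD = par_repD[OF f] and gE = par_repD[OF g]
lemmas DE_alg = alg_tensor_k_algebra[OF fD(1) gE(1)]
lemmas DE_mod = k_algebra_module[OF DE_alg]

lemma lin_kten_DE:
  "lin K L D p \<Longrightarrow> y \<in>. E \<Longrightarrow> lin K L DE (\<lambda>l. dt (p l) y)"
  "lin K L E q \<Longrightarrow> x \<in>. D \<Longrightarrow> lin K L DE (\<lambda>l. dt x (q l))"
  by (rule lin_fields[OF kt_lin_left[OF fD(2) gE(2)]] lin_fields[OF kt_lin_right[OF fD(2) gE(2)]]; simp)+

lemma kten_DE_closed: "x \<in>. D \<Longrightarrow> y \<in>. E \<Longrightarrow> dt x y \<in>. DE"
  using kt_tens_closed[OF fD(2) gE(2)] by simp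

lemmas prod_rules = lin_rules hopf_closed DE_alg DE_mod fD(1-4,7-9) gE(1-4,7-9) lin_kten_DE kten_DE_closed
  k_algebra_mult_closed[OF DE_alg] alg_tensor_tens_mult[OF fD(1) gE(1)]

declare alg_tensor_simps [simp del]

lemma prod_rep_lin: "lin K H DE prd"
  unfolding prod_rep_def by (simp add: prod_rules)

lemma lin_prod_rep: "lin K L H p \<Longrightarrow> lin K L DE (\<lambda>x. prd (p x))" by (rule lin_comp[OF prod_rep_lin])

lemma prod_rep_closed: "h \<in>. H \<Longrightarrow> prd h \<in>. DE" by (rule lin_closed[OF prod_rep_lin])

text \<open>The two coproducts stay as they are; the legs that belong to \<open>f\<close> and those that belong to \<open>g\<close> are collected
  afterwards (\<open>sw_middle_swap\<close>, \<open>sw_kten\<close>).\<close>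

lemma sw_kten_mult:
  assumes x: "x \<in>. H" and y: "y \<in>. H"
    and p: "lin K H D p" and q: "lin K H E q" and p': "lin K H D p'" and q': "lin K H E q'"
  shows "sw DE x (\<lambda>a b. dt (p a) (q b)) *[DE] sw DE y (\<lambda>a b. dt (p' a) (q' b)) =
    sw DE x (\<lambda>a b. sw DE y (\<lambda>c d. dt (p a *[D] p' c) (q b *[E] q' d)))"
proof -
  note l = p q p' q' and cl = lin_closed[OF p] lin_closed[OF q] lin_closed[OF p'] lin_closed[OF q']
  have yc: "sw DE y (\<lambda>a b. dt (p' a) (q' b)) \<in>. DE"
    by (rule sw_closed'[OF DE_mod y]) (simp_all add: l cl prod_rules)
  have "sw DE x (\<lambda>a b. dt (p a) (q b)) *[DE] sw DE y (\<lambda>a b. dt (p' a) (q' b)) =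
    sw DE x (\<lambda>a b. dt (p a) (q b) *[DE] sw DE y (\<lambda>a b. dt (p' a) (q' b)))"
    by (rule sw_push[OF DE_mod DE_mod x]) (simp_all add: l cl yc prod_rules)
  also have "\<dots> = sw DE x (\<lambda>a b. sw DE y (\<lambda>c d. dt (p a *[D] p' c) (q b *[E] q' d)))"
  proof (rule sw_cong[OF DE_mod x])
    show "bilin K H H DE (\<lambda>a b. dt (p a) (q b) *[DE] sw DE y (\<lambda>a b. dt (p' a) (q' b)))"
      using l cl yc by (simp add: prod_rules)
    fix a b assume ab: "a \<in>. H" "b \<in>. H"
    have "dt (p a) (q b) *[DE] sw DE y (\<lambda>a b. dt (p' a) (q' b)) =
      sw DE y (\<lambda>c d. dt (p a) (q b) *[DE] dt (p' c) (q' d))"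
      by (rule sw_push[OF DE_mod DE_mod y]) (simp_all add: l cl ab prod_rules)
    also have "\<dots> = sw DE y (\<lambda>c d. dt (p a *[D] p' c) (q b *[E] q' d))"
      by (rule sw_cong[OF DE_mod y]) (simp_all add: l cl ab prod_rules)
    finally show "dt (p a) (q b) *[DE] sw DE y (\<lambda>a b. dt (p' a) (q' b)) =
      sw DE y (\<lambda>c d. dt (p a *[D] p' c) (q b *[E] q' d))" .
  qed
  finally show ?thesis .
qed

lemma sw_kten:
  assumes x: "x \<in>. H" and y: "y \<in>. H" and P: "bilin K H H D P" and G: "bilin K H H E G"
  shows "sw DE x (\<lambda>a c. sw DE y (\<lambda>b d. dt (P a c) (G b d))) =
     dt (sw D x P) (sw E y G)"
proof -
  note Pb = bilin_left[OF P] bilin_right[OF P] bilin_closed[OF P] and Gb = bilin_left[OF G] bilin_right[OF G] bilin_closed[OF G]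
  have "sw DE x (\<lambda>a c. sw DE y (\<lambda>b d. dt (P a c) (G b d))) =
     sw DE x (\<lambda>a c. dt (P a c) (sw E y G))"
  proof (rule sw_cong[OF DE_mod x])
    show "sw DE y (\<lambda>b d. dt (P a c) (G b d)) = dt (P a c) (sw E y G)"
      if "a \<in>. H" "c \<in>. H" for a c by (rule sw_push[symmetric, OF gE(2) DE_mod y G]) (simp add: that Pb prod_rules)
  qed (simp add: y Pb Gb prod_rules)
  also have "\<dots> = dt (sw D x P) (sw E y G)"
    by (rule sw_push[symmetric, OF fD(2) DE_mod x P]) (simp add: sw_closed[OF gE(2) y G] prod_rules)
  finally show ?thesis .
qed

lemma prod_rep_antipode:
  assumes y: "y \<in>. H"
  shows "prd (S y) = sw DE y (\<lambda>c d. dt (f (S c)) (g (S d)))"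
  unfolding prod_rep_def by (rule sw_antipode[OF DE_mod y]) (simp add: prod_rules)

lemma prod_rep_rep_antipode:
  assumes k: "k \<in>. H"
  shows "sw DE k (\<lambda>x y. prd x *[DE] prd (S y)) =
    sw DE k (\<lambda>x y. dt (sw D x (\<lambda>a c. f a *[D] f (S c))) (sw E y (\<lambda>b d. g b *[E] g (S d))))"
proof -
  have "sw DE k (\<lambda>x y. prd x *[DE] prd (S y)) =
     sw DE k (\<lambda>x y. sw DE x (\<lambda>a b. sw DE y (\<lambda>c d. dt (f a *[D] f (S c)) (g b *[E] g (S d)))))"
  proof (rule sw_cong[OF DE_mod k])
    show "bilin K H H DE (\<lambda>x y. prd x *[DE] prd (S y))" by (simp add: prod_rules lin_prod_rep prod_rep_closed)
    show "prd x *[DE] prd (S y) =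
       sw DE x (\<lambda>a b. sw DE y (\<lambda>c d. dt (f a *[D] f (S c)) (g b *[E] g (S d))))"
      if "x \<in>. H" "y \<in>. H" for x y
      unfolding prod_rep_antipode[OF that(2)] unfolding prod_rep_def by (rule sw_kten_mult[OF that]) (simp_all add: prod_rules)
  qed
  also have "\<dots> = sw DE k (\<lambda>x y. sw DE x (\<lambda>a c. sw DE y (\<lambda>b d. dt (f a *[D] f (S c)) (g b *[E] g (S d)))))"
    by (rule sw_middle_swap[OF DE_mod k]) (simp add: prod_rules)
  also have "\<dots> = sw DE k (\<lambda>x y. dt (sw D x (\<lambda>a c. f a *[D] f (S c))) (sw E y (\<lambda>b d. g b *[E] g (S d))))"
    by (rule sw_cong[OF DE_mod k]) (simp_all add: prod_rules sw_kten del: alg_tensor_tens_mult)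
  finally show ?thesis .
qed

text \<open>Both sides of each relation are brought into a form in which \<open>f\<close> sees only the first and \<open>g\<close> only the second
  legs of the coproducts of \<open>h\<close> and \<open>k\<close>.  The relations then apply in each tensor factor separately.\<close>

lemma prod_rep_par_rep: "par_rep DE prd"
  unfolding par_rep_def
proof (intro conjI ballI)
  note pl = lin_prod_rep prod_rep_closed
  \<comment> \<open>the elements that play the role of \<open>e\<^sub>x\<close> for \<open>f\<close> and for \<open>g\<close>\<close>
  define P where "P x = sw D x (\<lambda>a c. f a *[D] f (S c))" for x
  define G where "G x = sw E x (\<lambda>b d. g b *[E] g (S d))" for x
  have Pl: "lin K H D P" and Gl: "lin K H E G"
    unfolding P_def G_def by (simp_all add: prod_rules)
  have PG: "lin K L H p \<Longrightarrow> lin K L D (\<lambda>x. P (p x))" "lin K L H p \<Longrightarrow> lin K L E (\<lambda>x. G (p x))"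
    "x \<in>. H \<Longrightarrow> P x \<in>. D" "x \<in>. H \<Longrightarrow> G x \<in>. E"
    for L :: "('a, 'l, 'lw) module_scheme" and p x
    using lin_comp[OF Pl] lin_comp[OF Gl] lin_closed[OF Pl] lin_closed[OF Gl] by blast+
  note facts = prod_rules pl PG
  show "k_algebra K DE" by (rule DE_alg)
  show "lin K H DE prd" by (rule prod_rep_lin)
  show "prd \<one>[H] = \<one>[DE]"
    unfolding prod_rep_def using sw_one[OF DE_mod, of "\<lambda>x y. dt (f x) (g y)"] by (simp add: facts alg_tensor_simps(5))
  fix h k assume h: "h \<in>. H" and k: "k \<in>. H"
  have PPS: "sw DE k (\<lambda>x y. prd x *[DE] prd (S y)) = sw DE k (\<lambda>x y. dt (P x) (G y))" if "k \<in>. H" for k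
    unfolding P_def G_def by (rule prod_rep_rep_antipode[OF that])
  have fP: "sw D x (\<lambda>p c. f (a *[H] p) *[D] f (S c)) = f a *[D] P x" if "a \<in>. H" "x \<in>. H" for a x
    unfolding P_def fD(5)[OF that, symmetric] by (rule sw_push[symmetric, OF fD(2) fD(2) that(2)]) (simp_all add: that facts)
  have gG: "sw E x (\<lambda>p c. g (a *[H] p) *[E] g (S c)) = g a *[E] G x" if "a \<in>. H" "x \<in>. H" for a x
    unfolding G_def gE(5)[OF that, symmetric] by (rule sw_push[symmetric, OF gE(2) gE(2) that(2)]) (simp_all add: that facts)
  have Pf: "sw D x (\<lambda>p c. f p *[D] f (S c *[H] a)) = P x *[D] f a" if "a \<in>. H" "x \<in>. H" for a x
  proof -
    have "P x *[D] f a = sw D x (\<lambda>p c. (f p *[D] f (S c)) *[D] f a)"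
      unfolding P_def by (rule sw_push[OF fD(2) fD(2) that(2)]) (simp_all add: that facts)
    also have "\<dots> = sw D x (\<lambda>p c. f p *[D] (f (S c) *[D] f a))"
      by (rule sw_cong[OF fD(2) that(2)]) (simp_all add: that facts k_algebra_assoc[OF fD(1)])
    finally show ?thesis using fD(6)[OF that(2,1)] by simp
  qed
  have Gg: "sw E x (\<lambda>p c. g p *[E] g (S c *[H] a)) = G x *[E] g a" if "a \<in>. H" "x \<in>. H" for a x
  proof -
    have "G x *[E] g a = sw E x (\<lambda>p c. (g p *[E] g (S c)) *[E] g a)"
      unfolding G_def by (rule sw_push[OF gE(2) gE(2) that(2)]) (simp_all add: that facts)
    also have "\<dots> = sw E x (\<lambda>p c. g p *[E] (g (S c) *[E] g a))"
      by (rule sw_cong[OF gE(2) that(2)]) (simp_all add: that facts k_algebra_assoc[OF gE(1)])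
    finally show ?thesis using gE(6)[OF that(2,1)] by simp
  qed
  show "sw DE k (\<lambda>x y. prd h *[DE] (prd x *[DE] prd (S y))) = sw DE k (\<lambda>x y. prd (h *[H] x) *[DE] prd (S y))"
  proof -
    let ?N = "sw DE h (\<lambda>a b. sw DE k (\<lambda>c d. dt (f a *[D] P c) (g b *[E] G d)))"
    have "sw DE k (\<lambda>x y. prd h *[DE] (prd x *[DE] prd (S y))) = prd h *[DE] sw DE k (\<lambda>x y. prd x *[DE] prd (S y))"
      by (rule sw_push[symmetric, OF DE_mod DE_mod k]) (simp_all add: h facts)
    also have "\<dots> = ?N"
      unfolding PPS[OF k] unfolding prod_rep_def by (rule sw_kten_mult[OF h k]) (simp_all add: facts Pl Gl)
    finally have 1: "sw DE k (\<lambda>x y. prd h *[DE] (prd x *[DE] prd (S y))) = ?N" .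
    let ?F = "\<lambda>a b p q c d. dt (f (a *[H] p) *[D] f (S c)) (g (b *[H] q) *[E] g (S d))"
    have "sw DE k (\<lambda>x y. prd (h *[H] x) *[DE] prd (S y)) =
       sw DE k (\<lambda>x y. sw DE h (\<lambda>a b. sw DE x (\<lambda>p q. sw DE y (\<lambda>c d. ?F a b p q c d))))"
    proof (rule sw_cong[OF DE_mod k])
      show "bilin K H H DE (\<lambda>x y. prd (h *[H] x) *[DE] prd (S y))" using h by (simp add: facts)
      fix x y assume xy: "x \<in>. H" "y \<in>. H"
      have "prd (h *[H] x) = sw DE h (\<lambda>a b. sw DE x (\<lambda>p q. dt (f (a *[H] p)) (g (b *[H] q))))"
        unfolding prod_rep_def by (rule sw_mult[OF DE_mod h xy(1)]) (simp add: facts)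
      also have "\<dots> *[DE] prd (S y) = sw DE h (\<lambda>a b. sw DE x (\<lambda>p q. dt (f (a *[H] p)) (g (b *[H] q))) *[DE] prd (S y))"
        by (rule sw_push[OF DE_mod DE_mod h]) (simp_all add: xy facts)
      also have "\<dots> = sw DE h (\<lambda>a b. sw DE x (\<lambda>p q. sw DE y (\<lambda>c d. ?F a b p q c d)))"
      proof (rule sw_cong[OF DE_mod h])
        show "bilin K H H DE (\<lambda>a b. sw DE x (\<lambda>p q. dt (f (a *[H] p)) (g (b *[H] q))) *[DE] prd (S y))"
          using xy by (simp add: facts)
        show "sw DE x (\<lambda>p q. dt (f (a *[H] p)) (g (b *[H] q))) *[DE] prd (S y) = sw DE x (\<lambda>p q. sw DE y (\<lambda>c d. ?F a b p q c d))"
          if "a \<in>. H" "b \<in>. H" for a b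
          unfolding prod_rep_antipode[OF xy(2)] by (rule sw_kten_mult[OF xy]) (simp_all add: that facts)
      qed
      finally show "prd (h *[H] x) *[DE] prd (S y) = sw DE h (\<lambda>a b. sw DE x (\<lambda>p q. sw DE y (\<lambda>c d. ?F a b p q c d)))" .
    qed
    also have "\<dots> = sw DE h (\<lambda>a b. sw DE k (\<lambda>x y. sw DE x (\<lambda>p q. sw DE y (\<lambda>c d. ?F a b p q c d))))"
      by (rule sw_swap[OF DE_mod k h]) (simp_all add: facts)
    also have "\<dots> = ?N"
    proof (rule sw_cong[OF DE_mod h])
      show "bilin K H H DE (\<lambda>a b. sw DE k (\<lambda>x y. sw DE x (\<lambda>p q. sw DE y (\<lambda>c d. ?F a b p q c d))))"
        using k by (simp add: facts)
      fix a b assume ab: "a \<in>. H" "b \<in>. H"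
      have "sw DE k (\<lambda>x y. sw DE x (\<lambda>p q. sw DE y (\<lambda>c d. ?F a b p q c d))) =
        sw DE k (\<lambda>x y. sw DE x (\<lambda>p q. sw DE y (\<lambda>c d. ?F a b p c q d)))"
        by (rule sw_middle_swap[OF DE_mod k]) (simp add: ab facts)
      also have "\<dots> = sw DE k (\<lambda>c d. dt (f a *[D] P c) (g b *[E] G d))"
      proof (rule sw_cong[OF DE_mod k])
        show "sw DE x (\<lambda>p q. sw DE y (\<lambda>c d. ?F a b p c q d)) = dt (f a *[D] P x) (g b *[E] G y)"
          if "x \<in>. H" "y \<in>. H" for x y
          unfolding fP[OF ab(1) that(1), symmetric] gG[OF ab(2) that(2), symmetric]
          by (rule sw_kten[OF that]) (simp_all add: ab facts)
      qed (simp add: ab facts)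
      finally show "sw DE k (\<lambda>x y. sw DE x (\<lambda>p q. sw DE y (\<lambda>c d. ?F a b p q c d))) =
        sw DE k (\<lambda>c d. dt (f a *[D] P c) (g b *[E] G d))" .
    qed
    finally show ?thesis using 1 by simp
  qed
  show "sw DE h (\<lambda>x y. prd x *[DE] (prd (S y) *[DE] prd k)) = sw DE h (\<lambda>x y. prd x *[DE] prd (S y *[H] k))"
  proof -
    let ?N = "sw DE h (\<lambda>c d. sw DE k (\<lambda>a b. dt (P c *[D] f a) (G d *[E] g b)))"
    have "sw DE h (\<lambda>x y. prd x *[DE] (prd (S y) *[DE] prd k)) = sw DE h (\<lambda>x y. (prd x *[DE] prd (S y)) *[DE] prd k)"
      by (rule sw_cong[OF DE_mod h]) (simp_all add: k facts k_algebra_assoc[OF DE_alg])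
    also have "\<dots> = sw DE h (\<lambda>x y. prd x *[DE] prd (S y)) *[DE] prd k"
      by (rule sw_push[symmetric, OF DE_mod DE_mod h]) (simp_all add: k facts)
    also have "\<dots> = ?N"
      unfolding PPS[OF h] unfolding prod_rep_def by (rule sw_kten_mult[OF h k]) (simp_all add: facts Pl Gl)
    finally have 1: "sw DE h (\<lambda>x y. prd x *[DE] (prd (S y) *[DE] prd k)) = ?N" .
    let ?F = "\<lambda>a b p q c d. dt (f p *[D] f (S c *[H] a)) (g q *[E] g (S d *[H] b))"
    have "sw DE h (\<lambda>x y. prd x *[DE] prd (S y *[H] k)) =
       sw DE h (\<lambda>x y. sw DE k (\<lambda>a b. sw DE x (\<lambda>p q. sw DE y (\<lambda>c d. ?F a b p q c d))))"
    proof (rule sw_cong[OF DE_mod h])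
      show "bilin K H H DE (\<lambda>x y. prd x *[DE] prd (S y *[H] k))" using k by (simp add: facts)
      fix x y assume xy: "x \<in>. H" "y \<in>. H"
      have "prd (S y *[H] k) = sw DE (S y) (\<lambda>c d. sw DE k (\<lambda>a b. dt (f (c *[H] a)) (g (d *[H] b))))"
        unfolding prod_rep_def by (rule sw_mult[OF DE_mod antipode_closed[OF xy(2)] k]) (simp add: facts)
      also have "\<dots> = sw DE y (\<lambda>c d. sw DE k (\<lambda>a b. dt (f (S c *[H] a)) (g (S d *[H] b))))"
        by (rule sw_antipode[OF DE_mod xy(2)]) (simp add: k facts)
      also have "\<dots> = sw DE k (\<lambda>a b. sw DE y (\<lambda>c d. dt (f (S c *[H] a)) (g (S d *[H] b))))"
        by (rule sw_swap[OF DE_mod xy(2) k]) (simp_all add: facts)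
      finally have "prd x *[DE] prd (S y *[H] k) = prd x *[DE] sw DE k (\<lambda>a b. sw DE y (\<lambda>c d. dt (f (S c *[H] a)) (g (S d *[H] b))))"
        by simp
      also have "\<dots> = sw DE k (\<lambda>a b. prd x *[DE] sw DE y (\<lambda>c d. dt (f (S c *[H] a)) (g (S d *[H] b))))"
        by (rule sw_push[OF DE_mod DE_mod k]) (simp_all add: xy facts)
      also have "\<dots> = sw DE k (\<lambda>a b. sw DE x (\<lambda>p q. sw DE y (\<lambda>c d. ?F a b p q c d)))"
      proof (rule sw_cong[OF DE_mod k])
        show "bilin K H H DE (\<lambda>a b. prd x *[DE] sw DE y (\<lambda>c d. dt (f (S c *[H] a)) (g (S d *[H] b))))"
          using xy by (simp add: facts)
        show "prd x *[DE] sw DE y (\<lambda>c d. dt (f (S c *[H] a)) (g (S d *[H] b))) =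
            sw DE x (\<lambda>p q. sw DE y (\<lambda>c d. ?F a b p q c d))"
          if "a \<in>. H" "b \<in>. H" for a b
          unfolding prod_rep_def by (rule sw_kten_mult[OF xy]) (simp_all add: that facts)
      qed
      finally show "prd x *[DE] prd (S y *[H] k) = sw DE k (\<lambda>a b. sw DE x (\<lambda>p q. sw DE y (\<lambda>c d. ?F a b p q c d)))" .
    qed
    also have "\<dots> = sw DE k (\<lambda>a b. sw DE h (\<lambda>x y. sw DE x (\<lambda>p q. sw DE y (\<lambda>c d. ?F a b p q c d))))"
      by (rule sw_swap[OF DE_mod h k]) (simp_all add: facts)
    also have "\<dots> = sw DE k (\<lambda>a b. sw DE h (\<lambda>c d. dt (P c *[D] f a) (G d *[E] g b)))"
    proof (rule sw_cong[OF DE_mod k])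
      show "bilin K H H DE (\<lambda>a b. sw DE h (\<lambda>x y. sw DE x (\<lambda>p q. sw DE y (\<lambda>c d. ?F a b p q c d))))"
        using h by (simp add: facts)
      fix a b assume ab: "a \<in>. H" "b \<in>. H"
      have "sw DE h (\<lambda>x y. sw DE x (\<lambda>p q. sw DE y (\<lambda>c d. ?F a b p q c d))) =
        sw DE h (\<lambda>x y. sw DE x (\<lambda>p q. sw DE y (\<lambda>c d. ?F a b p c q d)))"
        by (rule sw_middle_swap[OF DE_mod h]) (simp add: ab facts)
      also have "\<dots> = sw DE h (\<lambda>c d. dt (P c *[D] f a) (G d *[E] g b))"
      proof (rule sw_cong[OF DE_mod h])
        show "sw DE x (\<lambda>p q. sw DE y (\<lambda>c d. ?F a b p c q d)) = dt (P x *[D] f a) (G y *[E] g b)"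
          if "x \<in>. H" "y \<in>. H" for x y
          unfolding Pf[OF ab(1) that(1), symmetric] Gg[OF ab(2) that(2), symmetric]
          by (rule sw_kten[OF that]) (simp_all add: ab facts)
      qed (simp add: ab facts)
      finally show "sw DE h (\<lambda>x y. sw DE x (\<lambda>p q. sw DE y (\<lambda>c d. ?F a b p q c d))) =
        sw DE h (\<lambda>c d. dt (P c *[D] f a) (G d *[E] g b))" .
    qed
    also have "\<dots> = ?N" by (rule sw_swap[OF DE_mod k h]) (simp_all add: facts)
    finally show ?thesis using 1 by simp
  qed
qed

end

end

context partial_smash
begin

lemma \<gamma>_par_rep: "par_rep R \<gamma>"
  unfolding par_rep_def
  using \<gamma>_rel_left \<gamma>_rel_right lin_sm(2)[OF lin_id one_A_closed] by (simp add: smash_alg sm_one)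

abbreviation "Rop \<equiv> opposite R"

lemma Rop_alg: "k_algebra K Rop" by (rule opposite_k_algebra[OF smash_alg])

lemma lin_Rop: "lin K L Rop f = lin K L R f" by (simp add: lin_def additive_def)

lemma sw_Rop: "h \<in>. H \<Longrightarrow> bilin K H H R F \<Longrightarrow> sw Rop h F = sw R h F"
  using sw_push[OF smash_mod k_algebra_module[OF Rop_alg], of h F "\<lambda>x. x"] lin_id[of K R]
  by (simp add: lin_Rop[symmetric])

text \<open>\<open>S\<close> reverses products, and so does the passage to the opposite algebra; the two families of relations are
  exchanged.\<close>

lemma \<gamma>S_par_rep: "par_rep Rop (\<lambda>h. \<gamma> (S h))"
  unfolding par_rep_def
proof (intro conjI ballI)
  show "k_algebra K Rop" by (rule Rop_alg)
  show "lin K H Rop (\<lambda>h. \<gamma> (S h))" unfolding lin_Rop by (simp add: smash_rules)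
  show "\<gamma> (S \<one>[H]) = \<one>[Rop]" by (simp add: antipode_one sm_one)
  note ii = antipode_involutive antipode_mult
  fix h k assume h: "h \<in>. H" and k: "k \<in>. H"
  have "sw R k (\<lambda>x y. (\<gamma> (S (S y)) *[R] \<gamma> (S x)) *[R] \<gamma> (S h)) =
     sw R k (\<lambda>x y. (\<gamma> (S (S x)) *[R] \<gamma> (S y)) *[R] \<gamma> (S h))"
    by (rule sw_comm[OF smash_mod k]) (simp add: h smash_rules)
  also have "\<dots> = sw R k (\<lambda>x y. \<gamma> x *[R] (\<gamma> (S y) *[R] \<gamma> (S h)))"
    by (rule sw_cong[OF smash_mod k]) (simp_all add: h smash_rules ii R_assoc)
  also have "\<dots> = sw R k (\<lambda>x y. \<gamma> x *[R] \<gamma> (S y *[H] S h))"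
    by (rule \<gamma>_rel_left) (simp_all add: h k smash_rules)
  also have "\<dots> = sw R k (\<lambda>x y. \<gamma> y *[R] \<gamma> (S x *[H] S h))"
    by (rule sw_comm[OF smash_mod k]) (simp add: h smash_rules)
  also have "\<dots> = sw R k (\<lambda>x y. \<gamma> (S (S y)) *[R] \<gamma> (S (h *[H] x)))"
    by (rule sw_cong[OF smash_mod k]) (simp_all add: h smash_rules ii)
  finally show "sw Rop k (\<lambda>x y. \<gamma> (S h) *[Rop] (\<gamma> (S x) *[Rop] \<gamma> (S (S y)))) =
      sw Rop k (\<lambda>x y. \<gamma> (S (h *[H] x)) *[Rop] \<gamma> (S (S y)))"
    using h k by (simp add: sw_Rop smash_rules)
  have "sw R h (\<lambda>x y. (\<gamma> (S k) *[R] \<gamma> (S (S y))) *[R] \<gamma> (S x)) =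
     sw R h (\<lambda>x y. (\<gamma> (S k) *[R] \<gamma> (S (S x))) *[R] \<gamma> (S y))"
    by (rule sw_comm[OF smash_mod h]) (simp add: k smash_rules)
  also have "\<dots> = sw R h (\<lambda>x y. \<gamma> (S k) *[R] (\<gamma> x *[R] \<gamma> (S y)))"
    by (rule sw_cong[OF smash_mod h]) (simp_all add: k smash_rules ii R_assoc)
  also have "\<dots> = sw R h (\<lambda>x y. \<gamma> (S k *[H] x) *[R] \<gamma> (S y))"
    by (rule \<gamma>_rel_right) (simp_all add: h k smash_rules)
  also have "\<dots> = sw R h (\<lambda>x y. \<gamma> (S k *[H] y) *[R] \<gamma> (S x))"
    by (rule sw_comm[OF smash_mod h]) (simp add: k smash_rules)
  also have "\<dots> = sw R h (\<lambda>x y. \<gamma> (S (S y *[H] k)) *[R] \<gamma> (S x))"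
    by (rule sw_cong[OF smash_mod h]) (simp_all add: k smash_rules ii)
  finally show "sw Rop h (\<lambda>x y. \<gamma> (S x) *[Rop] (\<gamma> (S (S y)) *[Rop] \<gamma> (S k))) =
      sw Rop h (\<lambda>x y. \<gamma> (S x) *[Rop] \<gamma> (S (S y *[H] k)))"
    using h k by (simp add: sw_Rop smash_rules)
qed

section \<open>The smash product as a module over \<open>H\<^sub>p\<^sub>a\<^sub>r\<close>\<close>

abbreviation "LL \<equiv> smash_left_hpar K H A act"

lemma LL_simps [simp]:
  "carrier LL = carrier R" "add LL = add R" "zero LL = zero R" by (simp_all add: smash_left_hpar_def Let_def)

lemma LL_facts:
  "left_module Q LL" "\<And>h u. h \<in>. H \<Longrightarrow> u \<in>. R \<Longrightarrow> hc h \<cdot>[LL] u = \<gamma> h *[R] u"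
  "\<And>c u. c \<in>. K \<Longrightarrow> u \<in>. R \<Longrightarrow> (c \<cdot>[Q] \<one>[Q]) \<cdot>[LL] u = c \<cdot>[R] u"
  "\<And>k u. k \<in>. H \<Longrightarrow> u \<in>. R \<Longrightarrow> ee k \<cdot>[LL] u = \<alpha> (act k \<one>[A]) *[R] u"
proof -
  let ?M = "with_smult R (mult R)"
  have \<tau>: "lin K (scal R ?M) R (\<lambda>x. x)"
    by (intro linI) (simp_all add: module_add_closed[OF smash_mod] smash_rules k_algebra_smult_left[OF smash_alg] k_algebra_one_closed[OF smash_alg] R_l_one)
  have LL: "LL = with_smult R (hpar_action K R (\<lambda>h u. \<gamma> h *[R] u))" by (simp add: smash_left_hpar_def Let_def)
  note p = par_rep_module[OF \<gamma>_par_rep regular_left_module[OF smash_alg] smash_mod \<tau>, of "\<lambda>h u. \<gamma> h *[R] u", folded LL]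
  show "left_module Q LL" by (rule p(1)) (simp_all add: smash_rules)
  show "hc h \<cdot>[LL] u = \<gamma> h *[R] u" if "h \<in>. H" "u \<in>. R" for h u
    by (rule p(2)) (simp_all add: that smash_rules)
  show "(c \<cdot>[Q] \<one>[Q]) \<cdot>[LL] u = c \<cdot>[R] u" if "c \<in>. K" "u \<in>. R" for c u
    by (rule p(3)) (simp_all add: that smash_rules)
  show "ee k \<cdot>[LL] u = \<alpha> (act k \<one>[A]) *[R] u" if "k \<in>. H" "u \<in>. R" for k u
  proof -
    have "ee k \<cdot>[LL] u = sw R k (\<lambda>x y. \<gamma> x *[R] \<gamma> (S y)) \<cdot>[?M] u"
      by (rule p(4)) (simp_all add: that smash_rules)
    then show ?thesis using \<gamma>_\<gamma>S_one[OF that(1)] by simp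
  qed
qed

end


section \<open>The coinvariants \<open>A \<otimes> M\<close> over the enveloping algebra of \<open>A\<close>\<close>

context partial_smash
begin

abbreviation "EE \<equiv> enveloping K R"
abbreviation "AE \<equiv> enveloping K A"
abbreviation "etn \<equiv> kten K R Rop"

lemma EE_eq: "EE = alg_tensor K R Rop" by (simp add: enveloping_def)

lemma EE_alg: "k_algebra K EE"
  unfolding EE_eq by (rule alg_tensor_k_algebra[OF smash_alg Rop_alg])

lemma EE_mod: "module K EE" by (rule k_algebra_module[OF EE_alg])

lemma AE_alg: "k_algebra K AE"
  unfolding enveloping_def by (rule alg_tensor_k_algebra[OF A_alg opposite_k_algebra[OF A_alg]])

lemma EE_simps [simp]:
  "carrier EE = carrier (kt K R Rop)" "add EE = add (kt K R Rop)" "smult EE = smult (kt K R Rop)" "one EE = etn \<one>[R] \<one>[R]"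
  unfolding EE_eq by simp_all

lemma etn_closed: "s \<in>. R \<Longrightarrow> t \<in>. R \<Longrightarrow> etn s t \<in>. EE"
  using kt_tens_closed[OF smash_mod k_algebra_module[OF Rop_alg]] by simp

lemma lin_EE: "lin K L EE f = lin K L (kt K R Rop) f" by (simp add: lin_def additive_def)

lemma lin_etn:
  "lin K L R f \<Longrightarrow> t \<in>. R \<Longrightarrow> lin K L EE (\<lambda>x. etn (f x) t)"
  "lin K L R f \<Longrightarrow> t \<in>. R \<Longrightarrow> lin K L EE (\<lambda>x. etn t (f x))"
  unfolding lin_EE using kt_lin_left[OF smash_mod k_algebra_module[OF Rop_alg]]
    kt_lin_right[OF smash_mod k_algebra_module[OF Rop_alg]] by (simp_all add: lin_Rop)

lemma etn_mult:
  "s \<in>. R \<Longrightarrow> s' \<in>. R \<Longrightarrow> t \<in>. R \<Longrightarrow> t' \<in>. R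
   \<Longrightarrow> etn s s' *[EE] etn t t' = etn (s *[R] t) (t' *[R] s')"
  unfolding EE_eq by (simp add: alg_tensor_tens_mult[OF smash_alg Rop_alg])

lemma one_R_closed: "\<one>[R] \<in>. R" by (rule k_algebra_one_closed[OF smash_alg])

lemma \<alpha>_one: "\<alpha> \<one>[A] = \<one>[R]" by (rule sm_one)

text \<open>This element of the enveloping algebra acts on a bimodule by \<open>m \<mapsto> \<gamma>(h\<^sub>1) m \<gamma>(S h\<^sub>2)\<close>.\<close>

definition adj :: "'h \<Rightarrow> (('a, 'h) tens, ('a, 'h) tens) tens" where
  "adj = prod_rep R Rop \<gamma> (\<lambda>h. \<gamma> (S h))"

lemma adj_par_rep: "par_rep EE adj"
  unfolding EE_eq adj_def by (rule prod_rep_par_rep[OF \<gamma>_par_rep \<gamma>S_par_rep])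

lemma adj_eq: "adj h = sw EE h (\<lambda>x y. etn (\<gamma> x) (\<gamma> (S y)))"
  unfolding EE_eq adj_def prod_rep_def ..

text \<open>The element by which \<open>e\<^sub>k\<close> acts: conjugation by \<open>k\<^sub>1\<close> and by \<open>S k\<^sub>2\<close> yields \<open>\<alpha>(k\<^sub>1 \<cdot> 1)\<close> on the left and
  \<open>\<alpha>(k\<^sub>2 \<cdot> 1)\<close> on the right.\<close>

lemma adj_adj_antipode:
  assumes k: "k \<in>. H"
  shows "sw EE k (\<lambda>x y. adj x *[EE] adj (S y)) =
    sw EE k (\<lambda>x y. etn (\<alpha> (act x \<one>[A])) (\<alpha> (act y \<one>[A])))"
proof -
  have 2: "sw Rop y (\<lambda>b d. \<gamma> (S b) *[Rop] \<gamma> (S (S d))) = \<alpha> (act y \<one>[A])" if y: "y \<in>. H" for y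
  proof -
    have "sw Rop y (\<lambda>b d. \<gamma> (S b) *[Rop] \<gamma> (S (S d))) = sw R y (\<lambda>b d. \<gamma> (S (S d)) *[R] \<gamma> (S b))"
      using y by (simp add: sw_Rop smash_rules)
    also have "\<dots> = sw R y (\<lambda>b d. \<gamma> (S (S b)) *[R] \<gamma> (S d))"
      by (rule sw_comm[OF smash_mod y]) (simp add: smash_rules)
    also have "\<dots> = sw R y (\<lambda>b d. \<gamma> b *[R] \<gamma> (S d))"
      by (rule sw_cong[OF smash_mod y]) (simp_all add: smash_rules antipode_involutive)
    finally show ?thesis using \<gamma>_\<gamma>S_one[OF y] by simp
  qed
  have "sw EE k (\<lambda>x y. adj x *[EE] adj (S y)) = sw EE k (\<lambda>x y. etn
     (sw R x (\<lambda>a c. \<gamma> a *[R] \<gamma> (S c))) (sw Rop y (\<lambda>b d. \<gamma> (S b) *[Rop] \<gamma> (S (S d)))))"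
    unfolding EE_eq adj_def by (rule prod_rep_rep_antipode[OF \<gamma>_par_rep \<gamma>S_par_rep k])
  also have "\<dots> = sw EE k (\<lambda>x y. etn (\<alpha> (act x \<one>[A])) (\<alpha> (act y \<one>[A])))"
    by (rule sw_cong[symmetric, OF EE_mod k]) (simp_all add: smash_rules lin_etn 2 \<gamma>_\<gamma>S_one del: EE_simps opposite_simps)
  finally show ?thesis .
qed

lemma regular_env_bil:
  "lin K A A (\<lambda>a. b *[A] x *[A] a)" "lin K (opposite A) A (\<lambda>b. b *[A] x *[A] a)" "lin K A A (\<lambda>x. b *[A] x *[A] a)"
  if "a \<in>. A" "b \<in>. A" "x \<in>. A"
proof -
  show "lin K (opposite A) A (\<lambda>b. b *[A] x *[A] a)" by (rule lin_fields[of K A A]) (simp_all add: that act_rules)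
qed (simp_all add: that act_rules)

lemma regular_env_module: "right_module AE (regular_env A)"
  unfolding enveloping_def regular_env_def by (rule right_module_alg_tensor[OF A_alg opposite_k_algebra[OF A_alg] A_mod])
    (simp_all add: regular_env_bil act_rules A_assoc A_l_one A_r_one)

abbreviation "atn \<equiv> kten K A (opposite A)"

lemma regular_env_tens:
  assumes "a \<in>. A" "b \<in>. A" "x \<in>. A"
  shows "atn a b \<cdot>[regular_env A] x = b *[A] x *[A] a"
  unfolding regular_env_def
  using env_act_tens[OF A_alg opposite_k_algebra[OF A_alg] A_mod, of "\<lambda>a b x. b *[A] x *[A] a" a b x] assms
  by (simp add: regular_env_bil act_rules A_l_one A_r_one)

lemma regular_env_fields [simp]: "carrier (regular_env A) = carrier A" "add (regular_env A) = add A"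
  by (simp_all add: regular_env_def)

lemma AE_one: "\<one>[AE] = atn \<one>[A] \<one>[A]" and AE_carrier: "carrier AE = carrier (kt K A (opposite A))"
  and AE_smult: "smult AE = smult (kt K A (opposite A))" by (simp_all add: enveloping_def)

lemma AE_scalar: "c \<in>. K \<Longrightarrow> c \<cdot>[AE] \<one>[AE] = atn (c \<cdot>[A] \<one>[A]) \<one>[A]"
  unfolding AE_one AE_smult
  by (rule kt_smult[OF A_mod k_algebra_module[OF opposite_k_algebra[OF A_alg]]]) (simp_all add: one_A_closed)

lemma regular_env_scal: "lin K L A f \<Longrightarrow> lin K L (scal AE (regular_env A)) f"
  by (rule lin_fields[of K L A f]) (simp_all add: AE_scalar regular_env_tens act_rules A_l_one
     k_algebra_smult_right[OF A_alg] A_r_one)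

context
  fixes M :: "((('a, 'h) tens, ('a, 'h) tens) tens, 'm) module"
  assumes M: "left_module EE M"
begin

text \<open>\<open>bi s m t\<close> is the bimodule action \<open>s m t\<close>.\<close>

abbreviation "Mk \<equiv> scal EE M"
abbreviation "bi s m t \<equiv> etn s t \<cdot>[M] m"

lemmas FM = left_module_facts[OF M]

lemma Mk_mod: "module K Mk" by (rule scal_left_module[OF EE_alg M])

lemma bi_closed: "s \<in>. R \<Longrightarrow> t \<in>. R \<Longrightarrow> m \<in>. M \<Longrightarrow> bi s m t \<in>. M"
  using FM(3) etn_closed by blast

lemma lin_bi:
  "lin K L R f \<Longrightarrow> t \<in>. R \<Longrightarrow> m \<in>. M \<Longrightarrow> lin K L Mk (\<lambda>x. bi (f x) m t)"
  "lin K L R f \<Longrightarrow> s \<in>. R \<Longrightarrow> m \<in>. M \<Longrightarrow> lin K L Mk (\<lambda>x. bi s m (f x))"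
  "lin K L Mk g \<Longrightarrow> s \<in>. R \<Longrightarrow> t \<in>. R \<Longrightarrow> lin K L Mk (\<lambda>x. bi s (g x) t)"
    apply (rule lin_restrict_scalars[OF EE_alg M], assumption, rule lin_etn; assumption)
   apply (rule lin_restrict_scalars[OF EE_alg M], assumption, rule lin_etn; assumption)
  apply (rule lin_restrict_vectors[OF EE_alg M etn_closed]; assumption)
  done

lemma bi_bi: "s \<in>. R \<Longrightarrow> s' \<in>. R \<Longrightarrow> t \<in>. R \<Longrightarrow> t' \<in>. R \<Longrightarrow> m \<in>. M
   \<Longrightarrow> bi s (bi t m t') s' = bi (s *[R] t) m (t' *[R] s')"
  using FM(6)[OF etn_closed etn_closed] by (simp add: etn_mult)

lemma bi_one: "m \<in>. M \<Longrightarrow> bi \<one>[R] m \<one>[R] = m"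
  using FM(7) by simp

abbreviation "rM \<equiv> restrict_env K H A act M"

lemma restrict_env_eq:
  assumes "t \<in>. AE" "m \<in>. M"
  shows "t \<cdot>[rM] m = tens_lift Mk (\<lambda>a b. bi (\<alpha> a) m (\<alpha> b)) t"
proof -
  have b: "bilin K A (opposite A) EE (\<lambda>a b. etn (\<alpha> a) (\<alpha> b))"
    by (rule bilinI) (auto intro!: lin_etn lin_sm lin_id lin_fields[OF lin_id[of K A]] simp: smash_rules)
  show ?thesis
    unfolding restrict_env_def with_smult_simps
    by (rule kt_lift_push[OF A_mod k_algebra_module[OF opposite_k_algebra[OF A_alg]] _ EE_mod Mk_mod b])
      (use assms lin_restrict_scalars[OF EE_alg M assms(2) lin_id] in \<open>simp_all add: AE_carrier\<close>)
qed

lemma restrict_bil: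
  assumes "a \<in>. A" "b \<in>. A" "m \<in>. M"
  shows "lin K A Mk (\<lambda>a. bi (\<alpha> a) m (\<alpha> b))" "lin K (opposite A) Mk (\<lambda>b. bi (\<alpha> a) m (\<alpha> b))"
proof -
  show "lin K (opposite A) Mk (\<lambda>b. bi (\<alpha> a) m (\<alpha> b))"
    by (rule lin_fields[of K A Mk]) (simp_all add: assms smash_rules lin_bi)
qed (simp_all add: assms smash_rules lin_bi)

lemma restrict_bil3: "a \<in>. A \<Longrightarrow> b \<in>. A \<Longrightarrow> lin K Mk Mk (\<lambda>m. bi (\<alpha> a) m (\<alpha> b))"
  by (rule lin_bi(3)[OF lin_id]) (simp_all add: smash_rules)

lemma restrict_env_module: "left_module AE rM"
proof -
  have "left_module AE (with_smult Mk (\<lambda>t m. tens_lift Mk (\<lambda>a b. bi (\<alpha> a) m (\<alpha> b)) t))"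
    unfolding enveloping_def[of K A] by (rule left_module_alg_tensor[OF A_alg opposite_k_algebra[OF A_alg] Mk_mod])
      (simp_all add: restrict_bil restrict_bil3 bi_closed bi_bi smash_rules \<alpha>_mult \<alpha>_one bi_one)
  then show ?thesis by (rule left_module_fields) (use restrict_env_eq in \<open>simp_all add: restrict_env_def\<close>)
qed

lemma restrict_env_tens:
  assumes "a \<in>. A" "b \<in>. A" "m \<in>. M"
  shows "atn a b \<cdot>[rM] m = bi (\<alpha> a) m (\<alpha> b)"
proof -
  have "atn a b \<in>. AE"
    using assms kt_tens_closed[OF A_mod k_algebra_module[OF opposite_k_algebra[OF A_alg]]] by (simp add: AE_carrier)
  then show ?thesis
    using env_act_tens[OF A_alg opposite_k_algebra[OF A_alg] Mk_mod, of "\<lambda>a b m. bi (\<alpha> a) m (\<alpha> b)" a b m] assms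
    by (simp add: restrict_env_eq restrict_bil restrict_bil3 bi_one \<alpha>_one)
qed

lemma restrict_env_fields [simp]: "carrier rM = carrier M" "add rM = add M" by (simp_all add: restrict_env_def)

lemma Mk_smult: "c \<in>. K \<Longrightarrow> m \<in>. M \<Longrightarrow> c \<cdot>[Mk] m = bi (c \<cdot>[R] \<one>[R]) m \<one>[R]"
  using kt_smult[OF smash_mod k_algebra_module[OF Rop_alg], of c "\<one>[R]" "\<one>[R]"] one_R_closed by simp

lemma restrict_env_scal: "lin K L Mk f \<Longrightarrow> lin K L (scal AE rM) f"
proof (rule lin_fields[of K L Mk f])
  fix c x assume c: "c \<in>. K" and x: "x \<in>. Mk"
  have "\<alpha> (c \<cdot>[A] \<one>[A]) = c \<cdot>[R] \<one>[R]"
    using lin_smult[OF lin_sm(1)[OF lin_id one_H_closed] c one_A_closed] by (simp add: \<alpha>_one)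
  then show "c \<cdot>[scal AE rM] x = c \<cdot>[Mk] x"
    using c x by (simp add: AE_scalar restrict_env_tens act_rules \<alpha>_one Mk_smult del: scal_simps(4)) (simp add: AE_scalar restrict_env_tens act_rules \<alpha>_one)
qed simp_all

abbreviation "VM \<equiv> tensor AE (regular_env A) rM"
abbreviation "tn \<equiv> tens AE (regular_env A) rM"
abbreviation "\<tau> m \<equiv> tn \<one>[A] m"

interpretation VM: tensor_product AE "regular_env A" rM by (rule tensor_productI[OF regular_env_module restrict_env_module])

lemma VM_mod: "module K VM" by (rule tensor_module[OF AE_alg regular_env_module restrict_env_module])

lemma lin_tn:
  "lin K L A f \<Longrightarrow> m \<in>. M \<Longrightarrow> lin K L VM (\<lambda>x. tn (f x) m)"
  "lin K L Mk g \<Longrightarrow> a \<in>. A \<Longrightarrow> lin K L VM (\<lambda>x. tn a (g x))"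
  using lin_tens_right_module[OF AE_alg regular_env_module restrict_env_module regular_env_scal]
    lin_tens_left_module[OF AE_alg regular_env_module restrict_env_module restrict_env_scal] by simp_all

lemma tn_closed: "a \<in>. A \<Longrightarrow> m \<in>. M \<Longrightarrow> tn a m \<in>. VM"
  using VM.tens_closed by simp

lemma tn_middle:
  assumes "a \<in>. A" "b \<in>. A" "x \<in>. A" "m \<in>. M"
  shows "tn (b *[A] x *[A] a) m = tn x (bi (\<alpha> a) m (\<alpha> b))"
proof -
  have "atn a b \<in>. AE"
    using assms kt_tens_closed[OF A_mod k_algebra_module[OF opposite_k_algebra[OF A_alg]]] by (simp add: AE_carrier)
  then show ?thesis using VM.tens_middle[of "atn a b" x m] assms by (simp add: regular_env_tens restrict_env_tens)
qed

text \<open>An element of \<open>A\<close> in the left factor is the value of \<open>1\<close> under the action of \<open>A\<^sup>e\<close>, and moves to the right.\<close>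

lemma tn_\<tau>: "a \<in>. A \<Longrightarrow> m \<in>. M \<Longrightarrow> tn a m = \<tau> (bi (\<alpha> a) m \<one>[R])"
  using tn_middle[of a "\<one>[A]" "\<one>[A]" m] by (simp add: one_A_closed A_l_one \<alpha>_one)

lemma \<tau>_trace: "a \<in>. A \<Longrightarrow> m \<in>. M \<Longrightarrow> \<tau> (bi (\<alpha> a) m \<one>[R]) = \<tau> (bi \<one>[R] m (\<alpha> a))"
  using tn_middle[of "\<one>[A]" a "\<one>[A]" m] tn_\<tau>[of a m] by (simp add: one_A_closed A_r_one \<alpha>_one)

lemma VM_induct:
  assumes "v \<in>. VM" "\<And>m. m \<in>. M \<Longrightarrow> P (\<tau> m)"
    "\<And>v w. v \<in>. VM \<Longrightarrow> w \<in>. VM \<Longrightarrow> P v \<Longrightarrow> P w \<Longrightarrow> P (v +[VM] w)"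
  shows "P v"
  using assms(1)
proof (induction rule: VM.tensor_induct)
  case (tens a m)
  then show ?case using assms(2)[OF bi_closed[OF sm_closed[OF _ one_H_closed] one_R_closed], of a m] by (simp add: tn_\<tau>)
qed (rule assms(3))

text \<open>\<open>A \<otimes> M\<close> is the universal quotient of \<open>M\<close> on which left and right multiplication by \<open>A\<close> agree.  The
  formula \<open>F\<close> for all pure tensors is an assumption since the maps to which the lemma applies are given by their values on all pure tensors.\<close>

lemma VM_lift:
  assumes P: "module K P" and g: "lin K Mk P g"
    and tr: "\<And>a m. a \<in>. A \<Longrightarrow> m \<in>. M \<Longrightarrow> g (bi (\<alpha> a) m \<one>[R]) = g (bi \<one>[R] m (\<alpha> a))"
    and F: "\<And>a m. a \<in>. A \<Longrightarrow> m \<in>. M \<Longrightarrow> F a m = g (bi (\<alpha> a) m \<one>[R])"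
  shows "lin K VM P (tens_lift P F)" "\<And>m. m \<in>. M \<Longrightarrow> tens_lift P F (\<tau> m) = g m"
    "\<And>a m. a \<in>. A \<Longrightarrow> m \<in>. M \<Longrightarrow> tens_lift P F (tn a m) = F a m"
proof -
  let ?F = "\<lambda>a m. g (bi (\<alpha> a) m \<one>[R])"
  note oA = k_algebra_module[OF opposite_k_algebra[OF A_alg]]
  have l1: "lin K L P (\<lambda>x. ?F (f x) m)" if "lin K L A f" "m \<in>. M" for L :: "('k, 'l, 'lw) module_scheme" and f m
    by (rule lin_comp[OF g lin_bi(1)[OF lin_sm(1)]]) (simp_all add: that smash_rules one_R_closed)
  have l2: "lin K L P (\<lambda>x. ?F a (f x))" if "lin K L Mk f" "a \<in>. A" for L :: "('k, 'l, 'lw) module_scheme" and f a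
    by (rule lin_comp[OF g lin_bi(3)]) (simp_all add: that smash_rules one_R_closed)
  have F1: "additive M P (F a)" if "a \<in>. A" for a
    using lin_additive[OF l2[OF lin_id that]] F that abelian_group.axioms(1)[OF FM(2)]
    by (simp add: additive_def abelian_monoid.a_closed)
  have F2: "additive A P (\<lambda>a. F a m)" if "m \<in>. M" for m
    using lin_additive[OF l1[OF lin_id that]] F that module_add_closed[OF A_mod] by (simp add: additive_def)
  have bal: "F (r \<cdot>[regular_env A] x) m = F x (r \<cdot>[rM] m)"
    if r: "r \<in>. AE" and x: "x \<in>. A" and m: "m \<in>. M" for r x m
  proof -
    have rc: "r \<cdot>[regular_env A] x \<in>. A" "r \<cdot>[rM] m \<in>. M"
      using right_module_facts(3)[OF regular_env_module r, of x] left_module_facts(3)[OF restrict_env_module r, of m] x m by simp_all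
    have s1: "lin K (kt K A (opposite A)) A (\<lambda>r. r \<cdot>[regular_env A] x)"
      using env_act_lin[OF A_alg opposite_k_algebra[OF A_alg] A_mod, of "\<lambda>a b x. b *[A] x *[A] a" x] x
      by (simp add: regular_env_def regular_env_bil act_rules A_l_one A_r_one)
    have s2: "lin K (kt K A (opposite A)) Mk (\<lambda>r. r \<cdot>[rM] m)"
      by (rule lin_cong[OF env_act_lin[OF A_alg opposite_k_algebra[OF A_alg] Mk_mod, of "\<lambda>a b m. bi (\<alpha> a) m (\<alpha> b)" m]])
        (use m module_add_closed[OF kt_module[OF A_mod oA]] module_smult_closed[OF kt_module[OF A_mod oA]] in
         \<open>simp_all add: restrict_env_eq restrict_bil restrict_bil3 bi_one \<alpha>_one AE_carrier\<close>)
    have "?F (r \<cdot>[regular_env A] x) m = ?F x (r \<cdot>[rM] m)"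
    proof (rule kt_eq[OF A_mod oA _ l1[OF s1 m] l2[OF s2 x]])
      fix a b assume a: "a \<in>. A" and "b \<in>. (opposite A)"
      then have b: "b \<in>. A" by simp
      let ?n = "bi (\<alpha> (x *[A] a)) m \<one>[R]"
      have "g (bi (\<alpha> b) ?n \<one>[R]) = g (bi \<one>[R] ?n (\<alpha> b))"
        by (rule tr) (simp_all add: a b x m smash_rules bi_closed one_R_closed)
      then show "?F (atn a b \<cdot>[regular_env A] x) m = ?F x (atn a b \<cdot>[rM] m)"
        using a b x m by (simp add: regular_env_tens restrict_env_tens bi_bi smash_rules one_R_closed \<alpha>_mult
            R_l_one R_r_one A_assoc)
    qed (use r in \<open>simp add: AE_carrier\<close>)
    then show ?thesis using F rc x m by simp
  qed
  have B: "balanced AE (regular_env A) rM P F"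
  proof (rule balancedI)
    show "additive rM P (F a)" if "a \<in>. (regular_env A)" for a using F1[of a] that by (simp add: additive_def)
    show "additive (regular_env A) P (\<lambda>a. F a m)" if "m \<in>. rM" for m using F2[of m] that by (simp add: additive_def)
  qed (simp add: bal)
  show "lin K VM P (tens_lift P F)"
  proof (rule tens_lift_lin[OF AE_alg regular_env_module restrict_env_module P B])
    fix c x m assume c: "c \<in>. K" "x \<in>. (regular_env A)" "m \<in>. rM"
    then have "(c \<cdot>[AE] \<one>[AE]) \<cdot>[regular_env A] x = c \<cdot>[A] x"
      by (simp add: AE_scalar regular_env_tens act_rules A_l_one k_algebra_smult_right[OF A_alg] A_r_one)
    then show "F ((c \<cdot>[AE] \<one>[AE]) \<cdot>[regular_env A] x) m = c \<cdot>[P] F x m"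
      using c F lin_smult[OF l1[OF lin_id, of m] c(1), of x] module_smult_closed[OF A_mod c(1)] by simp
  qed
  show v: "tens_lift P F (tn a m) = F a m" if "a \<in>. A" "m \<in>. M" for a m
    by (rule VM.tens_lift_tens[OF module_abelian_group[OF P] B]) (simp_all add: that)
  show "tens_lift P F (\<tau> m) = g m" if "m \<in>. M" for m
    using v[OF one_A_closed that] F[OF one_A_closed that] that by (simp add: \<alpha>_one bi_one)
qed

lemmas coinv_rules = smash_rules one_R_closed VM_mod Mk_mod lin_tn lin_bi bi_closed tn_closed lin_etn etn_closed[simplified] bi_bi

abbreviation "conj_sum h m \<equiv> sw VM h (\<lambda>y z. \<tau> (bi (\<gamma> y) m (\<gamma> (S z))))"

lemma adj_\<tau>: "h \<in>. H \<Longrightarrow> m \<in>. M \<Longrightarrow> \<tau> (adj h \<cdot>[M] m) = conj_sum h m"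
  unfolding adj_eq by (rule sw_push[OF EE_mod VM_mod])
    (auto intro!: lin_tn lin_restrict_scalars[OF EE_alg M] lin_id bilinI lin_etn lin_sm one_A_closed simp: smash_rules)

lemma conj_sum_lin: "h \<in>. H \<Longrightarrow> lin K Mk VM (conj_sum h)" by (rule sw_param_lin') (simp_all add: coinv_rules)

text \<open>Moving \<open>\<alpha>(b)\<close> past \<open>\<gamma>(h\<^sub>1)\<close> yields \<open>\<alpha>(h\<^sub>1 \<cdot> b)\<close> on the far left, which the trace property takes to the far
  right.  There \<open>\<alpha>_mult_\<gamma>S\<close> lets it pass \<open>\<gamma>(S h\<^sub>3)\<close> as \<open>\<alpha>(b)\<close>.\<close>

lemma conj_sum_trace:
  assumes h: "h \<in>. H" and b: "b \<in>. A" and m: "m \<in>. M"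
  shows "conj_sum h (bi (\<alpha> b) m \<one>[R]) = conj_sum h (bi \<one>[R] m (\<alpha> b))"
proof -
  let ?G = "\<lambda>y p q. \<tau> (bi (\<gamma> y) m (\<gamma> (S p) *[R] \<alpha> (act q b)))"
  have "conj_sum h (bi (\<alpha> b) m \<one>[R]) = sw VM h (\<lambda>y z. sw VM y (\<lambda>p q. ?G q z p))"
  proof (rule sw_cong[OF VM_mod h])
    show "bilin K H H VM (\<lambda>y z. \<tau> (bi (\<gamma> y) (bi (\<alpha> b) m \<one>[R]) (\<gamma> (S z))))" using b m by (simp add: coinv_rules)
    fix y z assume yz: "y \<in>. H" "z \<in>. H"
    have "\<tau> (bi (\<gamma> y) (bi (\<alpha> b) m \<one>[R]) (\<gamma> (S z))) = \<tau> (bi (sw R y (\<lambda>p q. sm (act p b) q)) m (\<gamma> (S z)))"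
      using yz b m by (simp add: coinv_rules \<gamma>_mult_\<alpha> R_l_one)
    also have "\<dots> = sw VM y (\<lambda>p q. \<tau> (bi (sm (act p b) q) m (\<gamma> (S z))))"
      by (rule sw_push[OF smash_mod VM_mod yz(1)]) (simp_all add: yz b m coinv_rules)
    also have "\<dots> = sw VM y (\<lambda>p q. ?G q z p)"
    proof (rule sw_cong[OF VM_mod yz(1)])
      fix p q assume pq: "p \<in>. H" "q \<in>. H"
      have "\<tau> (bi (\<alpha> (act p b)) (bi (\<gamma> q) m (\<gamma> (S z))) \<one>[R]) = \<tau> (bi \<one>[R] (bi (\<gamma> q) m (\<gamma> (S z))) (\<alpha> (act p b)))"
        by (rule \<tau>_trace) (simp_all add: pq yz b m coinv_rules)
      then show "\<tau> (bi (sm (act p b) q) m (\<gamma> (S z))) = ?G q z p"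
        using pq yz b m by (simp add: coinv_rules sm_split R_l_one R_r_one)
    qed (simp add: yz b m coinv_rules)
    finally show "\<tau> (bi (\<gamma> y) (bi (\<alpha> b) m \<one>[R]) (\<gamma> (S z))) = sw VM y (\<lambda>p q. ?G q z p)" .
  qed
  also have "\<dots> = sw VM h (\<lambda>x y. sw VM y (\<lambda>q z. ?G q z x))"
    by (rule sw_coassoc[OF VM_mod h]) (simp add: b m coinv_rules)
  also have "\<dots> = sw VM h (\<lambda>x y. sw VM y (\<lambda>p q. ?G x q p))"
    by (rule sw_swap12[OF VM_mod h]) (simp add: b m coinv_rules)
  also have "\<dots> = sw VM h (\<lambda>x y. sw VM y (\<lambda>p q. ?G x p q))"
    by (rule sw_swap23[OF VM_mod h]) (simp add: b m coinv_rules)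
  also have "\<dots> = conj_sum h (bi \<one>[R] m (\<alpha> b))"
  proof (rule sw_cong[symmetric, OF VM_mod h])
    show "bilin K H H VM (\<lambda>y z. \<tau> (bi (\<gamma> y) (bi \<one>[R] m (\<alpha> b)) (\<gamma> (S z))))" using b m by (simp add: coinv_rules)
    fix y z assume yz: "y \<in>. H" "z \<in>. H"
    have "\<tau> (bi (\<gamma> y) (bi \<one>[R] m (\<alpha> b)) (\<gamma> (S z))) = \<tau> (bi (\<gamma> y) m (sw R z (\<lambda>p q. \<gamma> (S p) *[R] \<alpha> (act q b))))"
      using yz b m by (simp add: coinv_rules \<alpha>_mult_\<gamma>S R_r_one)
    also have "\<dots> = sw VM z (\<lambda>p q. ?G y p q)"
      by (rule sw_push[OF smash_mod VM_mod yz(2)]) (simp_all add: yz b m coinv_rules)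
    finally show "\<tau> (bi (\<gamma> y) (bi \<one>[R] m (\<alpha> b)) (\<gamma> (S z))) = sw VM z (\<lambda>p q. ?G y p q)" .
  qed
  finally show ?thesis .
qed

definition "coinv_op h = tens_lift VM (\<lambda>a m. sw VM h (\<lambda>x x'. sw VM x' (\<lambda>y z.
   tn (act x a) (bi (\<gamma> y) m (\<gamma> (S z))))))"

text \<open>The formula for \<open>[h]\<close> on \<open>a \<otimes> m\<close> with its threefold coproduct is the one for \<open>a = 1\<close> applied to \<open>\<alpha>(a) m\<close>.\<close>

lemma coinv_op_integrand:
  assumes h: "h \<in>. H" and a: "a \<in>. A" and m: "m \<in>. M"
  shows "sw VM h (\<lambda>x x'. sw VM x' (\<lambda>y z. tn (act x a) (bi (\<gamma> y) m (\<gamma> (S z))))) =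
    conj_sum h (bi (\<alpha> a) m \<one>[R])"
proof -
  let ?F = "\<lambda>x y z. tn (act x a) (bi (\<gamma> y) m (\<gamma> (S z)))"
  have "sw VM h (\<lambda>x x'. sw VM x' (?F x)) = sw VM h (\<lambda>w z. sw VM w (\<lambda>x y. ?F x y z))"
    by (rule sw_coassoc[symmetric, OF VM_mod h]) (simp add: a m coinv_rules)
  also have "\<dots> = conj_sum h (bi (\<alpha> a) m \<one>[R])"
  proof (rule sw_cong[symmetric, OF VM_mod h])
    show "bilin K H H VM (\<lambda>y z. \<tau> (bi (\<gamma> y) (bi (\<alpha> a) m \<one>[R]) (\<gamma> (S z))))" using a m by (simp add: coinv_rules)
    fix y z assume yz: "y \<in>. H" "z \<in>. H"
    have "\<tau> (bi (\<gamma> y) (bi (\<alpha> a) m \<one>[R]) (\<gamma> (S z))) = \<tau> (bi (sw R y (\<lambda>p q. sm (act p a) q)) m (\<gamma> (S z)))"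
      using yz a m by (simp add: coinv_rules \<gamma>_mult_\<alpha> R_l_one)
    also have "\<dots> = sw VM y (\<lambda>p q. \<tau> (bi (sm (act p a) q) m (\<gamma> (S z))))"
      by (rule sw_push[OF smash_mod VM_mod yz(1)]) (simp_all add: yz a m coinv_rules)
    also have "\<dots> = sw VM y (\<lambda>x y. ?F x y z)" by (rule sw_cong[OF VM_mod yz(1)])
        (simp_all add: yz a m coinv_rules tn_\<tau>[of "act _ a"] sm_split R_r_one)
    finally show "\<tau> (bi (\<gamma> y) (bi (\<alpha> a) m \<one>[R]) (\<gamma> (S z))) = sw VM y (\<lambda>x y. ?F x y z)" .
  qed
  finally show ?thesis .
qed

lemma coinv_op_facts:
  assumes h: "h \<in>. H"
  shows "lin K VM VM (coinv_op h)" "\<And>m. m \<in>. M \<Longrightarrow> coinv_op h (\<tau> m) = conj_sum h m"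
  unfolding coinv_op_def using VM_lift[OF VM_mod conj_sum_lin[OF h] conj_sum_trace[OF h] coinv_op_integrand[OF h]] by blast+

abbreviation "CM \<equiv> coinv_tensor K H A act M"

lemma CM_eq: "CM = with_smult VM (hpar_action K VM coinv_op)" by (simp add: coinv_tensor_def Let_def coinv_op_def[abs_def])

lemma CM_fields: "carrier CM = carrier VM" "add CM = add VM" by (simp_all add: CM_eq)

text \<open>In the last formula the two factors \<open>\<alpha>(k\<^sub>1 \<cdot> 1)\<close> and \<open>\<alpha>(k\<^sub>2 \<cdot> 1)\<close> come together by the trace property, and
  \<open>(k\<^sub>1 \<cdot> 1) (k\<^sub>2 \<cdot> 1) = k \<cdot> 1\<close>.\<close>

lemma CM_facts:
  "left_module Q CM"
  "\<And>h m. h \<in>. H \<Longrightarrow> m \<in>. M \<Longrightarrow> hc h \<cdot>[CM] \<tau> m = conj_sum h m"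
  "\<And>c v. c \<in>. K \<Longrightarrow> v \<in>. VM \<Longrightarrow> (c \<cdot>[Q] \<one>[Q]) \<cdot>[CM] v = c \<cdot>[VM] v"
  "\<And>k m. k \<in>. H \<Longrightarrow> m \<in>. M \<Longrightarrow> ee k \<cdot>[CM] \<tau> m = \<tau> (bi (\<alpha> (act k \<one>[A])) m \<one>[R])"
proof -
  have \<tau>: "lin K Mk VM \<tau>" by (simp add: coinv_rules)
  note p = par_rep_module[OF adj_par_rep M VM_mod \<tau> _ _ _, of coinv_op, folded CM_eq]
  have pt: "coinv_op h (\<tau> m) = \<tau> (adj h \<cdot>[M] m)" if "h \<in>. H" "m \<in>. M" for h m
    using coinv_op_facts(2)[OF that] adj_\<tau>[OF that] by simp
  show "left_module Q CM" by (rule p(1)[OF _ coinv_op_facts(1) pt]) (rule VM_induct)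
  show "hc h \<cdot>[CM] \<tau> m = conj_sum h m" if "h \<in>. H" "m \<in>. M" for h m
    proof -
    have "hc h \<cdot>[CM] \<tau> m = coinv_op h (\<tau> m)"
      by (rule p(2)[OF _ coinv_op_facts(1) pt that(1)]) (rule VM_induct, use tn_closed[OF one_A_closed that(2)] in auto)
    then show ?thesis using coinv_op_facts(2)[OF that] by simp
  qed
  show "(c \<cdot>[Q] \<one>[Q]) \<cdot>[CM] v = c \<cdot>[VM] v" if "c \<in>. K" "v \<in>. VM" for c v
    by (rule p(3)[OF _ coinv_op_facts(1) pt that]) (rule VM_induct)
  show "ee k \<cdot>[CM] \<tau> m = \<tau> (bi (\<alpha> (act k \<one>[A])) m \<one>[R])" if k: "k \<in>. H" and m: "m \<in>. M" for k m
  proof -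
    have "ee k \<cdot>[CM] \<tau> m = \<tau> (sw EE k (\<lambda>x y. adj x *[EE] adj (S y)) \<cdot>[M] m)"
      by (rule p(4)[OF _ coinv_op_facts(1) pt k m]) (rule VM_induct)
    also have "\<dots> = sw VM k (\<lambda>x y. \<tau> (bi (\<alpha> (act x \<one>[A])) m (\<alpha> (act y \<one>[A]))))"
      unfolding adj_adj_antipode[OF k] by (rule sw_push[OF EE_mod VM_mod k])
        (use m in \<open>auto intro!: lin_tn lin_restrict_scalars[OF EE_alg M] lin_id simp: coinv_rules simp del: EE_simps\<close>)
    also have "\<dots> = sw VM k (\<lambda>x y. \<tau> (bi (\<alpha> (act y \<one>[A] *[A] act x \<one>[A])) m \<one>[R]))"
    proof (rule sw_cong[OF VM_mod k])
      fix x y assume xy: "x \<in>. H" "y \<in>. H"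
      have "\<tau> (bi (\<alpha> (act y \<one>[A])) (bi (\<alpha> (act x \<one>[A])) m \<one>[R]) \<one>[R]) = \<tau> (bi \<one>[R] (bi (\<alpha> (act x \<one>[A])) m \<one>[R]) (\<alpha> (act y \<one>[A])))"
        by (rule \<tau>_trace) (simp_all add: xy m coinv_rules)
      then show "\<tau> (bi (\<alpha> (act x \<one>[A])) m (\<alpha> (act y \<one>[A]))) = \<tau> (bi (\<alpha> (act y \<one>[A] *[A] act x \<one>[A])) m \<one>[R])"
        using xy m by (simp add: coinv_rules \<alpha>_mult R_l_one R_r_one)
    qed (simp add: m coinv_rules)
    also have "\<dots> = sw VM k (\<lambda>x y. \<tau> (bi (\<alpha> (act x \<one>[A] *[A] act y \<one>[A])) m \<one>[R]))"
      by (rule sw_comm[OF VM_mod k]) (simp add: m coinv_rules)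
    also have "\<dots> = \<tau> (bi (\<alpha> (sw A k (\<lambda>x y. act x \<one>[A] *[A] act y \<one>[A]))) m \<one>[R])"
      by (rule sw_push[symmetric, OF A_mod VM_mod k]) (simp_all add: m coinv_rules)
    finally show ?thesis by (simp add: act_absorb_left[OF k one_A_closed])
  qed
qed

end

end


section \<open>The induced bimodule \<open>X \<otimes> (A # H)\<close> over the algebra of the elements \<open>e\<^sub>h\<close>\<close>

context partial_smash
begin

context
  fixes X :: "(('k, 'h) hpar_elem, 'x) module"
  assumes X: "right_module Q X"
begin

abbreviation "Xk \<equiv> scal Q X"
abbreviation "xr x z \<equiv> z \<cdot>[X] x"
abbreviation "WX \<equiv> tensor BB X LL"
abbreviation "tw \<equiv> tens BB X LL"

lemmas FX = right_module_facts[OF X]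

lemma Xk_mod: "module K Xk" by (rule scal_right_module[OF Q_alg X])

lemma xr_closed: "x \<in>. X \<Longrightarrow> z \<in>. Q \<Longrightarrow> xr x z \<in>. X"
  using FX(3) by blast

lemma lin_xr:
  "lin K L Q f \<Longrightarrow> x \<in>. X \<Longrightarrow> lin K L Xk (\<lambda>l. xr x (f l))"
  "lin K L Xk g \<Longrightarrow> z \<in>. Q \<Longrightarrow> lin K L Xk (\<lambda>l. xr (g l) z)"
   apply (rule lin_restrict_scalars_right[OF Q_alg X]; assumption)
  apply (rule lin_restrict_vectors_right[OF Q_alg X]; assumption)
  done

lemma xr_xr: "x \<in>. X \<Longrightarrow> y \<in>. Q \<Longrightarrow> z \<in>. Q \<Longrightarrow> xr (xr x y) z = xr x (y *[Q] z)"
  using FX(6) by simp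

lemma xr_one: "x \<in>. X \<Longrightarrow> xr x \<one>[Q] = x"
  using FX(7) by simp

lemmas BX = BB_right_module[OF X] and BL = BB_left_module[OF LL_facts(1)]

interpretation WX: tensor_product BB X LL by (rule tensor_productI[OF BX BL])

lemma WX_mod: "module K WX" by (rule tensor_module[OF BB_alg BX BL])

lemma LL_scal: "lin K L R f \<Longrightarrow> lin K L (scal BB LL) f"
  by (rule lin_fields[of K L R f]) (simp_all add: LL_facts(3))

lemma X_scal: "lin K L Xk f \<Longrightarrow> lin K L (scal BB X) f" by (rule lin_fields[of K L Xk f]) simp_all

lemma lin_tw:
  "lin K L Xk f \<Longrightarrow> u \<in>. R \<Longrightarrow> lin K L WX (\<lambda>l. tw (f l) u)"
  "lin K L R g \<Longrightarrow> x \<in>. X \<Longrightarrow> lin K L WX (\<lambda>l. tw x (g l))"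
  using lin_tens_right_module[OF BB_alg BX BL X_scal] lin_tens_left_module[OF BB_alg BX BL LL_scal] by simp_all

lemma tw_closed: "x \<in>. X \<Longrightarrow> u \<in>. R \<Longrightarrow> tw x u \<in>. WX"
  using WX.tens_closed by simp

lemma tw_ee: "k \<in>. H \<Longrightarrow> x \<in>. X \<Longrightarrow> u \<in>. R \<Longrightarrow>
    tw (xr x (ee k)) u = tw x (\<alpha> (act k \<one>[A]) *[R] u)"
  using WX.tens_middle[of "ee k" x u] BB_closed(3)[of k] by (simp add: LL_facts(4))

lemma WX_induct:
  assumes "v \<in>. WX" "\<And>x u. x \<in>. X \<Longrightarrow> u \<in>. R \<Longrightarrow> P (tw x u)"
    "\<And>v w. v \<in>. WX \<Longrightarrow> w \<in>. WX \<Longrightarrow> P v \<Longrightarrow> P w \<Longrightarrow> P (v +[WX] w)"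
  shows "P v"
  using assms(1) by (induction rule: WX.tensor_induct) (use assms(2,3) in auto)

lemma WX_eq:
  assumes "v \<in>. WX" "lin K WX P f" "lin K WX P g"
    "\<And>x u. x \<in>. X \<Longrightarrow> u \<in>. R \<Longrightarrow> f (tw x u) = g (tw x u)"
  shows "f v = g v"
  using assms(1) by (rule WX_induct) (simp_all add: assms(4) lin_add[OF assms(2)] lin_add[OF assms(3)] del: WX.tensor_fields)

text \<open>\<open>B\<close> is generated by the elements \<open>e\<^sub>k\<close>, and the elements of \<open>H\<^sub>p\<^sub>a\<^sub>r\<close> for which the map is balanced form a
  subalgebra.\<close>

lemma WX_lift:
  assumes P: "module K P"
    and F1: "\<And>x. x \<in>. X \<Longrightarrow> lin K R P (F x)" and F2: "\<And>u. u \<in>. R \<Longrightarrow> lin K Xk P (\<lambda>x. F x u)"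
    and e: "\<And>k x u. k \<in>. H \<Longrightarrow> x \<in>. X \<Longrightarrow> u \<in>. R \<Longrightarrow>
       F (xr x (ee k)) u = F x (\<alpha> (act k \<one>[A]) *[R] u)"
  shows "lin K WX P (tens_lift P F)" "\<And>x u. x \<in>. X \<Longrightarrow> u \<in>. R \<Longrightarrow> tens_lift P F (tw x u) = F x u"
proof -
  note FL = left_module_facts[OF LL_facts(1)]
  interpret P: module K P by (rule P)
  let ?D = "{b \<in> carrier Q. \<forall>x \<in> carrier X. \<forall>u \<in> carrier R. F (xr x b) u = F x (b \<cdot>[LL] u)}"
  have c1: "c \<cdot>[Q] \<one>[Q] \<in>. Q" if "c \<in>. K" for c
    using module_smult_closed[OF Q_mod that k_algebra_one_closed[OF Q_alg]] .
  have Lc: "b \<cdot>[LL] u \<in>. R" if "b \<in>. Q" "u \<in>. R" for b u using FL(3)[OF that(1), of u] that by simp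
  have c: "F (xr x (c \<cdot>[Q] \<one>[Q])) u = c \<cdot>[P] F x u" if "c \<in>. K" "x \<in>. X" "u \<in>. R" for c x u
    using lin_smult[OF F2[OF that(3)] that(1), of x] that by simp
  have Lscal: "(c \<cdot>[Q] b) \<cdot>[LL] u = c \<cdot>[R] (b \<cdot>[LL] u)" if "c \<in>. K" "b \<in>. Q" "u \<in>. R" for c b u
    using FL(6)[OF c1[OF that(1)] that(2), of u] that Lc by (simp add: scal_mult[OF Q_alg] LL_facts(3))
  have Xscal: "xr x (c \<cdot>[Q] b) = xr (xr x b) (c \<cdot>[Q] \<one>[Q])" if "c \<in>. K" "b \<in>. Q" "x \<in>. X" for c b x
    using that c1 by (simp add: xr_xr scal_mult[OF Q_alg])
  have "carrier BB \<subseteq> ?D"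
  proof (rule BB_minimal)
    show "\<one>[Q] \<in> ?D" using FL(7) by (simp add: xr_one k_algebra_one_closed[OF Q_alg])
    show "ee h \<in> ?D" if "h \<in>. H" for h using that e by (simp add: ee_closed LL_facts(4))
    show "y *[Q] z \<in> ?D" if "y \<in> ?D" "z \<in> ?D" for y z
      using that FL(6)[of y z] by (simp add: mult_Q_closed xr_xr[symmetric] xr_closed Lc)
    show "y +[Q] z \<in> ?D" if yz: "y \<in> ?D" "z \<in> ?D" for y z
    proof -
      have "F (xr x (y +[Q] z)) u = F x ((y +[Q] z) \<cdot>[LL] u)" if "x \<in>. X" "u \<in>. R" for x u
        using yz that additive_add[OF FX(5)[OF that(1)], of y z] additive_add[OF FL(5), of u y z]
          lin_add[OF F1[OF that(1)] Lc[OF _ that(2)] Lc[OF _ that(2)], of y z]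
          lin_add[OF F2[OF that(2)], of "xr x y" "xr x z"] by (simp add: xr_closed)
      then show ?thesis using yz module_add_closed[OF Q_mod] by simp
    qed
    show "c \<cdot>[Q] y \<in> ?D" if "c \<in>. K" "y \<in> ?D" for c y
      using that module_smult_closed[OF Q_mod] lin_smult[OF F1] by (simp add: Xscal xr_closed c Lscal Lc)
  qed auto
  then have bal: "F (xr x b) u = F x (b \<cdot>[LL] u)" if "b \<in>. BB" "x \<in>. X" "u \<in>. R" for b x u
    using that by blast
  have B: "balanced BB X LL P F"
  proof (rule balancedI)
    show "additive LL P (F x)" if "x \<in>. X" for x
      using lin_additive[OF F1[OF that]] by (simp add: additive_def)
    show "additive X P (\<lambda>x. F x u)" if "u \<in>. LL" for u
      using lin_additive[OF F2[of u]] that by (simp add: additive_def)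
  qed (simp add: bal)
  show "lin K WX P (tens_lift P F)" by (rule tens_lift_lin[OF BB_alg BX BL P B]) (simp add: c)
  show "tens_lift P F (tw x u) = F x u" if "x \<in>. X" "u \<in>. R" for x u
    by (rule WX.tens_lift_tens[OF module_abelian_group[OF P] B]) (simp_all add: that)
qed

lemmas induced_rules = smash_rules ee_rules one_R_closed WX_mod Xk_mod lin_xr xr_closed lin_tw tw_closed

abbreviation "lgen a h x u \<equiv> sw WX h (\<lambda>y z. tw (xr x (hc (S y))) (sm a z *[R] u))"

lemma lin_lgen:
  "lin K L R f \<Longrightarrow> a \<in>. A \<Longrightarrow> h \<in>. H \<Longrightarrow> x \<in>. X \<Longrightarrow> module K L \<Longrightarrow> lin K L WX (\<lambda>l. lgen a h x (f l))"
  "lin K L Xk g \<Longrightarrow> a \<in>. A \<Longrightarrow> h \<in>. H \<Longrightarrow> u \<in>. R \<Longrightarrow> module K L \<Longrightarrow> lin K L WX (\<lambda>l. lgen a h (g l) u)"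
  "lin K L A p \<Longrightarrow> h \<in>. H \<Longrightarrow> x \<in>. X \<Longrightarrow> u \<in>. R \<Longrightarrow> module K L \<Longrightarrow> lin K L WX (\<lambda>l. lgen (p l) h x u)"
  "lin K L H q \<Longrightarrow> a \<in>. A \<Longrightarrow> x \<in>. X \<Longrightarrow> u \<in>. R \<Longrightarrow> lin K L WX (\<lambda>l. lgen a (q l) x u)"
proof -
  show "lin K L WX (\<lambda>l. lgen a h x (f l))"
    if f: "lin K L R f" and as: "a \<in>. A" "h \<in>. H" "x \<in>. X" "module K L"
    using as lin_closed[OF f] by (intro sw_param_lin') (simp_all add: induced_rules f)
  show "lin K L WX (\<lambda>l. lgen a h (g l) u)"
    if f: "lin K L Xk g" and as: "a \<in>. A" "h \<in>. H" "u \<in>. R" "module K L"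
    using as lin_closed[OF f] by (intro sw_param_lin') (simp_all add: induced_rules f)
  show "lin K L WX (\<lambda>l. lgen (p l) h x u)"
    if f: "lin K L A p" and as: "h \<in>. H" "x \<in>. X" "u \<in>. R" "module K L"
    using as lin_closed[OF f] by (intro sw_param_lin') (simp_all add: induced_rules f)
  show "lin K L WX (\<lambda>l. lgen a (q l) x u)"
    if f: "lin K L H q" and as: "a \<in>. A" "x \<in>. X" "u \<in>. R"
    using as f by (intro sw_lin') (simp_all add: induced_rules)
qed

lemma sm_mult_\<alpha>_act:
  assumes a: "a \<in>. A" and z: "z \<in>. H" and k: "k \<in>. H"
  shows "sm a z *[R] \<alpha> (act k \<one>[A]) = sw R z (\<lambda>q w. sm (act (q *[H] k) \<one>[A] *[A] a) w)"
proof -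
  have "sm a z *[R] \<alpha> (act k \<one>[A]) = \<alpha> a *[R] (\<gamma> z *[R] \<alpha> (act k \<one>[A]))"
    using a z k by (simp add: sm_split[symmetric, of a z] R_assoc smash_rules)
  also have "\<dots> = sw R z (\<lambda>x y. \<alpha> a *[R] sm (act (x *[H] k) \<one>[A]) y)"
    unfolding \<gamma>_mult_\<alpha>_act[OF z k] by (rule sw_push[OF smash_mod smash_mod z]) (simp_all add: a k smash_rules)
  also have "\<dots> = sw R z (\<lambda>q w. sm (act (q *[H] k) \<one>[A] *[A] a) w)"
    by (rule sw_cong[OF smash_mod z]) (simp_all add: a k smash_rules \<alpha>_mult_sm act_unit_central)
  finally show ?thesis .
qed

text \<open>The left action of \<open>a # h\<close> is compatible with \<open>e\<^sub>k\<close>: moving \<open>e\<^sub>k\<close> past \<open>[S h\<^sub>1]\<close> gives \<open>e\<^bsub>h\<^sub>2 k\<^esub>\<close>, and the factor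
  \<open>h\<^sub>2 k \<cdot> 1\<close> is the one that appears when \<open>\<alpha>(k \<cdot> 1)\<close> is moved past \<open>\<gamma>(h\<^sub>3)\<close>.\<close>

lemma lgen_ee:
  assumes as: "a \<in>. A" "h \<in>. H" "k \<in>. H" "x \<in>. X" "u \<in>. R"
  shows "lgen a h (xr x (ee k)) u = lgen a h x (\<alpha> (act k \<one>[A]) *[R] u)"
proof -
  let ?F = "\<lambda>p q z. tw (xr x (hc (S p))) (sm (act (q *[H] k) \<one>[A] *[A] a) z *[R] u)"
  have "lgen a h (xr x (ee k)) u = sw WX h (\<lambda>y z. sw WX y (\<lambda>p q. ?F p q z))"
  proof (rule sw_cong[OF WX_mod as(2)])
    show "bilin K H H WX (\<lambda>y z. tw (xr (xr x (ee k)) (hc (S y))) (sm a z *[R] u))" using as by (simp add: induced_rules)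
    fix y z assume yz: "y \<in>. H" "z \<in>. H"
    have "tw (xr (xr x (ee k)) (hc (S y))) (sm a z *[R] u) =
        tw (xr x (sw Q y (\<lambda>p q. hc (S p) *[Q] ee (q *[H] k)))) (sm a z *[R] u)"
      using as yz by (simp add: xr_xr induced_rules ee_mult_hcS)
    also have "\<dots> = sw WX y (\<lambda>p q. tw (xr x (hc (S p) *[Q] ee (q *[H] k))) (sm a z *[R] u))"
      by (rule sw_push[OF Q_mod WX_mod yz(1)]) (simp_all add: as yz induced_rules)
    also have "\<dots> = sw WX y (\<lambda>p q. ?F p q z)" by (rule sw_cong[OF WX_mod yz(1)])
        (simp_all add: as yz induced_rules xr_xr[symmetric] tw_ee k_algebra_assoc[OF smash_alg, symmetric] \<alpha>_mult_sm)
    finally show "tw (xr (xr x (ee k)) (hc (S y))) (sm a z *[R] u) = sw WX y (\<lambda>p q. ?F p q z)" .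
  qed
  also have "\<dots> = sw WX h (\<lambda>p y. sw WX y (\<lambda>q z. ?F p q z))"
    by (rule sw_coassoc[OF WX_mod as(2)]) (simp add: as induced_rules)
  also have "\<dots> = lgen a h x (\<alpha> (act k \<one>[A]) *[R] u)"
  proof (rule sw_cong[symmetric, OF WX_mod as(2)])
    show "bilin K H H WX (\<lambda>y z. tw (xr x (hc (S y))) (sm a z *[R] (\<alpha> (act k \<one>[A]) *[R] u)))" using as by (simp add: induced_rules)
    fix p z assume pz: "p \<in>. H" "z \<in>. H"
    have "tw (xr x (hc (S p))) (sm a z *[R] (\<alpha> (act k \<one>[A]) *[R] u)) =
        tw (xr x (hc (S p))) (sw R z (\<lambda>q w. sm (act (q *[H] k) \<one>[A] *[A] a) w) *[R] u)"
      using as pz by (simp add: induced_rules k_algebra_assoc[OF smash_alg, symmetric] sm_mult_\<alpha>_act)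
    also have "\<dots> = sw WX z (\<lambda>q w. ?F p q w)"
      by (rule sw_push[OF smash_mod WX_mod pz(2)]) (simp_all add: as pz induced_rules)
    finally show "tw (xr x (hc (S p))) (sm a z *[R] (\<alpha> (act k \<one>[A]) *[R] u)) = sw WX z (\<lambda>q w. ?F p q w)" .
  qed
  finally show ?thesis .
qed

definition "lact s v = tens_lift WX (\<lambda>a h. tens_lift WX (lgen a h) v) s"
definition "ract v s = tens_lift WX (\<lambda>x u. tw x (u *[R] s)) v"

lemma lgen_lift:
  assumes "a \<in>. A" "h \<in>. H"
  shows "lin K WX WX (tens_lift WX (lgen a h))"
    "\<And>x u. x \<in>. X \<Longrightarrow> u \<in>. R \<Longrightarrow> tens_lift WX (lgen a h) (tw x u) = lgen a h x u"
  by (rule WX_lift[OF WX_mod]; (rule lin_lgen lgen_ee)?; use assms in \<open>simp add: induced_rules\<close>)+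

lemma lgen_lift_bilin:
  assumes v: "v \<in>. WX"
  shows "bilin K A H WX (\<lambda>a h. tens_lift WX (lgen a h) v)"
  using v
proof (rule WX_induct)
  fix x u assume xu: "x \<in>. X" "u \<in>. R"
  have "bilin K A H WX (\<lambda>a h. lgen a h x u)" by (rule bilinI) (auto intro!: lin_lgen lin_id xu A_mod)
  then show "bilin K A H WX (\<lambda>a h. tens_lift WX (lgen a h) (tw x u))"
    by (rule bilin_cong[OF _ A_mod H_mod]) (simp add: lgen_lift(2) xu)
next
  fix v w assume vw: "v \<in>. WX" "w \<in>. WX" "bilin K A H WX (\<lambda>a h. tens_lift WX (lgen a h) v)"
    "bilin K A H WX (\<lambda>a h. tens_lift WX (lgen a h) w)"
  have "bilin K A H WX (\<lambda>a h. tens_lift WX (lgen a h) v +[WX] tens_lift WX (lgen a h) w)"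
    by (intro bilinI lin_sum[OF WX_mod] bilin_left[OF vw(3)] bilin_left[OF vw(4)] bilin_right[OF vw(3)] bilin_right[OF vw(4)])
  then show "bilin K A H WX (\<lambda>a h. tens_lift WX (lgen a h) (v +[WX] w))"
    by (rule bilin_cong[OF _ A_mod H_mod]) (simp add: lin_add[OF lgen_lift(1)] vw del: WX.tensor_fields)
qed

lemma lact_lin_vector: "s \<in>. R \<Longrightarrow> lin K WX WX (lact s)"
  unfolding lact_def
  by (rule kt_lift_param_lin[OF A_mod H_mod WX_mod WX_mod smash_subset]) (auto intro: lgen_lift_bilin lgen_lift(1))

lemma lact_lin_scalar: "v \<in>. WX \<Longrightarrow> lin K R WX (\<lambda>s. lact s v)"
  unfolding lact_def by (rule lin_from_smash[OF kt_lift_lin[OF A_mod H_mod WX_mod lgen_lift_bilin]])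

text \<open>The definition lifts over \<open>A \<otimes> H\<close>.  On \<open>a # h\<close>, a sum of terms \<open>a (h\<^sub>1 \<cdot> 1) \<otimes> h\<^sub>2\<close>, the lift gives the value at
  \<open>(a, h)\<close> because the smash product absorbs \<open>h\<^sub>1 \<cdot> 1\<close>.\<close>

lemma lact_sm:
  assumes as: "a \<in>. A" "h \<in>. H" "x \<in>. X" "u \<in>. R"
  shows "lact (sm a h) (tw x u) = lgen a h x u"
proof -
  have b: "bilin K A H WX (\<lambda>a h. tens_lift WX (lgen a h) (tw x u))" by (rule lgen_lift_bilin[OF tw_closed[OF as(3,4)]])
  let ?F = "\<lambda>p y z. tw (xr x (hc (S y))) (sm (a *[A] act p \<one>[A]) z *[R] u)"
  have "lact (sm a h) (tw x u) = sw WX h (\<lambda>p q. tens_lift WX (\<lambda>a h. tens_lift WX (lgen a h) (tw x u)) (ten (a *[A] act p \<one>[A]) q))"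
    unfolding lact_def smash_elem_def[of K H A act a h]
    by (rule sw_push[OF TT_mod WX_mod as(2) _ kt_lift_lin[OF A_mod H_mod WX_mod b]]) (simp add: as act_rules)
  also have "\<dots> = sw WX h (\<lambda>p q. lgen (a *[A] act p \<one>[A]) q x u)"
    by (rule sw_cong[symmetric, OF WX_mod as(2)])
      (simp_all add: as induced_rules act_rules kt_lift_tens[OF A_mod H_mod WX_mod b] lgen_lift(2))
  also have "\<dots> = sw WX h (\<lambda>y q. sw WX q (\<lambda>p z. ?F p y z))"
    by (rule sw_swap12[OF WX_mod as(2)]) (simp add: as induced_rules act_rules)
  also have "\<dots> = lgen a h x u"
  proof (rule sw_cong[symmetric, OF WX_mod as(2)])
    show "bilin K H H WX (\<lambda>y z. tw (xr x (hc (S y))) (sm a z *[R] u))" using as by (simp add: induced_rules)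
    show "tw (xr x (hc (S y))) (sm a q *[R] u) = sw WX q (\<lambda>p z. ?F p y z)" if "y \<in>. H" "q \<in>. H" for y q
      unfolding sm_absorb[OF as(1) that(2), symmetric]
      by (rule sw_push[OF smash_mod WX_mod that(2)]) (simp_all add: as that induced_rules)
  qed
  finally show ?thesis .
qed

lemma lact_one: "v \<in>. WX \<Longrightarrow> lact \<one>[R] v = v"
proof (rule WX_eq[OF _ lact_lin_vector[OF one_R_closed] lin_id])
  fix x u assume xu: "x \<in>. X" "u \<in>. R"
  have "lact (sm \<one>[A] \<one>[H]) (tw x u) = tw (xr x (hc (S \<one>[H]))) (sm \<one>[A] \<one>[H] *[R] u)"
    unfolding lact_sm[OF one_A_closed one_H_closed xu] by (rule sw_one[OF WX_mod]) (simp add: xu induced_rules)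
  then show "lact \<one>[R] (tw x u) = tw x u"
    using xu by (simp add: sm_one antipode_one hc_one xr_one R_l_one)
qed

text \<open>Acting first by \<open>b # k\<close> and then by \<open>a # h\<close> produces \<open>[S k\<^sub>1] [S h\<^sub>1]\<close>.  This is \<open>[S(h\<^sub>1 k\<^sub>1)]\<close> times some
  \<open>e\<^sub>d\<close>, and the factor \<open>d \<cdot> 1\<close> is absorbed by \<open>a # h\<^sub>2\<close>.\<close>

lemma lact_mult_gen:
  assumes as: "a \<in>. A" "h \<in>. H" "b \<in>. A" "k \<in>. H" "x \<in>. X" "u \<in>. R"
  shows "lact (sm a h *[R] sm b k) (tw x u) = lact (sm a h) (lact (sm b k) (tw x u))"
proof -
  let ?F = "\<lambda>p y z y' z'. tw (xr x (hc (S (y *[H] y')))) (sm (a *[A] act p b) (z *[H] z') *[R] u)"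
  let ?N = "sw WX h (\<lambda>c z. sw WX k (\<lambda>y' z'. sw WX z (\<lambda>p q. ?F p c q y' z')))"
  note [simp] = induced_rules and [simp del] = WX.tensor_fields
  have "lact (sm a h *[R] sm b k) (tw x u) = sw WX h (\<lambda>p q. lact (sm (a *[A] act p b) (q *[H] k)) (tw x u))"
    unfolding sm_mult[OF as(1-4)]
    by (rule sw_push[OF smash_mod WX_mod as(2) _ lact_lin_scalar]) (use as in \<open>simp_all del: WX.tensor_fields\<close>)
  also have "\<dots> = sw WX h (\<lambda>p q. sw WX q (\<lambda>y z. sw WX k (\<lambda>y' z'. ?F p y z y' z')))"
  proof (rule sw_cong[OF WX_mod as(2)])
    have "lin K H R (\<lambda>p. sm (a *[A] act p b) (q *[H] k))" "lin K H R (\<lambda>q. sm (a *[A] act p b) (q *[H] k))"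
      if "p \<in>. H" "q \<in>. H" for p q using that as by simp_all
    then show "bilin K H H WX (\<lambda>p q. lact (sm (a *[A] act p b) (q *[H] k)) (tw x u))"
      using as by (intro bilinI lin_comp[OF lact_lin_scalar]) simp_all
    fix p q assume pq: "p \<in>. H" "q \<in>. H"
    have "lact (sm (a *[A] act p b) (q *[H] k)) (tw x u) = lgen (a *[A] act p b) (q *[H] k) x u"
      by (rule lact_sm) (simp_all add: as pq)
    also have "\<dots> = sw WX q (\<lambda>y z. sw WX k (\<lambda>y' z'. ?F p y z y' z'))"
      by (rule sw_mult[OF WX_mod pq(2) as(4)]) (simp_all add: as pq)
    finally show "lact (sm (a *[A] act p b) (q *[H] k)) (tw x u) =
      sw WX q (\<lambda>y z. sw WX k (\<lambda>y' z'. ?F p y z y' z'))" .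
  qed
  also have "\<dots> = sw WX h (\<lambda>y q. sw WX q (\<lambda>p z. sw WX k (\<lambda>y' z'. ?F p y z y' z')))"
    by (rule sw_swap12[OF WX_mod as(2)]) (simp add: as)
  also have "\<dots> = ?N"
  proof (rule sw_cong[OF WX_mod as(2)])
    show "sw WX q (\<lambda>p z. sw WX k (\<lambda>y' z'. ?F p y z y' z')) = sw WX k (\<lambda>y' z'. sw WX q (\<lambda>p z. ?F p y z y' z'))"
      if "y \<in>. H" "q \<in>. H" for y q by (rule sw_swap[OF WX_mod]) (simp_all add: as that)
  qed (simp add: as)
  finally have 1: "lact (sm a h *[R] sm b k) (tw x u) = ?N" .
  let ?w = "\<lambda>z z'. sm a z *[R] (sm b z' *[R] u)"
  have lh: "lin K WX WX (lact (sm a h))" by (rule lact_lin_vector) (simp add: as)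
  have "lact (sm a h) (lact (sm b k) (tw x u)) = sw WX k (\<lambda>y' z'. lact (sm a h) (tw (xr x (hc (S y'))) (sm b z' *[R] u)))"
    unfolding lact_sm[OF as(3-6)] by (rule sw_push[OF WX_mod WX_mod as(4) _ lh]) (simp_all add: as)
  also have "\<dots> = sw WX k (\<lambda>y' z'. sw WX h (\<lambda>c z. tw (xr x (hc (S (c *[H] y')))) (?w z z')))"
  proof (rule sw_cong[OF WX_mod as(4)])
    show "bilin K H H WX (\<lambda>y' z'. lact (sm a h) (tw (xr x (hc (S y'))) (sm b z' *[R] u)))"
      by (rule bilin_comp[OF _ lh]) (simp add: as)
    fix y' z' assume yz': "y' \<in>. H" "z' \<in>. H"
    let ?G = "\<lambda>c d z. tw (xr x (hc (S (c *[H] y')))) (sm (a *[A] act d \<one>[A]) z *[R] (sm b z' *[R] u))"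
    have "lact (sm a h) (tw (xr x (hc (S y'))) (sm b z' *[R] u)) = lgen a h (xr x (hc (S y'))) (sm b z' *[R] u)"
      by (rule lact_sm) (simp_all add: as yz')
    also have "\<dots> = sw WX h (\<lambda>y z. sw WX y (\<lambda>c d. ?G c d z))"
    proof (rule sw_cong[OF WX_mod as(2)])
      show "bilin K H H WX (\<lambda>y z. tw (xr (xr x (hc (S y'))) (hc (S y))) (sm a z *[R] (sm b z' *[R] u)))" using as yz' by simp
      fix y z assume yz: "y \<in>. H" "z \<in>. H"
      have "tw (xr (xr x (hc (S y'))) (hc (S y))) (?w z z') =
        tw (xr x (sw Q y (\<lambda>c d. hc (S y' *[H] S c) *[Q] ee d))) (?w z z')"
        using as yz yz' by (simp add: xr_xr hcS_mult_hcS)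
      also have "\<dots> = sw WX y (\<lambda>c d. tw (xr x (hc (S y' *[H] S c) *[Q] ee d)) (?w z z'))"
        by (rule sw_push[OF Q_mod WX_mod yz(1)]) (simp_all add: as yz yz')
      also have "\<dots> = sw WX y (\<lambda>c d. ?G c d z)"
      proof (rule sw_cong[OF WX_mod yz(1)])
        fix c d assume cd: "c \<in>. H" "d \<in>. H"
        have "tw (xr x (hc (S y' *[H] S c) *[Q] ee d)) (?w z z') = tw (xr x (hc (S y' *[H] S c))) (\<alpha> (act d \<one>[A]) *[R] ?w z z')"
          using as yz yz' cd by (simp add: xr_xr[symmetric] tw_ee)
        also have "\<alpha> (act d \<one>[A]) *[R] ?w z z' = (\<alpha> (act d \<one>[A]) *[R] sm a z) *[R] (sm b z' *[R] u)"
          using as yz yz' cd by (simp add: R_assoc)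
        finally show "tw (xr x (hc (S y' *[H] S c) *[Q] ee d)) (?w z z') = ?G c d z"
          using as yz yz' cd by (simp add: \<alpha>_mult_sm act_unit_central antipode_mult)
      qed (simp add: as yz yz')
      finally show "tw (xr (xr x (hc (S y'))) (hc (S y))) (?w z z') = sw WX y (\<lambda>c d. ?G c d z)" .
    qed
    also have "\<dots> = sw WX h (\<lambda>c y. sw WX y (\<lambda>d z. ?G c d z))"
      by (rule sw_coassoc[OF WX_mod as(2)]) (simp add: as yz')
    also have "\<dots> = sw WX h (\<lambda>c z. tw (xr x (hc (S (c *[H] y')))) (?w z z'))"
    proof (rule sw_cong[symmetric, OF WX_mod as(2)])
      show "tw (xr x (hc (S (c *[H] y')))) (?w y z') = sw WX y (\<lambda>d z. ?G c d z)" if "c \<in>. H" "y \<in>. H" for c y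
        unfolding sm_absorb[OF as(1) that(2), symmetric]
        by (rule sw_push[OF smash_mod WX_mod that(2)]) (simp_all add: as yz' that)
    qed (simp add: as yz')
    finally show "lact (sm a h) (tw (xr x (hc (S y'))) (sm b z' *[R] u)) =
       sw WX h (\<lambda>c z. tw (xr x (hc (S (c *[H] y')))) (?w z z'))" .
  qed
  also have "\<dots> = sw WX h (\<lambda>c z. sw WX k (\<lambda>y' z'. tw (xr x (hc (S (c *[H] y')))) (?w z z')))"
    by (rule sw_swap[OF WX_mod as(4,2)]) (simp_all add: as)
  also have "\<dots> = ?N"
  proof (rule sw_cong[OF WX_mod as(2)])
    fix c z assume cz: "c \<in>. H" "z \<in>. H"
    show "sw WX k (\<lambda>y' z'. tw (xr x (hc (S (c *[H] y')))) (?w z z')) =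
        sw WX k (\<lambda>y' z'. sw WX z (\<lambda>p q. ?F p c q y' z'))"
    proof (rule sw_cong[OF WX_mod as(4)])
      fix y' z' assume yz': "y' \<in>. H" "z' \<in>. H"
      have "tw (xr x (hc (S (c *[H] y')))) (?w z z') =
          tw (xr x (hc (S (c *[H] y')))) (sw R z (\<lambda>p q. sm (a *[A] act p b) (q *[H] z')) *[R] u)"
        unfolding sm_mult[OF as(1) cz(2) as(3) yz'(2), symmetric] using as cz yz' by (simp add: R_assoc)
      also have "\<dots> = sw WX z (\<lambda>p q. ?F p c q y' z')"
        by (rule sw_push[OF smash_mod WX_mod cz(2)]) (simp_all add: as cz yz')
      finally show "tw (xr x (hc (S (c *[H] y')))) (?w z z') = sw WX z (\<lambda>p q. ?F p c q y' z')" .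
    qed (simp add: as cz)
  qed (simp add: as)
  finally show ?thesis using 1 by simp
qed

lemma lact_closed: "s \<in>. R \<Longrightarrow> v \<in>. WX \<Longrightarrow> lact s v \<in>. WX"
  by (rule lin_closed[OF lact_lin_vector])

lemma lact_mult:
  assumes s: "s \<in>. R" and t: "t \<in>. R" and v: "v \<in>. WX"
  shows "lact (s *[R] t) v = lact s (lact t v)"
proof -
  have 1: "lact (sm a h *[R] sm b k) v = lact (sm a h) (lact (sm b k) v)"
    if as: "a \<in>. A" "h \<in>. H" "b \<in>. A" "k \<in>. H" for a h b k
    by (rule WX_eq[OF v lact_lin_vector lin_comp[OF lact_lin_vector lact_lin_vector]])
      (simp_all add: as smash_rules lact_mult_gen)
  have 2: "lact (sm a h *[R] t) v = lact (sm a h) (lact t v)" if as: "a \<in>. A" "h \<in>. H" for a h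
    by (rule smash_eq[OF t lin_comp[OF lact_lin_scalar[OF v]] lin_comp[OF lact_lin_vector lact_lin_scalar[OF v]]])
      (simp_all add: as 1 smash_rules)
  show ?thesis by (rule smash_eq[OF s lin_comp[OF lact_lin_scalar[OF v]] lact_lin_scalar])
      (simp_all add: t v 2 smash_rules lact_closed del: WX.tensor_fields)
qed

lemma ract_facts:
  assumes s: "s \<in>. R"
  shows "lin K WX WX (\<lambda>v. ract v s)" "\<And>x u. x \<in>. X \<Longrightarrow> u \<in>. R \<Longrightarrow> ract (tw x u) s = tw x (u *[R] s)"
  unfolding ract_def by (rule WX_lift[OF WX_mod]; use s in \<open>simp add: induced_rules tw_ee R_assoc\<close>)+

lemma ract_lin_scalar:
  assumes v: "v \<in>. WX"
  shows "lin K R WX (\<lambda>s. ract v s)"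
  using v
proof (rule WX_induct)
  fix x u assume xu: "x \<in>. X" "u \<in>. R"
  have "lin K R WX (\<lambda>s. tw x (u *[R] s))" using xu by (simp add: induced_rules)
  then show "lin K R WX (\<lambda>s. ract (tw x u) s)"
    by (rule lin_cong) (simp_all add: xu ract_facts(2) module_add_closed[OF smash_mod] module_smult_closed[OF smash_mod])
next
  fix v w assume vw: "v \<in>. WX" "w \<in>. WX" "lin K R WX (\<lambda>s. ract v s)" "lin K R WX (\<lambda>s. ract w s)"
  show "lin K R WX (\<lambda>s. ract (v +[WX] w) s)" by (rule lin_cong[OF lin_sum[OF WX_mod vw(3,4)]])
      (simp_all add: vw lin_add[OF ract_facts(1)] module_add_closed[OF smash_mod] module_smult_closed[OF smash_mod] del: WX.tensor_fields)
qed

lemma ract_closed: "s \<in>. R \<Longrightarrow> v \<in>. WX \<Longrightarrow> ract v s \<in>. WX"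
  by (rule lin_closed[OF ract_facts(1)])

lemma ract_mult:
  assumes "s \<in>. R" "t \<in>. R" "v \<in>. WX"
  shows "ract v (s *[R] t) = ract (ract v s) t"
  by (rule WX_eq[OF assms(3) ract_facts(1) lin_comp[OF ract_facts(1) ract_facts(1)]])
    (simp_all add: assms ract_facts(2) smash_rules R_assoc)

lemma lact_ract:
  assumes s: "s \<in>. R" and t: "t \<in>. R" and v: "v \<in>. WX"
  shows "lact s (ract v t) = ract (lact s v) t"
proof (rule smash_eq[OF s lact_lin_scalar lin_comp[OF ract_facts(1)[OF t] lact_lin_scalar[OF v]]])
  fix a h assume ah: "a \<in>. A" "h \<in>. H"
  show "lact (sm a h) (ract v t) = ract (lact (sm a h) v) t"
  proof (rule WX_eq[OF v lin_comp[OF lact_lin_vector ract_facts(1)[OF t]] lin_comp[OF ract_facts(1)[OF t] lact_lin_vector]])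
    fix x u assume xu: "x \<in>. X" "u \<in>. R"
    have "ract (lgen a h x u) t = sw WX h (\<lambda>y z. ract (tw (xr x (hc (S y))) (sm a z *[R] u)) t)"
      by (rule sw_push[OF WX_mod WX_mod ah(2) _ ract_facts(1)[OF t]]) (simp add: ah xu induced_rules)
    also have "\<dots> = lgen a h x (u *[R] t)" by (rule sw_cong[symmetric, OF WX_mod ah(2)])
        (simp_all add: ah xu t induced_rules ract_facts(2) R_assoc)
    finally show "lact (sm a h) (ract (tw x u) t) = ract (lact (sm a h) (tw x u)) t"
      using ah xu t by (simp add: ract_facts(2) lact_sm smash_rules)
  qed (simp_all add: ah smash_rules)
qed (rule ract_closed[OF t v])

abbreviation "WE \<equiv> induced_env K H A act X"

lemma WE_eq: "WE = with_smult WX (\<lambda>e v. tens_lift WX (\<lambda>s s'. ract (lact s' v) s) e)"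
  unfolding induced_env_def Let_def lact_def ract_def ..

lemma WE_bimodule:
  "right_module EE WE"
  "\<And>s t v. s \<in>. R \<Longrightarrow> t \<in>. R \<Longrightarrow> v \<in>. WX \<Longrightarrow> etn s t \<cdot>[WE] v = ract (lact t v) s"
proof -
  note cl = smash_rules lact_closed ract_closed one_R_closed
  have l1: "lin K R WX (\<lambda>s. ract (lact t v) s)" if "t \<in>. R" "v \<in>. WX" for t v
    by (rule ract_lin_scalar[OF lact_closed[OF that]])
  have l2: "lin K Rop WX (\<lambda>t. ract (lact t v) s)" if "s \<in>. R" "v \<in>. WX" for s v
    by (rule lin_fields[OF lin_comp[OF ract_facts(1)[OF that(1)] lact_lin_scalar[OF that(2)]]]) simp_all
  have l3: "lin K WX WX (\<lambda>v. ract (lact t v) s)" if "s \<in>. R" "t \<in>. R" for s t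
    by (rule lin_comp[OF ract_facts(1)[OF that(1)] lact_lin_vector[OF that(2)]])
  have one: "ract (lact \<one>[Rop] v) \<one>[R] = v" if "v \<in>. WX" for v
    unfolding opposite_simps lact_one[OF that] by (rule WX_eq[OF that ract_facts(1)[OF one_R_closed] lin_id])
      (simp add: ract_facts(2) one_R_closed R_r_one)
  show "right_module EE WE"
    unfolding EE_eq WE_eq by (rule right_module_alg_tensor[OF smash_alg Rop_alg WX_mod])
      (use l1 l2 l3 one in \<open>simp_all add: lact_mult ract_mult lact_ract cl del: WX.tensor_fields\<close>)
  show "etn s t \<cdot>[WE] v = ract (lact t v) s" if "s \<in>. R" "t \<in>. R" "v \<in>. WX" for s t v
    unfolding WE_eq with_smult_simps
    by (rule env_act_tens[OF smash_alg Rop_alg WX_mod, where g = "\<lambda>s t v. ract (lact t v) s"])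
      (use l1 l2 l3 one that in \<open>simp_all del: WX.tensor_fields\<close>)
qed

lemma WE_fields: "carrier WE = carrier WX" "add WE = add WX" by (simp_all add: WE_eq)

end

end


section \<open>Functoriality\<close>

lemma tensor_map_facts:
  assumes R: "k_algebra K R" and X: "right_module R X" and X': "right_module R X'"
    and Y: "left_module R Y" and Y': "left_module R Y'" and f: "lin R X X' f" and g: "lin R Y Y' g"
  shows "lin K (tensor R X Y) (tensor R X' Y') (tensor_map R X' Y' f g)"
    "\<And>x y. x \<in>. X \<Longrightarrow> y \<in>. Y \<Longrightarrow> tensor_map R X' Y' f g (tens R X Y x y) = tens R X' Y' (f x) (g y)"
proof -
  interpret T: tensor_product R X Y by (rule tensor_productI[OF X Y])
  interpret T': tensor_product R X' Y' by (rule tensor_productI[OF X' Y'])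
  have fx: "f x \<in>. X'" if "x \<in>. X" for x using lin_closed[OF f that] .
  have gy: "g y \<in>. Y'" if "y \<in>. Y" for y using lin_closed[OF g that] .
  have B: "balanced R X Y (tensor R X' Y') (\<lambda>x y. tens R X' Y' (f x) (g y))" by (intro balancedI additiveI)
      (simp_all add: fx gy T'.tens_closed lin_add[OF f] lin_add[OF g] T'.tens_add_left T'.tens_add_right
        lin_smult[OF f] lin_smult[OF g] T'.tens_middle del: T'.tensor_fields)
  have c1: "c \<cdot>[R] \<one>[R] \<in>. R" if "c \<in>. K" for c
    using module_smult_closed[OF k_algebra_module[OF R] that k_algebra_one_closed[OF R]] .
  show "lin K (tensor R X Y) (tensor R X' Y') (tensor_map R X' Y' f g)"
    unfolding tensor_map_def by (rule tens_lift_lin[OF R X Y tensor_module[OF R X' Y'] B])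
      (simp add: tensor_smult_tens[OF R X' Y'] fx gy lin_smult[OF f] c1)
  show "tensor_map R X' Y' f g (tens R X Y x y) = tens R X' Y' (f x) (g y)" if "x \<in>. X" "y \<in>. Y" for x y
    unfolding tensor_map_def by (rule T.tens_lift_tens[OF T'.tensor_group B that])
qed

context partial_smash
begin

text \<open>\<open>H\<^sub>p\<^sub>a\<^sub>r\<close> is generated by the classes \<open>[h]\<close> as an algebra.\<close>

lemma lin_hparI:
  assumes V: "left_module Q V" and V': "left_module Q V'" and f: "additive V V' f"
    and c: "\<And>c v. c \<in>. K \<Longrightarrow> v \<in>. V \<Longrightarrow> f ((c \<cdot>[Q] \<one>[Q]) \<cdot>[V] v) = (c \<cdot>[Q] \<one>[Q]) \<cdot>[V'] f v"
    and h: "\<And>h v. h \<in>. H \<Longrightarrow> v \<in>. V \<Longrightarrow> f (hc h \<cdot>[V] v) = hc h \<cdot>[V'] f v"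
  shows "lin Q V V' f"
proof (rule linI)
  note F = left_module_facts[OF V] and F' = left_module_facts[OF V'] and fc = additive_closed[OF f]
  show "f (z \<cdot>[V] v) = z \<cdot>[V'] f v" if "z \<in>. Q" and v: "v \<in>. V" for z v
    using that(1)
  proof (induction rule: hpar_induct)
    case (hc k z)
    then show ?case using h[OF hc(1) F(3)[OF hc(2) v]] v by (simp add: F(6) F'(6) fc hc_closed)
  next
    case (add y z)
    then show ?case using v by (simp add: additive_add[OF F(5)] additive_add[OF F'(5)] additive_add[OF f] F(3) fc)
  qed (rule c[OF _ v])
qed (use f in \<open>simp_all add: additive_def\<close>)

lemma VM_eq:
  assumes "left_module EE M" "v \<in>. (VM M)" "additive (VM M) P f" "additive (VM M) P g"
    "\<And>m. m \<in>. M \<Longrightarrow> f (\<tau> M m) = g (\<tau> M m)"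
  shows "f v = g v"
  using assms(2) by (rule VM_induct[OF assms(1)]) (simp_all only: assms(5) additive_add[OF assms(3)] additive_add[OF assms(4)])

text \<open>On the classes \<open>\<tau>(m)\<close> the induced map is \<open>\<tau>(m) \<mapsto> \<tau>(g m)\<close>, and \<open>g\<close> commutes with conjugation.\<close>

lemma CM_map:
  assumes M: "left_module EE M" and M': "left_module EE M'" and g: "lin EE M M' g"
  shows "lin Q (CM M) (CM M') (coinv_tensor_map K H A act M' g)"
    "\<And>m. m \<in>. M \<Longrightarrow> coinv_tensor_map K H A act M' g (\<tau> M m) = \<tau> M' (g m)"
proof -
  let ?G = "coinv_tensor_map K H A act M' g"
  note V = coinv_rules[OF M] and V' = coinv_rules[OF M'] and gc = lin_closed[OF g]
  have gb: "g (bi M s m t) = bi M' s (g m) t" if "s \<in>. R" "t \<in>. R" "m \<in>. M" for s t m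
    by (rule lin_smult[OF g etn_closed]) (simp_all add: that)
  have gk: "lin K (Mk M) (Mk M') g" by (rule linI) (use module_smult_closed[OF EE_mod _ k_algebra_one_closed[OF EE_alg]] in
      \<open>simp_all add: gc lin_add[OF g] lin_smult[OF g] del: EE_simps\<close>)
  have l: "lin K (Mk M) (VM M') (\<lambda>m. \<tau> M' (g m))" by (rule lin_tn(2)[OF M' gk]) (rule one_A_closed)
  have tr: "\<tau> M' (g (bi M (\<alpha> a) m \<one>[R])) = \<tau> M' (g (bi M \<one>[R] m (\<alpha> a)))" if "a \<in>. A" "m \<in>. M" for a m
    using that \<tau>_trace[OF M' that(1) gc[OF that(2)]] by (simp add: gb smash_rules one_R_closed)
  have F: "tn M' (id a) (g m) = \<tau> M' (g (bi M (\<alpha> a) m \<one>[R]))" if "a \<in>. A" "m \<in>. M" for a m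
    using that tn_\<tau>[OF M' that(1) gc[OF that(2)]] by (simp add: gb smash_rules one_R_closed)
  note L = VM_lift[OF M VM_mod[OF M'] l tr F, folded tensor_map_def coinv_tensor_map_def]
  show t: "?G (\<tau> M m) = \<tau> M' (g m)" if "m \<in>. M" for m by (rule L(2)) (simp_all add: that)
  have lG: "lin K (VM M) (VM M') ?G" by (rule L(1))
  show "lin Q (CM M) (CM M') ?G"
  proof (rule lin_hparI[OF CM_facts(1)[OF M] CM_facts(1)[OF M']])
    show "additive (CM M) (CM M') ?G"
      using lin_additive[OF lG] unfolding additive_def CM_fields[OF M] CM_fields[OF M'] .
    show "?G ((c \<cdot>[Q] \<one>[Q]) \<cdot>[CM M] v) = (c \<cdot>[Q] \<one>[Q]) \<cdot>[CM M'] ?G v" if "c \<in>. K" "v \<in>. (CM M)" for c v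
      using that lin_closed[OF lG] lin_smult[OF lG] unfolding CM_fields[OF M] by (simp only: CM_facts(3)[OF M] CM_facts(3)[OF M'])
    fix h v assume h: "h \<in>. H" and v: "v \<in>. (CM M)"
    show "?G (hc h \<cdot>[CM M] v) = hc h \<cdot>[CM M'] ?G v"
    proof (rule VM_eq[OF M v[unfolded CM_fields[OF M]], where f = "\<lambda>v. ?G (hc h \<cdot>[CM M] v)" and g = "\<lambda>v. hc h \<cdot>[CM M'] ?G v"])
      show "additive (VM M) (VM M') (\<lambda>v. ?G (hc h \<cdot>[CM M] v))"
        using left_module_facts(4)[OF CM_facts(1)[OF M] hc_closed[OF h]]
        by (intro additive_comp[OF lin_additive[OF lG]]) (simp only: additive_def CM_fields[OF M])
      show "additive (VM M) (VM M') (\<lambda>v. hc h \<cdot>[CM M'] ?G v)"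
        using left_module_facts(4)[OF CM_facts(1)[OF M'] hc_closed[OF h]]
        by (intro additive_comp[OF _ lin_additive[OF lG]]) (simp only: additive_def CM_fields[OF M'])
      fix m assume m: "m \<in>. M"
      have "?G (conj_sum M h m) = sw (VM M') h (\<lambda>y z. ?G (\<tau> M (bi M (\<gamma> y) m (\<gamma> (S z)))))"
        by (rule sw_push[OF VM_mod[OF M] VM_mod[OF M'] h _ lG]) (simp add: m V)
      also have "\<dots> = conj_sum M' h (g m)"
        by (rule sw_cong[symmetric, OF VM_mod[OF M'] h]) (simp_all add: m gc[OF m] V V' t gb)
      finally show "?G (hc h \<cdot>[CM M] \<tau> M m) = hc h \<cdot>[CM M'] ?G (\<tau> M m)"
        unfolding CM_facts(2)[OF M h m] t[OF m] CM_facts(2)[OF M' h gc[OF m]] .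
    qed
  qed
qed

lemma WE_map:
  assumes X: "right_module Q X" and X': "right_module Q X'" and f: "lin Q X X' f"
  shows "lin EE (WE X) (WE X') (tensor_map BB X' LL f id)"
    "\<And>x u. x \<in>. X \<Longrightarrow> u \<in>. R \<Longrightarrow> tensor_map BB X' LL f id (tw X x u) = tw X' (f x) u"
proof -
  let ?W = "tensor_map BB X' LL f id"
  note V = induced_rules[OF X] and V' = induced_rules[OF X'] and fc = lin_closed[OF f]
  have fk: "lin K (Xk X) (Xk X') f" by (rule linI) (use module_smult_closed[OF Q_mod _ k_algebra_one_closed[OF Q_alg]] in
      \<open>simp_all add: fc lin_add[OF f] lin_smult[OF f]\<close>)
  have l1: "lin K R (WX X') (\<lambda>u. tw X' (f x) (id u))" if "x \<in>. X" for x
    unfolding id_def by (rule lin_tw(2)[OF X' lin_id fc[OF that]])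
  have l2: "lin K (Xk X) (WX X') (\<lambda>x. tw X' (f x) (id u))" if "u \<in>. R" for u
    unfolding id_def by (rule lin_tw(1)[OF X' fk that])
  have e: "tw X' (f (xr X x (ee k))) (id u) = tw X' (f x) (id (\<alpha> (act k \<one>[A]) *[R] u))"
    if "k \<in>. H" "x \<in>. X" "u \<in>. R" for k x u
    using that by (simp add: lin_smult[OF f ee_closed] tw_ee[OF X'] fc)
  note L = WX_lift[OF X WX_mod[OF X'] l1 l2 e, folded tensor_map_def]
  have lW: "lin K (WX X) (WX X') ?W" by (rule L(1))
  show t: "?W (tw X x u) = tw X' (f x) u" if "x \<in>. X" "u \<in>. R" for x u
    by (rule trans[OF L(2) arg_cong[where f = "tw X' (f x)", OF id_apply]]) (simp_all add: that)
  note Wc = lin_closed[OF lW]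
  have la: "?W (lact X s v) = lact X' s (?W v)" if s: "s \<in>. R" and v: "v \<in>. (WX X)" for s v
  proof (rule smash_eq[OF s lin_comp[OF lW lact_lin_scalar[OF X v]] lact_lin_scalar[OF X' Wc[OF v]]])
    fix a h assume ah: "a \<in>. A" "h \<in>. H"
    show "?W (lact X (sm a h) v) = lact X' (sm a h) (?W v)"
    proof (rule WX_eq[OF X v lin_comp[OF lW lact_lin_vector[OF X]] lin_comp[OF lact_lin_vector[OF X'] lW]])
      fix x u assume xu: "x \<in>. X" "u \<in>. R"
      have "?W (lgen X a h x u) = sw (WX X') h (\<lambda>y z. ?W (tw X (xr X x (hc (S y))) (sm a z *[R] u)))"
        by (rule sw_push[OF WX_mod[OF X] WX_mod[OF X'] ah(2) _ lW]) (simp add: ah xu V)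
      also have "\<dots> = lgen X' a h (f x) u"
        by (rule sw_cong[symmetric, OF WX_mod[OF X'] ah(2)]) (simp_all add: ah xu V V' t fc lin_smult[OF f])
      finally show "?W (lact X (sm a h) (tw X x u)) = lact X' (sm a h) (?W (tw X x u))"
        using ah xu by (simp add: lact_sm[OF X] lact_sm[OF X'] t fc)
    qed (simp_all add: ah smash_rules)
  qed
  have ra: "?W (ract X v s) = ract X' (?W v) s" if s: "s \<in>. R" and v: "v \<in>. (WX X)" for s v
    by (rule WX_eq[OF X v lin_comp[OF lW ract_facts(1)[OF X s]] lin_comp[OF ract_facts(1)[OF X' s] lW]])
      (simp_all add: s t fc ract_facts(2)[OF X] ract_facts(2)[OF X'] mult_R_closed)
  show "lin EE (WE X) (WE X') ?W"
  proof (rule linI)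
    interpret T: tensor_product "self_alg K" R Rop by (rule tensor_product_K[OF smash_mod k_algebra_module[OF Rop_alg]])
    note R = right_module_facts[OF WE_bimodule(1)[OF X]] and R' = right_module_facts[OF WE_bimodule(1)[OF X']]
    have aW: "additive (WE X) (WE X') ?W"
      using lin_additive[OF lW] unfolding additive_def WE_fields[OF X] WE_fields[OF X'] .
    show "?W v \<in>. (WE X')" if "v \<in>. (WE X)" for v by (rule additive_closed[OF aW that])
    show "?W (v +[WE X] w) = ?W v +[WE X'] ?W w" if "v \<in>. (WE X)" "w \<in>. (WE X)" for v w
      by (rule additive_add[OF aW that])
    fix e v assume e: "e \<in>. EE" and v: "v \<in>. (WE X)"
    show "?W (e \<cdot>[WE X] v) = e \<cdot>[WE X'] ?W v"
    proof (rule T.additive_eq[where f = "\<lambda>e. ?W (e \<cdot>[WE X] v)" and g = "\<lambda>e. e \<cdot>[WE X'] ?W v"])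
      show "additive (kt K R Rop) (WE X') (\<lambda>e. ?W (e \<cdot>[WE X] v))"
        using additive_comp[OF aW R(5)[OF v]] by (simp only: additive_def EE_simps)
      show "additive (kt K R Rop) (WE X') (\<lambda>e. e \<cdot>[WE X'] ?W v)"
        using R'(5)[OF additive_closed[OF aW v]] by (simp only: additive_def EE_simps)
      fix s t assume s: "s \<in>. R" and "t \<in>. Rop"
      then have t: "t \<in>. R" by simp
      have v': "v \<in>. (WX X)" using v unfolding WE_fields[OF X] .
      show "?W (etn s t \<cdot>[WE X] v) = etn s t \<cdot>[WE X'] ?W v"
        unfolding WE_bimodule(2)[OF X s t v'] WE_bimodule(2)[OF X' s t Wc[OF v']]
        by (simp only: ra[OF s lact_closed[OF X t v']] la[OF t v'])
    qed (use e in \<open>simp only: EE_simps\<close>)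
  qed
qed

end


section \<open>The natural isomorphism\<close>

context partial_smash
begin

context
  fixes X :: "(('k, 'h) hpar_elem, 'x) module" and M :: "((('a, 'h) tens, ('a, 'h) tens) tens, 'm) module"
  assumes X: "right_module Q X" and M: "left_module EE M"
begin

abbreviation "F1 \<equiv> tensor Q X (CM M)"
abbreviation "F2 \<equiv> tensor EE (WE X) M"
abbreviation "t1 \<equiv> tens Q X (CM M)"
abbreviation "t2 \<equiv> tens EE (WE X) M"

interpretation F1: tensor_product Q X "CM M" by (rule tensor_productI[OF X CM_facts(1)[OF M]])
interpretation F2: tensor_product EE "WE X" M by (rule tensor_productI[OF WE_bimodule(1)[OF X] M])
declare F1.tensor_fields [simp del] F2.tensor_fields [simp del] EE_simps [simp del]

lemma F1_mod: "module K F1" and F2_mod: "module K F2"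
  by (rule tensor_module[OF Q_alg X CM_facts(1)[OF M]] tensor_module[OF EE_alg WE_bimodule(1)[OF X] M])+

lemma lin_t1:
  "lin K L (VM M) f \<Longrightarrow> x \<in>. X \<Longrightarrow> lin K L F1 (\<lambda>l. t1 x (f l))"
  "lin K L (Xk X) g \<Longrightarrow> v \<in>. (VM M) \<Longrightarrow> lin K L F1 (\<lambda>l. t1 (g l) v)"
proof -
  show "lin K L F1 (\<lambda>l. t1 x (f l))" if f: "lin K L (VM M) f" and x: "x \<in>. X"
  proof (rule lin_tens_left_module[OF Q_alg X CM_facts(1)[OF M] _ x])
    show "lin K L (scal Q (CM M)) f" by (rule lin_fields[OF f]) (simp_all only: scal_simps CM_fields[OF M] CM_facts(3)[OF M])
  qed
  show "lin K L F1 (\<lambda>l. t1 (g l) v)" if "lin K L (Xk X) g" "v \<in>. (VM M)"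
    by (rule lin_tens_right_module[OF Q_alg X CM_facts(1)[OF M] that(1)]) (use that(2) CM_fields[OF M] in simp)
qed

lemma t1_middle: "z \<in>. Q \<Longrightarrow> x \<in>. X \<Longrightarrow> v \<in>. (VM M) \<Longrightarrow> t1 (xr X x z) v = t1 x (z \<cdot>[CM M] v)"
  using F1.tens_middle[of z x v] CM_fields[OF M] by simp

text \<open>The scalars act through \<open>R\<^sup>e\<close> in the same way as through \<open>B\<close>.\<close>

lemma WE_scal: "lin K L (WX X) f \<Longrightarrow> lin K L (scal EE (WE X)) f"
proof (rule lin_fields[of K L "WX X" f])
  fix c v assume c: "c \<in>. K" and v: "v \<in>. (WX X)"
  have cR: "c \<cdot>[R] \<one>[R] \<in>. R" by (rule module_smult_closed[OF smash_mod c one_R_closed])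
  have "c \<cdot>[EE] \<one>[EE] = etn (c \<cdot>[R] \<one>[R]) \<one>[R]"
    using kt_smult[OF smash_mod k_algebra_module[OF Rop_alg], of c "\<one>[R]" "\<one>[R]"] one_R_closed c by (simp add: EE_simps)
  then have "(c \<cdot>[EE] \<one>[EE]) \<cdot>[WE X] v = ract X v (c \<cdot>[R] \<one>[R])"
    using WE_bimodule(2)[OF X cR one_R_closed v] lact_one[OF X v] by simp
  also have "\<dots> = c \<cdot>[WX X] ract X v \<one>[R]" by (rule lin_smult[OF ract_lin_scalar[OF X v] c one_R_closed])
  also have "ract X v \<one>[R] = v" by (rule WX_eq[OF X v ract_facts(1)[OF X one_R_closed] lin_id])
      (simp add: ract_facts(2)[OF X] one_R_closed R_r_one)
  finally show "c \<cdot>[scal EE (WE X)] v = c \<cdot>[WX X] v" by simp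
qed (simp_all add: WE_fields[OF X])

lemma lin_t2:
  "lin K L (WX X) f \<Longrightarrow> m \<in>. M \<Longrightarrow> lin K L F2 (\<lambda>l. t2 (f l) m)"
  "lin K L (Mk M) g \<Longrightarrow> v \<in>. (WX X) \<Longrightarrow> lin K L F2 (\<lambda>l. t2 v (g l))"
   apply (rule lin_tens_right_module[OF EE_alg WE_bimodule(1)[OF X] M WE_scal]; assumption)
  apply (rule lin_tens_left_module[OF EE_alg WE_bimodule(1)[OF X] M]; simp add: WE_fields[OF X])
  done

lemma t2_middle:
  assumes "s \<in>. R" "t \<in>. R" "v \<in>. (WX X)" "m \<in>. M"
  shows "t2 v (bi M s m t) = t2 (ract X (lact X t v) s) m"
  using F2.tens_middle[OF etn_closed[OF assms(1,2)], of v m] assms WE_fields[OF X] by (simp add: WE_bimodule(2)[OF X])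

lemma F1_eq:
  assumes w: "w \<in>. F1" and f: "additive F1 P f" and g: "additive F1 P g"
    and eq: "\<And>x m. x \<in>. X \<Longrightarrow> m \<in>. M \<Longrightarrow> f (t1 x (\<tau> M m)) = g (t1 x (\<tau> M m))"
  shows "f w = g w"
proof (rule F1.additive_eq[OF w f g])
  fix x v assume x: "x \<in>. X" and v: "v \<in>. (CM M)"
  have l: "additive (VM M) F1 (t1 x)" by (rule lin_additive[OF lin_t1(1)[OF lin_id x]])
  show "f (t1 x v) = g (t1 x v)"
    by (rule VM_eq[OF M v[unfolded CM_fields[OF M]] additive_comp[OF f l] additive_comp[OF g l] eq[OF x]])
qed

text \<open>As \<open>x \<otimes> u\<close> is \<open>x \<otimes> 1\<close> multiplied by \<open>u\<close> from the right, \<open>u\<close> can be moved to the other factor.  Hence the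
  second functor is generated by the elements \<open>(x \<otimes> 1) \<otimes> m\<close>.\<close>

lemma t2_normal:
  assumes "x \<in>. X" "u \<in>. R" "m \<in>. M"
  shows "t2 (tw X x u) m = t2 (tw X x \<one>[R]) (bi M u m \<one>[R])"
  using t2_middle[of u "\<one>[R]" "tw X x \<one>[R]" m] assms
  by (simp add: one_R_closed tw_closed[OF X] lact_one[OF X] ract_facts(2)[OF X] R_l_one)

lemma F2_eq:
  assumes w: "w \<in>. F2" and f: "additive F2 P f" and g: "additive F2 P g"
    and eq: "\<And>x m. x \<in>. X \<Longrightarrow> m \<in>. M \<Longrightarrow> f (t2 (tw X x \<one>[R]) m) = g (t2 (tw X x \<one>[R]) m)"
  shows "f w = g w"
proof (rule F2.additive_eq[OF w f g])
  fix v m assume v: "v \<in>. (WE X)" and m: "m \<in>. M"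
  have l: "additive (WX X) F2 (\<lambda>v. t2 v m)" by (rule lin_additive[OF lin_t2(1)[OF lin_id m]])
  note lf = additive_comp[OF f l] and lg = additive_comp[OF g l]
  show "f (t2 v m) = g (t2 v m)"
    using v[unfolded WE_fields[OF X]]
  proof (rule WX_induct[OF X])
    show "f (t2 (tw X x u) m) = g (t2 (tw X x u) m)" if "x \<in>. X" "u \<in>. R" for x u
      unfolding t2_normal[OF that m] by (rule eq[OF that(1) bi_closed[OF M that(2) one_R_closed m]])
  qed (simp only: additive_add[OF lf] additive_add[OF lg])
qed

definition "fwd_at x = tens_lift F2 (\<lambda>a m. t2 (tw X x \<one>[R]) (bi M (\<alpha> a) m \<one>[R]))"

text \<open>The trace property: \<open>\<alpha>(a)\<close> acts on \<open>x \<otimes> 1\<close> from the left by \<open>x [S 1] \<otimes> \<alpha>(a)\<close>, and \<open>[S 1]\<close> is the unit.\<close>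

lemma fwd_at_facts:
  assumes x: "x \<in>. X"
  shows "lin K (VM M) F2 (fwd_at x)" "\<And>m. m \<in>. M \<Longrightarrow> fwd_at x (\<tau> M m) = t2 (tw X x \<one>[R]) m"
proof -
  let ?x = "tw X x \<one>[R]"
  have xc: "?x \<in>. (WX X)" by (rule tw_closed[OF X x one_R_closed])
  have l: "lin K (Mk M) F2 (\<lambda>m. t2 ?x m)" by (rule lin_t2(2)[OF lin_id xc])
  have tr: "t2 ?x (bi M (\<alpha> a) m \<one>[R]) = t2 ?x (bi M \<one>[R] m (\<alpha> a))" if a: "a \<in>. A" and m: "m \<in>. M" for a m
  proof -
    have ac: "\<alpha> a \<in>. R" by (rule sm_closed[OF a one_H_closed])
    have "lact X (\<alpha> a) ?x = tw X (xr X x (hc (S \<one>[H]))) (\<alpha> a *[R] \<one>[R])"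
      unfolding lact_sm[OF X a one_H_closed x one_R_closed]
      by (rule sw_one[OF WX_mod[OF X]]) (simp add: a x induced_rules[OF X])
    also have "\<dots> = tw X x (\<alpha> a)"
      using ac x by (simp add: antipode_one hc_one xr_one[OF X] R_r_one)
    finally have "ract X (lact X (\<alpha> a) ?x) \<one>[R] = tw X x (\<alpha> a)"
      using ac x one_R_closed by (simp add: ract_facts(2)[OF X] R_r_one)
    moreover have "ract X (lact X \<one>[R] ?x) (\<alpha> a) = tw X x (\<alpha> a)"
      using ac x one_R_closed by (simp add: lact_one[OF X xc] ract_facts(2)[OF X] R_l_one)
    ultimately show ?thesis
      using t2_middle[OF ac one_R_closed xc m] t2_middle[OF one_R_closed ac xc m] by simp
  qed
  show "lin K (VM M) F2 (fwd_at x)" "\<And>m. m \<in>. M \<Longrightarrow> fwd_at x (\<tau> M m) = t2 ?x m"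
    unfolding fwd_at_def by (rule VM_lift[OF M F2_mod l tr refl]; assumption)+
qed

lemma fwd_at_lin: "v \<in>. (VM M) \<Longrightarrow> lin K (Xk X) F2 (\<lambda>x. fwd_at x v)"
proof (erule VM_induct[OF M])
  fix m assume m: "m \<in>. M"
  have "lin K (Xk X) F2 (\<lambda>x. t2 (tw X x \<one>[R]) m)" by (rule lin_t2(1)[OF lin_tw(1)[OF X lin_id one_R_closed] m])
  then show "lin K (Xk X) F2 (\<lambda>x. fwd_at x (\<tau> M m))"
    by (rule lin_cong) (use m module_add_closed[OF Xk_mod[OF X]] module_smult_closed[OF Xk_mod[OF X]] in \<open>simp_all add: fwd_at_facts\<close>)
next
  fix v w assume v: "v \<in>. (VM M)" "w \<in>. (VM M)" "lin K (Xk X) F2 (\<lambda>x. fwd_at x v)" "lin K (Xk X) F2 (\<lambda>x. fwd_at x w)"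
  show "lin K (Xk X) F2 (\<lambda>x. fwd_at x (v +[VM M] w))" by (rule lin_cong[OF lin_sum[OF F2_mod v(3,4)]])
      (use module_add_closed[OF Xk_mod[OF X]] module_smult_closed[OF Xk_mod[OF X]] in \<open>simp_all add: lin_add[OF fwd_at_facts(1) v(1,2)]\<close>)
qed

text \<open>After collecting \<open>\<gamma>(S h\<^sub>2) \<gamma>(h\<^sub>3)\<close> the result is moved to the left factor as \<open>e\<^bsub>S h\<^sub>2\<^esub>\<close>,
  where it is absorbed by \<open>[h\<^sub>1]\<close>.\<close>

lemma conjugate_unit:
  assumes h: "h \<in>. H" and x: "x \<in>. X"
  shows "sw (WX X) h (\<lambda>y z. ract X (lact X (\<gamma> (S z)) (tw X x \<one>[R])) (\<gamma> y)) = tw X (xr X x (hc h)) \<one>[R]"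
proof -
  let ?P = "WX X"
  note [simp] = induced_rules[OF X] ract_facts(2)[OF X]
  note P = WX_mod[OF X]
  let ?F = "\<lambda>y p q. tw X (xr X x (hc p)) (\<gamma> (S q) *[R] \<gamma> y)"
  have "sw ?P h (\<lambda>y z. ract X (lact X (\<gamma> (S z)) (tw X x \<one>[R])) (\<gamma> y)) =
      sw ?P h (\<lambda>y z. sw ?P z (\<lambda>p q. ?F y p q))"
  proof (rule sw_cong[symmetric, OF P h])
    fix y z assume y: "y \<in>. H" and z: "z \<in>. H"
    have "lact X (\<gamma> (S z)) (tw X x \<one>[R]) = lgen X \<one>[A] (S z) x \<one>[R]"
      by (rule lact_sm[OF X]) (simp_all add: x z)
    also have "\<dots> = sw ?P z (\<lambda>p q. tw X (xr X x (hc (S (S p)))) (\<gamma> (S q) *[R] \<one>[R]))"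
      by (rule sw_antipode[OF P z]) (simp add: x)
    finally have 1: "lact X (\<gamma> (S z)) (tw X x \<one>[R]) = sw ?P z (\<lambda>p q. tw X (xr X x (hc (S (S p)))) (\<gamma> (S q) *[R] \<one>[R]))" .
    have "ract X (lact X (\<gamma> (S z)) (tw X x \<one>[R])) (\<gamma> y) =
        sw ?P z (\<lambda>p q. ract X (tw X (xr X x (hc (S (S p)))) (\<gamma> (S q) *[R] \<one>[R])) (\<gamma> y))"
      unfolding 1 by (rule sw_push[OF P P z _ ract_facts(1)[OF X]]) (simp_all add: x y)
    also have "\<dots> = sw ?P z (\<lambda>p q. ?F y p q)"
      by (rule sw_cong[symmetric, OF P z]) (simp_all add: x y antipode_involutive R_r_one)
    finally show "sw ?P z (\<lambda>p q. ?F y p q) = ract X (lact X (\<gamma> (S z)) (tw X x \<one>[R])) (\<gamma> y)" by simp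
  qed (simp add: x)
  also have "\<dots> = sw ?P h (\<lambda>p w. sw ?P w (\<lambda>y q. ?F y p q))" by (rule sw_swap12[OF P h]) (simp add: x)
  also have "\<dots> = sw ?P h (\<lambda>p w. sw ?P w (\<lambda>q y. ?F y p q))" by (rule sw_swap23[OF P h]) (simp add: x)
  also have "\<dots> = sw ?P h (\<lambda>p w. tw X (xr X x (hc p *[Q] ee (S w))) \<one>[R])"
  proof (rule sw_cong[symmetric, OF P h])
    fix p w assume p: "p \<in>. H" and w: "w \<in>. H"
    have "tw X (xr X x (hc p *[Q] ee (S w))) \<one>[R] = tw X (xr X x (hc p)) (\<alpha> (act (S w) \<one>[A]))"
      using x p w by (simp add: xr_xr[OF X, symmetric] tw_ee[OF X] R_r_one)
    also have "\<dots> = sw ?P w (\<lambda>q y. ?F y p q)"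
      unfolding \<gamma>S_mult_sm[OF w one_A_closed, symmetric] by (rule sw_push[OF smash_mod P w]) (simp_all add: x p)
    finally show "tw X (xr X x (hc p *[Q] ee (S w))) \<one>[R] = sw ?P w (\<lambda>q y. ?F y p q)" .
  qed (simp add: x ee_rules)
  also have "\<dots> = tw X (xr X x (sw Q h (\<lambda>p w. hc p *[Q] ee (S w)))) \<one>[R]"
    by (rule sw_push[symmetric, OF Q_mod P h]) (simp_all add: x ee_rules)
  finally show ?thesis unfolding hc_mult_ee_antipode[OF h] .
qed

lemma fwd_at_hc:
  assumes h: "h \<in>. H" and x: "x \<in>. X" and v: "v \<in>. (VM M)"
  shows "fwd_at (xr X x (hc h)) v = fwd_at x (hc h \<cdot>[CM M] v)"
proof (rule VM_eq[OF M v, where f = "fwd_at (xr X x (hc h))" and g = "\<lambda>v. fwd_at x (hc h \<cdot>[CM M] v)"])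
  note xh = xr_closed[OF X x hc_closed[OF h]] and xc = tw_closed[OF X x one_R_closed]
  show "additive (VM M) F2 (fwd_at (xr X x (hc h)))" by (rule lin_additive[OF fwd_at_facts(1)[OF xh]])
  show "additive (VM M) F2 (\<lambda>v. fwd_at x (hc h \<cdot>[CM M] v))"
    using left_module_facts(4)[OF CM_facts(1)[OF M] hc_closed[OF h]]
    by (intro additive_comp[OF lin_additive[OF fwd_at_facts(1)[OF x]]]) (simp only: additive_def CM_fields[OF M])
  fix m assume m: "m \<in>. M"
  have "fwd_at x (hc h \<cdot>[CM M] \<tau> M m) = sw F2 h (\<lambda>y z. fwd_at x (\<tau> M (bi M (\<gamma> y) m (\<gamma> (S z)))))"
    unfolding CM_facts(2)[OF M h m]
    by (rule sw_push[OF VM_mod[OF M] F2_mod h _ fwd_at_facts(1)[OF x]]) (simp add: m coinv_rules[OF M])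
  also have "\<dots> = sw F2 h (\<lambda>y z. t2 (ract X (lact X (\<gamma> (S z)) (tw X x \<one>[R])) (\<gamma> y)) m)"
  proof (rule sw_cong[OF F2_mod h])
    have "bilin K H H (VM M) (\<lambda>y z. \<tau> M (bi M (\<gamma> y) m (\<gamma> (S z))))" using m by (simp add: coinv_rules[OF M])
    then show "bilin K H H F2 (\<lambda>y z. fwd_at x (\<tau> M (bi M (\<gamma> y) m (\<gamma> (S z)))))" by (rule bilin_comp[OF _ fwd_at_facts(1)[OF x]])
    fix y z assume yz: "y \<in>. H" "z \<in>. H"
    then show "fwd_at x (\<tau> M (bi M (\<gamma> y) m (\<gamma> (S z)))) = t2 (ract X (lact X (\<gamma> (S z)) (tw X x \<one>[R])) (\<gamma> y)) m"
      using t2_middle[OF _ _ xc m, of "\<gamma> y" "\<gamma> (S z)"] x m by (simp add: fwd_at_facts(2) coinv_rules[OF M])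
  qed
  also have "\<dots> = t2 (tw X (xr X x (hc h)) \<one>[R]) m"
    unfolding conjugate_unit[OF h x, symmetric]
  proof (rule sw_push[symmetric, OF WX_mod[OF X] F2_mod h _ lin_t2(1)[OF lin_id m]])
    show "bilin K H H (WX X) (\<lambda>y z. ract X (lact X (\<gamma> (S z)) (tw X x \<one>[R])) (\<gamma> y))"
    proof (rule bilinI)
      fix y assume y: "y \<in>. H"
      have l: "lin K H R (\<lambda>z. \<gamma> (S z))" "\<gamma> y \<in>. R" using y by (simp_all add: smash_rules)
      show "lin K H (WX X) (\<lambda>z. ract X (lact X (\<gamma> (S z)) (tw X x \<one>[R])) (\<gamma> y))"
        by (rule lin_comp[OF ract_facts(1)[OF X l(2)] lin_comp[OF lact_lin_scalar[OF X xc] l(1)]])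
    next
      fix z assume z: "z \<in>. H"
      have l: "lin K H R (\<lambda>y. \<gamma> y)" "\<gamma> (S z) \<in>. R" using z by (simp_all add: smash_rules)
      show "lin K H (WX X) (\<lambda>y. ract X (lact X (\<gamma> (S z)) (tw X x \<one>[R])) (\<gamma> y))"
        by (rule lin_comp[OF ract_lin_scalar[OF X lact_closed[OF X l(2) xc]] l(1)])
    qed
  qed
  finally show "fwd_at (xr X x (hc h)) (\<tau> M m) = fwd_at x (hc h \<cdot>[CM M] \<tau> M m)"
    by (simp add: fwd_at_facts(2)[OF xh m])
qed

definition "fwd = tens_lift F2 fwd_at"

lemma fwd_facts:
  "lin K F1 F2 fwd" "\<And>x m. x \<in>. X \<Longrightarrow> m \<in>. M \<Longrightarrow> fwd (t1 x (\<tau> M m)) = t2 (tw X x \<one>[R]) m"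
proof -
  note C = left_module_facts[OF CM_facts(1)[OF M]] and FX = right_module_facts[OF X]
  have c: "fwd_at (xr X x (c \<cdot>[Q] \<one>[Q])) v = c \<cdot>[F2] fwd_at x v" if "c \<in>. K" "x \<in>. X" "v \<in>. (VM M)" for c x v
    using lin_smult[OF fwd_at_lin[OF that(3)] that(1), of x] that(2) by simp
  have bal: "fwd_at (xr X x z) v = fwd_at x (z \<cdot>[CM M] v)" if "z \<in>. Q" and v: "v \<in>. (VM M)" and "x \<in>. X" for z v x
    using that(1,3)
  proof (induction arbitrary: x rule: hpar_induct)
    case (scalar d)
    then show ?case using c[OF scalar(1,2) v] lin_smult[OF fwd_at_facts(1)[OF scalar(2)] scalar(1) v] v by (simp add: CM_facts(3)[OF M])
  next
    case (hc h z)
    have zv: "z \<cdot>[CM M] v \<in>. (VM M)" using C(3)[OF hc(2), of v] v by (simp only: CM_fields[OF M])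
    show ?case
      using hc(3)[OF xr_closed[OF X hc(4) hc_closed[OF hc(1)]]] fwd_at_hc[OF hc(1,4) zv] hc(1,2,4) v
      by (simp only: xr_xr[OF X hc(4) hc_closed[OF hc(1)] hc(2), symmetric]  C(6)[OF hc_closed[OF hc(1)] hc(2), of v] CM_fields[OF M])
  next
    case (add y z)
    have zv: "z \<cdot>[CM M] v \<in>. (VM M)" "y \<cdot>[CM M] v \<in>. (VM M)"
      using C(3)[OF add(1), of v] C(3)[OF add(2), of v] v by (simp_all only: CM_fields[OF M])
    show ?case
      using add.IH[OF add.prems] lin_add[OF fwd_at_lin[OF v], of "xr X x y" "xr X x z"] xr_closed[OF X add.prems] add(1,2)
        lin_add[OF fwd_at_facts(1)[OF add.prems] zv(2,1)] additive_add[OF FX(5)[OF add.prems] add(1,2)]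
        additive_add[OF C(5) add(1,2), of v] v by (simp add: CM_fields[OF M])
  qed
  have B: "balanced Q X (CM M) F2 fwd_at"
  proof (rule balancedI)
    show "additive (CM M) F2 (fwd_at x)" if "x \<in>. X" for x
      using lin_additive[OF fwd_at_facts(1)[OF that]] by (simp only: additive_def CM_fields[OF M])
    show "additive X F2 (\<lambda>x. fwd_at x v)" if "v \<in>. (CM M)" for v
      using lin_additive[OF fwd_at_lin[OF that[unfolded CM_fields[OF M]]]] by (simp only: additive_def scal_simps)
  qed (simp add: bal CM_fields[OF M])
  show "lin K F1 F2 fwd"
    unfolding fwd_def by (rule tens_lift_lin[OF Q_alg X CM_facts(1)[OF M] F2_mod B]) (simp add: c CM_fields[OF M])
  show "fwd (t1 x (\<tau> M m)) = t2 (tw X x \<one>[R]) m" if "x \<in>. X" "m \<in>. M" for x m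
    using F1.tens_lift_tens[OF F2.tensor_group B that(1), of "\<tau> M m"] tn_closed[OF M one_A_closed that(2)]
    by (simp add: fwd_def fwd_at_facts(2)[OF that] CM_fields[OF M])
qed

text \<open>The action of \<open>[S h\<^sub>1]\<close> multiplies by some \<open>\<gamma>(S h\<^sub>2)\<close> on the left and by \<open>\<gamma>(h\<^sub>1)\<close> on the right.  The left factor
  combines with \<open>a # h\<^sub>3\<close> to \<open>\<alpha>(S h\<^sub>2 \<cdot> a)\<close>, which the trace property takes to the right; there \<open>\<gamma>(h\<^sub>1) \<alpha>(S h\<^sub>2 \<cdot> a)\<close>
  is \<open>a # h\<close>.\<close>

lemma hcS_\<tau>:
  assumes a: "a \<in>. A" and h: "h \<in>. H" and n: "n \<in>. M"
  shows "sw (VM M) h (\<lambda>y z. hc (S y) \<cdot>[CM M] \<tau> M (bi M (sm a z) n \<one>[R])) = \<tau> M (bi M \<one>[R] n (sm a h))"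
proof -
  let ?P = "VM M"
  note [simp] = coinv_rules[OF M] R_l_one
  note P = VM_mod[OF M]
  let ?F = "\<lambda>q p z. \<tau> M (bi M (\<gamma> (S p) *[R] sm a z) n (\<gamma> q))"
  have eq: "hc (S y) \<cdot>[CM M] \<tau> M (bi M (sm a z) n \<one>[R]) = sw ?P y (\<lambda>q p. ?F q p z)"
    if y: "y \<in>. H" and z: "z \<in>. H" for y z
  proof -
    have b: "bi M (sm a z) n \<one>[R] \<in>. M" using a z n by simp
    have "hc (S y) \<cdot>[CM M] \<tau> M (bi M (sm a z) n \<one>[R]) = conj_sum M (S y) (bi M (sm a z) n \<one>[R])"
      by (rule CM_facts(2)[OF M antipode_closed[OF y] b])
    also have "\<dots> = sw ?P y (\<lambda>p q. \<tau> M (bi M (\<gamma> (S p)) (bi M (sm a z) n \<one>[R]) (\<gamma> (S (S q)))))"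
      by (rule sw_antipode[OF P y]) (simp add: a z n)
    also have "\<dots> = sw ?P y (\<lambda>p q. ?F q p z)"
      by (rule sw_cong[symmetric, OF P y]) (simp_all add: a z n antipode_involutive)
    also have "\<dots> = sw ?P y (\<lambda>q p. ?F q p z)" by (rule sw_comm[OF P y]) (simp add: a z n)
    finally show ?thesis .
  qed
  have "sw ?P h (\<lambda>y z. hc (S y) \<cdot>[CM M] \<tau> M (bi M (sm a z) n \<one>[R])) =
      sw ?P h (\<lambda>y z. sw ?P y (\<lambda>q p. ?F q p z))" by (rule sw_cong[symmetric, OF P h]) (simp_all add: a n eq)
  also have "\<dots> = sw ?P h (\<lambda>q w. sw ?P w (\<lambda>p z. ?F q p z))" by (rule sw_coassoc[OF P h]) (simp add: a n)
  also have "\<dots> = sw ?P h (\<lambda>q w. \<tau> M (bi M \<one>[R] n (\<gamma> q *[R] \<alpha> (act (S w) a))))"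
  proof (rule sw_cong[symmetric, OF P h])
    fix q w assume q: "q \<in>. H" and w: "w \<in>. H"
    have "\<tau> M (bi M (\<alpha> (act (S w) a)) (bi M \<one>[R] n (\<gamma> q)) \<one>[R]) = \<tau> M (bi M \<one>[R] (bi M \<one>[R] n (\<gamma> q)) (\<alpha> (act (S w) a)))"
      by (rule \<tau>_trace[OF M]) (simp_all add: a q w n)
    then have "\<tau> M (bi M \<one>[R] n (\<gamma> q *[R] \<alpha> (act (S w) a))) = \<tau> M (bi M (\<alpha> (act (S w) a)) n (\<gamma> q))"
      using a q w n by (simp add: R_r_one)
    also have "\<dots> = sw ?P w (\<lambda>p z. ?F q p z)"
      unfolding \<gamma>S_mult_sm[OF w a, symmetric] by (rule sw_push[OF smash_mod P w]) (simp_all add: a q n)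
    finally show "\<tau> M (bi M \<one>[R] n (\<gamma> q *[R] \<alpha> (act (S w) a))) = sw ?P w (\<lambda>p z. ?F q p z)" .
  qed (simp add: a n)
  also have "\<dots> = sw ?P h (\<lambda>w q. \<tau> M (bi M \<one>[R] n (\<gamma> q *[R] \<alpha> (act (S w) a))))"
    by (rule sw_comm[OF P h]) (simp add: a n)
  also have "\<dots> = \<tau> M (bi M \<one>[R] n (sm a h))"
    unfolding \<gamma>_mult_\<alpha>S[OF h a, symmetric] by (rule sw_push[symmetric, OF smash_mod P h]) (simp_all add: a n)
  finally show ?thesis .
qed

definition "bwd_at v m = tens_lift F1 (\<lambda>x u. t1 x (\<tau> M (bi M u m \<one>[R]))) v"

lemma bwd_at_facts:
  assumes m: "m \<in>. M"
  shows "lin K (WX X) F1 (\<lambda>v. bwd_at v m)"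
    "\<And>x u. x \<in>. X \<Longrightarrow> u \<in>. R \<Longrightarrow> bwd_at (tw X x u) m = t1 x (\<tau> M (bi M u m \<one>[R]))"
proof -
  note V = coinv_rules[OF M]
  have l1: "lin K R F1 (\<lambda>u. t1 x (\<tau> M (bi M u m \<one>[R])))" if "x \<in>. X" for x
    by (rule lin_t1(1)[OF _ that]) (simp add: m V)
  have l2: "lin K (Xk X) F1 (\<lambda>x. t1 x (\<tau> M (bi M u m \<one>[R])))" if "u \<in>. R" for u
    by (rule lin_t1(2)[OF lin_id]) (simp add: m that V)
  have e: "t1 (xr X x (ee k)) (\<tau> M (bi M u m \<one>[R])) = t1 x (\<tau> M (bi M (\<alpha> (act k \<one>[A]) *[R] u) m \<one>[R]))"
    if "k \<in>. H" "x \<in>. X" "u \<in>. R" for k x u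
    using that m t1_middle[OF ee_closed[OF that(1)] that(2), of "\<tau> M (bi M u m \<one>[R])"]
    by (simp add: V CM_facts(4)[OF M] R_l_one)
  show "lin K (WX X) F1 (\<lambda>v. bwd_at v m)"
    unfolding bwd_at_def by (rule WX_lift(1)[OF X F1_mod l1 l2 e])
  show "bwd_at (tw X x u) m = t1 x (\<tau> M (bi M u m \<one>[R]))" if "x \<in>. X" "u \<in>. R" for x u
    unfolding bwd_at_def by (rule WX_lift(2)[OF X F1_mod l1 l2 e]) (simp_all add: that)
qed

lemma bwd_at_lin: "v \<in>. (WX X) \<Longrightarrow> lin K (Mk M) F1 (bwd_at v)"
proof (erule WX_induct[OF X])
  fix x u assume xu: "x \<in>. X" "u \<in>. R"
  have "lin K (Mk M) F1 (\<lambda>m. t1 x (\<tau> M (bi M u m \<one>[R])))"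
    by (rule lin_t1(1)[OF _ xu(1)]) (simp add: xu coinv_rules[OF M])
  then show "lin K (Mk M) F1 (bwd_at (tw X x u))"
    by (rule lin_cong) (use xu module_add_closed[OF Mk_mod[OF M]] module_smult_closed[OF Mk_mod[OF M]] in \<open>simp_all add: bwd_at_facts\<close>)
next
  fix v w assume v: "v \<in>. (WX X)" "w \<in>. (WX X)" "lin K (Mk M) F1 (bwd_at v)" "lin K (Mk M) F1 (bwd_at w)"
  show "lin K (Mk M) F1 (bwd_at (v +[WX X] w))" by (rule lin_cong[OF lin_sum[OF F1_mod v(3,4)]])
      (use module_add_closed[OF Mk_mod[OF M]] module_smult_closed[OF Mk_mod[OF M]] in \<open>simp_all add: lin_add[OF bwd_at_facts(1) v(1,2)]\<close>)
qed

text \<open>Right multiplication by \<open>s\<close> is built into the formula; left multiplication by \<open>t\<close> is \<open>hcS_\<tau>\<close>.\<close>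

lemma bwd_at_middle:
  assumes s: "s \<in>. R" and t: "t \<in>. R" and v: "v \<in>. (WX X)" and m: "m \<in>. M"
  shows "bwd_at (ract X (lact X t v) s) m = bwd_at v (bi M s m t)"
proof -
  note V = coinv_rules[OF M] and W = induced_rules[OF X]
  have l1: "lin K R F1 (\<lambda>t. bwd_at (ract X (lact X t v) s) m)" if "v \<in>. (WX X)" for v
    by (rule lin_comp[OF bwd_at_facts(1)[OF m] lin_comp[OF ract_facts(1)[OF X s] lact_lin_scalar[OF X that]]])
  have l2: "lin K R F1 (\<lambda>t. bwd_at v (bi M s m t))" if "v \<in>. (WX X)" for v
    by (rule lin_comp[OF bwd_at_lin[OF that] lin_bi(2)[OF M lin_id s m]])
  show ?thesis
  proof (rule smash_eq[OF t l1[OF v] l2[OF v]])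
    fix a h assume a: "a \<in>. A" and h: "h \<in>. H"
    note ah = sm_closed[OF a h]
    show "bwd_at (ract X (lact X (sm a h) v) s) m = bwd_at v (bi M s m (sm a h))"
    proof (rule WX_eq[OF X v _ bwd_at_facts(1)[OF bi_closed[OF M s ah m]]])
      show "lin K (WX X) F1 (\<lambda>v. bwd_at (ract X (lact X (sm a h) v) s) m)"
        by (rule lin_comp[OF bwd_at_facts(1)[OF m] lin_comp[OF ract_facts(1)[OF X s] lact_lin_vector[OF X ah]]])
      fix x u assume x: "x \<in>. X" and u: "u \<in>. R"
      let ?n = "bi M (u *[R] s) m \<one>[R]"
      have n: "?n \<in>. M" using s u m by (simp add: V)
      let ?L = "\<lambda>v. bwd_at (ract X v s) m"
      have L: "lin K (WX X) F1 ?L" by (rule lin_comp[OF bwd_at_facts(1)[OF m] ract_facts(1)[OF X s]])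
      have b: "bilin K H H (WX X) (\<lambda>y z. tw X (xr X x (hc (S y))) (sm a z *[R] u))" using a u x by (simp add: W)
      have "bwd_at (ract X (lact X (sm a h) (tw X x u)) s) m = ?L (lgen X a h x u)" by (simp add: lact_sm[OF X a h x u])
      also have "\<dots> = sw F1 h (\<lambda>y z. ?L (tw X (xr X x (hc (S y))) (sm a z *[R] u)))"
        by (rule sw_push[OF WX_mod[OF X] F1_mod h b L])
      also have "\<dots> = sw F1 h (\<lambda>y z. t1 x (hc (S y) \<cdot>[CM M] \<tau> M (bi M (sm a z) ?n \<one>[R])))"
        by (rule sw_cong[OF F1_mod h bilin_comp[OF b L]])
          (simp add: a u x s m W V ract_facts(2)[OF X s] bwd_at_facts(2)[OF m] t1_middle
             R_assoc R_l_one)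
      also have "\<dots> = t1 x (sw (VM M) h (\<lambda>y z. hc (S y) \<cdot>[CM M] \<tau> M (bi M (sm a z) ?n \<one>[R])))"
      proof (rule sw_push[symmetric, OF VM_mod[OF M] F1_mod h _ lin_t1(1)[OF lin_id x]])
        have sk: "lin K (VM M) (scal Q (CM M)) (\<lambda>v. v)" "lin K (scal Q (CM M)) (VM M) (\<lambda>v. v)"
          by (rule lin_fields[OF lin_id[of K "VM M"]]; simp only: scal_simps CM_fields[OF M] CM_facts(3)[OF M])+
        show "bilin K H H (VM M) (\<lambda>y z. hc (S y) \<cdot>[CM M] \<tau> M (bi M (sm a z) ?n \<one>[R]))"
        proof (rule bilinI)
          fix y assume y: "y \<in>. H"
          have "lin K H (VM M) (\<lambda>z. \<tau> M (bi M (sm a z) ?n \<one>[R]))" using a n by (simp add: V)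
          then show "lin K H (VM M) (\<lambda>z. hc (S y) \<cdot>[CM M] \<tau> M (bi M (sm a z) ?n \<one>[R]))"
            by (rule lin_comp[OF sk(2) lin_restrict_vectors[OF Q_alg CM_facts(1)[OF M] hc_closed[OF antipode_closed[OF y]] lin_comp[OF sk(1)]]])
        next
          fix z assume z: "z \<in>. H"
          have zc: "\<tau> M (bi M (sm a z) ?n \<one>[R]) \<in>. (CM M)" unfolding CM_fields[OF M] using a n z by (simp add: V)
          have "lin K H Q (\<lambda>y. hc (S y))" by (simp add: hpar_rules)
          then show "lin K H (VM M) (\<lambda>y. hc (S y) \<cdot>[CM M] \<tau> M (bi M (sm a z) ?n \<one>[R]))"
            by (rule lin_comp[OF sk(2) lin_restrict_scalars[OF Q_alg CM_facts(1)[OF M] zc]])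
        qed
      qed
      also have "\<dots> = bwd_at (tw X x u) (bi M s m (sm a h))"
        unfolding hcS_\<tau>[OF a h n]
        using x u s m ah by (simp add: V bwd_at_facts(2) R_l_one R_r_one)
      finally show "bwd_at (ract X (lact X (sm a h) (tw X x u)) s) m = bwd_at (tw X x u) (bi M s m (sm a h))" .
    qed
  qed
qed

definition "bwd = tens_lift F1 bwd_at"

lemma bwd_facts:
  "lin K F2 F1 bwd" "\<And>x m. x \<in>. X \<Longrightarrow> m \<in>. M \<Longrightarrow> bwd (t2 (tw X x \<one>[R]) m) = t1 x (\<tau> M m)"
proof -
  note W = right_module_facts[OF WE_bimodule(1)[OF X]] and FM = left_module_facts[OF M]
  interpret T: tensor_product "self_alg K" R Rop by (rule tensor_product_K[OF smash_mod k_algebra_module[OF Rop_alg]])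
  have aW: "additive (WE X) F1 (\<lambda>v. bwd_at v m)" if "m \<in>. M" for m
    using lin_additive[OF bwd_at_facts(1)[OF that]] by (simp only: additive_def WE_fields[OF X])
  have aM: "additive M F1 (bwd_at v)" if "v \<in>. (WE X)" for v
    using lin_additive[OF bwd_at_lin[OF that[unfolded WE_fields[OF X]]]] by (simp only: additive_def scal_simps)
  have bal: "bwd_at (e \<cdot>[WE X] v) m = bwd_at v (e \<cdot>[M] m)"
    if e: "e \<in>. EE" and v: "v \<in>. (WE X)" and m: "m \<in>. M" for e v m
  proof (rule T.additive_eq[where f = "\<lambda>e. bwd_at (e \<cdot>[WE X] v) m" and g = "\<lambda>e. bwd_at v (e \<cdot>[M] m)"])
    show "additive (kt K R Rop) F1 (\<lambda>e. bwd_at (e \<cdot>[WE X] v) m)"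
      using additive_comp[OF aW[OF m] W(5)[OF v]] by (simp only: additive_def EE_simps)
    show "additive (kt K R Rop) F1 (\<lambda>e. bwd_at v (e \<cdot>[M] m))"
      using additive_comp[OF aM[OF v] FM(5)[OF m]] by (simp only: additive_def EE_simps)
    fix s t assume s: "s \<in>. R" and "t \<in>. Rop"
    then have t: "t \<in>. R" by simp
    note v' = v[unfolded WE_fields[OF X]]
    show "bwd_at (etn s t \<cdot>[WE X] v) m = bwd_at v (bi M s m t)"
      unfolding WE_bimodule(2)[OF X s t v'] by (rule bwd_at_middle[OF s t v' m])
  qed (use e in \<open>simp only: EE_simps\<close>)
  have B: "balanced EE (WE X) M F1 bwd_at" by (rule balancedI[OF aM aW bal])
  show "lin K F2 F1 bwd"
    unfolding bwd_def
  proof (rule tens_lift_lin[OF EE_alg WE_bimodule(1)[OF X] M F1_mod B])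
    fix c v m assume c: "c \<in>. K" and v: "v \<in>. (WE X)" and m: "m \<in>. M"
    have c1: "c \<cdot>[EE] \<one>[EE] \<in>. EE" by (rule module_smult_closed[OF EE_mod c k_algebra_one_closed[OF EE_alg]])
    show "bwd_at ((c \<cdot>[EE] \<one>[EE]) \<cdot>[WE X] v) m = c \<cdot>[F1] bwd_at v m"
      using lin_smult[OF bwd_at_lin[OF v[unfolded WE_fields[OF X]]] c, of m] m by (simp add: bal[OF c1 v m])
  qed
  show "bwd (t2 (tw X x \<one>[R]) m) = t1 x (\<tau> M m)" if x: "x \<in>. X" and m: "m \<in>. M" for x m
    using F2.tens_lift_tens[OF F1.tensor_group B, of "tw X x \<one>[R]" m] tw_closed[OF X x one_R_closed] m
    by (simp add: bwd_def bwd_at_facts(2)[OF m x one_R_closed] WE_fields[OF X] bi_one[OF M m] del: tensor_product.tensor_fields)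
qed

lemma fwd_bij: "bij_betw fwd (carrier F1) (carrier F2)"
proof (rule bij_betwI[where g = bwd])
  note f = lin_additive[OF fwd_facts(1)] and b = lin_additive[OF bwd_facts(1)]
  have i: "additive P P (\<lambda>x. x)" for P :: "('k, 'p) module" by (simp add: additive_def)
  show "fwd \<in> carrier F1 \<rightarrow> carrier F2" "bwd \<in> carrier F2 \<rightarrow> carrier F1"
    using additive_closed[OF f] additive_closed[OF b] by (simp_all add: Pi_iff)
  show "bwd (fwd w) = w" if "w \<in>. F1" for w
    by (rule F1_eq[OF that additive_comp[OF b f] i]) (simp add: fwd_facts(2) bwd_facts(2))
  show "fwd (bwd w) = w" if "w \<in>. F2" for w
    by (rule F2_eq[OF that additive_comp[OF f b] i]) (simp add: fwd_facts(2) bwd_facts(2))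
qed

end

lemma functor1_map_facts:
  assumes "right_module Q X" "right_module Q X'" "left_module EE M" "left_module EE M'" "lin Q X X' f" "lin EE M M' g"
  shows "lin K (F1 X M) (F1 X' M') (functor1_map K H A act X' M' f g)"
    "\<And>x m. x \<in>. X \<Longrightarrow> m \<in>. M \<Longrightarrow> functor1_map K H A act X' M' f g (t1 X M x (\<tau> M m)) = t1 X' M' (f x) (\<tau> M' (g m))"
proof -
  note T = tensor_map_facts[OF Q_alg assms(1,2) CM_facts(1)[OF assms(3)] CM_facts(1)[OF assms(4)] assms(5) CM_map(1)[OF assms(3,4,6)], folded functor1_map_def]
  show "lin K (F1 X M) (F1 X' M') (functor1_map K H A act X' M' f g)" by (rule T(1))
  show "functor1_map K H A act X' M' f g (t1 X M x (\<tau> M m)) = t1 X' M' (f x) (\<tau> M' (g m))" if "x \<in>. X" "m \<in>. M" for x m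
    using T(2)[OF that(1), of "\<tau> M m"] tn_closed[OF assms(3) one_A_closed that(2)]
    by (simp only: CM_fields[OF assms(3)] CM_map(2)[OF assms(3,4,6) that(2)])
qed

lemma functor2_map_facts:
  assumes "right_module Q X" "right_module Q X'" "left_module EE M" "left_module EE M'" "lin Q X X' f" "lin EE M M' g"
  shows "lin K (F2 X M) (F2 X' M') (functor2_map K H A act X' M' f g)"
    "\<And>x m. x \<in>. X \<Longrightarrow> m \<in>. M \<Longrightarrow>
      functor2_map K H A act X' M' f g (t2 X M (tw X x \<one>[R]) m) = t2 X' M' (tw X' (f x) \<one>[R]) (g m)"
proof -
  note T = tensor_map_facts[OF EE_alg WE_bimodule(1)[OF assms(1)] WE_bimodule(1)[OF assms(2)] assms(3,4) WE_map(1)[OF assms(1,2,5)] assms(6), folded functor2_map_def]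
  show "lin K (F2 X M) (F2 X' M') (functor2_map K H A act X' M' f g)" by (rule T(1))
  show "functor2_map K H A act X' M' f g (t2 X M (tw X x \<one>[R]) m) = t2 X' M' (tw X' (f x) \<one>[R]) (g m)"
    if "x \<in>. X" "m \<in>. M" for x m
    using T(2)[OF _ that(2), of "tw X x \<one>[R]"] tw_closed[OF assms(1) that(1) one_R_closed]
    by (simp only: WE_fields[OF assms(1)] WE_map(2)[OF assms(1,2,5) that(1) one_R_closed])
qed

lemma functor1_bifunctor: "bifunctor K Q EE (functor1 K H A act :: (_, 'x) module \<Rightarrow> (_, 'm) module \<Rightarrow> _) (functor1_map K H A act)"
proof (rule bifunctor.intro, unfold functor1_def mod_hom_iff_lin)
  fix X :: "(_, 'x) module" and M :: "(_, 'm) module"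
  assume X: "right_module Q X" and M: "left_module EE M"
  show "module K (F1 X M)" by (rule F1_mod[OF X M])
  have i: "lin Q X X id" "lin EE M M id" by (simp_all add: id_def lin_id)
  fix t :: "(_, _) tens" assume "t \<in>. (F1 X M)"
  then show "functor1_map K H A act X M id id t = t"
    by (rule F1_eq[OF X M _ lin_additive[OF functor1_map_facts(1)[OF X X M M i]] additive_id])
      (simp add: functor1_map_facts(2)[OF X X M M i])
next
  fix X X' :: "(_, 'x) module" and M M' :: "(_, 'm) module" and f g
  assume a: "right_module Q X" "right_module Q X'" "left_module EE M" "left_module EE M'" "lin Q X X' f" "lin EE M M' g"
  show "lin K (F1 X M) (F1 X' M') (functor1_map K H A act X' M' f g)" by (rule functor1_map_facts(1)[OF a])
next
  fix X X' X'' :: "(_, 'x) module" and M M' M'' :: "(_, 'm) module" and f f' g g' t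
  assume a: "right_module Q X" "right_module Q X'" "right_module Q X''" "left_module EE M" "left_module EE M'" "left_module EE M''"
    "lin Q X X' f" "lin Q X' X'' f'" "lin EE M M' g" "lin EE M' M'' g'" and t: "t \<in>. (F1 X M)"
  have c: "lin Q X X'' (f' \<circ> f)" "lin EE M M'' (g' \<circ> g)"
    using lin_comp[OF a(8,7)] lin_comp[OF a(10,9)] by (simp_all add: comp_def)
  note 1 = functor1_map_facts[OF a(1,2,4,5,7,9)] and 2 = functor1_map_facts[OF a(2,3,5,6,8,10)] and 3 = functor1_map_facts[OF a(1,3,4,6) c]
  show "functor1_map K H A act X'' M'' (f' \<circ> f) (g' \<circ> g) t =
      functor1_map K H A act X'' M'' f' g' (functor1_map K H A act X' M' f g t)"
    by (rule F1_eq[OF a(1,4) t lin_additive[OF 3(1)] additive_comp[OF lin_additive[OF 2(1)] lin_additive[OF 1(1)]]])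
      (simp add: 1 2 3 lin_closed[OF a(7)] lin_closed[OF a(9)])
qed

lemma functor2_bifunctor: "bifunctor K Q EE (functor2 K H A act :: (_, 'x) module \<Rightarrow> (_, 'm) module \<Rightarrow> _) (functor2_map K H A act)"
proof (rule bifunctor.intro, unfold functor2_def mod_hom_iff_lin)
  fix X :: "(_, 'x) module" and M :: "(_, 'm) module"
  assume X: "right_module Q X" and M: "left_module EE M"
  show "module K (F2 X M)" by (rule F2_mod[OF X M])
  have i: "lin Q X X id" "lin EE M M id" by (simp_all add: id_def lin_id)
  fix t :: "(_, _) tens" assume "t \<in>. (F2 X M)"
  then show "functor2_map K H A act X M id id t = t"
    by (rule F2_eq[OF X M _ lin_additive[OF functor2_map_facts(1)[OF X X M M i]] additive_id])
      (simp add: functor2_map_facts(2)[OF X X M M i])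
next
  fix X X' :: "(_, 'x) module" and M M' :: "(_, 'm) module" and f g
  assume a: "right_module Q X" "right_module Q X'" "left_module EE M" "left_module EE M'" "lin Q X X' f" "lin EE M M' g"
  show "lin K (F2 X M) (F2 X' M') (functor2_map K H A act X' M' f g)" by (rule functor2_map_facts(1)[OF a])
next
  fix X X' X'' :: "(_, 'x) module" and M M' M'' :: "(_, 'm) module" and f f' g g' t
  assume a: "right_module Q X" "right_module Q X'" "right_module Q X''" "left_module EE M" "left_module EE M'" "left_module EE M''"
    "lin Q X X' f" "lin Q X' X'' f'" "lin EE M M' g" "lin EE M' M'' g'" and t: "t \<in>. (F2 X M)"
  have c: "lin Q X X'' (f' \<circ> f)" "lin EE M M'' (g' \<circ> g)"
    using lin_comp[OF a(8,7)] lin_comp[OF a(10,9)] by (simp_all add: comp_def)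
  note 1 = functor2_map_facts[OF a(1,2,4,5,7,9)] and 2 = functor2_map_facts[OF a(2,3,5,6,8,10)] and 3 = functor2_map_facts[OF a(1,3,4,6) c]
  show "functor2_map K H A act X'' M'' (f' \<circ> f) (g' \<circ> g) t =
      functor2_map K H A act X'' M'' f' g' (functor2_map K H A act X' M' f g t)"
    by (rule F2_eq[OF a(1,4) t lin_additive[OF 3(1)] additive_comp[OF lin_additive[OF 2(1)] lin_additive[OF 1(1)]]])
      (simp add: 1 2 3 lin_closed[OF a(7)] lin_closed[OF a(9)])
qed

lemma functors_naturally_isomorphic:
  "naturally_isomorphic K Q EE (functor1 K H A act :: (_, 'x) module \<Rightarrow> (_, 'm) module \<Rightarrow> _) (functor1_map K H A act) (functor2 K H A act) (functor2_map K H A act)"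
  unfolding naturally_isomorphic_def functor1_def functor2_def mod_hom_iff_lin
proof (intro exI[of _ fwd] conjI allI impI ballI; elim conjE)
  fix X :: "(_, 'x) module" and M :: "(_, 'm) module"
  assume X: "right_module Q X" and M: "left_module EE M"
  show "lin K (F1 X M) (F2 X M) (fwd X M)" by (rule fwd_facts(1)[OF X M])
  show "bij_betw (fwd X M) (carrier (F1 X M)) (carrier (F2 X M))" by (rule fwd_bij[OF X M])
next
  fix X X' :: "(_, 'x) module" and M M' :: "(_, 'm) module" and f g t
  assume t: "t \<in>. (F1 X M)" and a: "right_module Q X" "right_module Q X'" "left_module EE M" "left_module EE M'" "lin Q X X' f" "lin EE M M' g"
  note 1 = functor1_map_facts[OF a] and 2 = functor2_map_facts[OF a] and f = fwd_facts[OF a(1,3)] and f' = fwd_facts[OF a(2,4)]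
  show "fwd X' M' (functor1_map K H A act X' M' f g t) = functor2_map K H A act X' M' f g (fwd X M t)"
    by (rule F1_eq[OF a(1,3) t additive_comp[OF lin_additive[OF f'(1)] lin_additive[OF 1(1)]] additive_comp[OF lin_additive[OF 2(1)] lin_additive[OF f(1)]]])
      (simp add: 1 2 f f' lin_closed[OF a(5)] lin_closed[OF a(6)])
qed

end

theorem proposition3p17:
  fixes K :: "'k ring" and H :: "('k, 'h) hopf" and A :: "('k, 'a) module"
    and act :: "'h \<Rightarrow> 'a \<Rightarrow> 'a"
  assumes "cocommutative_hopf_algebra K H"
    and "symmetric_partial_action K H A act"
  shows "bifunctor K (hpar K H) (smash_env K H A act)
        (functor1 K H A act :: (_, 'x) module \<Rightarrow> (_, 'm) module \<Rightarrow> _) (functor1_map K H A act) \<and>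
    bifunctor K (hpar K H) (smash_env K H A act)
        (functor2 K H A act :: (_, 'x) module \<Rightarrow> (_, 'm) module \<Rightarrow> _) (functor2_map K H A act) \<and>
    naturally_isomorphic K (hpar K H) (smash_env K H A act)
        (functor1 K H A act :: (_, 'x) module \<Rightarrow> (_, 'm) module \<Rightarrow> _) (functor1_map K H A act)
        (functor2 K H A act) (functor2_map K H A act)"
proof -
  interpret partial_smash K H A act by (simp add: partial_smash_def assms)
  show ?thesis by (intro conjI functor1_bifunctor functor2_bifunctor functors_naturally_isomorphic)
qed


end
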